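(* Let $\Gamma_0,\Lambda_0$ be groups with the Haagerup property and let $\Gamma_i$, $1\le i\le n\le\infty$, and $\Lambda_j$, $1\le j\le m\le\infty$, be ICC groups, each having a normal, non virtually abelian subgroup with the relative property (T). Assume either $\Gamma_0$ is infinite or $n\ge2$. Let $\sigma$ (resp. $\theta$) be a free ergodic measure preserving action of $\Gamma=\Gamma_0*\Gamma_1*\cdots$ (resp. $\Lambda=\Lambda_0*\Lambda_1*\cdots$) on a probability space $(X,\mu)$ (resp. $(Y,\nu)$) such that $\sigma_j=\sigma_{|\Gamma_j}$ (resp. $\theta_j=\theta_{|\Lambda_j}$) is ergodic for all $j\ge1$. If $\mathcal R_{\sigma,\Gamma}\simeq\mathcal R_{\theta,\Lambda}^t$ for some $t>0$, then $n=m$ and there exists a permutation $\pi$ of the set of indices $i\ge1$ such that $\mathcal R_{\sigma_i,\Gamma_i}\simeq\mathcal R^t_{\theta_{\pi(i)},\Lambda_{\pi(i)}}$ for all $i\ge1$.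
   Context: Groups are countable discrete; probability spaces are standard. A subgroup $H\subset G$ has the relative property (T) if the pair $(G,H)$ has the relative property (T) of Kazhdan–Margulis. ICC: all non-trivial conjugacy classes are infinite. $\mathcal R_{\sigma,\Gamma}$ is the orbit equivalence relation of the action $\sigma$ of $\Gamma$. For an ergodic countable measure preserving equivalence relation $\mathcal R$ on $(Y,\nu)$ and $t>0$, $\mathcal R^t$ is the restriction of $\mathcal R\times(\text{full relation on }\{1,\dots,k\})$, $k\ge t$ an integer, to a subset of $Y\times\{1,\dots,k\}$ of measure $t$ ($\nu$ times counting measure), with normalized measure. Isomorphism $\simeq$ means a measure preserving isomorphism of the underlying probability spaces carrying one relation onto the other almost everywhere. *)

theory Defs
  imports
    "HOL-Probability.Probability_Measure"
    "HOL-Library.Extended_Nat"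
    "HOL-Library.Nonpos_Ints"
    "HOL-Combinatorics.Permutations"
    "HOL-Algebra.Group_Action"
begin

section \<open>Free products of groups\<close>

definition free_product_words :: "'i set \<Rightarrow> ('i \<Rightarrow> 'g monoid) \<Rightarrow> ('i \<times> 'g) list set" where
  "free_product_words I G = lists (SIGMA i:I. carrier (G i))"

text \<open>The congruence on the monoid of words generated by deleting identity letters and
  multiplying adjacent letters that come from the same factor.\<close>

inductive_set free_product_rel ::
    "'i set \<Rightarrow> ('i \<Rightarrow> 'g monoid) \<Rightarrow> (('i \<times> 'g) list \<times> ('i \<times> 'g) list) set"
  for I G where
  refl: "u \<in> free_product_words I G \<Longrightarrow> (u, u) \<in> free_product_rel I G"
| sym: "(u, v) \<in> free_product_rel I G \<Longrightarrow> (v, u) \<in> free_product_rel I G"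
| trans: "(u, v) \<in> free_product_rel I G \<Longrightarrow> (v, w) \<in> free_product_rel I G
    \<Longrightarrow> (u, w) \<in> free_product_rel I G"
| one: "u \<in> free_product_words I G \<Longrightarrow> v \<in> free_product_words I G \<Longrightarrow> i \<in> I
    \<Longrightarrow> (u @ (i, \<one>\<^bsub>G i\<^esub>) # v, u @ v) \<in> free_product_rel I G"
| mult: "u \<in> free_product_words I G \<Longrightarrow> v \<in> free_product_words I G \<Longrightarrow> i \<in> I
    \<Longrightarrow> a \<in> carrier (G i) \<Longrightarrow> b \<in> carrier (G i)
    \<Longrightarrow> (u @ (i, a) # (i, b) # v, u @ (i, a \<otimes>\<^bsub>G i\<^esub> b) # v) \<in> free_product_rel I G"

definition free_product :: "'i set \<Rightarrow> ('i \<Rightarrow> 'g monoid) \<Rightarrow> ('i \<times> 'g) list set monoid" where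
  "free_product I G =
     \<lparr>carrier = free_product_words I G // free_product_rel I G,
      mult = (\<lambda>A B. \<Union>u\<in>A. \<Union>v\<in>B. free_product_rel I G `` {u @ v}),
      one = free_product_rel I G `` {[]}\<rparr>"

text \<open>The canonical homomorphism from the \<open>i\<close>-th factor to the free product.\<close>

definition free_product_incl :: "'i set \<Rightarrow> ('i \<Rightarrow> 'g monoid) \<Rightarrow> 'i \<Rightarrow> 'g \<Rightarrow> ('i \<times> 'g) list set" where
  "free_product_incl I G i a = free_product_rel I G `` {[(i, a)]}"

lemma free_product_words_append [simp]:
  "u @ v \<in> free_product_words I G \<longleftrightarrow> u \<in> free_product_words I G \<and> v \<in> free_product_words I G"
  by (auto simp: free_product_words_def)

lemma free_product_words_Nil [simp]: "[] \<in> free_product_words I G"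
  by (simp add: free_product_words_def)

lemma free_product_words_Cons [simp]:
  "(i, a) # v \<in> free_product_words I G \<longleftrightarrow> i \<in> I \<and> a \<in> carrier (G i) \<and> v \<in> free_product_words I G"
  by (auto simp: free_product_words_def)

context
  fixes I :: "'i set" and G :: "'i \<Rightarrow> 'g monoid"
  assumes grp: "\<And>i. i \<in> I \<Longrightarrow> group (G i)"
begin

lemma free_product_rel_words:
  assumes "(u, v) \<in> free_product_rel I G"
  shows "u \<in> free_product_words I G \<and> v \<in> free_product_words I G"
  using assms by induction (simp_all add: grp group.is_monoid monoid.m_closed)

lemma equiv_free_product_rel: "equiv (free_product_words I G) (free_product_rel I G)"
proof (rule equivI)
  show "free_product_rel I G \<subseteq> free_product_words I G \<times> free_product_words I G"
    using free_product_rel_words by (intro subrelI) simp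
  show "refl_on (free_product_words I G) (free_product_rel I G)"
    by (auto simp: refl_on_def intro: free_product_rel.refl)
  show "sym_on UNIV (free_product_rel I G)"
    by (rule symI) (rule free_product_rel.sym)
  show "trans_on UNIV (free_product_rel I G)"
    by (rule transI) (rule free_product_rel.trans)
qed

lemma free_product_rel_context:
  assumes "(u, v) \<in> free_product_rel I G" "p \<in> free_product_words I G" "q \<in> free_product_words I G"
  shows "(p @ u @ q, p @ v @ q) \<in> free_product_rel I G"
  using assms
proof induction
  case (refl u) then show ?case by (simp add: free_product_rel.refl)
next
  case (sym u v) then show ?case by (simp add: free_product_rel.sym[of "p @ u @ q"])
next
  case (trans u v w) then show ?case using free_product_rel.trans[of "p @ u @ q" "p @ v @ q"] by simp
next
  case (one u v i) then show ?case using free_product_rel.one[of "p @ u" I G "v @ q" i] by simp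
next
  case (mult u v i a b)
  then show ?case using free_product_rel.mult[of "p @ u" I G "v @ q" i a b] by simp
qed

lemma free_product_rel_append:
  assumes "(u, u') \<in> free_product_rel I G" "(v, v') \<in> free_product_rel I G"
  shows "(u @ v, u' @ v') \<in> free_product_rel I G"
proof -
  have "(u @ v, u' @ v) \<in> free_product_rel I G"
    using free_product_rel_context[OF assms(1), of "[]" v] free_product_rel_words[OF assms(2)] by simp
  moreover have "(u' @ v, u' @ v') \<in> free_product_rel I G"
    using free_product_rel_context[OF assms(2), of u' "[]"] free_product_rel_words[OF assms(1)] by simp
  ultimately show ?thesis by (rule free_product_rel.trans)
qed

lemma free_product_mult:
  assumes "u \<in> free_product_words I G" "v \<in> free_product_words I G"
  shows "free_product_rel I G `` {u} \<otimes>\<^bsub>free_product I G\<^esub> free_product_rel I G `` {v}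
    = free_product_rel I G `` {u @ v}"
proof -
  have *: "free_product_rel I G `` {u' @ v'} = free_product_rel I G `` {u @ v}"
    if "u' \<in> free_product_rel I G `` {u}" "v' \<in> free_product_rel I G `` {v}" for u' v'
    using equiv_class_eq[OF equiv_free_product_rel free_product_rel_append, of u u' v v'] that by simp
  have "u \<in> free_product_rel I G `` {u}" "v \<in> free_product_rel I G `` {v}"
    using assms by (simp_all add: free_product_rel.refl)
  with * have "(\<Union>u'\<in>free_product_rel I G `` {u}. \<Union>v'\<in>free_product_rel I G `` {v}.
      free_product_rel I G `` {u' @ v'}) = free_product_rel I G `` {u @ v}"
    by blast
  then show ?thesis by (simp add: free_product_def)
qed

lemma free_product_inverse:
  assumes "u \<in> free_product_words I G"
  shows "\<exists>v \<in> free_product_words I G. (v @ u, []) \<in> free_product_rel I G"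
  using assms
proof (induction u)
  case Nil then show ?case using free_product_rel.refl[of "[]" I G] by (intro bexI[of _ "[]"]) simp_all
next
  case (Cons x u)
  obtain i a where x: "x = (i, a)" by force
  with Cons obtain v where v: "v \<in> free_product_words I G" "(v @ u, []) \<in> free_product_rel I G"
    and ia: "i \<in> I" "a \<in> carrier (G i)" "u \<in> free_product_words I G" by auto
  interpret group "G i" using grp ia by simp
  have "((v @ [(i, inv\<^bsub>G i\<^esub> a)]) @ x # u, v @ (i, \<one>\<^bsub>G i\<^esub>) # u) \<in> free_product_rel I G"
    using free_product_rel.mult[of v I G u i "inv\<^bsub>G i\<^esub> a" a] v ia x by simp
  also have "(v @ (i, \<one>\<^bsub>G i\<^esub>) # u, v @ u) \<in> free_product_rel I G"
    using free_product_rel.one[of v I G u i] v ia by simp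
  also (free_product_rel.trans) note v(2)
  finally (free_product_rel.trans) have "((v @ [(i, inv\<^bsub>G i\<^esub> a)]) @ x # u, []) \<in> free_product_rel I G" .
  then show ?case using v ia by (intro bexI[of _ "v @ [(i, inv\<^bsub>G i\<^esub> a)]"]) auto
qed

lemma group_free_product: "group (free_product I G)"
proof (rule groupI)
  have car: "\<And>x. x \<in> carrier (free_product I G) \<Longrightarrow>
      \<exists>u \<in> free_product_words I G. x = free_product_rel I G `` {u}"
    by (auto simp: free_product_def elim: quotientE)
  have mem: "\<And>u. u \<in> free_product_words I G \<Longrightarrow>
      free_product_rel I G `` {u} \<in> carrier (free_product I G)"
    by (auto simp: free_product_def intro: quotientI)
  have one_eq: "\<one>\<^bsub>free_product I G\<^esub> = free_product_rel I G `` {[]}"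
    by (simp add: free_product_def)
  show "\<one>\<^bsub>free_product I G\<^esub> \<in> carrier (free_product I G)"
    by (simp add: one_eq mem)
  fix x assume x: "x \<in> carrier (free_product I G)"
  show "\<one>\<^bsub>free_product I G\<^esub> \<otimes>\<^bsub>free_product I G\<^esub> x = x"
    using car[OF x] by (auto simp: one_eq free_product_mult)
  show "\<exists>y\<in>carrier (free_product I G). y \<otimes>\<^bsub>free_product I G\<^esub> x = \<one>\<^bsub>free_product I G\<^esub>"
  proof -
    obtain u where u: "u \<in> free_product_words I G" "x = free_product_rel I G `` {u}"
      using car[OF x] by auto
    obtain v where v: "v \<in> free_product_words I G" "(v @ u, []) \<in> free_product_rel I G"
      using free_product_inverse[OF u(1)] by auto
    have "free_product_rel I G `` {v @ u} = free_product_rel I G `` {[]}"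
      by (rule equiv_class_eq[OF equiv_free_product_rel v(2)])
    then show ?thesis
      using u v mem by (intro bexI[of _ "free_product_rel I G `` {v}"])
        (simp_all add: free_product_mult one_eq)
  qed
  fix y assume y: "y \<in> carrier (free_product I G)"
  show "x \<otimes>\<^bsub>free_product I G\<^esub> y \<in> carrier (free_product I G)"
    using car[OF x] car[OF y] by (auto simp: free_product_mult mem)
  fix z assume z: "z \<in> carrier (free_product I G)"
  show "x \<otimes>\<^bsub>free_product I G\<^esub> y \<otimes>\<^bsub>free_product I G\<^esub> z = x \<otimes>\<^bsub>free_product I G\<^esub> (y \<otimes>\<^bsub>free_product I G\<^esub> z)"
    using car[OF x] car[OF y] car[OF z] by (auto simp: free_product_mult)
qed

lemma free_product_incl_hom:
  assumes "i \<in> I"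
  shows "free_product_incl I G i \<in> hom (G i) (free_product I G)"
proof (rule homI)
  fix a b assume a: "a \<in> carrier (G i)" and b: "b \<in> carrier (G i)"
  show "free_product_incl I G i a \<in> carrier (free_product I G)"
    using a assms by (auto simp: free_product_incl_def free_product_def intro!: quotientI)
  have "([(i, a), (i, b)], [(i, a \<otimes>\<^bsub>G i\<^esub> b)]) \<in> free_product_rel I G"
    using free_product_rel.mult[of "[]" I G "[]" i a b] a b assms by simp
  from equiv_class_eq[OF equiv_free_product_rel this]
  show "free_product_incl I G i (a \<otimes>\<^bsub>G i\<^esub> b)
      = free_product_incl I G i a \<otimes>\<^bsub>free_product I G\<^esub> free_product_incl I G i b"
    using a b assms by (simp add: free_product_incl_def free_product_mult)
qed

end

section \<open>Properties of countable discrete groups\<close>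

definition icc_group :: "('g, 'b) monoid_scheme \<Rightarrow> bool" where
  "icc_group G \<longleftrightarrow> group G \<and>
     (\<forall>x\<in>carrier G. x \<noteq> \<one>\<^bsub>G\<^esub> \<longrightarrow> infinite ((\<lambda>g. g \<otimes>\<^bsub>G\<^esub> x \<otimes>\<^bsub>G\<^esub> inv\<^bsub>G\<^esub> g) ` carrier G))"

definition virtually_abelian :: "('g, 'b) monoid_scheme \<Rightarrow> bool" where
  "virtually_abelian G \<longleftrightarrow>
     (\<exists>K. subgroup K G \<and> comm_group (G\<lparr>carrier := K\<rparr>) \<and> finite (rcosets\<^bsub>G\<^esub> K))"

definition positive_definite :: "('g, 'b) monoid_scheme \<Rightarrow> ('g \<Rightarrow> complex) \<Rightarrow> bool" where
  "positive_definite G \<phi> \<longleftrightarrow>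
     (\<forall>F c. finite F \<and> F \<subseteq> carrier G \<longrightarrow>
        (\<Sum>g\<in>F. \<Sum>h\<in>F. cnj (c g) * c h * \<phi> (inv\<^bsub>G\<^esub> g \<otimes>\<^bsub>G\<^esub> h)) \<in> \<real>\<^sub>\<ge>\<^sub>0)"

definition haagerup_property :: "('g, 'b) monoid_scheme \<Rightarrow> bool" where
  "haagerup_property G \<longleftrightarrow>
     (\<exists>\<phi> :: nat \<Rightarrow> 'g \<Rightarrow> complex.
        (\<forall>k. positive_definite G (\<phi> k) \<and> \<phi> k \<one>\<^bsub>G\<^esub> = 1 \<and>
             (\<forall>\<epsilon>>0. finite {g \<in> carrier G. cmod (\<phi> k g) \<ge> \<epsilon>})) \<and>
        (\<forall>g\<in>carrier G. (\<lambda>k. \<phi> k g) \<longlonglongrightarrow> 1))"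

text \<open>The complex Hilbert space of square summable functions supported on a set \<open>S\<close> of natural
  numbers. Up to isomorphism these are exactly the separable Hilbert spaces. Given a
  representation of a countable group with almost invariant vectors, the closed span of the orbits
  of countably many such vectors is a separable subrepresentation that still has them, so separable
  spaces suffice to define the relative property (T).\<close>

definition ell2 :: "nat set \<Rightarrow> (nat \<Rightarrow> complex) set" where
  "ell2 S = {x. (\<forall>k. k \<notin> S \<longrightarrow> x k = 0) \<and> summable (\<lambda>k. (cmod (x k))\<^sup>2)}"

definition ell2_inner :: "(nat \<Rightarrow> complex) \<Rightarrow> (nat \<Rightarrow> complex) \<Rightarrow> complex" where
  "ell2_inner x y = (\<Sum>k. x k * cnj (y k))"

definition ell2_norm :: "(nat \<Rightarrow> complex) \<Rightarrow> real" where
  "ell2_norm x = sqrt (\<Sum>k. (cmod (x k))\<^sup>2)"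

definition ell2_unitary :: "nat set \<Rightarrow> ((nat \<Rightarrow> complex) \<Rightarrow> (nat \<Rightarrow> complex)) \<Rightarrow> bool" where
  "ell2_unitary S U \<longleftrightarrow> bij_betw U (ell2 S) (ell2 S) \<and>
     (\<forall>x\<in>ell2 S. \<forall>y\<in>ell2 S. U (\<lambda>k. x k + y k) = (\<lambda>k. U x k + U y k)) \<and>
     (\<forall>a. \<forall>x\<in>ell2 S. U (\<lambda>k. a * x k) = (\<lambda>k. a * U x k)) \<and>
     (\<forall>x\<in>ell2 S. \<forall>y\<in>ell2 S. ell2_inner (U x) (U y) = ell2_inner x y)"

definition unitary_rep ::
    "('g, 'b) monoid_scheme \<Rightarrow> nat set \<Rightarrow> ('g \<Rightarrow> (nat \<Rightarrow> complex) \<Rightarrow> (nat \<Rightarrow> complex)) \<Rightarrow> bool" where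
  "unitary_rep G S \<rho> \<longleftrightarrow>
     (\<forall>g\<in>carrier G. ell2_unitary S (\<rho> g)) \<and>
     (\<forall>g\<in>carrier G. \<forall>h\<in>carrier G. \<forall>x\<in>ell2 S. \<rho> (g \<otimes>\<^bsub>G\<^esub> h) x = \<rho> g (\<rho> h x))"

definition almost_invariant_vectors ::
    "('g, 'b) monoid_scheme \<Rightarrow> nat set \<Rightarrow> ('g \<Rightarrow> (nat \<Rightarrow> complex) \<Rightarrow> (nat \<Rightarrow> complex)) \<Rightarrow> bool" where
  "almost_invariant_vectors G S \<rho> \<longleftrightarrow>
     (\<forall>F \<epsilon>. finite F \<and> F \<subseteq> carrier G \<and> \<epsilon> > 0 \<longrightarrow>
        (\<exists>\<xi>\<in>ell2 S. ell2_norm \<xi> = 1 \<and> (\<forall>g\<in>F. ell2_norm (\<lambda>k. \<rho> g \<xi> k - \<xi> k) < \<epsilon>)))"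

definition relative_property_T :: "('g, 'b) monoid_scheme \<Rightarrow> 'g set \<Rightarrow> bool" where
  "relative_property_T G H \<longleftrightarrow>
     (\<forall>S \<rho>. unitary_rep G S \<rho> \<and> almost_invariant_vectors G S \<rho> \<longrightarrow>
        (\<exists>\<xi>\<in>ell2 S. \<xi> \<noteq> (\<lambda>k. 0) \<and> (\<forall>h\<in>H. \<rho> h \<xi> = \<xi>)))"

section \<open>Probability measure preserving actions\<close>

definition standard_prob_space :: "'x measure \<Rightarrow> bool" where
  "standard_prob_space M \<longleftrightarrow> prob_space M \<and>
     (\<exists>T. completely_metrizable_space T \<and> second_countable T \<and> topspace T = space M \<and>
          sets M = sigma_sets (topspace T) {U. openin T U})"

definition pmp_action :: "('g, 'b) monoid_scheme \<Rightarrow> 'x measure \<Rightarrow> ('g \<Rightarrow> 'x \<Rightarrow> 'x) \<Rightarrow> bool" where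
  "pmp_action G M \<sigma> \<longleftrightarrow> group_action G (space M) \<sigma> \<and>
     (\<forall>g\<in>carrier G. \<sigma> g \<in> measurable M M \<and> distr M M (\<sigma> g) = M)"

definition free_action :: "('g, 'b) monoid_scheme \<Rightarrow> 'x measure \<Rightarrow> ('g \<Rightarrow> 'x \<Rightarrow> 'x) \<Rightarrow> bool" where
  "free_action G M \<sigma> \<longleftrightarrow> (\<forall>g\<in>carrier G. g \<noteq> \<one>\<^bsub>G\<^esub> \<longrightarrow> (AE x in M. \<sigma> g x \<noteq> x))"

definition ergodic_action :: "('g, 'b) monoid_scheme \<Rightarrow> 'x measure \<Rightarrow> ('g \<Rightarrow> 'x \<Rightarrow> 'x) \<Rightarrow> bool" where
  "ergodic_action G M \<sigma> \<longleftrightarrow>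
     (\<forall>A\<in>sets M. (\<forall>g\<in>carrier G. \<sigma> g -` A \<inter> space M = A) \<longrightarrow>
        measure M A = 0 \<or> measure M A = 1)"

definition orbit_relation ::
    "('g, 'b) monoid_scheme \<Rightarrow> 'x measure \<Rightarrow> ('g \<Rightarrow> 'x \<Rightarrow> 'x) \<Rightarrow> ('x \<times> 'x) set" where
  "orbit_relation G M \<sigma> = {(x, y). x \<in> space M \<and> y \<in> orbit G \<sigma> x}"

section \<open>Isomorphism and amplification of equivalence relations\<close>

definition rel_isomorphic ::
    "'x measure \<Rightarrow> ('x \<times> 'x) set \<Rightarrow> 'y measure \<Rightarrow> ('y \<times> 'y) set \<Rightarrow> bool" where
  "rel_isomorphic M R N S \<longleftrightarrow>
     (\<exists>X0 Y0 f. X0 \<in> sets M \<and> Y0 \<in> sets N \<and>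
        (AE x in M. x \<in> X0) \<and> (AE y in N. y \<in> Y0) \<and>
        bij_betw f X0 Y0 \<and>
        f \<in> measurable (restrict_space M X0) (restrict_space N Y0) \<and>
        the_inv_into X0 f \<in> measurable (restrict_space N Y0) (restrict_space M X0) \<and>
        distr (restrict_space M X0) (restrict_space N Y0) f = restrict_space N Y0 \<and>
        (\<forall>x\<in>X0. \<forall>x'\<in>X0. (x, x') \<in> R \<longleftrightarrow> (f x, f x') \<in> S))"

definition amplified_space :: "'y measure \<Rightarrow> nat \<Rightarrow> ('y \<times> nat) set \<Rightarrow> real \<Rightarrow> ('y \<times> nat) measure" where
  "amplified_space N k E t =
     scale_measure (ennreal (1 / t)) (restrict_space (N \<Otimes>\<^sub>M count_space {1..k}) E)"

definition amplified_rel :: "('y \<times> 'y) set \<Rightarrow> ('y \<times> nat) set \<Rightarrow> (('y \<times> nat) \<times> ('y \<times> nat)) set" where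
  "amplified_rel S E = {((y, i), (y', j)). (y, i) \<in> E \<and> (y', j) \<in> E \<and> (y, y') \<in> S}"

text \<open>The amplification of an ergodic relation by \<open>t\<close> is only defined up to isomorphism; all choices
  of \<open>k\<close> and \<open>E\<close> give isomorphic relations, so being isomorphic to it means being isomorphic to the
  relation obtained from some such choice.\<close>

definition isomorphic_to_amplification ::
    "'x measure \<Rightarrow> ('x \<times> 'x) set \<Rightarrow> 'y measure \<Rightarrow> ('y \<times> 'y) set \<Rightarrow> real \<Rightarrow> bool" where
  "isomorphic_to_amplification M R N S t \<longleftrightarrow>
     (\<exists>k E. real k \<ge> t \<and> E \<in> sets (N \<Otimes>\<^sub>M count_space {1..k}) \<and>
        emeasure (N \<Otimes>\<^sub>M count_space {1..k}) E = ennreal t \<and>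
        rel_isomorphic M R (amplified_space N k E t) (amplified_rel S E))"

end

theory Submission imports Defs "HOL-Library.Sublist" begin

text \<open>An isomorphism of the two relations turns the action of a factor \<open>\<Gamma>\<^sub>i\<close> into a measurable
  cocycle with values in the free product of the \<open>\<Lambda>\<^sub>j\<close>, which acts on its Bass--Serre tree. The function
  \<open>r\<close> to the power of the distance is positive definite for \<open>0 < r < 1\<close> and tends to \<open>1\<close> as \<open>r\<close> tends to
  \<open>1\<close>. Integrated along the cocycle it gives positive definite functions on \<open>\<Gamma>\<^sub>i\<close>, so the relative
  property (T) produces an equivariant measurable choice of bounded sets of vertices, for the normal
  subgroup \<open>H\<close>. The centre of such a set is an equivariant vertex. Its type cannot be a group element
  because \<open>H\<close> is infinite and the cocycle is essentially injective, so it is a coset of some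
  \<open>\<Lambda>\<^sub>j\<close>. It is unique, hence invariant under all of \<open>\<Gamma>\<^sub>i\<close> by normality. Applied to \<open>\<Lambda>\<^sub>0\<close> instead of the
  free product, the same argument with the Haagerup functions in place of \<open>r\<close> to the distance shows \<open>j \<noteq> 0\<close>.
  Thus orbits of \<open>\<Gamma>\<^sub>i\<close> are moved into orbits of \<open>\<Lambda>\<^sub>j\<close>. Doing the same in the other direction and
  using uniqueness once more shows that \<open>i\<close> determines \<open>j\<close> bijectively and that the orbit relations
  correspond. As \<open>\<Lambda>\<^sub>j\<close> is ergodic, the resulting map can be corrected along \<open>\<Lambda>\<^sub>j\<close>-orbits to an isomorphism
  onto the same amplification.\<close>

section \<open>Kernels and the Gelfand--Naimark--Segal construction\<close>

text \<open>Property (T) speaks of unitary representations on the concrete spaces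
  \<open>ell2 S\<close>, so the Gelfand--Naimark--Segal space is realised there by a Cholesky
  factorisation, whose triangular shape gives finitely supported generating vectors. The invariant
  vector is passed on only as a sequence of finite combinations of group elements: these, unlike an
  abstract vector, can be pushed along the cocycle into the fibre over each point and converge there
  along a fast subsequence. The limit is an invariant function on the target group over almost every
  point, and its superlevel sets are the bounded sets. Amplification shapes the rest. Forgetting the
  second coordinate of an isomorphism onto an amplification leaves a map \<open>q\<close> that
  matches orbits but is injective only on countably many pieces, and a measurable choice along
  orbits gives a map \<open>v\<close> back. Both are instances of one notion,
  \<open>orbit_map\<close>, so the two directions are treated alike. Null sets are removed once, by
  passing to invariant conull sets where the actions are free at every point and the cocycle
  identities are exact.\<close>

definition supp :: "('a \<Rightarrow> 'b::zero) \<Rightarrow> 'a set" where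
  "supp a = {x. a x \<noteq> 0}"

definition psd_on :: "'a set \<Rightarrow> ('a \<Rightarrow> 'a \<Rightarrow> complex) \<Rightarrow> bool" where
  "psd_on A \<kappa> \<longleftrightarrow> (\<forall>F c. finite F \<and> F \<subseteq> A \<longrightarrow> (\<Sum>i\<in>F. \<Sum>j\<in>F. cnj (c i) * c j * \<kappa> i j) \<in> \<real>\<^sub>\<ge>\<^sub>0)"

text \<open>The squared norm of the combination with coefficients \<open>c\<close> in the Hilbert
  space determined by \<open>\<kappa>\<close>; for a positive semidefinite kernel and finite support
  the double sum is already real.\<close>

definition qform :: "('a \<Rightarrow> 'a \<Rightarrow> complex) \<Rightarrow> ('a \<Rightarrow> complex) \<Rightarrow> real" where
  "qform \<kappa> c = Re (\<Sum>i\<in>supp c. \<Sum>j\<in>supp c. cnj (c i) * c j * \<kappa> i j)"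

lemma psd_onD:
  assumes "psd_on A \<kappa>" "finite F" "F \<subseteq> A"
  shows "Re (\<Sum>i\<in>F. \<Sum>j\<in>F. cnj (c i) * c j * \<kappa> i j) \<ge> 0"
    and "Im (\<Sum>i\<in>F. \<Sum>j\<in>F. cnj (c i) * c j * \<kappa> i j) = 0"
  using assms unfolding psd_on_def by (auto simp: complex_nonneg_Reals_iff)

lemma psd_on_diag:
  assumes "psd_on A \<kappa>" "i \<in> A"
  shows "Re (\<kappa> i i) \<ge> 0" "Im (\<kappa> i i) = 0"
  using psd_onD[OF assms(1), of "{i}" "\<lambda>_. 1"] assms(2) by auto

text \<open>The form is real at the coefficient vectors \<open>(1, 1)\<close> and
  \<open>(1, \<i>)\<close>; its imaginary parts there are the imaginary part of the sum and the real
  part of the difference of the two entries.\<close>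

lemma psd_on_hermitian:
  assumes "psd_on A \<kappa>" "i \<in> A" "j \<in> A"
  shows "\<kappa> i j = cnj (\<kappa> j i)"
proof (cases "i = j")
  case True
  then show ?thesis using psd_on_diag[OF assms(1,2)] by (simp add: complex_eq_iff)
next
  case False
  have d: "Im (\<kappa> i i) = 0" "Im (\<kappa> j j) = 0"
    using psd_on_diag(2)[OF assms(1)] assms by auto
  have "Im (\<kappa> i j + \<kappa> j i) = 0"
    using psd_onD(2)[OF assms(1), of "{i, j}" "\<lambda>_. 1"] assms False d by (auto simp: )
  moreover have "Re (\<kappa> i j) - Re (\<kappa> j i) = 0"
    using psd_onD(2)[OF assms(1), of "{i, j}" "\<lambda>x. if x = i then 1 else \<i>"] assms False d
    by (auto simp: )
  ultimately show ?thesis by (simp add: complex_eq_iff)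
qed

lemma qform_nonneg:
  assumes "psd_on A \<kappa>" "finite (supp c)" "supp c \<subseteq> A"
  shows "0 \<le> qform \<kappa> c"
  unfolding qform_def using psd_onD(1)[OF assms] .

text \<open>With a vanishing diagonal entry the form on \<open>{i, k}\<close> is affine along a real
  line of coefficients at \<open>k\<close>, so a nonzero off-diagonal entry would make it negative
  somewhere.\<close>

lemma psd_on_null_column:
  assumes "psd_on A \<kappa>" "i \<in> A" "k \<in> A" "\<kappa> k k = 0"
  shows "\<kappa> i k = 0"
proof (cases "i = k")
  case False
  show ?thesis
  proof (rule ccontr)
    assume nz: "\<kappa> i k \<noteq> 0"
    define r where "r = (cmod (\<kappa> i k))\<^sup>2"
    have r: "r > 0" using nz by (simp add: r_def)
    \<comment> \<open>Solves \<open>Re (\<kappa> i i) - 2 * M * r = -1\<close>.\<close>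
    define M where "M = (Re (\<kappa> i i) + 1) / (2 * r)"
    define t where "t = - of_real M * cnj (\<kappa> i k)"
    have h: "\<kappa> k i = cnj (\<kappa> i k)" using psd_on_hermitian[OF assms(1,3,2)] .
    have "0 \<le> Re (\<Sum>x\<in>{i,k}. \<Sum>y\<in>{i,k}. cnj (if x = i then 1 else t) * (if y = i then 1 else t) * \<kappa> x y)"
      by (rule psd_onD(1)[OF assms(1)]) (use assms in auto)
    also have "(\<Sum>x\<in>{i,k}. \<Sum>y\<in>{i,k}. cnj (if x = i then 1 else t) * (if y = i then 1 else t) * \<kappa> x y)
        = \<kappa> i i + t * \<kappa> i k + cnj t * \<kappa> k i"
      using False assms(4) by (simp add: algebra_simps)
    also have "Re \<dots> = Re (\<kappa> i i) - 2 * M * r"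
      unfolding t_def h r_def cmod_power2 by (simp add: power2_eq_square algebra_simps)
    also have "\<dots> = -1" using r by (simp add: M_def field_simps)
    finally show False by simp
  qed
qed (use assms in simp)

text \<open>Successive Schur complements of a positive semidefinite kernel. When the pivot vanishes the
  division yields \<open>0\<close> and the step is skipped.\<close>

fun schur :: "(nat \<Rightarrow> nat \<Rightarrow> complex) \<Rightarrow> nat \<Rightarrow> nat \<Rightarrow> nat \<Rightarrow> complex" where
  "schur \<kappa> 0 i j = \<kappa> i j"
| "schur \<kappa> (Suc k) i j = schur \<kappa> k i j - schur \<kappa> k k j * schur \<kappa> k i k / schur \<kappa> k k k"

text \<open>Row \<open>j\<close> will be the vector that represents the index \<open>j\<close>. A
  zero pivot makes its whole column zero, again through division by zero, so that such a coordinate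
  never occurs.\<close>

definition cholesky :: "(nat \<Rightarrow> nat \<Rightarrow> complex) \<Rightarrow> nat \<Rightarrow> nat \<Rightarrow> complex" where
  "cholesky \<kappa> j k = schur \<kappa> k k j / of_real (sqrt (Re (schur \<kappa> k k k)))"

text \<open>Eliminating \<open>k\<close> amounts to minimising the form over the coefficient at
  \<open>k\<close>: the reduced form is the old one evaluated at the minimiser.\<close>

lemma psd_schur_step:
  fixes \<kappa> :: "nat \<Rightarrow> nat \<Rightarrow> complex"
  assumes psd: "psd_on UNIV \<kappa>"
  shows "psd_on UNIV (\<lambda>i j. \<kappa> i j - \<kappa> k j * \<kappa> i k / \<kappa> k k)"
proof (cases "\<kappa> k k = 0")
  case True then show ?thesis using psd by simp
next
  case False
  define r where "r = \<kappa> k k"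
  have r: "r \<noteq> 0" "cnj r = r" using False psd_on_hermitian[OF psd, of k k] by (auto simp: r_def)
  have herm: "\<kappa> i j = cnj (\<kappa> j i)" for i j by (rule psd_on_hermitian[OF psd]) auto
  show ?thesis unfolding psd_on_def
  proof (intro allI impI, elim conjE)
    fix F :: "nat set" and c :: "nat \<Rightarrow> complex"
    assume F: "finite F"
    \<comment> \<open>The reduced kernel vanishes in row and column \<open>k\<close>, so this index
      contributes nothing to the reduced form.\<close>
    define F0 where "F0 = F - {k}"
    have F0: "finite F0" "k \<notin> F0" using F by (auto simp: F0_def)
    define b where "b = (\<Sum>j\<in>F0. c j * \<kappa> k j)"
    have cb: "cnj b = (\<Sum>i\<in>F0. cnj (c i) * \<kappa> i k)"
      unfolding b_def cnj_sum by (intro sum.cong HOL.refl, subst herm[of _ k], simp)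
    \<comment> \<open>The minimising coefficient at \<open>k\<close>; completing the square there
      produces the term \<open>- cnj b * b / r\<close>.\<close>
    define c' where "c' = (\<lambda>i. if i = k then - b / r else c i)"
    have "(\<Sum>i\<in>F. \<Sum>j\<in>F. cnj (c i) * c j * (\<kappa> i j - \<kappa> k j * \<kappa> i k / \<kappa> k k))
        = (\<Sum>i\<in>F. \<Sum>j\<in>F0. cnj (c i) * c j * (\<kappa> i j - \<kappa> k j * \<kappa> i k / \<kappa> k k))"
      by (intro sum.cong HOL.refl sum.mono_neutral_right F) (use False in \<open>auto simp: F0_def\<close>)
    also have "\<dots> = (\<Sum>i\<in>F0. \<Sum>j\<in>F0. cnj (c i) * c j * (\<kappa> i j - \<kappa> k j * \<kappa> i k / \<kappa> k k))"
      by (intro sum.mono_neutral_right F) (use False in \<open>auto simp: F0_def\<close>)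
    also have "\<dots> = (\<Sum>i\<in>F0. \<Sum>j\<in>F0. cnj (c i) * c j * \<kappa> i j)
        - (\<Sum>i\<in>F0. \<Sum>j\<in>F0. (cnj (c i) * \<kappa> i k) * (c j * \<kappa> k j) / r)"
      unfolding r_def sum_subtractf[symmetric]
      by (intro sum.cong HOL.refl) (simp add: algebra_simps)
    also have "(\<Sum>i\<in>F0. \<Sum>j\<in>F0. (cnj (c i) * \<kappa> i k) * (c j * \<kappa> k j) / r) = cnj b * b / r"
      unfolding cb unfolding b_def by (simp add: sum_product sum_divide_distrib)
    also have "(\<Sum>i\<in>F0. \<Sum>j\<in>F0. cnj (c i) * c j * \<kappa> i j) - cnj b * b / r
       = (\<Sum>i\<in>insert k F0. \<Sum>j\<in>insert k F0. cnj (c' i) * c' j * \<kappa> i j)"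
    proof -
      have c': "c' i = c i" if "i \<in> F0" for i using that F0 by (auto simp: c'_def)
      have "(\<Sum>i\<in>insert k F0. \<Sum>j\<in>insert k F0. cnj (c' i) * c' j * \<kappa> i j)
        = cnj (c' k) * c' k * r + (\<Sum>j\<in>F0. cnj (c' k) * c j * \<kappa> k j)
          + (\<Sum>i\<in>F0. cnj (c i) * c' k * \<kappa> i k + (\<Sum>j\<in>F0. cnj (c i) * c j * \<kappa> i j))"
        using F0 by (simp add: r_def c' cong: sum.cong)
      also have "(\<Sum>j\<in>F0. cnj (c' k) * c j * \<kappa> k j) = cnj (c' k) * b"
        by (simp add: b_def sum_distrib_left mult.assoc)
      also have "(\<Sum>i\<in>F0. cnj (c i) * c' k * \<kappa> i k + (\<Sum>j\<in>F0. cnj (c i) * c j * \<kappa> i j))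
         = c' k * cnj b + (\<Sum>i\<in>F0. \<Sum>j\<in>F0. cnj (c i) * c j * \<kappa> i j)"
        by (simp add: cb sum_distrib_left sum.distrib mult_ac)
      also have "c' k = - b / r" by (simp add: c'_def)
      finally show ?thesis using r by (simp add: field_simps)
    qed
    also have "\<dots> \<in> \<real>\<^sub>\<ge>\<^sub>0" using psd[unfolded psd_on_def, rule_format, of "insert k F0" c'] F0(1) by blast
    finally show "(\<Sum>i\<in>F. \<Sum>j\<in>F. cnj (c i) * c j * (\<kappa> i j - \<kappa> k j * \<kappa> i k / \<kappa> k k)) \<in> \<real>\<^sub>\<ge>\<^sub>0" .
  qed
qed

lemma psd_schur: "psd_on UNIV \<kappa> \<Longrightarrow> psd_on UNIV (schur \<kappa> k)"
proof (induction k)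
  case 0
  moreover have "schur \<kappa> 0 = \<kappa>" by (intro ext) simp
  ultimately show ?case by simp
next
  case (Suc k)
  have "schur \<kappa> (Suc k) = (\<lambda>i j. schur \<kappa> k i j - schur \<kappa> k k j * schur \<kappa> k i k / schur \<kappa> k k k)"
    by (intro ext) simp
  then show ?case using psd_schur_step[OF Suc.IH[OF Suc.prems]] by simp
qed

text \<open>Step \<open>l\<close> clears column \<open>l\<close>, where a null pivot already forces
  a null column; each later step subtracts a multiple of an entry of that column, which is
  zero.\<close>

lemma schur_zero:
  assumes "psd_on UNIV \<kappa>" "l < k"
  shows "schur \<kappa> k i l = 0"
  using assms(2)
proof (induction k arbitrary: i)
  case (Suc k)
  note psd = psd_schur[OF assms(1), of k]
  show ?case
  proof (cases "l = k")
    case True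
    show ?thesis
    proof (cases "schur \<kappa> k k k = 0")
      case 0: True
      then show ?thesis using psd_on_null_column[OF psd, of i k] True by simp
    qed (use True in simp)
  qed (use Suc in simp)
qed simp

lemma cholesky_triangular:
  assumes "psd_on UNIV \<kappa>" "j < k"
  shows "cholesky \<kappa> j k = 0"
  using schur_zero[OF assms] by (simp add: cholesky_def)

lemma cholesky_gram:
  assumes psd: "psd_on UNIV \<kappa>"
  shows "schur \<kappa> k i j = \<kappa> i j - (\<Sum>l<k. cholesky \<kappa> j l * cnj (cholesky \<kappa> i l))"
proof (induction k)
  case (Suc k)
  note p = psd_schur[OF psd, of k]
  have r: "schur \<kappa> k k k = of_real (Re (schur \<kappa> k k k))" "Re (schur \<kappa> k k k) \<ge> 0"
    using psd_on_diag[OF p] by (auto simp: complex_eq_iff)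
  have sq: "complex_of_real (sqrt (Re (schur \<kappa> k k k))) * of_real (sqrt (Re (schur \<kappa> k k k))) = schur \<kappa> k k k"
    using r by (metis of_real_mult real_sqrt_mult_self abs_of_nonneg)
  have "cholesky \<kappa> j k * cnj (cholesky \<kappa> i k) = schur \<kappa> k k j * schur \<kappa> k i k / schur \<kappa> k k k"
    unfolding cholesky_def using psd_on_hermitian[OF p, of i k] sq by simp
  then show ?case using Suc by simp
qed simp

definition delta :: "'a \<Rightarrow> 'a \<Rightarrow> complex" where
  "delta k = (\<lambda>l. if l = k then 1 else 0)"

text \<open>Kolmogorov's decomposition with two features that the triangular matrix provides: every
  vector has finite support, and \<open>S\<close> retains only the coordinates with a nonzero pivot,
  so that every coordinate vector of \<open>S\<close> is a finite combination of rows. An operator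
  on \<open>ell2 S\<close> can thereby be described through the rows alone.\<close>

lemma kolmogorov:
  fixes \<kappa> :: "nat \<Rightarrow> nat \<Rightarrow> complex"
  assumes psd: "psd_on UNIV \<kappa>"
  obtains S and e :: "nat \<Rightarrow> nat \<Rightarrow> complex"
  where "\<And>j k. e j k \<noteq> 0 \<Longrightarrow> k \<le> j \<and> k \<in> S"
    and "\<And>i j. ell2_inner (e j) (e i) = \<kappa> i j"
    and "\<And>l. l \<in> S \<Longrightarrow> \<exists>a. \<forall>k. (\<Sum>i\<le>l. a i * e i k) = delta l k"
proof
  let ?S = "{k. schur \<kappa> k k k \<noteq> 0}" and ?e = "cholesky \<kappa>"
  show supp: "k \<le> j \<and> k \<in> ?S" if "?e j k \<noteq> 0" for j k
    using that cholesky_triangular[OF psd, of j k] by (force simp: cholesky_def not_le[symmetric])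
  show "ell2_inner (?e j) (?e i) = \<kappa> i j" for i j
  proof -
    have "ell2_inner (?e j) (?e i) = (\<Sum>l<Suc i. ?e j l * cnj (?e i l))"
      unfolding ell2_inner_def by (rule suminf_finite) (use supp[of i] in \<open>auto simp: not_less\<close>, metis not_less_eq_eq supp)
    also have "\<dots> = \<kappa> i j - schur \<kappa> (Suc i) i j"
      using cholesky_gram[OF psd, of "Suc i" i j] by simp
    \<comment> \<open>Only columns of the remainder are known to vanish, so symmetry turns row
      \<open>i\<close> into column \<open>i\<close>.\<close>
    also have "schur \<kappa> (Suc i) i j = cnj (schur \<kappa> (Suc i) j i)"
      by (rule psd_on_hermitian[OF psd_schur[OF psd]]) auto
    also have "schur \<kappa> (Suc i) j i = 0" by (rule schur_zero[OF psd]) simp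
    finally show ?thesis by simp
  qed
  show "\<exists>a. \<forall>k. (\<Sum>i\<le>l. a i * ?e i k) = delta l k" if "l \<in> ?S" for l
    using that
  proof (induction l rule: less_induct)
    case (less l)
    have "\<exists>a. \<forall>k. (\<Sum>i\<le>m. a i * ?e i k) = delta m k" if "m < l" "m \<in> ?S" for m
      using less.IH that by blast
    note ex = this
    define a where "a m = (SOME a. \<forall>k. (\<Sum>i\<le>m. a i * ?e i k) = delta m k)" for m
    have a: "(\<Sum>i\<le>m. a m i * ?e i k) = delta m k" if "m < l" "m \<in> ?S" for m k
      using someI_ex[OF ex[OF that]] unfolding a_def by blast
    define r where "r = ?e l l"
    have "Re (schur \<kappa> l l l) \<noteq> 0" using less.prems psd_on_diag[OF psd_schur[OF psd, of l], of l]
      by (auto simp: complex_eq_iff)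
    then have r: "r \<noteq> 0" using less.prems by (simp add: r_def cholesky_def)
    \<comment> \<open>Back substitution: row \<open>l\<close> minus its earlier entries, divided by
      its diagonal entry \<open>r\<close>. Entries at coordinates outside \<open>S\<close> are zero
      and are left out.\<close>
    define b where "b i = (if i = l then 1 / r else - (\<Sum>m\<in>{i..<l} \<inter> ?S. ?e l m * a m i) / r)" for i
    have "(\<Sum>i\<le>l. b i * ?e i k) = delta l k" for k
    proof -
      have "(\<Sum>i\<le>l. b i * ?e i k) = ?e l k / r + (\<Sum>i<l. b i * ?e i k)"
        by (subst sum.lessThan_Suc[of _ l, unfolded lessThan_Suc_atMost]) (simp add: b_def)
      also have "(\<Sum>i<l. b i * ?e i k) = - (\<Sum>i<l. \<Sum>m\<in>{i..<l} \<inter> ?S. ?e l m * a m i * ?e i k) / r"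
        by (simp add: b_def sum_distrib_right sum_negf sum_divide_distrib)
      also have "(\<Sum>i<l. \<Sum>m\<in>{i..<l} \<inter> ?S. ?e l m * a m i * ?e i k)
          = (\<Sum>i<l. \<Sum>m<l. if m \<in> ?S \<and> i \<le> m then ?e l m * a m i * ?e i k else 0)"
        by (intro sum.cong HOL.refl sum.mono_neutral_cong_left) auto
      also have "\<dots> = (\<Sum>m<l. \<Sum>i<l. if m \<in> ?S \<and> i \<le> m then ?e l m * a m i * ?e i k else 0)"
        by (rule sum.swap)
      also have "\<dots> = (\<Sum>m<l. ?e l m * delta m k)"
      proof (intro sum.cong HOL.refl)
        fix m assume m: "m \<in> {..<l}"
        show "(\<Sum>i<l. if m \<in> ?S \<and> i \<le> m then ?e l m * a m i * ?e i k else 0) = ?e l m * delta m k"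
        proof (cases "m \<in> ?S")
          case True
          have "(\<Sum>i<l. if m \<in> ?S \<and> i \<le> m then ?e l m * a m i * ?e i k else 0)
             = (\<Sum>i\<le>m. ?e l m * (a m i * ?e i k))"
            using True m by (intro sum.mono_neutral_cong_right) (auto simp: mult.assoc)
          also have "\<dots> = ?e l m * delta m k"
            unfolding sum_distrib_left[symmetric] using a[of m k] m True by simp
          finally show ?thesis .
        next
          case False then show ?thesis using supp[of l m] by auto
        qed
      qed
      also have "\<dots> = (if k < l then ?e l k else 0)"
        by (simp add: delta_def if_distrib[of "\<lambda>x. _ * x"] cong: if_cong)
      finally show ?thesis using r supp[of l k]
        by (cases k l rule: linorder_cases) (auto simp: delta_def r_def)
    qed
    then show ?case by blast
  qed
qed

section \<open>Square-summable sequences: polarisation and Bessel's inequality\<close>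

lemma ell2_inner_finite:
  assumes "finite F" "\<And>k. k \<notin> F \<Longrightarrow> x k = 0 \<or> y k = 0"
  shows "ell2_inner x y = (\<Sum>k\<in>F. x k * cnj (y k))"
  unfolding ell2_inner_def by (rule suminf_finite) (use assms in auto)

lemma ell2_iff: "x \<in> ell2 S \<longleftrightarrow> supp x \<subseteq> S \<and> summable (\<lambda>k. (cmod (x k))\<^sup>2)"
  by (auto simp: ell2_def supp_def)

lemma ell2_finite_supp:
  assumes "finite (supp x)" "supp x \<subseteq> S"
  shows "x \<in> ell2 S"
  unfolding ell2_iff
proof
  show "summable (\<lambda>k. (cmod (x k))\<^sup>2)"
    by (rule summable_finite[OF assms(1)]) (auto simp: supp_def)
qed (rule assms)

lemma ell2_summable_prod:
  assumes "x \<in> ell2 S" "y \<in> ell2 S"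
  shows "summable (\<lambda>k. x k * cnj (y k))"
proof (rule summable_comparison_test)
  have "cmod (x k) * cmod (y k) \<le> (cmod (x k))\<^sup>2 + (cmod (y k))\<^sup>2" for k
    using sum_squares_bound[of "cmod (x k)" "cmod (y k)"]
      mult_nonneg_nonneg[OF norm_ge_zero norm_ge_zero, of "x k" "y k"] by linarith
  then show "\<exists>N. \<forall>n\<ge>N. norm (x n * cnj (y n)) \<le> (cmod (x n))\<^sup>2 + (cmod (y n))\<^sup>2"
    by (simp add: norm_mult)
  show "summable (\<lambda>k. (cmod (x k))\<^sup>2 + (cmod (y k))\<^sup>2)"
    using assms by (intro summable_add) (auto simp: ell2_iff)
qed

lemma cmod_add_sq: "(cmod (a + b))\<^sup>2 = (cmod a)\<^sup>2 + 2 * Re (a * cnj b) + (cmod b)\<^sup>2"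
  unfolding cmod_power2 by (simp add: power2_eq_square algebra_simps)

lemma ell2_add:
  assumes "x \<in> ell2 S" "y \<in> ell2 S"
  shows "(\<lambda>k. x k + y k) \<in> ell2 S"
    and "(\<Sum>k. (cmod (x k + y k))\<^sup>2)
      = (\<Sum>k. (cmod (x k))\<^sup>2) + 2 * Re (ell2_inner x y) + (\<Sum>k. (cmod (y k))\<^sup>2)"
proof -
  have s: "summable (\<lambda>k. (cmod (x k))\<^sup>2)" "summable (\<lambda>k. (cmod (y k))\<^sup>2)"
    "summable (\<lambda>k. Re (x k * cnj (y k)))"
    using assms summable_Re[OF ell2_summable_prod[OF assms]] by (auto simp: ell2_iff)
  have s2: "summable (\<lambda>k. 2 * Re (x k * cnj (y k)))" by (intro summable_mult s)
  have s3: "summable (\<lambda>k. (cmod (x k))\<^sup>2 + 2 * Re (x k * cnj (y k)))" by (intro summable_add s s2)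
  have "summable (\<lambda>k. (cmod (x k))\<^sup>2 + 2 * Re (x k * cnj (y k)) + (cmod (y k))\<^sup>2)"
    by (intro summable_add s3 s)
  then have "summable (\<lambda>k. (cmod (x k + y k))\<^sup>2)" by (simp add: cmod_add_sq)
  then show "(\<lambda>k. x k + y k) \<in> ell2 S"
    using assms by (auto simp: ell2_def)
  have "(\<Sum>k. (cmod (x k + y k))\<^sup>2) = (\<Sum>k. (cmod (x k))\<^sup>2 + 2 * Re (x k * cnj (y k))) + (\<Sum>k. (cmod (y k))\<^sup>2)"
    unfolding cmod_add_sq by (rule suminf_add[symmetric, OF s3 s(2)])
  also have "(\<Sum>k. (cmod (x k))\<^sup>2 + 2 * Re (x k * cnj (y k))) = (\<Sum>k. (cmod (x k))\<^sup>2) + (\<Sum>k. 2 * Re (x k * cnj (y k)))"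
    by (rule suminf_add[symmetric, OF s(1) s2])
  also have "(\<Sum>k. 2 * Re (x k * cnj (y k))) = 2 * Re (ell2_inner x y)"
    unfolding ell2_inner_def using suminf_mult[OF s(3), of 2] Re_suminf[OF ell2_summable_prod[OF assms]]
    by simp
  finally show "(\<Sum>k. (cmod (x k + y k))\<^sup>2)
      = (\<Sum>k. (cmod (x k))\<^sup>2) + 2 * Re (ell2_inner x y) + (\<Sum>k. (cmod (y k))\<^sup>2)" by simp
qed

lemma ell2_scale:
  assumes "x \<in> ell2 S"
  shows "(\<lambda>k. a * x k) \<in> ell2 S"
    and "(\<Sum>k. (cmod (a * x k))\<^sup>2) = (cmod a)\<^sup>2 * (\<Sum>k. (cmod (x k))\<^sup>2)"
proof -
  have s: "summable (\<lambda>k. (cmod (x k))\<^sup>2)" using assms by (auto simp: ell2_iff)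
  then have "summable (\<lambda>k. (cmod (a * x k))\<^sup>2)"
    unfolding norm_mult power_mult_distrib by (intro summable_mult)
  then show "(\<lambda>k. a * x k) \<in> ell2 S" using assms by (auto simp: ell2_def)
  show "(\<Sum>k. (cmod (a * x k))\<^sup>2) = (cmod a)\<^sup>2 * (\<Sum>k. (cmod (x k))\<^sup>2)"
    unfolding norm_mult power_mult_distrib by (rule suminf_mult[OF s])
qed

lemma ell2_inner_scale_right:
  assumes "x \<in> ell2 S" "y \<in> ell2 S"
  shows "ell2_inner x (\<lambda>k. a * y k) = cnj a * ell2_inner x y"
  unfolding ell2_inner_def suminf_mult[OF ell2_summable_prod[OF assms], symmetric]
  by (simp add: mult_ac)

lemma ell2_norm_nonneg: "x \<in> ell2 S \<Longrightarrow> 0 \<le> (\<Sum>k. (cmod (x k))\<^sup>2)"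
  by (rule suminf_nonneg) (auto simp: ell2_iff)

text \<open>Polarisation: the norm of a sum gives the real part, and replacing the second vector by
  \<open>\<i>\<close> times it gives the imaginary part.\<close>

lemma isometry_inner:
  assumes U: "\<And>x. x \<in> ell2 S \<Longrightarrow> U x \<in> ell2 S"
    and add: "\<And>x y. x \<in> ell2 S \<Longrightarrow> y \<in> ell2 S \<Longrightarrow> U (\<lambda>k. x k + y k) = (\<lambda>k. U x k + U y k)"
    and scale: "\<And>a x. x \<in> ell2 S \<Longrightarrow> U (\<lambda>k. a * x k) = (\<lambda>k. a * U x k)"
    and iso: "\<And>x. x \<in> ell2 S \<Longrightarrow> (\<Sum>k. (cmod (U x k))\<^sup>2) = (\<Sum>k. (cmod (x k))\<^sup>2)"
    and xy: "x \<in> ell2 S" "y \<in> ell2 S"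
  shows "ell2_inner (U x) (U y) = ell2_inner x y"
proof -
  have re: "Re (ell2_inner (U x) (U y)) = Re (ell2_inner x y)" if "x \<in> ell2 S" "y \<in> ell2 S" for x y
    using ell2_add(2)[OF that] ell2_add(2)[OF U U, OF that] iso[OF ell2_add(1)[OF that]]
      iso[OF that(1)] iso[OF that(2)] by (simp add: add[OF that])
  have "Re (ell2_inner (U x) (\<lambda>k. \<i> * U y k)) = Re (ell2_inner x (\<lambda>k. \<i> * y k))"
    using re[OF xy(1) ell2_scale(1)[OF xy(2), of \<i>]] by (simp add: scale[OF xy(2)])
  then have "Im (ell2_inner (U x) (U y)) = Im (ell2_inner x y)"
    by (simp add: ell2_inner_scale_right[OF U U, OF xy] ell2_inner_scale_right[OF xy])
  with re[OF xy] show ?thesis by (simp add: complex_eq_iff)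
qed

text \<open>It is enough to expand the squared distance from \<open>x\<close> to its projection
  \<open>w\<close> over the finite window \<open>W\<close> that carries all the \<open>u l\<close>,
  since the coordinates of \<open>x\<close> outside \<open>W\<close> only enlarge the right-hand
  side.\<close>

lemma bessel:
  fixes u :: "'a \<Rightarrow> nat \<Rightarrow> complex"
  assumes T: "finite T"
    and u: "\<And>l. l \<in> T \<Longrightarrow> finite (supp (u l))"
    and orth: "\<And>l m. l \<in> T \<Longrightarrow> m \<in> T \<Longrightarrow> ell2_inner (u l) (u m) = (if l = m then 1 else 0)"
    and x: "x \<in> ell2 S"
  shows "(\<Sum>l\<in>T. (cmod (ell2_inner x (u l)))\<^sup>2) \<le> (\<Sum>k. (cmod (x k))\<^sup>2)"
proof -
  define W where "W = (\<Union>l\<in>T. supp (u l))"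
  have W: "finite W" using T u by (auto simp: W_def)
  have Wu: "ell2_inner y (u l) = (\<Sum>k\<in>W. y k * cnj (u l k))" if "l \<in> T" for y l
    by (rule ell2_inner_finite[OF W]) (use that in \<open>auto simp: W_def supp_def\<close>)
  define b where "b l = ell2_inner x (u l)" for l
  define w where "w k = (\<Sum>l\<in>T. b l * u l k)" for k
  have xw: "(\<Sum>k\<in>W. x k * cnj (w k)) = (\<Sum>l\<in>T. cnj (b l) * b l)"
  proof -
    have "(\<Sum>k\<in>W. x k * cnj (w k)) = (\<Sum>k\<in>W. \<Sum>l\<in>T. cnj (b l) * (x k * cnj (u l k)))"
      by (simp add: w_def sum_distrib_left mult_ac)
    also have "\<dots> = (\<Sum>l\<in>T. \<Sum>k\<in>W. cnj (b l) * (x k * cnj (u l k)))" by (rule sum.swap)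
    also have "\<dots> = (\<Sum>l\<in>T. cnj (b l) * b l)"
      by (intro sum.cong HOL.refl) (simp add: sum_distrib_left[symmetric] Wu[symmetric] b_def)
    finally show ?thesis .
  qed
  have ww: "(\<Sum>k\<in>W. w k * cnj (w k)) = (\<Sum>l\<in>T. cnj (b l) * b l)"
  proof -
    have "(\<Sum>k\<in>W. w k * cnj (w k)) = (\<Sum>k\<in>W. \<Sum>l\<in>T. cnj (b l) * (w k * cnj (u l k)))"
      by (subst (2) w_def) (simp add: sum_distrib_left mult_ac)
    also have "\<dots> = (\<Sum>l\<in>T. cnj (b l) * (\<Sum>k\<in>W. w k * cnj (u l k)))"
      by (subst sum.swap) (simp add: sum_distrib_left)
    also have "\<dots> = (\<Sum>l\<in>T. cnj (b l) * b l)"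
    proof (intro sum.cong HOL.refl arg_cong2[of _ _ _ _ times])
      fix l assume l: "l \<in> T"
      have "(\<Sum>k\<in>W. w k * cnj (u l k)) = (\<Sum>k\<in>W. \<Sum>m\<in>T. b m * (u m k * cnj (u l k)))"
        unfolding w_def sum_distrib_right by (simp add: mult_ac)
      also have "\<dots> = (\<Sum>m\<in>T. b m * (\<Sum>k\<in>W. u m k * cnj (u l k)))"
        by (subst sum.swap) (simp add: sum_distrib_left)
      also have "\<dots> = (\<Sum>m\<in>T. b m * (if m = l then 1 else 0))"
        by (intro sum.cong HOL.refl) (simp add: Wu[OF l, symmetric] orth l)
      also have "\<dots> = b l" using T l by (simp add: if_distrib[of "\<lambda>x. _ * x"] cong: if_cong)
      finally show "(\<Sum>k\<in>W. w k * cnj (u l k)) = b l" .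
    qed
    finally show ?thesis .
  qed
  have n: "cnj z * z = of_real ((cmod z)\<^sup>2)" for z
    by (metis complex_norm_square mult.commute)
  have "0 \<le> (\<Sum>k\<in>W. (cmod (x k + - w k))\<^sup>2)" by (intro sum_nonneg) auto
  also have "\<dots> = (\<Sum>k\<in>W. (cmod (x k))\<^sup>2) + 2 * Re (\<Sum>k\<in>W. x k * cnj (- w k)) + (\<Sum>k\<in>W. (cmod (w k))\<^sup>2)"
    unfolding cmod_add_sq by (simp add: sum.distrib sum_distrib_left)
  also have "(\<Sum>k\<in>W. x k * cnj (- w k)) = - of_real (\<Sum>l\<in>T. (cmod (b l))\<^sup>2)"
    using xw by (simp add: sum_negf n)
  also have "(\<Sum>k\<in>W. (cmod (w k))\<^sup>2) = (\<Sum>l\<in>T. (cmod (b l))\<^sup>2)"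
  proof -
    have "complex_of_real (\<Sum>k\<in>W. (cmod (w k))\<^sup>2) = (\<Sum>k\<in>W. w k * cnj (w k))"
      by (simp add: complex_norm_square del: of_real_power)
    also have "\<dots> = complex_of_real (\<Sum>l\<in>T. (cmod (b l))\<^sup>2)" unfolding ww n by simp
    finally show ?thesis using of_real_eq_iff by blast
  qed
  finally have "(\<Sum>l\<in>T. (cmod (b l))\<^sup>2) \<le> (\<Sum>k\<in>W. (cmod (x k))\<^sup>2)" by simp
  also have "\<dots> \<le> (\<Sum>k. (cmod (x k))\<^sup>2)"
    by (rule sum_le_suminf) (use x W in \<open>auto simp: ell2_iff\<close>)
  finally show ?thesis by (simp add: b_def)
qed

section \<open>The unitary representation on a GNS space\<close>

locale gns_data = group K for K :: "('k, 'm) monoid_scheme" (structure) +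
  fixes C :: "'c set" and S :: "nat set" and v :: "'c \<Rightarrow> nat \<Rightarrow> complex"
    and p :: "'k \<Rightarrow> 'c \<Rightarrow> 'c" and \<kappa> :: "'c \<Rightarrow> 'c \<Rightarrow> complex"
  assumes v_supp: "c \<in> C \<Longrightarrow> finite (supp (v c)) \<and> supp (v c) \<subseteq> S"
    and gram: "c \<in> C \<Longrightarrow> d \<in> C \<Longrightarrow> ell2_inner (v d) (v c) = \<kappa> c d"
    and total: "l \<in> S \<Longrightarrow> \<exists>a. finite (supp a) \<and> supp a \<subseteq> C \<and> (\<forall>k. (\<Sum>c\<in>supp a. a c * v c k) = delta l k)"
    and p_closed: "g \<in> carrier K \<Longrightarrow> c \<in> C \<Longrightarrow> p g c \<in> C"
    and p_mult: "g \<in> carrier K \<Longrightarrow> h \<in> carrier K \<Longrightarrow> c \<in> C \<Longrightarrow> p (g \<otimes> h) c = p g (p h c)"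
    and p_one: "c \<in> C \<Longrightarrow> p \<one> c = c"
    and \<kappa>_inv: "g \<in> carrier K \<Longrightarrow> c \<in> C \<Longrightarrow> d \<in> C \<Longrightarrow> \<kappa> (p g c) (p g d) = \<kappa> c d"
begin

definition comb :: "('c \<Rightarrow> complex) \<Rightarrow> bool" where
  "comb a \<longleftrightarrow> finite (supp a) \<and> supp a \<subseteq> C"

text \<open>The combination \<open>a\<close> after its indices have been moved by \<open>g\<close>;
  once the unitary \<open>rho g\<close> exists, \<open>rho_tv\<close> identifies this with its value
  at the unmoved combination.\<close>

definition tv :: "'k \<Rightarrow> ('c \<Rightarrow> complex) \<Rightarrow> nat \<Rightarrow> complex" where
  "tv g a = (\<lambda>k. \<Sum>c\<in>supp a. a c * v (p g c) k)"

lemma tv_superset: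
  assumes "finite F" "supp a \<subseteq> F"
  shows "tv g a k = (\<Sum>c\<in>F. a c * v (p g c) k)"
  unfolding tv_def by (intro sum.mono_neutral_left assms) (auto simp: supp_def)

lemma tv_supp:
  assumes "g \<in> carrier K" "comb a"
  shows "finite (supp (tv g a)) \<and> supp (tv g a) \<subseteq> S"
proof -
  have "supp (tv g a) \<subseteq> (\<Union>c\<in>supp a. supp (v (p g c)))"
  proof
    fix k assume "k \<in> supp (tv g a)"
    then have "(\<Sum>c\<in>supp a. a c * v (p g c) k) \<noteq> 0" by (simp add: supp_def tv_def)
    then obtain c where "c \<in> supp a" "a c * v (p g c) k \<noteq> 0" by (rule sum.not_neutral_contains_not_neutral)
    then show "k \<in> (\<Union>c\<in>supp a. supp (v (p g c)))" by (auto simp: supp_def)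
  qed
  moreover have "finite (\<Union>c\<in>supp a. supp (v (p g c)))" "(\<Union>c\<in>supp a. supp (v (p g c))) \<subseteq> S"
    using assms v_supp[OF p_closed] unfolding comb_def by blast+
  ultimately show ?thesis by (meson finite_subset order_trans)
qed

lemma inner_tv_right:
  assumes "g \<in> carrier K" "comb b"
  shows "ell2_inner x (tv g b) = (\<Sum>d\<in>supp b. cnj (b d) * ell2_inner x (v (p g d)))"
proof -
  define W where "W = (\<Union>c\<in>supp b. supp (v (p g c)))"
  have W: "finite W" using assms v_supp[OF p_closed] unfolding comb_def W_def by blast
  have Wv: "ell2_inner x (v (p g d)) = (\<Sum>k\<in>W. x k * cnj (v (p g d) k))" if "d \<in> supp b" for d
    by (rule ell2_inner_finite[OF W]) (use that in \<open>auto simp: W_def supp_def\<close>)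
  have "tv g b k = 0" if "k \<notin> W" for k
    unfolding tv_def using that by (intro sum.neutral) (auto simp: W_def supp_def)
  then have "ell2_inner x (tv g b) = (\<Sum>k\<in>W. x k * cnj (tv g b k))"
    by (intro ell2_inner_finite[OF W]) auto
  also have "\<dots> = (\<Sum>k\<in>W. \<Sum>d\<in>supp b. cnj (b d) * (x k * cnj (v (p g d) k)))"
    unfolding tv_def cnj_sum sum_distrib_left by (simp add: mult_ac)
  also have "\<dots> = (\<Sum>d\<in>supp b. \<Sum>k\<in>W. cnj (b d) * (x k * cnj (v (p g d) k)))" by (rule sum.swap)
  also have "\<dots> = (\<Sum>d\<in>supp b. cnj (b d) * ell2_inner x (v (p g d)))"
    by (intro sum.cong HOL.refl) (simp add: sum_distrib_left[symmetric] Wv)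
  finally show ?thesis .
qed

lemma inner_cnj: "finite (supp x) \<Longrightarrow> ell2_inner x y = cnj (ell2_inner y x)"
  by (subst (1 2) ell2_inner_finite[of "supp x"]) (auto simp: supp_def mult.commute)

lemma inner_tv_left:
  assumes "g \<in> carrier K" "comb b"
  shows "ell2_inner (tv g b) x = (\<Sum>d\<in>supp b. b d * ell2_inner (v (p g d)) x)"
proof -
  have "ell2_inner (tv g b) x = cnj (ell2_inner x (tv g b))"
    using tv_supp[OF assms] by (intro inner_cnj) auto
  also have "\<dots> = (\<Sum>d\<in>supp b. b d * cnj (ell2_inner x (v (p g d))))"
    by (simp add: inner_tv_right[OF assms])
  also have "\<dots> = (\<Sum>d\<in>supp b. b d * ell2_inner (v (p g d)) x)"
  proof (intro sum.cong HOL.refl)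
    fix d assume "d \<in> supp b"
    then have "d \<in> C" using assms by (auto simp: comb_def)
    then show "b d * cnj (ell2_inner x (v (p g d))) = b d * ell2_inner (v (p g d)) x"
      using v_supp[OF p_closed[OF assms(1)]] by (subst (2) inner_cnj) auto
  qed
  finally show ?thesis .
qed

lemma inner_tv_tv:
  assumes "g \<in> carrier K" "comb a" "comb b"
  shows "ell2_inner (tv g a) (tv g b) = (\<Sum>d\<in>supp b. \<Sum>c\<in>supp a. cnj (b d) * a c * \<kappa> d c)"
proof -
  have "ell2_inner (v (p g c)) (v (p g d)) = \<kappa> d c" if "c \<in> supp a" "d \<in> supp b" for c d
  proof -
    have "c \<in> C" "d \<in> C" using that assms by (auto simp: comb_def)
    then show ?thesis using assms by (simp add: gram p_closed \<kappa>_inv)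
  qed
  then show ?thesis
    using assms by (simp add: inner_tv_right inner_tv_left sum_distrib_left mult.assoc)
qed

text \<open>Invariance of the kernel removes \<open>g\<close> from the right-hand side, so moving
  the indices preserves norms.\<close>

lemma nsq_tv:
  assumes "g \<in> carrier K" "comb a"
  shows "(\<Sum>k. (cmod (tv g a k))\<^sup>2) = qform \<kappa> a"
proof -
  have f: "finite (supp (tv g a))" using tv_supp[OF assms] by simp
  have "(\<Sum>k. (cmod (tv g a k))\<^sup>2) = (\<Sum>k\<in>supp (tv g a). (cmod (tv g a k))\<^sup>2)"
    by (rule suminf_finite[OF f]) (auto simp: supp_def)
  also have "complex_of_real \<dots> = ell2_inner (tv g a) (tv g a)"
    by (subst ell2_inner_finite[OF f]) (auto simp: supp_def complex_norm_square simp del: of_real_power)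
  then have "(\<Sum>k\<in>supp (tv g a). (cmod (tv g a k))\<^sup>2) = Re (ell2_inner (tv g a) (tv g a))"
    by (metis Re_complex_of_real)
  also have "\<dots> = qform \<kappa> a"
    using inner_tv_tv[OF assms assms(2)] by (simp add: qform_def)
  finally show ?thesis .
qed

lemma comb_diff: "comb a \<Longrightarrow> comb b \<Longrightarrow> comb (\<lambda>c. a c - b c)"
proof -
  assume "comb a" "comb b"
  moreover have "supp (\<lambda>c. a c - b c) \<subseteq> supp a \<union> supp b" by (auto simp: supp_def)
  ultimately show ?thesis unfolding comb_def by (meson finite_UnI finite_subset le_supI order_trans)
qed

lemma tv_diff:
  assumes "comb a" "comb b"
  shows "tv g (\<lambda>c. a c - b c) k = tv g a k - tv g b k"
proof -
  have f: "finite (supp a \<union> supp b)" using assms by (auto simp: comb_def)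
  have "supp (\<lambda>c. a c - b c) \<subseteq> supp a \<union> supp b" by (auto simp: supp_def)
  from tv_superset[OF f this] show ?thesis
    by (simp add: tv_superset[OF f, of a] tv_superset[OF f, of b] sum_subtractf algebra_simps)
qed

text \<open>Well-definedness: a linear relation among the vectors survives translation because its
  norm, zero, does.\<close>

lemma tv_zero:
  assumes "g \<in> carrier K" "comb a" "\<And>k. tv \<one> a k = 0"
  shows "tv g a k = 0"
proof -
  have "(\<Sum>k. (cmod (tv g a k))\<^sup>2) = 0"
    using nsq_tv[OF assms(1,2)] nsq_tv[OF one_closed assms(2)] assms(3) by simp
  moreover have "tv g a \<in> ell2 S" using tv_supp[OF assms(1,2)] by (auto intro: ell2_finite_supp)
  ultimately have "(cmod (tv g a k))\<^sup>2 = 0"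
    by (subst (asm) suminf_eq_zero_iff) (auto simp: ell2_iff)
  then show ?thesis by simp
qed

lemma tv_eq:
  assumes "g \<in> carrier K" "comb a" "comb b" "\<And>k. tv \<one> a k = tv \<one> b k"
  shows "tv g a k = tv g b k"
  using tv_zero[OF assms(1) comb_diff[OF assms(2,3)], of k] tv_diff[OF assms(2,3)] assms(4) by simp

definition D :: "nat \<Rightarrow> 'c \<Rightarrow> complex" where
  "D l = (SOME a. finite (supp a) \<and> supp a \<subseteq> C \<and> (\<forall>k. (\<Sum>c\<in>supp a. a c * v c k) = delta l k))"

lemma D:
  assumes "l \<in> S"
  shows "comb (D l)" "tv \<one> (D l) = delta l"
proof -
  have *: "finite (supp (D l)) \<and> supp (D l) \<subseteq> C \<and> (\<forall>k. (\<Sum>c\<in>supp (D l). D l c * v c k) = delta l k)"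
    unfolding D_def by (rule someI_ex[OF total[OF assms]])
  then show "comb (D l)" by (simp add: comb_def)
  show "tv \<one> (D l) = delta l"
  proof
    fix k
    have "tv \<one> (D l) k = (\<Sum>c\<in>supp (D l). D l c * v c k)"
      unfolding tv_def using * by (intro sum.cong HOL.refl) (auto simp: p_one)
    then show "tv \<one> (D l) k = delta l k" using * by simp
  qed
qed

text \<open>The image of the \<open>l\<close>-th coordinate vector under \<open>g\<close>, that is,
  a column of the matrix of the future unitary.\<close>

definition u :: "'k \<Rightarrow> nat \<Rightarrow> nat \<Rightarrow> complex" where "u g l = tv g (D l)"

lemma u_supp: "g \<in> carrier K \<Longrightarrow> l \<in> S \<Longrightarrow> finite (supp (u g l)) \<and> supp (u g l) \<subseteq> S"
  unfolding u_def by (rule tv_supp) (auto intro: D)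

lemma inner_delta: "ell2_inner x (delta l) = x l"
  by (subst ell2_inner_finite[of "{l}"]) (auto simp: delta_def)

lemma u_orth:
  assumes "g \<in> carrier K" "l \<in> S" "m \<in> S"
  shows "ell2_inner (u g l) (u g m) = (if l = m then 1 else 0)"
proof -
  have "ell2_inner (u g l) (u g m) = ell2_inner (tv \<one> (D l)) (tv \<one> (D m))"
    using assms by (simp add: u_def inner_tv_tv D(1))
  also have "\<dots> = (if l = m then 1 else 0)"
    using assms by (simp add: D inner_delta) (simp add: delta_def)
  finally show ?thesis .
qed

lemma tv_lincomb:
  fixes w :: "nat \<Rightarrow> complex"
  assumes T: "finite T" "T \<subseteq> S"
  shows "comb (\<lambda>d. \<Sum>l\<in>T. w l * D l d)"
    and "tv h (\<lambda>d. \<Sum>l\<in>T. w l * D l d) k = (\<Sum>l\<in>T. w l * u h l k)"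
proof -
  define F where "F = (\<Union>l\<in>T. supp (D l))"
  have D': "finite (supp (D l))" "supp (D l) \<subseteq> C" if "l \<in> T" for l
    using D(1)[of l] that T by (auto simp: comb_def)
  have F: "finite F" "F \<subseteq> C" unfolding F_def using T D' by auto
  let ?b = "\<lambda>d. \<Sum>l\<in>T. w l * D l d"
  have bF: "supp ?b \<subseteq> F"
  proof
    fix d assume "d \<in> supp ?b"
    then have "(\<Sum>l\<in>T. w l * D l d) \<noteq> 0" by (simp add: supp_def)
    then obtain l where "l \<in> T" "w l * D l d \<noteq> 0" by (rule sum.not_neutral_contains_not_neutral)
    then show "d \<in> F" by (auto simp: F_def supp_def)
  qed
  then show "comb ?b" using F by (auto simp: comb_def intro: finite_subset)
  have "tv h ?b k = (\<Sum>d\<in>F. \<Sum>l\<in>T. w l * (D l d * v (p h d) k))"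
    by (simp add: tv_superset[OF F(1) bF] sum_distrib_right mult.assoc)
  also have "\<dots> = (\<Sum>l\<in>T. w l * (\<Sum>d\<in>F. D l d * v (p h d) k))"
    by (subst sum.swap) (simp add: sum_distrib_left)
  also have "\<dots> = (\<Sum>l\<in>T. w l * u h l k)"
    unfolding u_def
    by (intro sum.cong HOL.refl) (subst tv_superset[OF F(1)], auto simp: F_def)
  finally show "tv h ?b k = (\<Sum>l\<in>T. w l * u h l k)" .
qed

text \<open>The two sides are translates by \<open>g\<close> of combinations that coincide at the
  identity, so \<open>tv_eq\<close> applies. That the coefficients do not depend on \<open>g\<close>
  is what makes the matrices multiply correctly.\<close>

lemma v_expand:
  assumes g: "g \<in> carrier K" and c: "c \<in> C"
  shows "v (p g c) k = (\<Sum>l\<in>supp (v c). v c l * u g l k)"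
proof -
  have vs: "finite (supp (v c))" "supp (v c) \<subseteq> S" using v_supp[OF c] by auto
  note b = tv_lincomb[OF vs, where w = "v c"]
  have dc: "comb (delta c)" "supp (delta c) = {c}" using c by (auto simp: comb_def supp_def delta_def)
  have tvd: "tv h (delta c) k = v (p h c) k" for h k by (simp add: tv_def dc) (simp add: delta_def)
  have "tv \<one> (\<lambda>d. \<Sum>l\<in>supp (v c). v c l * D l d) k = tv \<one> (delta c) k" for k
  proof -
    have "tv \<one> (\<lambda>d. \<Sum>l\<in>supp (v c). v c l * D l d) k = (\<Sum>l\<in>supp (v c). v c l * delta l k)"
      unfolding b(2) using vs D(2) by (intro sum.cong HOL.refl) (auto simp: u_def)
    also have "\<dots> = v c k"
      using vs(1) by (auto simp: delta_def if_distrib[of "\<lambda>x. _ * x"] supp_def cong: if_cong)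
    finally show ?thesis by (simp add: tvd p_one c)
  qed
  from tv_eq[OF g b(1) dc(1) this] show ?thesis by (simp add: b(2) tvd)
qed

text \<open>Defined through the adjoint: coordinate \<open>l\<close> of the image is the inner
  product of \<open>x\<close> with the image of the \<open>l\<close>-th coordinate vector under
  \<open>inv g\<close>. As that image has finite support, the formula involves no limit.\<close>

definition rho :: "'k \<Rightarrow> (nat \<Rightarrow> complex) \<Rightarrow> nat \<Rightarrow> complex" where
  "rho g x = (\<lambda>l. if l \<in> S then ell2_inner x (u (inv g) l) else 0)"

lemma rho_v:
  assumes g: "g \<in> carrier K" and c: "c \<in> C"
  shows "rho g (v c) = v (p g c)"
proof
  fix l
  have supp: "supp (v (p g c)) \<subseteq> S" using v_supp[OF p_closed[OF g c]] by simp
  show "rho g (v c) l = v (p g c) l"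
  proof (cases "l \<in> S")
    case True
    have "ell2_inner (v c) (u (inv g) l) = (\<Sum>d\<in>supp (D l). cnj (D l d) * ell2_inner (v c) (v (p (inv g) d)))"
      unfolding u_def using True g by (intro inner_tv_right D) auto
    also have "\<dots> = (\<Sum>d\<in>supp (D l). cnj (D l d) * ell2_inner (v (p g c)) (v (p \<one> d)))"
    proof (intro sum.cong HOL.refl arg_cong2[of _ _ _ _ times])
      fix d assume "d \<in> supp (D l)"
      then have d: "d \<in> C" using D(1)[OF True] by (auto simp: comb_def)
      have "\<kappa> (p (inv g) d) c = \<kappa> (p g (p (inv g) d)) (p g c)"
        using g c d by (simp add: \<kappa>_inv p_closed)
      also have "p g (p (inv g) d) = d" using g d by (simp add: p_mult[symmetric] p_one)
      finally show "ell2_inner (v c) (v (p (inv g) d)) = ell2_inner (v (p g c)) (v (p \<one> d))"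
        using g c d by (simp add: gram p_closed p_one)
    qed
    also have "\<dots> = ell2_inner (v (p g c)) (tv \<one> (D l))"
      by (subst inner_tv_right) (auto intro: D True)
    also have "\<dots> = v (p g c) l" by (simp add: D True inner_delta)
    finally show ?thesis using True by (simp add: rho_def)
  next
    case False then show ?thesis using supp by (auto simp: rho_def supp_def)
  qed
qed

lemma inner_sum_right:
  assumes "finite T" "\<And>m. m \<in> T \<Longrightarrow> finite (supp (w m))"
  shows "ell2_inner x (\<lambda>k. \<Sum>m\<in>T. a m * w m k) = (\<Sum>m\<in>T. cnj (a m) * ell2_inner x (w m))"
proof -
  define W where "W = (\<Union>m\<in>T. supp (w m))"
  have W: "finite W" using assms by (auto simp: W_def)
  have Wv: "ell2_inner x (w m) = (\<Sum>k\<in>W. x k * cnj (w m k))" if "m \<in> T" for m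
    by (rule ell2_inner_finite[OF W]) (use that in \<open>auto simp: W_def supp_def\<close>)
  have "(\<Sum>m\<in>T. a m * w m k) = 0" if "k \<notin> W" for k
    using that by (intro sum.neutral) (auto simp: W_def supp_def)
  then have "ell2_inner x (\<lambda>k. \<Sum>m\<in>T. a m * w m k) = (\<Sum>k\<in>W. x k * cnj (\<Sum>m\<in>T. a m * w m k))"
    by (intro ell2_inner_finite[OF W]) auto
  also have "\<dots> = (\<Sum>k\<in>W. \<Sum>m\<in>T. cnj (a m) * (x k * cnj (w m k)))"
    unfolding cnj_sum sum_distrib_left by (simp add: mult_ac)
  also have "\<dots> = (\<Sum>m\<in>T. \<Sum>k\<in>W. cnj (a m) * (x k * cnj (w m k)))" by (rule sum.swap)
  also have "\<dots> = (\<Sum>m\<in>T. cnj (a m) * ell2_inner x (w m))"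
    by (intro sum.cong HOL.refl) (simp add: sum_distrib_left[symmetric] Wv)
  finally show ?thesis .
qed

text \<open>The rows of \<open>rho g\<close> are finitely supported, so the composition is a finite
  sum over the support of one row; \<open>v_expand\<close> recognises this sum as a row for the
  product.\<close>

lemma rho_mult:
  assumes g: "g \<in> carrier K" and h: "h \<in> carrier K"
  shows "rho (g \<otimes> h) x = rho g (rho h x)"
proof
  fix l
  show "rho (g \<otimes> h) x l = rho g (rho h x) l"
  proof (cases "l \<in> S")
    case True
    define y where "y = u (inv g) l"
    have y: "finite (supp y)" "supp y \<subseteq> S" using u_supp[of "inv g" l] g True by (auto simp: y_def)
    have "rho g (rho h x) l = ell2_inner (rho h x) y" using True by (simp add: rho_def y_def)
    also have "\<dots> = (\<Sum>m\<in>supp y. cnj (y m) * ell2_inner x (u (inv h) m))"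
      using y by (subst ell2_inner_finite[OF y(1)]) (auto simp: supp_def rho_def subset_iff mult.commute intro!: sum.cong)
    also have "\<dots> = ell2_inner x (\<lambda>k. \<Sum>m\<in>supp y. y m * u (inv h) m k)"
      by (rule inner_sum_right[symmetric]) (use y u_supp h in auto)
    also have "(\<lambda>k. \<Sum>m\<in>supp y. y m * u (inv h) m k) = u (inv (g \<otimes> h)) l"
    proof
      fix k
      define W where "W = supp y \<union> (\<Union>d\<in>supp (D l). supp (v (p (inv g) d)))"
      have Dl: "finite (supp (D l))" "supp (D l) \<subseteq> C" using D(1)[OF True] by (auto simp: comb_def)
      have W: "finite W" using y Dl v_supp[OF p_closed] g by (auto simp: W_def)
      have "(\<Sum>m\<in>supp y. y m * u (inv h) m k) = (\<Sum>m\<in>W. y m * u (inv h) m k)"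
        by (intro sum.mono_neutral_left W) (auto simp: W_def supp_def)
      also have "\<dots> = (\<Sum>m\<in>W. \<Sum>d\<in>supp (D l). D l d * (v (p (inv g) d) m * u (inv h) m k))"
        by (simp add: y_def u_def[of "inv g" l] tv_def sum_distrib_right mult.assoc)
      also have "\<dots> = (\<Sum>d\<in>supp (D l). D l d * (\<Sum>m\<in>W. v (p (inv g) d) m * u (inv h) m k))"
        by (subst sum.swap) (simp add: sum_distrib_left)
      also have "\<dots> = (\<Sum>d\<in>supp (D l). D l d * v (p (inv (g \<otimes> h)) d) k)"
      proof (intro sum.cong HOL.refl arg_cong2[of _ _ _ _ times])
        fix d assume d: "d \<in> supp (D l)"
        then have dC: "d \<in> C" using Dl by auto
        have "(\<Sum>m\<in>W. v (p (inv g) d) m * u (inv h) m k)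
          = (\<Sum>m\<in>supp (v (p (inv g) d)). v (p (inv g) d) m * u (inv h) m k)"
          by (intro sum.mono_neutral_right W) (use d in \<open>auto simp: W_def supp_def\<close>)
        also have "\<dots> = v (p (inv h) (p (inv g) d)) k"
          using v_expand[of "inv h" "p (inv g) d" k] g h dC p_closed by simp
        also have "p (inv h) (p (inv g) d) = p (inv (g \<otimes> h)) d"
          using g h dC by (simp add: inv_mult_group p_mult)
        finally show "(\<Sum>m\<in>W. v (p (inv g) d) m * u (inv h) m k) = v (p (inv (g \<otimes> h)) d) k" .
      qed
      finally show "(\<Sum>m\<in>supp y. y m * u (inv h) m k) = u (inv (g \<otimes> h)) l k"
        by (simp add: u_def tv_def)
    qed
    finally show ?thesis using True by (simp add: rho_def)
  qed (simp add: rho_def)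
qed

lemma rho_one: "x \<in> ell2 S \<Longrightarrow> rho \<one> x = x"
  by (intro ext) (auto simp: rho_def u_def D inner_delta ell2_def)

lemma rho_closed:
  assumes g: "g \<in> carrier K" and x: "x \<in> ell2 S"
  shows "rho g x \<in> ell2 S" "(\<Sum>k. (cmod (rho g x k))\<^sup>2) \<le> (\<Sum>k. (cmod (x k))\<^sup>2)"
proof -
  have b: "(\<Sum>l<n. (cmod (rho g x l))\<^sup>2) \<le> (\<Sum>k. (cmod (x k))\<^sup>2)" for n
  proof -
    have "(\<Sum>l<n. (cmod (rho g x l))\<^sup>2) = (\<Sum>l\<in>{..<n} \<inter> S. (cmod (rho g x l))\<^sup>2)"
      by (intro sum.mono_neutral_right) (auto simp: rho_def)
    also have "\<dots> = (\<Sum>l\<in>{..<n} \<inter> S. (cmod (ell2_inner x (u (inv g) l)))\<^sup>2)"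
      by (intro sum.cong) (auto simp: rho_def)
    also have "\<dots> \<le> (\<Sum>k. (cmod (x k))\<^sup>2)"
      by (rule bessel[where S = S]) (use g x u_supp u_orth in auto)
    finally show ?thesis .
  qed
  have s: "summable (\<lambda>k. (cmod (rho g x k))\<^sup>2)"
    by (rule summableI_nonneg_bounded[OF _ b]) simp
  then show "rho g x \<in> ell2 S" by (auto simp: ell2_def rho_def)
  show "(\<Sum>k. (cmod (rho g x k))\<^sup>2) \<le> (\<Sum>k. (cmod (x k))\<^sup>2)"
    by (rule suminf_le_const[OF s b])
qed

lemma rho_inv: "g \<in> carrier K \<Longrightarrow> x \<in> ell2 S \<Longrightarrow> rho (inv g) (rho g x) = x"
  using rho_mult[of "inv g" g x] rho_one by simp

text \<open>Bessel's inequality yields only contractions, but the inverse of \<open>rho g\<close> is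
  a contraction as well.\<close>

lemma rho_norm:
  assumes g: "g \<in> carrier K" and x: "x \<in> ell2 S"
  shows "(\<Sum>k. (cmod (rho g x k))\<^sup>2) = (\<Sum>k. (cmod (x k))\<^sup>2)"
  using rho_closed(2)[OF g x] rho_closed(2)[of "inv g", OF _ rho_closed(1)[OF g x]] g
  by (simp add: rho_inv x)

lemma rho_add:
  assumes g: "g \<in> carrier K" and x: "x \<in> ell2 S" and y: "y \<in> ell2 S"
  shows "rho g (\<lambda>k. x k + y k) = (\<lambda>k. rho g x k + rho g y k)"
proof
  fix l
  show "rho g (\<lambda>k. x k + y k) l = rho g x l + rho g y l"
  proof (cases "l \<in> S")
    case True
    then have f: "finite (supp (u (inv g) l))" using u_supp[of "inv g" l] g by auto
    have "ell2_inner z (u (inv g) l) = (\<Sum>k\<in>supp (u (inv g) l). z k * cnj (u (inv g) l k))" for z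
      by (rule ell2_inner_finite[OF f]) (auto simp: supp_def)
    then show ?thesis using True by (simp add: rho_def algebra_simps sum.distrib)
  qed (simp add: rho_def)
qed

lemma rho_scale:
  assumes g: "g \<in> carrier K" and x: "x \<in> ell2 S"
  shows "rho g (\<lambda>k. a * x k) = (\<lambda>k. a * rho g x k)"
proof
  fix l
  show "rho g (\<lambda>k. a * x k) l = a * rho g x l"
  proof (cases "l \<in> S")
    case True
    then have f: "finite (supp (u (inv g) l))" using u_supp[of "inv g" l] g by auto
    have "ell2_inner z (u (inv g) l) = (\<Sum>k\<in>supp (u (inv g) l). z k * cnj (u (inv g) l k))" for z
      by (rule ell2_inner_finite[OF f]) (auto simp: supp_def)
    then show ?thesis using True by (simp add: rho_def sum_distrib_left mult.assoc)
  qed (simp add: rho_def)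
qed

lemma rho_tv:
  assumes g: "g \<in> carrier K" and a: "comb a"
  shows "rho g (tv \<one> a) = tv g a"
proof
  fix l
  show "rho g (tv \<one> a) l = tv g a l"
  proof (cases "l \<in> S")
    case True
    have "rho g (tv \<one> a) l = (\<Sum>d\<in>supp a. a d * ell2_inner (v (p \<one> d)) (u (inv g) l))"
      using True a by (simp add: rho_def inner_tv_left)
    also have "\<dots> = (\<Sum>d\<in>supp a. a d * v (p g d) l)"
    proof (intro sum.cong HOL.refl arg_cong2[of _ _ _ _ times])
      fix d assume "d \<in> supp a"
      then have d: "d \<in> C" using a by (auto simp: comb_def)
      show "ell2_inner (v (p \<one> d)) (u (inv g) l) = v (p g d) l"
        using fun_cong[OF rho_v[OF g d], of l] True by (simp add: p_one d rho_def)
    qed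
    finally show ?thesis by (simp add: tv_def)
  next
    case False then show ?thesis using tv_supp[OF g a] by (auto simp: rho_def supp_def)
  qed
qed

theorem unitary_rep_rho: "unitary_rep K S rho"
  unfolding unitary_rep_def
proof (intro conjI ballI)
  fix g assume g: "g \<in> carrier K"
  have "bij_betw (rho g) (ell2 S) (ell2 S)"
  proof (rule bij_betwI[where g = "rho (inv g)"])
    show "rho g \<in> ell2 S \<rightarrow> ell2 S" "rho (inv g) \<in> ell2 S \<rightarrow> ell2 S"
      using rho_closed(1) g by blast+
    show "rho (inv g) (rho g x) = x" "rho g (rho (inv g) x) = x" if "x \<in> ell2 S" for x
      using rho_inv[OF g that] rho_inv[OF inv_closed[OF g] that] g by simp_all
  qed
  then show "ell2_unitary S (rho g)"
    unfolding ell2_unitary_def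
    using isometry_inner[of S "rho g", OF rho_closed(1)[OF g] rho_add[OF g] rho_scale[OF g] rho_norm[OF g]]
      rho_add[OF g] rho_scale[OF g] by (intro conjI) (assumption, blast+)
next
  fix g h x assume "g \<in> carrier K" "h \<in> carrier K"
  then show "rho (g \<otimes> h) x = rho g (rho h x)" by (rule rho_mult)
qed

end

section \<open>Direct sums of GNS representations and almost invariant vectors\<close>

lemma ell2_diff:
  assumes "x \<in> ell2 S" "y \<in> ell2 S"
  shows "(\<lambda>k. x k - y k) \<in> ell2 S"
    and "(\<Sum>k. (cmod (x k - y k))\<^sup>2) = (\<Sum>k. (cmod (x k))\<^sup>2) - 2 * Re (ell2_inner x y) + (\<Sum>k. (cmod (y k))\<^sup>2)"
    and "(\<Sum>k. (cmod (x k - y k))\<^sup>2) \<le> 2 * (\<Sum>k. (cmod (x k))\<^sup>2) + 2 * (\<Sum>k. (cmod (y k))\<^sup>2)"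
proof -
  note ny = ell2_scale[OF assms(2), of "-1"]
  note a = ell2_add[OF assms(1) ny(1)]
  show d: "(\<lambda>k. x k - y k) \<in> ell2 S" using a(1) by simp
  show eq: "(\<Sum>k. (cmod (x k - y k))\<^sup>2) = (\<Sum>k. (cmod (x k))\<^sup>2) - 2 * Re (ell2_inner x y) + (\<Sum>k. (cmod (y k))\<^sup>2)"
    using a(2) ell2_inner_scale_right[OF assms, of "-1"] by (simp del: ) 
  have "0 \<le> (\<Sum>k. (cmod (x k + y k))\<^sup>2)" by (rule ell2_norm_nonneg[OF ell2_add(1)[OF assms]])
  then show "(\<Sum>k. (cmod (x k - y k))\<^sup>2) \<le> 2 * (\<Sum>k. (cmod (x k))\<^sup>2) + 2 * (\<Sum>k. (cmod (y k))\<^sup>2)"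
    unfolding eq ell2_add(2)[OF assms] by simp
qed

lemma nonneg_Reals_sum:
  fixes f :: "'a \<Rightarrow> complex"
  assumes "\<And>x. x \<in> A \<Longrightarrow> f x \<in> \<real>\<^sub>\<ge>\<^sub>0"
  shows "sum f A \<in> \<real>\<^sub>\<ge>\<^sub>0"
  using assms by (induction A rule: infinite_finite_induct) auto

text \<open>The orthogonal sum over \<open>m\<close> of the kernels of the functions
  \<open>\<phi> m\<close>. Almost invariant vectors for all tolerances have to live in one
  representation, while a single \<open>\<phi> m\<close> serves only some tolerances.\<close>

definition gns_kernel :: "('k, 'm) monoid_scheme \<Rightarrow> (nat \<Rightarrow> 'k \<Rightarrow> complex) \<Rightarrow> nat \<times> 'k \<Rightarrow> nat \<times> 'k \<Rightarrow> complex" where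
  "gns_kernel K \<phi> x y = (if fst x = fst y then \<phi> (fst x) (inv\<^bsub>K\<^esub> (snd x) \<otimes>\<^bsub>K\<^esub> snd y) else 0)"

lemma gns_kernel_slice:
  assumes pd: "positive_definite K (\<phi> m)" and F: "finite F" "F \<subseteq> {m} \<times> carrier K"
  shows "(\<Sum>x\<in>F. \<Sum>y\<in>F. cnj (c x) * c y * gns_kernel K \<phi> x y) \<in> \<real>\<^sub>\<ge>\<^sub>0"
proof -
  have Fe: "F = (\<lambda>g. (m, g)) ` (snd ` F)" using F(2) by force
  have inj: "inj_on (\<lambda>g. (m, g)) (snd ` F)" by (auto simp: inj_on_def)
  have "(\<Sum>x\<in>F. \<Sum>y\<in>F. cnj (c x) * c y * gns_kernel K \<phi> x y)
    = (\<Sum>g\<in>snd ` F. \<Sum>h\<in>snd ` F. cnj (c (m, g)) * c (m, h) * \<phi> m (inv\<^bsub>K\<^esub> g \<otimes>\<^bsub>K\<^esub> h))"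
    by (subst (1 2) Fe, subst (1 2) sum.reindex[OF inj]) (simp add: gns_kernel_def)
  also have "\<dots> \<in> \<real>\<^sub>\<ge>\<^sub>0"
    using pd[unfolded positive_definite_def, rule_format, of "snd ` F" "\<lambda>g. c (m, g)"] F by force
  finally show ?thesis .
qed

lemma psd_gns_kernel:
  assumes pd: "\<And>m. positive_definite K (\<phi> m)"
  shows "psd_on (UNIV \<times> carrier K) (gns_kernel K \<phi>)"
  unfolding psd_on_def
proof (intro allI impI, elim conjE)
  fix F :: "(nat \<times> 'a) set" and c
  assume F: "finite F" "F \<subseteq> UNIV \<times> carrier K"
  let ?t = "\<lambda>x y. cnj (c x) * c y * gns_kernel K \<phi> x y"
  have "(\<Sum>x\<in>F. \<Sum>y\<in>F. ?t x y) = (\<Sum>m\<in>fst ` F. \<Sum>x\<in>{x\<in>F. fst x = m}. \<Sum>y\<in>F. ?t x y)"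
    by (rule sum.image_gen[OF F(1)])
  also have "\<dots> = (\<Sum>m\<in>fst ` F. \<Sum>x\<in>{x\<in>F. fst x = m}. \<Sum>y\<in>{y\<in>F. fst y = m}. ?t x y)"
    by (intro sum.cong HOL.refl sum.mono_neutral_right F) (auto simp: gns_kernel_def)
  also have "\<dots> \<in> \<real>\<^sub>\<ge>\<^sub>0"
  proof -
    have "(\<Sum>x\<in>{x\<in>F. fst x = m}. \<Sum>y\<in>{y\<in>F. fst y = m}. ?t x y) \<in> \<real>\<^sub>\<ge>\<^sub>0" for m
      by (rule gns_kernel_slice[where m = m]) (use F pd in auto)
    then show ?thesis by (rule nonneg_Reals_sum)
  qed
  finally show "(\<Sum>x\<in>F. \<Sum>y\<in>F. ?t x y) \<in> \<real>\<^sub>\<ge>\<^sub>0" .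
qed

text \<open>Different levels are orthogonal, so restricting to level \<open>n\<close> is an
  orthogonal projection: the cross terms vanish and the remaining levels contribute a nonnegative
  amount.\<close>

lemma qform_slice_le:
  assumes pd: "\<And>m. positive_definite K (\<phi> m)"
    and a: "finite (supp a)" "supp a \<subseteq> UNIV \<times> carrier K"
  shows "finite (supp (\<lambda>g. a (n, g)))" "supp (\<lambda>g. a (n, g)) \<subseteq> carrier K"
    and "qform (\<lambda>g h. \<phi> n (inv\<^bsub>K\<^esub> g \<otimes>\<^bsub>K\<^esub> h)) (\<lambda>g. a (n, g)) \<le> qform (gns_kernel K \<phi>) a"
proof -
  let ?c = "\<lambda>g. a (n, g)" and ?t = "\<lambda>x y. cnj (a x) * a y * gns_kernel K \<phi> x y"
  define F1 where "F1 = {x \<in> supp a. fst x = n}"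
  define F2 where "F2 = {x \<in> supp a. fst x \<noteq> n}"
  have F1e: "F1 = (\<lambda>g. (n, g)) ` supp ?c" by (auto simp: F1_def supp_def image_iff)
  have inj: "inj_on (\<lambda>g. (n, g)) (supp ?c)" by (auto simp: inj_on_def)
  have fin: "finite F1" "finite F2" using a by (auto simp: F1_def F2_def)
  show "finite (supp ?c)" using fin(1) unfolding F1e by (rule finite_imageD[OF _ inj])
  show "supp ?c \<subseteq> carrier K" using a(2) by (auto simp: supp_def)
  have u: "supp a = F1 \<union> F2" "F1 \<inter> F2 = {}" by (auto simp: F1_def F2_def)
  have z: "?t x y = 0" if "x \<in> F1 \<and> y \<in> F2 \<or> x \<in> F2 \<and> y \<in> F1" for x y
    using that by (auto simp: F1_def F2_def gns_kernel_def)
  have "(\<Sum>x\<in>supp a. \<Sum>y\<in>supp a. ?t x y) = (\<Sum>x\<in>F1. \<Sum>y\<in>F1. ?t x y) + (\<Sum>x\<in>F1. \<Sum>y\<in>F2. ?t x y)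
     + ((\<Sum>x\<in>F2. \<Sum>y\<in>F1. ?t x y) + (\<Sum>x\<in>F2. \<Sum>y\<in>F2. ?t x y))"
    unfolding u(1) by (simp add: sum.union_disjoint[OF fin u(2)] sum.distrib)
  also have "(\<Sum>x\<in>F1. \<Sum>y\<in>F2. ?t x y) = 0" by (intro sum.neutral ballI) (use z in blast)
  also have "(\<Sum>x\<in>F2. \<Sum>y\<in>F1. ?t x y) = 0" by (intro sum.neutral ballI) (use z in blast)
  finally have eq: "(\<Sum>x\<in>supp a. \<Sum>y\<in>supp a. ?t x y) = (\<Sum>x\<in>F1. \<Sum>y\<in>F1. ?t x y) + (\<Sum>x\<in>F2. \<Sum>y\<in>F2. ?t x y)"
    by simp
  have "Re (\<Sum>x\<in>F2. \<Sum>y\<in>F2. ?t x y) \<ge> 0"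
    by (rule psd_onD(1)[OF psd_gns_kernel[OF pd] fin(2)]) (use a F2_def in auto)
  moreover have "(\<Sum>x\<in>F1. \<Sum>y\<in>F1. ?t x y)
    = (\<Sum>g\<in>supp ?c. \<Sum>h\<in>supp ?c. cnj (?c g) * ?c h * \<phi> n (inv\<^bsub>K\<^esub> g \<otimes>\<^bsub>K\<^esub> h))"
    unfolding F1e by (simp add: sum.reindex[OF inj] gns_kernel_def)
  ultimately show "qform (\<lambda>g h. \<phi> n (inv\<^bsub>K\<^esub> g \<otimes>\<^bsub>K\<^esub> h)) ?c \<le> qform (gns_kernel K \<phi>) a"
    unfolding qform_def eq by simp
qed

lemma (in group) gns_data_exists:
  assumes cnt: "countable (carrier G)" and pd: "\<And>m. positive_definite G (\<phi> m)"
  obtains S v where "gns_data G (UNIV \<times> carrier G) S v (\<lambda>g x. (fst x, g \<otimes> snd x)) (gns_kernel G \<phi>)"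
proof -
  define C where "C = (UNIV :: nat set) \<times> carrier G"
  \<comment> \<open>The factor of natural numbers makes \<open>C\<close> infinite even when the
    group is finite, so \<open>b\<close> and \<open>t\<close> below are mutually inverse bijections
    between the natural numbers and \<open>C\<close>.\<close>
  have C: "countable C" "infinite C"
    using cnt by (auto simp: C_def finite_cartesian_product_iff)
  define b where "b = from_nat_into C"
  define t where "t = to_nat_on C"
  have b: "b i \<in> C" for i using C by (simp add: b_def from_nat_into infinite_imp_nonempty)
  have bt: "b (t c) = c" if "c \<in> C" for c using that C by (simp add: b_def t_def)
  have tb: "t (b i) = i" for i using C by (simp add: b_def t_def)
  have inj: "inj b" by (metis injI tb)
  define \<kappa> where "\<kappa> i j = gns_kernel G \<phi> (b i) (b j)" for i j
  have psd: "psd_on UNIV \<kappa>"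
    unfolding psd_on_def
  proof (intro allI impI, elim conjE)
    fix F :: "nat set" and c :: "nat \<Rightarrow> complex" assume F: "finite F"
    have "(\<Sum>x\<in>b ` F. \<Sum>y\<in>b ` F. cnj (c (t x)) * c (t y) * gns_kernel G \<phi> x y) \<in> \<real>\<^sub>\<ge>\<^sub>0"
      using psd_gns_kernel[where K = G and \<phi> = \<phi>, OF pd, unfolded psd_on_def, rule_format, of "b ` F" "\<lambda>x. c (t x)"] F b
      by (auto simp: C_def)
    also have "(\<Sum>x\<in>b ` F. \<Sum>y\<in>b ` F. cnj (c (t x)) * c (t y) * gns_kernel G \<phi> x y)
      = (\<Sum>i\<in>F. \<Sum>j\<in>F. cnj (c i) * c j * \<kappa> i j)"
      by (simp add: sum.reindex[OF inj_on_subset[OF inj subset_UNIV]] \<kappa>_def tb)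
    finally show "(\<Sum>i\<in>F. \<Sum>j\<in>F. cnj (c i) * c j * \<kappa> i j) \<in> \<real>\<^sub>\<ge>\<^sub>0" .
  qed
  show thesis
  proof (rule kolmogorov[OF psd])
  fix S and e :: "nat \<Rightarrow> nat \<Rightarrow> complex"
  assume e: "\<And>j k. e j k \<noteq> 0 \<Longrightarrow> k \<le> j \<and> k \<in> S" "\<And>i j. ell2_inner (e j) (e i) = \<kappa> i j"
    "\<And>l. l \<in> S \<Longrightarrow> \<exists>a. \<forall>k. (\<Sum>i\<le>l. a i * e i k) = delta l k"
  show thesis
  proof (rule that[of S "\<lambda>c. e (t c)"], unfold_locales, unfold C_def[symmetric])
    fix c assume c: "c \<in> C"
    show "finite (supp (e (t c))) \<and> supp (e (t c)) \<subseteq> S"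
      using e(1) by (auto simp: supp_def intro: finite_subset[of _ "{..t c}"])
    show "(fst c, \<one> \<otimes> snd c) = c" using c by (auto simp: C_def)
    fix d assume d: "d \<in> C"
    show "ell2_inner (e (t d)) (e (t c)) = gns_kernel G \<phi> c d" using c d by (simp add: e(2) \<kappa>_def bt)
  next
    fix l assume "l \<in> S"
    then obtain a where a: "\<And>k. (\<Sum>i\<le>l. a i * e i k) = delta l k" using e(3) by blast
    define A where "A c = (if c \<in> C \<and> t c \<le> l then a (t c) else 0)" for c
    have supp: "supp A \<subseteq> b ` {..l}"
    proof
      fix c assume "c \<in> supp A"
      then have "c \<in> C" "t c \<le> l" by (auto simp: supp_def A_def split: if_splits)
      then show "c \<in> b ` {..l}" using bt[of c] by (metis atMost_iff image_eqI)
    qed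
    have "(\<Sum>c\<in>supp A. A c * e (t c) k) = delta l k" for k
    proof -
      have "(\<Sum>c\<in>supp A. A c * e (t c) k) = (\<Sum>c\<in>b ` {..l}. A c * e (t c) k)"
        by (intro sum.mono_neutral_left supp) (auto simp: supp_def)
      also have "\<dots> = (\<Sum>i\<le>l. a i * e i k)"
        by (simp add: sum.reindex[OF inj_on_subset[OF inj subset_UNIV]] A_def tb b)
      finally show ?thesis using a by simp
    qed
    moreover have "finite (supp A)" using supp by (rule finite_subset) simp
    moreover have "supp A \<subseteq> C" by (auto simp: supp_def A_def split: if_splits)
    ultimately show "\<exists>A. finite (supp A) \<and> supp A \<subseteq> C \<and> (\<forall>k. (\<Sum>c\<in>supp A. A c * e (t c) k) = delta l k)"
      by blast
  next
    fix g c assume g: "g \<in> carrier G" and c: "c \<in> C"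
    then show "(fst c, g \<otimes> snd c) \<in> C" by (auto simp: C_def)
    fix d assume d: "d \<in> C"
    have "inv (g \<otimes> snd c) \<otimes> (g \<otimes> snd d) = inv (snd c) \<otimes> snd d"
      using g c d by (auto simp: C_def inv_mult_group m_assoc inv_solve_left')
    then show "gns_kernel G \<phi> (fst c, g \<otimes> snd c) (fst d, g \<otimes> snd d) = gns_kernel G \<phi> c d"
      by (simp add: gns_kernel_def)
  next
    fix g h c assume "g \<in> carrier G" "h \<in> carrier G" "c \<in> C"
    then show "(fst c, g \<otimes> h \<otimes> snd c) = (fst (fst c, h \<otimes> snd c), g \<otimes> snd (fst c, h \<otimes> snd c))"
      by (auto simp: C_def m_assoc)
  qed
  qed
qed

text \<open>The value zero outside the carrier keeps the support of a translate inside the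
  group.\<close>

definition translate :: "('k, 'm) monoid_scheme \<Rightarrow> 'k \<Rightarrow> ('k \<Rightarrow> complex) \<Rightarrow> 'k \<Rightarrow> complex" where
  "translate K h c = (\<lambda>g. if g \<in> carrier K then c (inv\<^bsub>K\<^esub> h \<otimes>\<^bsub>K\<^esub> g) else 0)"

lemma ell2_truncation:
  assumes \<xi>: "\<xi> \<in> ell2 S"
  defines "tr \<equiv> \<lambda>n k. if k < n then \<xi> k else 0"
  shows "tr n \<in> ell2 S" and "(\<lambda>n. \<Sum>k. (cmod (tr n k - \<xi> k))\<^sup>2) \<longlonglongrightarrow> 0"
proof -
  have s: "summable (\<lambda>k. (cmod (\<xi> k))\<^sup>2)" using \<xi> by (simp add: ell2_iff)
  show "tr n \<in> ell2 S"
    by (rule ell2_finite_supp) (use \<xi> in \<open>auto simp: supp_def tr_def ell2_def intro: finite_subset[of _ "{..<n}"]\<close>)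
  have fs: "(\<lambda>k. (cmod (tr n k))\<^sup>2) sums (\<Sum>k<n. (cmod (\<xi> k))\<^sup>2)" for n
    using sums_finite[of "{..<n}" "\<lambda>k. (cmod (tr n k))\<^sup>2"] by (auto simp: tr_def)
  have "(\<Sum>k. (cmod (tr n k - \<xi> k))\<^sup>2) = (\<Sum>k. (cmod (\<xi> k))\<^sup>2) - (\<Sum>k<n. (cmod (\<xi> k))\<^sup>2)" for n
  proof -
    have "(\<lambda>k. (cmod (\<xi> k))\<^sup>2 - (cmod (tr n k))\<^sup>2) sums ((\<Sum>k. (cmod (\<xi> k))\<^sup>2) - (\<Sum>k<n. (cmod (\<xi> k))\<^sup>2))"
      by (intro sums_diff fs summable_sums s)
    moreover have "(\<lambda>k. (cmod (\<xi> k))\<^sup>2 - (cmod (tr n k))\<^sup>2) = (\<lambda>k. (cmod (tr n k - \<xi> k))\<^sup>2)"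
      by (auto simp: tr_def)
    ultimately show ?thesis by (simp add: sums_iff)
  qed
  moreover have "(\<lambda>n. (\<Sum>k. (cmod (\<xi> k))\<^sup>2) - (\<Sum>k<n. (cmod (\<xi> k))\<^sup>2)) \<longlonglongrightarrow> (\<Sum>k. (cmod (\<xi> k))\<^sup>2) - (\<Sum>k. (cmod (\<xi> k))\<^sup>2)"
    by (intro tendsto_diff tendsto_const summable_LIMSEQ s)
  ultimately show "(\<lambda>n. \<Sum>k. (cmod (tr n k - \<xi> k))\<^sup>2) \<longlonglongrightarrow> 0" by simp
qed

lemma (in gns_data) ell2_norm_v_diff:
  assumes "c \<in> C" "d \<in> C"
  shows "(\<Sum>k. (cmod (v d k - v c k))\<^sup>2) = Re (\<kappa> d d) - 2 * Re (\<kappa> c d) + Re (\<kappa> c c)"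
proof -
  have v: "v x \<in> ell2 S" if "x \<in> C" for x using v_supp[OF that] by (auto intro: ell2_finite_supp)
  have n: "(\<Sum>k. (cmod (v x k))\<^sup>2) = Re (\<kappa> x x)" if "x \<in> C" for x
  proof -
    have x: "comb (delta x)" "supp (delta x) = {x}" using that by (auto simp: comb_def supp_def delta_def)
    have "tv \<one> (delta x) = v x" using that by (simp add: tv_def x p_one) (simp add: delta_def)
    then show ?thesis using nsq_tv[OF one_closed x(1)] by (simp add: qform_def x) (simp add: delta_def)
  qed
  show ?thesis using assms by (simp add: ell2_diff(2)[OF v v] n gram)
qed

text \<open>The invariant vector is encoded by coefficient functions \<open>c i\<close> whose
  combinations converge to its component at one level \<open>n\<close>: Cauchy in norm,
  asymptotically fixed by \<open>H\<close>, and with a nonzero limit \<open>L\<close> of inner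
  products with the vector at \<open>g0\<close>. In this form it can be transported to other
  realisations of the same kernel.\<close>

lemma relative_property_T_gns:
  fixes K :: "('k, 'm) monoid_scheme" and \<phi> :: "nat \<Rightarrow> 'k \<Rightarrow> complex"
  assumes grp: "group K" and cnt: "countable (carrier K)"
    and T: "relative_property_T K H" and HK: "H \<subseteq> carrier K"
    and pd: "\<And>m. positive_definite K (\<phi> m)" and \<phi>1: "\<And>m. \<phi> m \<one>\<^bsub>K\<^esub> = 1"
    and lim: "\<And>g. g \<in> carrier K \<Longrightarrow> (\<lambda>m. \<phi> m g) \<longlonglongrightarrow> 1"
  obtains n and c :: "nat \<Rightarrow> 'k \<Rightarrow> complex" and g0 L where
    "\<And>i. finite (supp (c i)) \<and> supp (c i) \<subseteq> carrier K"
    "\<And>e. e > 0 \<Longrightarrow> \<exists>N. \<forall>i\<ge>N. \<forall>j\<ge>N.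
        qform (\<lambda>g h. \<phi> n (inv\<^bsub>K\<^esub> g \<otimes>\<^bsub>K\<^esub> h)) (\<lambda>g. c i g - c j g) < e"
    "\<And>h. h \<in> H \<Longrightarrow>
        (\<lambda>i. qform (\<lambda>g h. \<phi> n (inv\<^bsub>K\<^esub> g \<otimes>\<^bsub>K\<^esub> h)) (\<lambda>g. translate K h (c i) g - c i g)) \<longlonglongrightarrow> 0"
    "g0 \<in> carrier K" "L \<noteq> 0"
    "(\<lambda>i. \<Sum>g\<in>supp (c i). c i g * \<phi> n (inv\<^bsub>K\<^esub> g0 \<otimes>\<^bsub>K\<^esub> g)) \<longlonglongrightarrow> L"
proof -
  interpret K: group K by fact
  define C where "C = (UNIV :: nat set) \<times> carrier K"
  define \<kappa> where "\<kappa> = gns_kernel K \<phi>"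
  show thesis
  proof (rule K.gns_data_exists[OF cnt pd])
    fix S v
    assume gd: "gns_data K (UNIV \<times> carrier K) S v (\<lambda>g x. (fst x, g \<otimes>\<^bsub>K\<^esub> snd x)) (gns_kernel K \<phi>)"
    interpret gns_data K C S v "\<lambda>g x. (fst x, g \<otimes>\<^bsub>K\<^esub> snd x)" \<kappa>
      using gd unfolding C_def \<kappa>_def .
    have v: "v x \<in> ell2 S" if "x \<in> C" for x using v_supp[OF that] by (auto intro: ell2_finite_supp)
    have "almost_invariant_vectors K S rho"
      unfolding almost_invariant_vectors_def
    proof (intro allI impI, elim conjE)
      fix F and \<epsilon> :: real assume F: "finite F" "F \<subseteq> carrier K" "\<epsilon> > 0"
      \<comment> \<open>The unit vector at \<open>(m, \<one>)\<close> is displaced by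
        \<open>g\<close> by the squared amount \<open>2 - 2 * Re (\<phi> m g)\<close>, whence the
        tolerance, half the square of \<open>\<epsilon>\<close>.\<close>
      have "\<forall>\<^sub>F m in sequentially. \<forall>g\<in>F. dist (\<phi> m g) 1 < \<epsilon>\<^sup>2 / 2"
        using F lim by (intro eventually_ball_finite ballI tendstoD) auto
      then obtain m where m: "\<And>g. g \<in> F \<Longrightarrow> dist (\<phi> m g) 1 < \<epsilon>\<^sup>2 / 2"
        by (auto simp: eventually_sequentially)
      have mC: "(m, g) \<in> C" if "g \<in> carrier K" for g using that by (simp add: C_def)
      have "ell2_norm (v (m, \<one>\<^bsub>K\<^esub>)) = 1"
      proof -
        have "complex_of_real (\<Sum>k. (cmod (v (m, \<one>\<^bsub>K\<^esub>) k))\<^sup>2) = 1"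
        proof -
          have dl: "comb (delta (m, \<one>\<^bsub>K\<^esub>))" "supp (delta (m, \<one>\<^bsub>K\<^esub>)) = {(m, \<one>\<^bsub>K\<^esub>)}"
            by (auto simp: comb_def supp_def delta_def mC)
          have "tv \<one>\<^bsub>K\<^esub> (delta (m, \<one>\<^bsub>K\<^esub>)) = v (m, \<one>\<^bsub>K\<^esub>)"
            by (simp add: tv_def dl) (simp add: delta_def)
          then show ?thesis using nsq_tv[OF K.one_closed dl(1)]
            by (simp add: qform_def dl \<kappa>_def gns_kernel_def \<phi>1) (simp add: delta_def)
        qed
        then show ?thesis by (simp add: ell2_norm_def)
      qed
      moreover have "ell2_norm (\<lambda>k. rho g (v (m, \<one>\<^bsub>K\<^esub>)) k - v (m, \<one>\<^bsub>K\<^esub>) k) < \<epsilon>" if g: "g \<in> F" for g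
      proof -
        have gK: "g \<in> carrier K" using g F by auto
        have "(\<Sum>k. (cmod (rho g (v (m, \<one>\<^bsub>K\<^esub>)) k - v (m, \<one>\<^bsub>K\<^esub>) k))\<^sup>2) = 2 - 2 * Re (\<phi> m g)"
          using ell2_norm_v_diff[of "(m, \<one>\<^bsub>K\<^esub>)" "(m, g)"] gK mC
          by (simp add: rho_v \<kappa>_def gns_kernel_def \<phi>1)
        also have "\<dots> = - 2 * Re (\<phi> m g - 1)" by simp
        also have "\<dots> \<le> 2 * cmod (\<phi> m g - 1)" using abs_Re_le_cmod[of "\<phi> m g - 1"] by linarith
        also have "\<dots> < \<epsilon>\<^sup>2" using m[OF g] by (simp add: dist_norm)
        finally show ?thesis unfolding ell2_norm_def using F(3) by (simp add: real_less_lsqrt)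
      qed
      ultimately show "\<exists>\<xi>\<in>ell2 S. ell2_norm \<xi> = 1 \<and> (\<forall>g\<in>F. ell2_norm (\<lambda>k. rho g \<xi> k - \<xi> k) < \<epsilon>)"
        using v[OF mC[OF K.one_closed]] by blast
    qed
    then have "\<exists>\<xi>\<in>ell2 S. \<xi> \<noteq> (\<lambda>k. 0) \<and> (\<forall>h\<in>H. rho h \<xi> = \<xi>)"
      by (intro T[unfolded relative_property_T_def, rule_format, of S rho] conjI unitary_rep_rho)
    then obtain \<xi> where \<xi>: "\<xi> \<in> ell2 S" "\<xi> \<noteq> (\<lambda>k. 0)" "\<And>h. h \<in> H \<Longrightarrow> rho h \<xi> = \<xi>"
      by blast
    \<comment> \<open>Truncations of the invariant vector are finitely supported, hence finite
      combinations of the generating vectors; \<open>d n\<close> is their squared error.\<close>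
    define tr where "tr n = (\<lambda>k. if k < n then \<xi> k else 0)" for n
    define d where "d n = (\<Sum>k. (cmod (tr n k - \<xi> k))\<^sup>2)" for n
    have tr: "tr n \<in> ell2 S" for n using ell2_truncation(1)[OF \<xi>(1)] unfolding tr_def .
    have d0: "d \<longlonglongrightarrow> 0" using ell2_truncation(2)[OF \<xi>(1)] unfolding d_def tr_def .
    define T where "T n = {..<n} \<inter> S" for n
    have T: "finite (T n)" "T n \<subseteq> S" for n by (auto simp: T_def)
    define A where "A n = (\<lambda>x. \<Sum>l\<in>T n. \<xi> l * D l x)" for n
    note A = tv_lincomb[OF T, where w = \<xi>, folded A_def]
    have trA: "tv \<one>\<^bsub>K\<^esub> (A n) = tr n" for n
    proof
      fix k
      have "tv \<one>\<^bsub>K\<^esub> (A n) k = (\<Sum>l\<in>T n. \<xi> l * delta l k)"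
        unfolding A(2)
      proof (intro sum.cong HOL.refl)
        fix l assume "l \<in> T n"
        then have "l \<in> S" by (simp add: T_def)
        then show "\<xi> l * u \<one>\<^bsub>K\<^esub> l k = \<xi> l * delta l k" by (simp add: u_def D(2))
      qed
      also have "\<dots> = tr n k" using \<xi>(1)
        by (auto simp: delta_def T_def tr_def ell2_def if_distrib[of "\<lambda>x. _ * x"] cong: if_cong)
      finally show "tv \<one>\<^bsub>K\<^esub> (A n) k = tr n k" .
    qed
    have drho: "rho g (\<lambda>k. x k - y k) = (\<lambda>k. rho g x k - rho g y k)"
      if "g \<in> carrier K" "x \<in> ell2 S" "y \<in> ell2 S" for g x y
      using rho_add[OF that(1,2) ell2_scale(1)[OF that(3), of "-1"]] rho_scale[OF that(1,3), of "-1"]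
      by (simp add: fun_eq_iff)
    have q1: "qform \<kappa> (\<lambda>x. A i x - A j x) \<le> 2 * d i + 2 * d j" for i j
    proof -
      have "qform \<kappa> (\<lambda>x. A i x - A j x) = (\<Sum>k. (cmod (tr i k - tr j k))\<^sup>2)"
        using nsq_tv[OF K.one_closed comb_diff[OF A(1) A(1)]] by (simp add: tv_diff A(1) trA)
      also have "\<dots> = (\<Sum>k. (cmod ((tr i k - \<xi> k) - (tr j k - \<xi> k)))\<^sup>2)" by simp
      also have "\<dots> \<le> 2 * d i + 2 * d j" unfolding d_def
        by (rule ell2_diff(3)[OF ell2_diff(1) ell2_diff(1)]) (rule tr \<xi>(1))+
      finally show ?thesis .
    qed
    \<comment> \<open>Translation by \<open>h\<close> on the level of coefficients; its restriction
      to one level is \<open>translate\<close>.\<close>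
    define sh where "sh h a = (\<lambda>x. if x \<in> C then a (fst x, inv\<^bsub>K\<^esub> h \<otimes>\<^bsub>K\<^esub> snd x) else (0::complex))" for h a
    have sh: "comb (sh h a)" "tv \<one>\<^bsub>K\<^esub> (sh h a) = tv h a" if h: "h \<in> carrier K" and a: "comb a" for h a
    proof -
      let ?p = "\<lambda>x. (fst x, h \<otimes>\<^bsub>K\<^esub> snd x)"
      have inj: "inj_on ?p (supp a)"
      proof (rule inj_onI)
        fix x y assume xy: "x \<in> supp a" "y \<in> supp a" "?p x = ?p y"
        then have "x \<in> C" "y \<in> C" using a by (auto simp: comb_def)
        then have "snd x \<in> carrier K" "snd y \<in> carrier K" by (auto simp: C_def)
        then show "x = y" using xy h by (simp add: prod_eq_iff)
      qed
      have "supp (sh h a) = ?p ` supp a"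
      proof (intro equalityI subsetI)
        fix x assume "x \<in> supp (sh h a)"
        then have x: "x \<in> C" "a (fst x, inv\<^bsub>K\<^esub> h \<otimes>\<^bsub>K\<^esub> snd x) \<noteq> 0"
          by (auto simp: supp_def sh_def split: if_splits)
        have "x = ?p (fst x, inv\<^bsub>K\<^esub> h \<otimes>\<^bsub>K\<^esub> snd x)"
          using x h by (auto simp: C_def K.m_assoc[symmetric])
        then show "x \<in> ?p ` supp a" by (rule image_eqI) (use x in \<open>simp add: supp_def\<close>)
      next
        fix x assume "x \<in> ?p ` supp a"
        then obtain y where y: "y \<in> supp a" "x = ?p y" by auto
        then have "y \<in> C" using a by (auto simp: comb_def)
        then have "snd y \<in> carrier K" by (auto simp: C_def)
        then show "x \<in> supp (sh h a)"
          using y h by (auto simp: supp_def sh_def C_def K.m_assoc[symmetric])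
      qed
      note s = this
      have "finite (supp a)" "supp a \<subseteq> C" using a by (auto simp: comb_def)
      then show "comb (sh h a)" unfolding comb_def s using h by (auto simp: C_def)
      show "tv \<one>\<^bsub>K\<^esub> (sh h a) = tv h a"
      proof
        fix k
        have "tv \<one>\<^bsub>K\<^esub> (sh h a) k = (\<Sum>y\<in>supp a. sh h a (?p y) * v (fst (?p y), \<one>\<^bsub>K\<^esub> \<otimes>\<^bsub>K\<^esub> snd (?p y)) k)"
          unfolding tv_def s by (simp add: sum.reindex[OF inj])
        also have "\<dots> = tv h a k" unfolding tv_def
        proof (intro sum.cong HOL.refl)
          fix y assume "y \<in> supp a"
          then have "y \<in> C" using a by (auto simp: comb_def)
          then have "snd y \<in> carrier K" by (auto simp: C_def)
          then show "sh h a (?p y) * v (fst (?p y), \<one>\<^bsub>K\<^esub> \<otimes>\<^bsub>K\<^esub> snd (?p y)) k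
              = a y * v (fst y, h \<otimes>\<^bsub>K\<^esub> snd y) k"
            using h by (simp add: sh_def C_def K.m_assoc[symmetric])
        qed
        finally show "tv \<one>\<^bsub>K\<^esub> (sh h a) k = tv h a k" .
      qed
    qed
    \<comment> \<open>Since \<open>h\<close> fixes \<open>\<xi>\<close>, the displacement of
      \<open>tr i\<close> equals that of \<open>tr i - \<xi>\<close>, whose squared norm is at most
      four times the squared error.\<close>
    have q2: "qform \<kappa> (\<lambda>x. sh h (A i) x - A i x) \<le> 4 * d i" if h: "h \<in> H" for h i
    proof -
      have hK: "h \<in> carrier K" using h HK by auto
      have di: "(\<lambda>k. tr i k - \<xi> k) \<in> ell2 S" by (rule ell2_diff(1)[OF tr \<xi>(1)])
      have "qform \<kappa> (\<lambda>x. sh h (A i) x - A i x) = (\<Sum>k. (cmod (rho h (tr i) k - tr i k))\<^sup>2)"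
        using nsq_tv[OF K.one_closed comb_diff[OF sh(1)[OF hK A(1)[of i]] A(1)[of i]]]
          rho_tv[OF hK A(1)[of i]]
        by (simp add: tv_diff A(1) sh hK trA)
      also have "\<dots> = (\<Sum>k. (cmod (rho h (\<lambda>k. tr i k - \<xi> k) k - (tr i k - \<xi> k)))\<^sup>2)"
        by (simp add: drho hK tr \<xi>(1) \<xi>(3)[OF h])
      also have "\<dots> \<le> 2 * (\<Sum>k. (cmod (rho h (\<lambda>k. tr i k - \<xi> k) k))\<^sup>2) + 2 * d i"
        unfolding d_def by (rule ell2_diff(3)[OF rho_closed(1)[OF hK di] di])
      also have "(\<Sum>k. (cmod (rho h (\<lambda>k. tr i k - \<xi> k) k))\<^sup>2) = d i"
        unfolding d_def by (rule rho_norm[OF hK di])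
      finally show ?thesis by simp
    qed
    \<comment> \<open>Each coordinate of \<open>\<xi>\<close> is a finite combination of these inner
      products, so they cannot all vanish.\<close>
    have "\<exists>x\<in>C. ell2_inner \<xi> (v x) \<noteq> 0"
    proof (rule ccontr)
      assume z: "\<not> (\<exists>x\<in>C. ell2_inner \<xi> (v x) \<noteq> 0)"
      have "\<xi> l = 0" for l
      proof (cases "l \<in> S")
        case True
        have "\<xi> l = ell2_inner \<xi> (tv \<one>\<^bsub>K\<^esub> (D l))" using D(2)[OF True] by (simp add: inner_delta)
        also have "\<dots> = (\<Sum>x\<in>supp (D l). cnj (D l x) * ell2_inner \<xi> (v (fst x, \<one>\<^bsub>K\<^esub> \<otimes>\<^bsub>K\<^esub> snd x)))"
          by (rule inner_tv_right[OF K.one_closed D(1)[OF True]])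
        also have "\<dots> = 0"
        proof (intro sum.neutral ballI)
          fix x assume "x \<in> supp (D l)"
          then have "x \<in> C" using D(1)[OF True] by (auto simp: comb_def)
          then show "cnj (D l x) * ell2_inner \<xi> (v (fst x, \<one>\<^bsub>K\<^esub> \<otimes>\<^bsub>K\<^esub> snd x)) = 0"
            using z p_one[of x] by auto
        qed
        finally show ?thesis .
      qed (use \<xi>(1) in \<open>auto simp: ell2_def\<close>)
      then show False using \<xi>(2) by auto
    qed
    then obtain n g0 where ng: "(n, g0) \<in> C" "ell2_inner \<xi> (v (n, g0)) \<noteq> 0" by auto
    define c where "c i = (\<lambda>g. A i (n, g))" for i
    let ?\<kappa>n = "\<lambda>g h. \<phi> n (inv\<^bsub>K\<^esub> g \<otimes>\<^bsub>K\<^esub> h)"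
    have cb: "finite (supp a)" "supp a \<subseteq> UNIV \<times> carrier K" if "comb a" for a
      using that unfolding comb_def by (auto simp: C_def)
    note sl = qform_slice_le[of K \<phi>, OF pd cb, folded \<kappa>_def]
    have dlim: "(\<lambda>i. 4 * d i) \<longlonglongrightarrow> 0" using tendsto_mult_right_zero[OF d0, of 4] by simp
    have tl: "translate K h (c i) = (\<lambda>g. sh h (A i) (n, g))" for h i
      by (auto simp: translate_def c_def sh_def C_def)
    show thesis
    proof (rule that)
      show "finite (supp (c i)) \<and> supp (c i) \<subseteq> carrier K" for i
        unfolding c_def using sl(1,2)[OF A(1) A(1)] by blast
      show "\<exists>N. \<forall>i\<ge>N. \<forall>j\<ge>N. qform ?\<kappa>n (\<lambda>g. c i g - c j g) < e" if e: "e > 0" for e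
      proof -
        obtain N where N: "\<And>i. i \<ge> N \<Longrightarrow> 4 * d i < e"
          using order_tendstoD(2)[OF dlim e] by (auto simp: eventually_sequentially)
        have "qform ?\<kappa>n (\<lambda>g. c i g - c j g) < e" if "i \<ge> N" "j \<ge> N" for i j
        proof -
          have "qform ?\<kappa>n (\<lambda>g. c i g - c j g) \<le> qform \<kappa> (\<lambda>x. A i x - A j x)"
            unfolding c_def using sl(3)[OF comb_diff[OF A(1) A(1)] comb_diff[OF A(1) A(1)]] .
          also have "\<dots> \<le> 2 * d i + 2 * d j" by (rule q1)
          also have "\<dots> < e" using N[OF that(1)] N[OF that(2)] by linarith
          finally show ?thesis .
        qed
        then show ?thesis by blast
      qed
      show "(\<lambda>i. qform ?\<kappa>n (\<lambda>g. translate K h (c i) g - c i g)) \<longlonglongrightarrow> 0" if h: "h \<in> H" for h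
      proof (rule tendsto_sandwich[OF _ _ tendsto_const dlim])
        have hK: "h \<in> carrier K" using h HK by auto
        note cd = comb_diff[OF sh(1)[OF hK A(1)] A(1)]
        have "0 \<le> qform ?\<kappa>n (\<lambda>g. translate K h (c i) g - c i g)" for i
          unfolding tl unfolding c_def
          by (rule qform_nonneg[of "carrier K"])
            (use pd[of n] sl(1,2)[OF cd cd] in \<open>auto simp: psd_on_def positive_definite_def\<close>)
        then show "\<forall>\<^sub>F i in sequentially. 0 \<le> qform ?\<kappa>n (\<lambda>g. translate K h (c i) g - c i g)" by simp
        have "qform ?\<kappa>n (\<lambda>g. translate K h (c i) g - c i g) \<le> 4 * d i" for i
          unfolding tl unfolding c_def using order_trans[OF sl(3)[OF cd cd] q2[OF h]] .
        then show "\<forall>\<^sub>F i in sequentially. qform ?\<kappa>n (\<lambda>g. translate K h (c i) g - c i g) \<le> 4 * d i" by simp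
      qed
      show "g0 \<in> carrier K" using ng by (simp add: C_def)
      show "ell2_inner \<xi> (v (n, g0)) \<noteq> 0" by fact
      have fv: "finite (supp (v (n, g0)))" using v_supp[OF ng(1)] by simp
      have "ell2_inner (tr i) (v (n, g0)) = (\<Sum>g\<in>supp (c i). c i g * ?\<kappa>n g0 g)" for i
      proof -
        have "ell2_inner (tr i) (v (n, g0)) = (\<Sum>x\<in>supp (A i). A i x * ell2_inner (v (fst x, \<one>\<^bsub>K\<^esub> \<otimes>\<^bsub>K\<^esub> snd x)) (v (n, g0)))"
          unfolding trA[symmetric] by (rule inner_tv_left[OF K.one_closed A(1)])
        also have "\<dots> = (\<Sum>x\<in>supp (A i). A i x * \<kappa> (n, g0) x)"
        proof (intro sum.cong HOL.refl)
          fix x assume "x \<in> supp (A i)"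
          then have "x \<in> C" using A(1)[of i] by (auto simp: comb_def)
          then show "A i x * ell2_inner (v (fst x, \<one>\<^bsub>K\<^esub> \<otimes>\<^bsub>K\<^esub> snd x)) (v (n, g0)) = A i x * \<kappa> (n, g0) x"
            using p_one[of x] gram[OF ng(1), of x] by simp
        qed
        also have "\<dots> = (\<Sum>x\<in>(\<lambda>g. (n, g)) ` supp (c i). A i x * \<kappa> (n, g0) x)"
          by (intro sum.mono_neutral_right cb A(1))
            (auto simp: supp_def c_def \<kappa>_def gns_kernel_def image_iff)
        also have "\<dots> = (\<Sum>g\<in>supp (c i). c i g * ?\<kappa>n g0 g)"
          by (subst sum.reindex) (auto simp: inj_on_def c_def \<kappa>_def gns_kernel_def)
        finally show ?thesis .
      qed
      moreover have "(\<lambda>i. ell2_inner (tr i) (v (n, g0))) \<longlonglongrightarrow> ell2_inner \<xi> (v (n, g0))"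
      proof (rule tendsto_eventually)
        from fv obtain N where "\<forall>k\<in>supp (v (n, g0)). k < N"
          unfolding finite_nat_set_iff_bounded by blast
        then have N: "\<And>k. k \<in> supp (v (n, g0)) \<Longrightarrow> k < N" by blast
        have "ell2_inner (tr i) (v (n, g0)) = ell2_inner \<xi> (v (n, g0))" if "i \<ge> N" for i
        proof -
          have "ell2_inner x (v (n, g0)) = (\<Sum>k\<in>supp (v (n, g0)). x k * cnj (v (n, g0) k))" for x
            by (rule ell2_inner_finite[OF fv]) (auto simp: supp_def)
          moreover have "tr i k = \<xi> k" if "k \<in> supp (v (n, g0))" for k
            using N[OF that] \<open>i \<ge> N\<close> by (simp add: tr_def)
          ultimately show ?thesis by (simp cong: sum.cong)
        qed
        then show "\<forall>\<^sub>F i in sequentially. ell2_inner (tr i) (v (n, g0)) = ell2_inner \<xi> (v (n, g0))"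
          by (auto simp: eventually_sequentially)
      qed
      ultimately show "(\<lambda>i. \<Sum>g\<in>supp (c i). c i g * ?\<kappa>n g0 g) \<longlonglongrightarrow> ell2_inner \<xi> (v (n, g0))" by simp
    qed
  qed
qed

section \<open>Measured cocycles into a countable group\<close>

text \<open>The map may identify points; coefficients over the same image are added up.\<close>

lemma psd_on_pullback:
  assumes psd: "psd_on A \<kappa>" and s: "s ` B \<subseteq> A"
  shows "psd_on B (\<lambda>i j. \<kappa> (s i) (s j))"
  unfolding psd_on_def
proof (intro allI impI, elim conjE)
  fix F and c :: "_ \<Rightarrow> complex" assume F: "finite F" "F \<subseteq> B"
  define C where "C a = (\<Sum>i\<in>{i\<in>F. s i = a}. c i)" for a
  have "(\<Sum>i\<in>F. \<Sum>j\<in>F. cnj (c i) * c j * \<kappa> (s i) (s j))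
     = (\<Sum>i\<in>F. \<Sum>b\<in>s ` F. \<Sum>j\<in>{j\<in>F. s j = b}. cnj (c i) * c j * \<kappa> (s i) (s j))"
    by (intro sum.cong HOL.refl sum.image_gen F(1))
  also have "\<dots> = (\<Sum>a\<in>s ` F. \<Sum>i\<in>{i\<in>F. s i = a}. \<Sum>b\<in>s ` F. \<Sum>j\<in>{j\<in>F. s j = b}. cnj (c i) * c j * \<kappa> (s i) (s j))"
    by (rule sum.image_gen[OF F(1)])
  also have "\<dots> = (\<Sum>a\<in>s ` F. \<Sum>b\<in>s ` F. cnj (C a) * C b * \<kappa> a b)"
  proof (rule sum.cong[OF HOL.refl])
    fix a assume "a \<in> s ` F"
    have "(\<Sum>i\<in>{i\<in>F. s i = a}. \<Sum>b\<in>s ` F. \<Sum>j\<in>{j\<in>F. s j = b}. cnj (c i) * c j * \<kappa> (s i) (s j))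
      = (\<Sum>i\<in>{i\<in>F. s i = a}. \<Sum>b\<in>s ` F. cnj (c i) * (C b * \<kappa> a b))"
      by (intro sum.cong HOL.refl) (simp add: C_def sum_distrib_left sum_distrib_right mult.assoc)
    also have "\<dots> = (\<Sum>b\<in>s ` F. cnj (C a) * C b * \<kappa> a b)"
      by (subst sum.swap) (simp add: C_def[of a] sum_distrib_right mult.assoc)
    finally show "(\<Sum>i\<in>{i\<in>F. s i = a}. \<Sum>b\<in>s ` F. \<Sum>j\<in>{j\<in>F. s j = b}. cnj (c i) * c j * \<kappa> (s i) (s j))
      = (\<Sum>b\<in>s ` F. cnj (C a) * C b * \<kappa> a b)" .
  qed
  also have "\<dots> \<in> \<real>\<^sub>\<ge>\<^sub>0"
    using psd[unfolded psd_on_def, rule_format, of "s ` F" C] F s by blast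
  finally show "(\<Sum>i\<in>F. \<Sum>j\<in>F. cnj (c i) * c j * \<kappa> (s i) (s j)) \<in> \<real>\<^sub>\<ge>\<^sub>0" .
qed

text \<open>Subtracting the projection onto the unit vector at \<open>a\<close> leaves a vector of
  nonnegative squared length; its coefficient at the extra point is \<open>- b\<close>.\<close>

lemma psd_cauchy_schwarz:
  assumes psd: "psd_on A \<kappa>" and a: "a \<in> A" "\<kappa> a a = 1" and F: "finite F" "s ` F \<subseteq> A"
  shows "(cmod (\<Sum>j\<in>F. c j * \<kappa> a (s j)))\<^sup>2 \<le> Re (\<Sum>i\<in>F. \<Sum>j\<in>F. cnj (c i) * c j * \<kappa> (s i) (s j))"
proof -
  define b where "b = (\<Sum>j\<in>F. c j * \<kappa> a (s j))"
  have cb: "cnj b = (\<Sum>i\<in>F. cnj (c i) * \<kappa> (s i) a)"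
    unfolding b_def cnj_sum
  proof (intro sum.cong HOL.refl)
    fix i assume "i \<in> F"
    then have "s i \<in> A" using F by auto
    then show "cnj (c i * \<kappa> a (s i)) = cnj (c i) * \<kappa> (s i) a"
      using psd_on_hermitian[OF psd _ a(1), of "s i"] by simp
  qed
  \<comment> \<open>\<open>None\<close> indexes the extra point, which keeps it separate even if
    \<open>a\<close> occurs among the points \<open>s i\<close>.\<close>
  define s' where "s' = (\<lambda>x. case x of None \<Rightarrow> a | Some i \<Rightarrow> s i)"
  define c' where "c' = (\<lambda>x. case x of None \<Rightarrow> - b | Some i \<Rightarrow> c i)"
  define F' where "F' = insert None (Some ` F)"
  have "psd_on F' (\<lambda>i j. \<kappa> (s' i) (s' j))"
    by (rule psd_on_pullback[OF psd]) (use a F in \<open>auto simp: F'_def s'_def\<close>)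
  from psd_onD(1)[OF this, of F' c'] have "0 \<le> Re (\<Sum>i\<in>F'. \<Sum>j\<in>F'. cnj (c' i) * c' j * \<kappa> (s' i) (s' j))"
    using F by (simp add: F'_def)
  also have "(\<Sum>i\<in>F'. \<Sum>j\<in>F'. cnj (c' i) * c' j * \<kappa> (s' i) (s' j))
    = cnj b * b - cnj b * b - b * cnj b + (\<Sum>i\<in>F. \<Sum>j\<in>F. cnj (c i) * c j * \<kappa> (s i) (s j))"
  proof -
    have "(\<Sum>i\<in>F'. \<Sum>j\<in>F'. cnj (c' i) * c' j * \<kappa> (s' i) (s' j))
      = cnj b * b - (\<Sum>j\<in>F. cnj b * (c j * \<kappa> a (s j)))
        + (\<Sum>i\<in>F. - (b * (cnj (c i) * \<kappa> (s i) a)) + (\<Sum>j\<in>F. cnj (c i) * c j * \<kappa> (s i) (s j)))"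
      using F(1) by (simp add: F'_def c'_def s'_def a sum.reindex sum_negf mult.assoc mult.left_commute)
    also have "(\<Sum>j\<in>F. cnj b * (c j * \<kappa> a (s j))) = cnj b * b" by (simp add: b_def sum_distrib_left)
    also have "(\<Sum>i\<in>F. - (b * (cnj (c i) * \<kappa> (s i) a)) + (\<Sum>j\<in>F. cnj (c i) * c j * \<kappa> (s i) (s j)))
       = - b * cnj b + (\<Sum>i\<in>F. \<Sum>j\<in>F. cnj (c i) * c j * \<kappa> (s i) (s j))"
      unfolding cb by (simp add: sum.distrib sum_negf sum_distrib_left sum_subtractf)
    finally show ?thesis by simp
  qed
  also have "Re \<dots> = Re (\<Sum>i\<in>F. \<Sum>j\<in>F. cnj (c i) * c j * \<kappa> (s i) (s j)) - (cmod b)\<^sup>2"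
  proof -
    have "Re (b * cnj b) = (cmod b)\<^sup>2" by (metis Re_complex_of_real complex_norm_square)
    then show ?thesis by (simp add: mult.commute)
  qed
  finally show ?thesis by (simp add: b_def)
qed

lemma (in group) positive_definite_psd:
  "positive_definite G \<psi> \<Longrightarrow> psd_on (carrier G) (\<lambda>a b. \<psi> (inv a \<otimes> b))"
  by (simp add: positive_definite_def psd_on_def)

lemma (in group) positive_definite_le_1:
  assumes pd: "positive_definite G \<psi>" and one: "\<psi> \<one> = 1" and g: "g \<in> carrier G"
  shows "cmod (\<psi> g) \<le> 1"
proof -
  have "(cmod (\<psi> g))\<^sup>2 \<le> 1"
    using psd_cauchy_schwarz[OF positive_definite_psd[OF pd], of \<one> "{g}" "\<lambda>x. x" "\<lambda>_. 1"] one g by simp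
  then show ?thesis by (simp add: abs_square_le_1)
qed

lemma complex_integral_nonneg_Reals:
  fixes f :: "'a \<Rightarrow> complex"
  assumes "\<And>x. x \<in> space M \<Longrightarrow> f x \<in> \<real>\<^sub>\<ge>\<^sub>0"
  shows "integral\<^sup>L M f \<in> \<real>\<^sub>\<ge>\<^sub>0"
proof -
  have e: "f x = complex_of_real (Re (f x))" "Re (f x) \<ge> 0" if "x \<in> space M" for x
    using assms[OF that] by (auto simp: complex_nonneg_Reals_iff complex_eq_iff)
  have "integral\<^sup>L M f = integral\<^sup>L M (\<lambda>x. complex_of_real (Re (f x)))"
    by (intro Bochner_Integration.integral_cong HOL.refl) (rule e)
  moreover have "integral\<^sup>L M (\<lambda>x. Re (f x)) \<ge> 0"
    by (rule Bochner_Integration.integral_nonneg) (rule e)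
  ultimately show ?thesis by (simp only: integral_complex_of_real) simp
qed

text \<open>The identities are required at every point and not just almost everywhere; restricting
  actions to invariant conull sets will achieve this.\<close>

locale pmp_cocycle = prob_space M + K: group K + L: group L
  for M :: "'x measure" and K :: "('k, 'a) monoid_scheme" and L :: "('l, 'b) monoid_scheme" +
  fixes \<alpha> :: "'k \<Rightarrow> 'x \<Rightarrow> 'x" and \<omega> :: "'k \<Rightarrow> 'x \<Rightarrow> 'l"
  assumes countable_K: "countable (carrier K)" and countable_L: "countable (carrier L)"
    and \<alpha>_measurable: "g \<in> carrier K \<Longrightarrow> \<alpha> g \<in> measurable M M"
    and \<alpha>_distr: "g \<in> carrier K \<Longrightarrow> distr M M (\<alpha> g) = M"
    and \<alpha>_one: "x \<in> space M \<Longrightarrow> \<alpha> \<one>\<^bsub>K\<^esub> x = x"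
    and \<alpha>_mult: "g \<in> carrier K \<Longrightarrow> h \<in> carrier K \<Longrightarrow> x \<in> space M \<Longrightarrow> \<alpha> (g \<otimes>\<^bsub>K\<^esub> h) x = \<alpha> g (\<alpha> h x)"
    and \<omega>_measurable: "g \<in> carrier K \<Longrightarrow> \<omega> g \<in> measurable M (count_space (carrier L))"
    and \<omega>_mult: "g \<in> carrier K \<Longrightarrow> h \<in> carrier K \<Longrightarrow> x \<in> space M \<Longrightarrow>
      \<omega> (g \<otimes>\<^bsub>K\<^esub> h) x = \<omega> g (\<alpha> h x) \<otimes>\<^bsub>L\<^esub> \<omega> h x"
begin

lemma \<alpha>_space: "g \<in> carrier K \<Longrightarrow> x \<in> space M \<Longrightarrow> \<alpha> g x \<in> space M"
  using \<alpha>_measurable by (auto simp: measurable_def)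

lemma \<omega>_closed: "g \<in> carrier K \<Longrightarrow> x \<in> space M \<Longrightarrow> \<omega> g x \<in> carrier L"
  using \<omega>_measurable by (auto simp: measurable_def)

lemma \<omega>_one: "x \<in> space M \<Longrightarrow> \<omega> \<one>\<^bsub>K\<^esub> x = \<one>\<^bsub>L\<^esub>"
  using \<omega>_mult[of "\<one>\<^bsub>K\<^esub>" "\<one>\<^bsub>K\<^esub>" x] \<omega>_closed[of "\<one>\<^bsub>K\<^esub>" x] by (simp add: \<alpha>_one L.l_cancel_one')

lemma \<alpha>_inv:
  assumes "g \<in> carrier K" "x \<in> space M"
  shows "\<alpha> (inv\<^bsub>K\<^esub> g) (\<alpha> g x) = x" "\<alpha> g (\<alpha> (inv\<^bsub>K\<^esub> g) x) = x"
  using assms by (simp_all add: \<alpha>_mult[symmetric] \<alpha>_one)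

lemma AE_\<alpha>:
  assumes g: "g \<in> carrier K" and P: "AE x in M. P x"
  shows "AE x in M. P (\<alpha> g x)"
proof -
  have "AE x in distr M M (\<alpha> g). P x" unfolding \<alpha>_distr[OF g] by (rule P)
  then show ?thesis by (rule AE_distrD[OF \<alpha>_measurable[OF g]])
qed

text \<open>A copy of the group \<open>K\<close> placed in the fibre over \<open>x\<close>: by
  \<open>pt_diff\<close> the difference of two points is a cocycle value at a translate of
  \<open>x\<close>, and by \<open>pt_translate\<close> moving the base point multiplies the points
  on the left by the cocycle.\<close>

definition pt :: "'k \<Rightarrow> 'x \<Rightarrow> 'l" where
  "pt g x = inv\<^bsub>L\<^esub> (\<omega> (inv\<^bsub>K\<^esub> g) x)"

lemma pt_closed: "g \<in> carrier K \<Longrightarrow> x \<in> space M \<Longrightarrow> pt g x \<in> carrier L"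
  by (simp add: pt_def \<omega>_closed)

lemma pt_measurable: "g \<in> carrier K \<Longrightarrow> pt g \<in> measurable M (count_space (carrier L))"
  unfolding pt_def by (rule measurable_compose[OF \<omega>_measurable]) auto

lemma measurable_from_L:
  assumes "f \<in> measurable M (count_space (carrier L))" "\<And>l. l \<in> carrier L \<Longrightarrow> F l \<in> space N"
  shows "(\<lambda>x. F (f x)) \<in> measurable M N"
  by (rule measurable_compose[OF assms(1)]) (use assms(2) in auto)

lemma pt_diff:
  assumes "g \<in> carrier K" "h \<in> carrier K" "x \<in> space M"
  shows "inv\<^bsub>L\<^esub> (pt g x) \<otimes>\<^bsub>L\<^esub> pt h x = \<omega> (inv\<^bsub>K\<^esub> g \<otimes>\<^bsub>K\<^esub> h) (\<alpha> (inv\<^bsub>K\<^esub> h) x)"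
proof -
  have y: "\<alpha> (inv\<^bsub>K\<^esub> h) x \<in> space M" using assms by (simp add: \<alpha>_space)
  have "\<omega> (inv\<^bsub>K\<^esub> g) x = \<omega> ((inv\<^bsub>K\<^esub> g \<otimes>\<^bsub>K\<^esub> h) \<otimes>\<^bsub>K\<^esub> inv\<^bsub>K\<^esub> h) x"
    using assms by (simp add: K.m_assoc)
  also have "\<dots> = \<omega> (inv\<^bsub>K\<^esub> g \<otimes>\<^bsub>K\<^esub> h) (\<alpha> (inv\<^bsub>K\<^esub> h) x) \<otimes>\<^bsub>L\<^esub> \<omega> (inv\<^bsub>K\<^esub> h) x"
    using assms by (intro \<omega>_mult) auto
  finally show ?thesis using assms y
    by (simp add: pt_def \<omega>_closed L.m_assoc)
qed

lemma pt_translate: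
  assumes "g \<in> carrier K" "h \<in> carrier K" "x \<in> space M"
  shows "pt g (\<alpha> h x) = \<omega> h x \<otimes>\<^bsub>L\<^esub> pt (inv\<^bsub>K\<^esub> h \<otimes>\<^bsub>K\<^esub> g) x"
proof -
  have "inv\<^bsub>K\<^esub> (inv\<^bsub>K\<^esub> h \<otimes>\<^bsub>K\<^esub> g) = inv\<^bsub>K\<^esub> g \<otimes>\<^bsub>K\<^esub> h" using assms by (simp add: K.inv_mult_group)
  then have "pt (inv\<^bsub>K\<^esub> h \<otimes>\<^bsub>K\<^esub> g) x = inv\<^bsub>L\<^esub> (\<omega> (inv\<^bsub>K\<^esub> g) (\<alpha> h x) \<otimes>\<^bsub>L\<^esub> \<omega> h x)"
    using assms by (simp add: pt_def \<omega>_mult)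
  then show ?thesis using assms
    by (simp add: pt_def L.inv_mult_group \<omega>_closed \<alpha>_space L.m_assoc[symmetric])
qed

definition mean :: "('l \<Rightarrow> complex) \<Rightarrow> 'k \<Rightarrow> complex" where
  "mean \<psi> g = (\<integral>x. \<psi> (\<omega> g x) \<partial>M)"

text \<open>Over \<open>x\<close>, the combination \<open>c\<close> is pushed forward to the points
  \<open>pt g x\<close> in the GNS space of \<open>\<psi>\<close>; the value at \<open>l\<close> is
  its inner product with the vector at \<open>l\<close>, and \<open>qx\<close> is its squared
  norm.\<close>

definition sect :: "('l \<Rightarrow> complex) \<Rightarrow> ('k \<Rightarrow> complex) \<Rightarrow> 'x \<Rightarrow> 'l \<Rightarrow> complex" where
  "sect \<psi> c x l = (\<Sum>g\<in>supp c. c g * \<psi> (inv\<^bsub>L\<^esub> l \<otimes>\<^bsub>L\<^esub> pt g x))"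

definition qx :: "('l \<Rightarrow> complex) \<Rightarrow> ('k \<Rightarrow> complex) \<Rightarrow> 'x \<Rightarrow> real" where
  "qx \<psi> c x = qform (\<lambda>g h. \<psi> (inv\<^bsub>L\<^esub> (pt g x) \<otimes>\<^bsub>L\<^esub> pt h x)) c"

abbreviation "fin_supp c \<equiv> finite (supp c) \<and> supp c \<subseteq> carrier K"

context
  fixes \<psi> :: "'l \<Rightarrow> complex"
  assumes pd: "positive_definite L \<psi>" and \<psi>1: "\<psi> \<one>\<^bsub>L\<^esub> = 1"
begin

lemma \<psi>_pt_measurable [measurable]:
  assumes "g \<in> carrier K" "h \<in> carrier K"
  shows "(\<lambda>x. \<psi> (inv\<^bsub>L\<^esub> (pt g x) \<otimes>\<^bsub>L\<^esub> pt h x)) \<in> borel_measurable M"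
proof -
  have "(\<lambda>x. \<psi> (\<omega> (inv\<^bsub>K\<^esub> g \<otimes>\<^bsub>K\<^esub> h) (\<alpha> (inv\<^bsub>K\<^esub> h) x))) \<in> borel_measurable M"
  proof (rule measurable_compose[OF \<alpha>_measurable])
    show "(\<lambda>x. \<psi> (\<omega> (inv\<^bsub>K\<^esub> g \<otimes>\<^bsub>K\<^esub> h) x)) \<in> borel_measurable M"
      by (rule measurable_from_L[OF \<omega>_measurable]) (use assms in auto)
  qed (use assms in auto)
  then show ?thesis using assms by (simp add: pt_diff cong: measurable_cong)
qed

text \<open>By \<open>pt_diff\<close> the integrand is a cocycle value at a translated point, and
  invariance of the measure removes the translation. Thus norms in the GNS space of
  \<open>mean \<psi>\<close> are integrals of norms in the fibres.\<close>

lemma integral_pt: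
  assumes g: "g \<in> carrier K" "h \<in> carrier K"
  shows "integrable M (\<lambda>x. \<psi> (inv\<^bsub>L\<^esub> (pt g x) \<otimes>\<^bsub>L\<^esub> pt h x))"
    and "(\<integral>x. \<psi> (inv\<^bsub>L\<^esub> (pt g x) \<otimes>\<^bsub>L\<^esub> pt h x) \<partial>M) = mean \<psi> (inv\<^bsub>K\<^esub> g \<otimes>\<^bsub>K\<^esub> h)"
proof -
  show "integrable M (\<lambda>x. \<psi> (inv\<^bsub>L\<^esub> (pt g x) \<otimes>\<^bsub>L\<^esub> pt h x))"
    by (rule integrable_const_bound[of _ 1])
      (use g pd \<psi>1 in \<open>auto intro!: AE_I2 L.positive_definite_le_1 simp: pt_closed\<close>)
  have m: "(\<lambda>x. \<psi> (\<omega> (inv\<^bsub>K\<^esub> g \<otimes>\<^bsub>K\<^esub> h) x)) \<in> borel_measurable M"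
    by (rule measurable_from_L[OF \<omega>_measurable]) (use g in auto)
  have a: "\<alpha> (inv\<^bsub>K\<^esub> h) \<in> measurable M M" using g by (intro \<alpha>_measurable) auto
  have "(\<integral>x. \<psi> (inv\<^bsub>L\<^esub> (pt g x) \<otimes>\<^bsub>L\<^esub> pt h x) \<partial>M)
    = (\<integral>x. \<psi> (\<omega> (inv\<^bsub>K\<^esub> g \<otimes>\<^bsub>K\<^esub> h) (\<alpha> (inv\<^bsub>K\<^esub> h) x)) \<partial>M)"
    using g by (intro Bochner_Integration.integral_cong HOL.refl) (simp add: pt_diff)
  also have "\<dots> = (\<integral>x. \<psi> (\<omega> (inv\<^bsub>K\<^esub> g \<otimes>\<^bsub>K\<^esub> h) x) \<partial>(distr M M (\<alpha> (inv\<^bsub>K\<^esub> h))))"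
    by (rule integral_distr[OF a m, symmetric])
  also have "\<dots> = mean \<psi> (inv\<^bsub>K\<^esub> g \<otimes>\<^bsub>K\<^esub> h)" using g by (simp add: \<alpha>_distr mean_def)
  finally show "(\<integral>x. \<psi> (inv\<^bsub>L\<^esub> (pt g x) \<otimes>\<^bsub>L\<^esub> pt h x) \<partial>M) = mean \<psi> (inv\<^bsub>K\<^esub> g \<otimes>\<^bsub>K\<^esub> h)" .
qed

lemma psd_pt: "x \<in> space M \<Longrightarrow> psd_on (carrier K) (\<lambda>g h. \<psi> (inv\<^bsub>L\<^esub> (pt g x) \<otimes>\<^bsub>L\<^esub> pt h x))"
  by (rule psd_on_pullback[OF L.positive_definite_psd[OF pd], of "\<lambda>g. pt g x"]) (auto simp: pt_closed)

lemma integral_double_sum: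
  assumes "F \<subseteq> carrier K"
  shows "integrable M (\<lambda>x. \<Sum>g\<in>F. \<Sum>h\<in>F. cnj (c g) * c h * \<psi> (inv\<^bsub>L\<^esub> (pt g x) \<otimes>\<^bsub>L\<^esub> pt h x))"
    and "(\<integral>x. (\<Sum>g\<in>F. \<Sum>h\<in>F. cnj (c g) * c h * \<psi> (inv\<^bsub>L\<^esub> (pt g x) \<otimes>\<^bsub>L\<^esub> pt h x)) \<partial>M)
       = (\<Sum>g\<in>F. \<Sum>h\<in>F. cnj (c g) * c h * mean \<psi> (inv\<^bsub>K\<^esub> g \<otimes>\<^bsub>K\<^esub> h))"
proof -
  have i: "integrable M (\<lambda>x. cnj (c g) * c h * \<psi> (inv\<^bsub>L\<^esub> (pt g x) \<otimes>\<^bsub>L\<^esub> pt h x))" if "g \<in> F" "h \<in> F" for g h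
    using integral_pt(1)[of g h] that assms by (intro integrable_mult_right) auto
  show "integrable M (\<lambda>x. \<Sum>g\<in>F. \<Sum>h\<in>F. cnj (c g) * c h * \<psi> (inv\<^bsub>L\<^esub> (pt g x) \<otimes>\<^bsub>L\<^esub> pt h x))"
    by (intro Bochner_Integration.integrable_sum i)
  have "(\<integral>x. (\<Sum>g\<in>F. \<Sum>h\<in>F. cnj (c g) * c h * \<psi> (inv\<^bsub>L\<^esub> (pt g x) \<otimes>\<^bsub>L\<^esub> pt h x)) \<partial>M)
    = (\<Sum>g\<in>F. \<Sum>h\<in>F. \<integral>x. cnj (c g) * c h * \<psi> (inv\<^bsub>L\<^esub> (pt g x) \<otimes>\<^bsub>L\<^esub> pt h x) \<partial>M)"
    by (subst Bochner_Integration.integral_sum, intro Bochner_Integration.integrable_sum i, assumption+,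
        intro sum.cong HOL.refl Bochner_Integration.integral_sum i)
  also have "\<dots> = (\<Sum>g\<in>F. \<Sum>h\<in>F. cnj (c g) * c h * mean \<psi> (inv\<^bsub>K\<^esub> g \<otimes>\<^bsub>K\<^esub> h))"
    using assms by (intro sum.cong HOL.refl) (simp add: integral_pt(2)[symmetric] subset_iff)
  finally show "(\<integral>x. (\<Sum>g\<in>F. \<Sum>h\<in>F. cnj (c g) * c h * \<psi> (inv\<^bsub>L\<^esub> (pt g x) \<otimes>\<^bsub>L\<^esub> pt h x)) \<partial>M)
       = (\<Sum>g\<in>F. \<Sum>h\<in>F. cnj (c g) * c h * mean \<psi> (inv\<^bsub>K\<^esub> g \<otimes>\<^bsub>K\<^esub> h))" .
qed

text \<open>Positivity in every fibre survives integration.\<close>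

lemma positive_definite_mean: "positive_definite K (mean \<psi>)"
  unfolding positive_definite_def
proof (intro allI impI, elim conjE)
  fix F c assume F: "finite F" "F \<subseteq> carrier K"
  show "(\<Sum>g\<in>F. \<Sum>h\<in>F. cnj (c g) * c h * mean \<psi> (inv\<^bsub>K\<^esub> g \<otimes>\<^bsub>K\<^esub> h)) \<in> \<real>\<^sub>\<ge>\<^sub>0"
    unfolding integral_double_sum(2)[OF F(2), symmetric]
    by (rule complex_integral_nonneg_Reals) (use psd_pt F in \<open>auto simp: psd_on_def\<close>)
qed

lemma qx_nonneg: "x \<in> space M \<Longrightarrow> fin_supp c \<Longrightarrow> 0 \<le> qx \<psi> c x"
  unfolding qx_def by (rule qform_nonneg[OF psd_pt]) auto

lemma integral_qx:
  assumes "fin_supp c"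
  shows "integrable M (qx \<psi> c)" "(\<integral>x. qx \<psi> c x \<partial>M) = qform (\<lambda>g h. mean \<psi> (inv\<^bsub>K\<^esub> g \<otimes>\<^bsub>K\<^esub> h)) c"
proof -
  have "supp c \<subseteq> carrier K" using assms by simp
  note i = integral_double_sum[OF this, of c]
  show "integrable M (qx \<psi> c)" using integrable_Re[OF i(1)] by (simp add: qx_def[abs_def] qform_def)
  show "(\<integral>x. qx \<psi> c x \<partial>M) = qform (\<lambda>g h. mean \<psi> (inv\<^bsub>K\<^esub> g \<otimes>\<^bsub>K\<^esub> h)) c"
    using integral_Re[OF i(1)] i(2) by (simp add: qx_def[abs_def] qform_def)
qed

lemma nn_integral_qx:
  assumes "fin_supp c"
  shows "(\<integral>\<^sup>+x. ennreal (qx \<psi> c x) \<partial>M) = ennreal (qform (\<lambda>g h. mean \<psi> (inv\<^bsub>K\<^esub> g \<otimes>\<^bsub>K\<^esub> h)) c)"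
  using nn_integral_eq_integral[OF integral_qx(1)[OF assms]] integral_qx(2)[OF assms] qx_nonneg assms
  by (auto intro: AE_I2)

text \<open>Cauchy--Schwarz against the unit vector at \<open>l\<close>; the bound is uniform in
  \<open>l\<close>.\<close>

lemma sect_bound:
  assumes "x \<in> space M" "fin_supp c" "l \<in> carrier L"
  shows "(cmod (sect \<psi> c x l))\<^sup>2 \<le> qx \<psi> c x"
proof -
  have "(\<lambda>g. pt g x) ` supp c \<subseteq> carrier L" using assms pt_closed by auto
  moreover have "\<psi> (inv\<^bsub>L\<^esub> l \<otimes>\<^bsub>L\<^esub> l) = 1" using assms \<psi>1 by simp
  ultimately show ?thesis
    using psd_cauchy_schwarz[OF L.positive_definite_psd[OF pd] assms(3), of "supp c" "\<lambda>g. pt g x" c] assms(2)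
    by (simp only: sect_def qx_def qform_def simp_thms)
qed

lemma sect_superset:
  assumes "finite F" "supp c \<subseteq> F"
  shows "sect \<psi> c x l = (\<Sum>g\<in>F. c g * \<psi> (inv\<^bsub>L\<^esub> l \<otimes>\<^bsub>L\<^esub> pt g x))"
  unfolding sect_def by (intro sum.mono_neutral_left assms) (auto simp: supp_def)

lemma fin_supp_diff:
  fixes c d :: "'k \<Rightarrow> complex"
  shows "fin_supp c \<Longrightarrow> fin_supp d \<Longrightarrow> fin_supp (\<lambda>g. c g - d g)"
proof -
  assume "fin_supp c" "fin_supp d"
  moreover have "supp (\<lambda>g. c g - d g) \<subseteq> supp c \<union> supp d" by (auto simp: supp_def)
  ultimately show ?thesis by (meson finite_UnI finite_subset le_supI order_trans)
qed

lemma sect_diff: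
  assumes "fin_supp c" "fin_supp d"
  shows "sect \<psi> (\<lambda>g. c g - d g) x l = sect \<psi> c x l - sect \<psi> d x l"
proof -
  have f: "finite (supp c \<union> supp d)" using assms by auto
  have "supp (\<lambda>g. c g - d g) \<subseteq> supp c \<union> supp d" by (auto simp: supp_def)
  from sect_superset[OF f this] show ?thesis
    by (simp add: sect_superset[OF f, of c] sect_superset[OF f, of d] sum_subtractf algebra_simps)
qed

lemma translate_supp:
  assumes "h \<in> carrier K" "fin_supp c"
  shows "supp (translate K h c) = (\<lambda>g. h \<otimes>\<^bsub>K\<^esub> g) ` supp c" "fin_supp (translate K h c)"
proof -
  show s: "supp (translate K h c) = (\<lambda>g. h \<otimes>\<^bsub>K\<^esub> g) ` supp c"
  proof (intro equalityI subsetI)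
    fix g assume "g \<in> supp (translate K h c)"
    then have g: "g \<in> carrier K" "c (inv\<^bsub>K\<^esub> h \<otimes>\<^bsub>K\<^esub> g) \<noteq> 0" by (auto simp: supp_def translate_def split: if_splits)
    have "g = h \<otimes>\<^bsub>K\<^esub> (inv\<^bsub>K\<^esub> h \<otimes>\<^bsub>K\<^esub> g)" using g assms by (simp add: K.m_assoc[symmetric])
    then show "g \<in> (\<lambda>g. h \<otimes>\<^bsub>K\<^esub> g) ` supp c" by (rule image_eqI) (use g in \<open>simp add: supp_def\<close>)
  next
    fix g assume "g \<in> (\<lambda>g. h \<otimes>\<^bsub>K\<^esub> g) ` supp c"
    then obtain g' where g: "g' \<in> supp c" "g = h \<otimes>\<^bsub>K\<^esub> g'" by auto
    then have "g' \<in> carrier K" using assms by auto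
    then show "g \<in> supp (translate K h c)" using g assms
      by (simp add: supp_def translate_def K.m_assoc[symmetric])
  qed
  show "fin_supp (translate K h c)" unfolding s using assms by auto
qed

text \<open>Moving the base point multiplies the points \<open>pt\<close> on the left by the
  cocycle, which cancels against the same factor in the argument; what remains is an index shift by
  \<open>inv h\<close>.\<close>

lemma sect_translate:
  assumes h: "h \<in> carrier K" and c: "fin_supp c" and x: "x \<in> space M" and l: "l \<in> carrier L"
  shows "sect \<psi> c (\<alpha> h x) (\<omega> h x \<otimes>\<^bsub>L\<^esub> l) = sect \<psi> (translate K (inv\<^bsub>K\<^esub> h) c) x l"
proof -
  have hi: "inv\<^bsub>K\<^esub> h \<in> carrier K" using h by simp
  have inj: "inj_on (\<lambda>g. inv\<^bsub>K\<^esub> h \<otimes>\<^bsub>K\<^esub> g) (supp c)"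
  proof (rule inj_onI)
    fix g g' assume gg: "g \<in> supp c" "g' \<in> supp c" "inv\<^bsub>K\<^esub> h \<otimes>\<^bsub>K\<^esub> g = inv\<^bsub>K\<^esub> h \<otimes>\<^bsub>K\<^esub> g'"
    then have "g \<in> carrier K" "g' \<in> carrier K" using c by auto
    then show "g = g'" using gg hi by simp
  qed
  have "sect \<psi> (translate K (inv\<^bsub>K\<^esub> h) c) x l
    = (\<Sum>g\<in>supp c. translate K (inv\<^bsub>K\<^esub> h) c (inv\<^bsub>K\<^esub> h \<otimes>\<^bsub>K\<^esub> g) * \<psi> (inv\<^bsub>L\<^esub> l \<otimes>\<^bsub>L\<^esub> pt (inv\<^bsub>K\<^esub> h \<otimes>\<^bsub>K\<^esub> g) x))"
    unfolding sect_def translate_supp(1)[OF hi c] by (simp add: sum.reindex[OF inj])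
  also have "\<dots> = sect \<psi> c (\<alpha> h x) (\<omega> h x \<otimes>\<^bsub>L\<^esub> l)"
    unfolding sect_def
  proof (intro sum.cong HOL.refl)
    fix g assume "g \<in> supp c"
    then have g: "g \<in> carrier K" using c by auto
    have "translate K (inv\<^bsub>K\<^esub> h) c (inv\<^bsub>K\<^esub> h \<otimes>\<^bsub>K\<^esub> g) = c g"
      using g h by (simp add: translate_def K.m_assoc[symmetric])
    moreover have "inv\<^bsub>L\<^esub> (\<omega> h x \<otimes>\<^bsub>L\<^esub> l) \<otimes>\<^bsub>L\<^esub> pt g (\<alpha> h x) = inv\<^bsub>L\<^esub> l \<otimes>\<^bsub>L\<^esub> pt (inv\<^bsub>K\<^esub> h \<otimes>\<^bsub>K\<^esub> g) x"
    proof -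
      let ?p = "pt (inv\<^bsub>K\<^esub> h \<otimes>\<^bsub>K\<^esub> g) x" and ?w = "\<omega> h x"
      have cl: "?p \<in> carrier L" "?w \<in> carrier L" using g h x by (auto intro!: pt_closed \<omega>_closed)
      have "inv\<^bsub>L\<^esub> (?w \<otimes>\<^bsub>L\<^esub> l) \<otimes>\<^bsub>L\<^esub> (?w \<otimes>\<^bsub>L\<^esub> ?p) = inv\<^bsub>L\<^esub> l \<otimes>\<^bsub>L\<^esub> (inv\<^bsub>L\<^esub> ?w \<otimes>\<^bsub>L\<^esub> (?w \<otimes>\<^bsub>L\<^esub> ?p))"
        using cl l by (simp add: L.inv_mult_group L.m_assoc)
      also have "inv\<^bsub>L\<^esub> ?w \<otimes>\<^bsub>L\<^esub> (?w \<otimes>\<^bsub>L\<^esub> ?p) = ?p" using cl by (simp add: L.m_assoc[symmetric])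
      finally have "inv\<^bsub>L\<^esub> (?w \<otimes>\<^bsub>L\<^esub> l) \<otimes>\<^bsub>L\<^esub> (?w \<otimes>\<^bsub>L\<^esub> ?p) = inv\<^bsub>L\<^esub> l \<otimes>\<^bsub>L\<^esub> ?p" .
      then show ?thesis using cl l g h x by (simp add: pt_translate)
    qed
    ultimately show "translate K (inv\<^bsub>K\<^esub> h) c (inv\<^bsub>K\<^esub> h \<otimes>\<^bsub>K\<^esub> g) * \<psi> (inv\<^bsub>L\<^esub> l \<otimes>\<^bsub>L\<^esub> pt (inv\<^bsub>K\<^esub> h \<otimes>\<^bsub>K\<^esub> g) x)
      = c g * \<psi> (inv\<^bsub>L\<^esub> (\<omega> h x \<otimes>\<^bsub>L\<^esub> l) \<otimes>\<^bsub>L\<^esub> pt g (\<alpha> h x))" by simp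
  qed
  finally show ?thesis by simp
qed

lemma sect_measurable:
  assumes "fin_supp c" "l \<in> carrier L"
  shows "(\<lambda>x. sect \<psi> c x l) \<in> borel_measurable M"
  unfolding sect_def
proof (intro borel_measurable_sum borel_measurable_times borel_measurable_const)
  fix g assume "g \<in> supp c"
  then have g: "g \<in> carrier K" using assms by auto
  show "(\<lambda>x. \<psi> (inv\<^bsub>L\<^esub> l \<otimes>\<^bsub>L\<^esub> pt g x)) \<in> borel_measurable M"
    by (rule measurable_from_L[OF pt_measurable[OF g]]) auto
qed

lemma integral_sect_pt:
  assumes "fin_supp c" "g0 \<in> carrier K"
  shows "integrable M (\<lambda>x. sect \<psi> c x (pt g0 x))"
    "(\<integral>x. sect \<psi> c x (pt g0 x) \<partial>M) = (\<Sum>g\<in>supp c. c g * mean \<psi> (inv\<^bsub>K\<^esub> g0 \<otimes>\<^bsub>K\<^esub> g))"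
proof -
  have i: "integrable M (\<lambda>x. c g * \<psi> (inv\<^bsub>L\<^esub> (pt g0 x) \<otimes>\<^bsub>L\<^esub> pt g x))" if "g \<in> supp c" for g
    using integral_pt(1)[OF assms(2), of g] that assms(1) by (intro integrable_mult_right) auto
  show "integrable M (\<lambda>x. sect \<psi> c x (pt g0 x))"
    unfolding sect_def by (intro Bochner_Integration.integrable_sum i)
  show "(\<integral>x. sect \<psi> c x (pt g0 x) \<partial>M) = (\<Sum>g\<in>supp c. c g * mean \<psi> (inv\<^bsub>K\<^esub> g0 \<otimes>\<^bsub>K\<^esub> g))"
    unfolding sect_def
    by (subst Bochner_Integration.integral_sum[OF i], assumption, intro sum.cong HOL.refl)
      (use assms in \<open>simp add: integral_pt(2)[symmetric] subset_iff\<close>)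
qed

end

end

section \<open>From invariant vectors to invariant families of subsets\<close>

lemma limit_of_summable_increments:
  fixes s :: "nat \<Rightarrow> complex"
  assumes b: "\<And>i. cmod (s (Suc i) - s i) \<le> b i" and sb: "summable b"
  shows "s \<longlonglongrightarrow> lim s" and "cmod (lim s - s i) \<le> (\<Sum>m. b (m + i))"
proof -
  have "summable (\<lambda>i. s (Suc i) - s i)"
    by (rule summable_comparison_test[OF _ sb]) (use b in auto)
  then have "(\<lambda>n. \<Sum>i<n. s (Suc i) - s i) \<longlonglongrightarrow> (\<Sum>i. s (Suc i) - s i)" by (rule summable_LIMSEQ)
  then have "(\<lambda>n. s n - s 0) \<longlonglongrightarrow> (\<Sum>i. s (Suc i) - s i)" by (simp add: sum_lessThan_telescope)
  then have "(\<lambda>n. s n - s 0 + s 0) \<longlonglongrightarrow> (\<Sum>i. s (Suc i) - s i) + s 0" by (intro tendsto_intros)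
  then have "convergent s" by (auto simp: convergent_def)
  then show lim: "s \<longlonglongrightarrow> lim s" by (simp add: convergent_LIMSEQ_iff)
  have sb': "summable (\<lambda>m. b (m + i))" using sb by (rule summable_ignore_initial_segment)
  have "(\<lambda>n. s (n + i) - s i) \<longlonglongrightarrow> lim s - s i"
    by (intro tendsto_intros LIMSEQ_ignore_initial_segment lim)
  moreover have "cmod (s (n + i) - s i) \<le> (\<Sum>m. b (m + i))" for n
  proof -
    have "s (n + i) - s i = (\<Sum>m<n. s (Suc (m + i)) - s (m + i))"
      using sum_lessThan_telescope[of "\<lambda>m. s (m + i)" n] by simp
    also have "cmod \<dots> \<le> (\<Sum>m<n. b (m + i))" by (rule sum_norm_le) (rule b)
    also have "\<dots> \<le> (\<Sum>m. b (m + i))"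
      by (rule sum_le_suminf[OF sb']) (auto intro: order_trans[OF norm_ge_zero b])
    finally show ?thesis .
  qed
  ultimately show "cmod (lim s - s i) \<le> (\<Sum>m. b (m + i))"
    by (intro Lim_bounded[OF tendsto_norm]) auto
qed

lemma summable_tail_tendsto_0:
  fixes b :: "nat \<Rightarrow> real"
  assumes "summable b"
  shows "(\<lambda>i. \<Sum>m. b (m + i)) \<longlonglongrightarrow> 0"
proof -
  have "(\<lambda>i. suminf b - (\<Sum>m<i. b m)) \<longlonglongrightarrow> suminf b - suminf b"
    by (intro tendsto_intros summable_LIMSEQ assms)
  then show ?thesis by (simp add: suminf_minus_initial_segment[OF assms])
qed

lemma cauchy_subsequence:
  fixes q :: "nat \<Rightarrow> nat \<Rightarrow> real" and b :: "nat \<Rightarrow> real"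
  assumes q: "\<And>e. e > 0 \<Longrightarrow> \<exists>N. \<forall>i\<ge>N. \<forall>j\<ge>N. q i j < e" and b: "\<And>i. b i > 0"
  shows "\<exists>r. strict_mono r \<and> (\<forall>i. q (r (Suc i)) (r i) < b i)"
proof -
  have "\<forall>m. \<exists>N. \<forall>i\<ge>N. \<forall>j\<ge>N. q i j < b m" using q b by blast
  then obtain N where N: "\<And>m i j. i \<ge> N m \<Longrightarrow> j \<ge> N m \<Longrightarrow> q i j < b m" by metis
  define r where "r i = i + (\<Sum>m\<le>i. N m)" for i
  have "strict_mono r" by (rule strict_monoI_Suc) (simp add: r_def)
  moreover have "r i \<ge> N i" "r (Suc i) \<ge> N i" for i
    using member_le_sum[of i "{..i}" N] by (auto simp: r_def)
  ultimately show ?thesis using N by blast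
qed

context pmp_cocycle
begin

text \<open>The invariant vector becomes over almost every \<open>x\<close> a function
  \<open>f x\<close> on the target group, and \<open>B x\<close> is a superlevel set of its modulus.
  A finite combination approximates \<open>f x\<close> uniformly on the group, so \<open>B x\<close>
  lies in finitely many translates of a region where \<open>\<psi> n\<close> is not small. For
  Haagerup functions such regions are finite, for powers of the tree distance they are
  bounded.\<close>

lemma relative_T_invariant_sets:
  assumes T: "relative_property_T K H" and H: "subgroup H K"
    and pd: "\<And>n. positive_definite L (\<psi> n)" and one: "\<And>n. \<psi> n \<one>\<^bsub>L\<^esub> = 1"
    and lim: "\<And>g. g \<in> carrier K \<Longrightarrow> AE x in M. (\<lambda>n. \<psi> n (\<omega> g x)) \<longlonglongrightarrow> 1"
  obtains n and B :: "'x \<Rightarrow> 'l set" where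
    "\<And>x. B x \<subseteq> carrier L"
    "\<And>l. l \<in> carrier L \<Longrightarrow> {x \<in> space M. l \<in> B x} \<in> sets M"
    "\<And>h. h \<in> H \<Longrightarrow> AE x in M. \<forall>l\<in>carrier L. \<omega> h x \<otimes>\<^bsub>L\<^esub> l \<in> B (\<alpha> h x) \<longleftrightarrow> l \<in> B x"
    "AE x in M. \<exists>\<delta>>0. \<exists>A. finite A \<and> A \<subseteq> carrier L \<and>
        B x \<subseteq> {l. \<exists>a\<in>A. cmod (\<psi> n (inv\<^bsub>L\<^esub> l \<otimes>\<^bsub>L\<^esub> a)) > \<delta>}"
    "\<not> (AE x in M. B x = {})"
proof -
  have HK: "H \<subseteq> carrier K" using H by (rule subgroup.subset)
  have mlim: "(\<lambda>n. mean (\<psi> n) g) \<longlonglongrightarrow> 1" if g: "g \<in> carrier K" for g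
  proof -
    have "(\<lambda>n. mean (\<psi> n) g) \<longlonglongrightarrow> (\<integral>x. 1 \<partial>M)"
      unfolding mean_def
    proof (rule integral_dominated_convergence[where w = "\<lambda>_. 1"])
      show "(\<lambda>x. \<psi> n (\<omega> g x)) \<in> borel_measurable M" for n
        by (rule measurable_from_L[OF \<omega>_measurable[OF g]]) auto
      show "AE x in M. norm (\<psi> n (\<omega> g x)) \<le> 1" for n
        using \<omega>_closed[OF g] by (intro AE_I2 L.positive_definite_le_1 pd one)
    qed (use lim[OF g] in auto)
    then show ?thesis by (simp add: prob_space)
  qed
  have m1: "mean (\<psi> n) \<one>\<^bsub>K\<^esub> = 1" for n
  proof -
    have "mean (\<psi> n) \<one>\<^bsub>K\<^esub> = (\<integral>x. 1 \<partial>M)"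
      unfolding mean_def by (intro Bochner_Integration.integral_cong HOL.refl) (simp add: \<omega>_one one)
    then show ?thesis by (simp add: prob_space)
  qed
  show thesis
  proof (rule relative_property_T_gns[OF K.is_group countable_K T HK positive_definite_mean[OF pd one] m1 mlim])
    fix n and c :: "nat \<Rightarrow> 'k \<Rightarrow> complex" and g0 and Lm :: complex
    let ?Q = "qform (\<lambda>g h. mean (\<psi> n) (inv\<^bsub>K\<^esub> g \<otimes>\<^bsub>K\<^esub> h))"
    assume c: "\<And>i. fin_supp (c i)"
      and cau: "\<And>e. e > 0 \<Longrightarrow> \<exists>N. \<forall>i\<ge>N. \<forall>j\<ge>N. ?Q (\<lambda>g. c i g - c j g) < e"
      and inv: "\<And>h. h \<in> H \<Longrightarrow> (\<lambda>i. ?Q (\<lambda>g. translate K h (c i) g - c i g)) \<longlonglongrightarrow> 0"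
      and g0: "g0 \<in> carrier K" and Lm: "Lm \<noteq> 0"
        "(\<lambda>i. \<Sum>g\<in>supp (c i). c i g * mean (\<psi> n) (inv\<^bsub>K\<^esub> g0 \<otimes>\<^bsub>K\<^esub> g)) \<longlonglongrightarrow> Lm"
    define \<Psi> where "\<Psi> = \<psi> n"
    have P: "positive_definite L \<Psi>" "\<Psi> \<one>\<^bsub>L\<^esub> = 1" using pd one by (simp_all add: \<Psi>_def)
    \<comment> \<open>The rate \<open>(1/8)^i\<close> for squared norms leaves a summable
      \<open>(1/4)^i\<close> after the factor \<open>2^i\<close> of the estimate below.\<close>
    obtain r where r: "strict_mono r" "\<And>i. ?Q (\<lambda>g. c (r (Suc i)) g - c (r i) g) < (1/8)^i"
      using cauchy_subsequence[of "\<lambda>i j. ?Q (\<lambda>g. c i g - c j g)" "\<lambda>i. (1/8)^i", OF cau] by auto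
    define c' where "c' i = c (r i)" for i
    define D where "D i = (\<lambda>g. c' (Suc i) g - c' i g)" for i
    have c': "fin_supp (c' i)" for i using c by (simp add: c'_def)
    have D: "fin_supp (D i)" for i unfolding D_def by (rule fin_supp_diff[OF P c' c'])
    define sq where "sq i x = sqrt (qx \<Psi> (D i) x)" for i x
    have sqm [measurable]: "sq i \<in> borel_measurable M" for i
      unfolding sq_def[abs_def] using borel_measurable_integrable[OF integral_qx(1)[OF P D]] by measurable
    have sq0: "0 \<le> sq i x" if "x \<in> space M" for i x using qx_nonneg[OF P that D] by (simp add: sq_def)
    \<comment> \<open>The bound for the integral of \<open>sq i\<close> that comes from
      \<open>sqrt a \<le> (1/2)^i + 2^i * a\<close> with \<open>a\<close> of integral at most
      \<open>(1/8)^i\<close>.\<close>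
    define b where "b i = (1/2::real)^i + (1/4)^i" for i :: nat
    have sb: "summable b" unfolding b_def[abs_def] by (intro summable_add summable_geometric) auto
    have b0: "0 \<le> b i" for i by (simp add: b_def)
    have Jb: "(\<integral>\<^sup>+x. ennreal (sq i x) \<partial>M) \<le> ennreal (b i)" for i
    proof -
      have "(\<integral>\<^sup>+x. ennreal (sq i x) \<partial>M) \<le> (\<integral>\<^sup>+x. ennreal ((1/2)^i) + ennreal (2^i) * ennreal (qx \<Psi> (D i) x) \<partial>M)"
      proof (rule nn_integral_mono)
        fix x assume x: "x \<in> space M"
        define a where "a = qx \<Psi> (D i) x"
        have a: "a \<ge> 0" using qx_nonneg[OF P x D] by (simp add: a_def)
        have "0 \<le> (sqrt a * 2^i - 1)\<^sup>2" by simp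
        also have "\<dots> = a * 2^i * 2^i - 2 * sqrt a * 2^i + 1"
          using a by (simp add: power2_eq_square algebra_simps)
        finally have "2 * sqrt a * 2^i \<le> (a * 2^i + (1/2)^i) * 2^i"
          by (simp add: algebra_simps power_one_over)
        then have "2 * sqrt a \<le> a * 2^i + (1/2)^i" by (simp add: mult_le_cancel_right)
        moreover have "0 \<le> sqrt a" using a by simp
        ultimately have "sqrt a \<le> (1/2)^i + 2^i * a" unfolding mult.commute[of "2^i" a] by linarith
        then have "ennreal (sq i x) \<le> ennreal ((1/2)^i + 2^i * a)" unfolding sq_def a_def by (rule ennreal_leI)
        also have "\<dots> = ennreal ((1/2)^i) + ennreal (2^i) * ennreal a" using a by (simp add: ennreal_plus ennreal_mult)
        finally show "ennreal (sq i x) \<le> ennreal ((1/2)^i) + ennreal (2^i) * ennreal (qx \<Psi> (D i) x)"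
          by (simp add: a_def)
      qed
      also have "\<dots> = ennreal ((1/2)^i) + ennreal (2^i) * (\<integral>\<^sup>+x. ennreal (qx \<Psi> (D i) x) \<partial>M)"
        using borel_measurable_integrable[OF integral_qx(1)[OF P D]]
        by (simp add: nn_integral_add nn_integral_cmult emeasure_space_1)
      also have "(\<integral>\<^sup>+x. ennreal (qx \<Psi> (D i) x) \<partial>M) = ennreal (?Q (D i))"
        using nn_integral_qx[OF P D] by (simp add: \<Psi>_def)
      also have "\<dots> \<le> ennreal ((1/8)^i)"
        using r(2)[of i] by (intro ennreal_leI) (simp add: D_def c'_def)
      also have "ennreal ((1/2)^i) + ennreal (2^i) * ennreal ((1/8)^i) = ennreal ((1/2)^i + 2^i * (1/8)^i)"
        by (simp add: ennreal_plus ennreal_mult)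
      also have "(2::real)^i * (1/8)^i = (1/4)^i" by (simp add: power_mult_distrib[symmetric])
      finally show ?thesis by (simp add: b_def add_left_mono mult_left_mono)
    qed
    have Jsum: "(\<integral>\<^sup>+x. (\<Sum>m. ennreal (sq (m + i) x)) \<partial>M) \<le> ennreal (\<Sum>m. b (m + i))" for i
    proof -
      have "(\<integral>\<^sup>+x. (\<Sum>m. ennreal (sq (m + i) x)) \<partial>M) = (\<Sum>m. \<integral>\<^sup>+x. ennreal (sq (m + i) x) \<partial>M)"
        by (rule nn_integral_suminf) simp
      also have "\<dots> \<le> (\<Sum>m. ennreal (b (m + i)))" by (intro suminf_le Jb) auto
      also have "\<dots> = ennreal (\<Sum>m. b (m + i))"
        by (rule suminf_ennreal2) (use b0 sb in \<open>auto intro: summable_ignore_initial_segment\<close>)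
      finally show ?thesis .
    qed
    have good: "AE x in M. summable (\<lambda>i. sq i x)"
    proof -
      have "(\<integral>\<^sup>+x. (\<Sum>m. ennreal (sq m x)) \<partial>M) \<noteq> \<infinity>"
        using Jsum[of 0] by (auto simp: top_unique)
      then have "AE x in M. (\<Sum>m. ennreal (sq m x)) \<noteq> \<infinity>" by (intro nn_integral_PInf_AE) auto
      then show ?thesis using AE_space by eventually_elim (auto intro!: summable_suminf_not_top sq0)
    qed
    define f where "f x l = lim (\<lambda>i. sect \<Psi> (c' i) x l)" for x l
    have step: "cmod (sect \<Psi> (c' (Suc i)) x l - sect \<Psi> (c' i) x l) \<le> sq i x"
      if "x \<in> space M" "l \<in> carrier L" for i x l
      unfolding sect_diff[OF P c' c', symmetric] D_def[symmetric] sq_def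
      using sect_bound[OF P that(1) D that(2)] by (rule real_le_rsqrt)
    have fl: "(\<lambda>i. sect \<Psi> (c' i) x l) \<longlonglongrightarrow> f x l"
        "\<And>i. cmod (f x l - sect \<Psi> (c' i) x l) \<le> (\<Sum>m. sq (m + i) x)"
      if "x \<in> space M" "l \<in> carrier L" "summable (\<lambda>i. sq i x)" for x l
      using limit_of_summable_increments[of "\<lambda>i. sect \<Psi> (c' i) x l" "\<lambda>i. sq i x"] step that
      by (simp_all add: f_def)
    have f_meas [measurable]: "(\<lambda>x. f x l) \<in> borel_measurable M" if "l \<in> carrier L" for l
      unfolding f_def by (rule borel_measurable_lim_metric) (rule sect_measurable[OF P c' that])
    \<comment> \<open>If \<open>f\<close> vanished, the sections along \<open>pt g0\<close> would be
      bounded by tails of a summable series; but their integrals converge to the nonzero inner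
      product \<open>Lm\<close>.\<close>
    have nz: "\<not> (AE x in M. \<forall>l\<in>carrier L. f x l = 0)"
    proof
      assume z: "AE x in M. \<forall>l\<in>carrier L. f x l = 0"
      define J where "J i = (\<integral>x. sect \<Psi> (c' i) x (pt g0 x) \<partial>M)" for i
      have "(\<lambda>i. \<Sum>g\<in>supp (c (r i)). c (r i) g * mean (\<psi> n) (inv\<^bsub>K\<^esub> g0 \<otimes>\<^bsub>K\<^esub> g)) \<longlonglongrightarrow> Lm"
        using LIMSEQ_subseq_LIMSEQ[OF Lm(2) r(1)] by (simp add: o_def)
      then have JL: "J \<longlonglongrightarrow> Lm"
        unfolding J_def integral_sect_pt(2)[OF P c' g0] by (simp add: c'_def \<Psi>_def)
      have "cmod (J i) \<le> (\<Sum>m. b (m + i))" for i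
      proof -
        have "ennreal (cmod (J i)) \<le> (\<integral>\<^sup>+x. ennreal (cmod (sect \<Psi> (c' i) x (pt g0 x))) \<partial>M)"
          unfolding J_def by (rule integral_norm_bound_ennreal[OF integral_sect_pt(1)[OF P c' g0]])
        also have "\<dots> \<le> (\<integral>\<^sup>+x. (\<Sum>m. ennreal (sq (m + i) x)) \<partial>M)"
        proof (rule nn_integral_mono_AE)
          show "AE x in M. ennreal (cmod (sect \<Psi> (c' i) x (pt g0 x))) \<le> (\<Sum>m. ennreal (sq (m + i) x))"
            using z good AE_space
          proof eventually_elim
            case (elim x)
            have l: "pt g0 x \<in> carrier L" using elim g0 by (simp add: pt_closed)
            have "cmod (sect \<Psi> (c' i) x (pt g0 x)) \<le> (\<Sum>m. sq (m + i) x)"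
              using fl(2)[OF elim(3) l elim(2), of i] elim(1) l by simp
            then have "ennreal (cmod (sect \<Psi> (c' i) x (pt g0 x))) \<le> ennreal (\<Sum>m. sq (m + i) x)"
              by (rule ennreal_leI)
            also have "\<dots> = (\<Sum>m. ennreal (sq (m + i) x))"
              by (rule suminf_ennreal2[symmetric]) (use sq0 elim in \<open>auto intro: summable_ignore_initial_segment\<close>)
            finally show ?case .
          qed
        qed
        also have "\<dots> \<le> ennreal (\<Sum>m. b (m + i))" by (rule Jsum)
        finally show ?thesis using b0 sb
          by (subst (asm) ennreal_le_iff) (auto intro!: suminf_nonneg intro: summable_ignore_initial_segment)
      qed
      then have "J \<longlonglongrightarrow> 0"
        by (intro Lim_null_comparison[OF _ summable_tail_tendsto_0[OF sb]]) auto
      then show False using JL Lm(1) LIMSEQ_unique by blast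
    qed
    \<comment> \<open>The translation defect tends to zero in the mean, so by Fatou's lemma its
      lower limit is zero almost everywhere; since the sections converge there, this is enough for
      their limits to agree.\<close>
    have equi: "AE x in M. \<forall>l\<in>carrier L. f (\<alpha> h x) (\<omega> h x \<otimes>\<^bsub>L\<^esub> l) = f x l" if h: "h \<in> H" for h
    proof -
      have hK: "h \<in> carrier K" "inv\<^bsub>K\<^esub> h \<in> carrier K" and hi: "inv\<^bsub>K\<^esub> h \<in> H"
        using h HK H by (auto simp: subgroup.m_inv_closed)
      define E where "E i = (\<lambda>g. translate K (inv\<^bsub>K\<^esub> h) (c' i) g - c' i g)" for i
      have tr: "fin_supp (translate K (inv\<^bsub>K\<^esub> h) (c' i))" for i by (rule translate_supp(2)[OF P hK(2) c'])
      have E: "fin_supp (E i)" for i unfolding E_def by (rule fin_supp_diff[OF P tr c'])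
      have em: "(\<lambda>x. ennreal (qx \<Psi> (E i) x)) \<in> borel_measurable M" for i
        using borel_measurable_integrable[OF integral_qx(1)[OF P E]] by measurable
      have "(\<integral>\<^sup>+x. liminf (\<lambda>i. ennreal (qx \<Psi> (E i) x)) \<partial>M) \<le> liminf (\<lambda>i. \<integral>\<^sup>+x. ennreal (qx \<Psi> (E i) x) \<partial>M)"
        by (rule nn_integral_liminf) (rule em)
      also have "(\<lambda>i. \<integral>\<^sup>+x. ennreal (qx \<Psi> (E i) x) \<partial>M) \<longlonglongrightarrow> ennreal 0"
      proof -
        have "(\<lambda>i. ?Q (\<lambda>g. translate K (inv\<^bsub>K\<^esub> h) (c (r i)) g - c (r i) g)) \<longlonglongrightarrow> 0"
          using LIMSEQ_subseq_LIMSEQ[OF inv[OF hi] r(1)] by (simp add: o_def)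
        then show ?thesis unfolding nn_integral_qx[OF P E] by (intro tendsto_ennrealI) (simp add: E_def c'_def \<Psi>_def)
      qed
      then have "liminf (\<lambda>i. \<integral>\<^sup>+x. ennreal (qx \<Psi> (E i) x) \<partial>M) = 0"
        by (intro lim_imp_Liminf) auto
      finally have "(\<integral>\<^sup>+x. liminf (\<lambda>i. ennreal (qx \<Psi> (E i) x)) \<partial>M) = 0" by simp
      then have li: "AE x in M. liminf (\<lambda>i. ennreal (qx \<Psi> (E i) x)) = 0"
        by (subst (asm) nn_integral_0_iff_AE) (use em in auto)
      show ?thesis using li good AE_\<alpha>[OF hK(1) good] AE_space
      proof eventually_elim
        case (elim x)
        have hx: "\<alpha> h x \<in> space M" using elim hK by (simp add: \<alpha>_space)
        show ?case
        proof
          fix l assume l: "l \<in> carrier L"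
          have wl: "\<omega> h x \<otimes>\<^bsub>L\<^esub> l \<in> carrier L" using l elim hK by (simp add: \<omega>_closed)
          define d where "d = f (\<alpha> h x) (\<omega> h x \<otimes>\<^bsub>L\<^esub> l) - f x l"
          have "(\<lambda>i. sect \<Psi> (c' i) (\<alpha> h x) (\<omega> h x \<otimes>\<^bsub>L\<^esub> l) - sect \<Psi> (c' i) x l) \<longlonglongrightarrow> d"
            unfolding d_def by (intro tendsto_diff fl(1) hx wl l elim)
          then have t: "(\<lambda>i. ennreal ((cmod (sect \<Psi> (c' i) (\<alpha> h x) (\<omega> h x \<otimes>\<^bsub>L\<^esub> l) - sect \<Psi> (c' i) x l))\<^sup>2)) \<longlonglongrightarrow> ennreal ((cmod d)\<^sup>2)"
            by (intro tendsto_ennrealI tendsto_power tendsto_norm)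
          have "ennreal ((cmod d)\<^sup>2) = liminf (\<lambda>i. ennreal ((cmod (sect \<Psi> (c' i) (\<alpha> h x) (\<omega> h x \<otimes>\<^bsub>L\<^esub> l) - sect \<Psi> (c' i) x l))\<^sup>2))"
            using lim_imp_Liminf[OF _ t] by simp
          also have "\<dots> \<le> liminf (\<lambda>i. ennreal (qx \<Psi> (E i) x))"
          proof (intro Liminf_mono always_eventually allI ennreal_leI)
            fix i
            show "(cmod (sect \<Psi> (c' i) (\<alpha> h x) (\<omega> h x \<otimes>\<^bsub>L\<^esub> l) - sect \<Psi> (c' i) x l))\<^sup>2 \<le> qx \<Psi> (E i) x"
              using sect_bound[OF P elim(4) E l, of i]
              by (simp add: sect_translate[OF P hK(1) c' elim(4) l] E_def sect_diff[OF P tr c'])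
          qed
          finally have "ennreal ((cmod d)\<^sup>2) = 0" using elim(1) by simp
          then have "d = 0" by simp
          then show "f (\<alpha> h x) (\<omega> h x \<otimes>\<^bsub>L\<^esub> l) = f x l" by (simp add: d_def)
        qed
      qed
    qed
    have "\<exists>m::nat. \<not> (AE x in M. \<forall>l\<in>carrier L. cmod (f x l) \<le> 1 / real (Suc m))"
    proof (rule ccontr)
      assume "\<not> ?thesis"
      then have "AE x in M. \<forall>m. \<forall>l\<in>carrier L. cmod (f x l) \<le> 1 / real (Suc m)"
        by (simp add: AE_all_countable)
      then have "AE x in M. \<forall>l\<in>carrier L. f x l = 0"
      proof eventually_elim
        case (elim x)
        show ?case
        proof (rule ballI, rule ccontr)
          fix l assume l: "l \<in> carrier L" "f x l \<noteq> 0"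
          then obtain m where "inverse (real (Suc m)) < cmod (f x l)"
            using reals_Archimedean[of "cmod (f x l)"] by auto
          then show False using elim l by (fastforce simp: inverse_eq_divide not_le[symmetric])
        qed
      qed
      then show False using nz by simp
    qed
    then obtain m where m: "\<not> (AE x in M. \<forall>l\<in>carrier L. cmod (f x l) \<le> 1 / real (Suc m))" by blast
    define \<epsilon> where "\<epsilon> = 1 / real (Suc m)"
    have \<epsilon>: "\<epsilon> > 0" by (simp add: \<epsilon>_def)
    define B where "B x = {l \<in> carrier L. cmod (f x l) > \<epsilon>}" for x
    show thesis
    proof (rule that)
      show "B x \<subseteq> carrier L" for x by (auto simp: B_def)
      show "{x \<in> space M. l \<in> B x} \<in> sets M" if "l \<in> carrier L" for l
        using that f_meas[OF that] by (simp add: B_def)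
      show "AE x in M. \<forall>l\<in>carrier L. \<omega> h x \<otimes>\<^bsub>L\<^esub> l \<in> B (\<alpha> h x) \<longleftrightarrow> l \<in> B x" if h: "h \<in> H" for h
        using equi[OF h] AE_space
        by eventually_elim (use h HK in \<open>auto simp: B_def \<omega>_closed subset_iff\<close>)
      show "\<not> (AE x in M. B x = {})"
      proof
        assume "AE x in M. B x = {}"
        then have "AE x in M. \<forall>l\<in>carrier L. cmod (f x l) \<le> 1 / real (Suc m)"
          by eventually_elim (auto simp: B_def \<epsilon>_def not_less)
        then show False using m by blast
      qed
      show "AE x in M. \<exists>\<delta>>0. \<exists>A. finite A \<and> A \<subseteq> carrier L \<and>
          B x \<subseteq> {l. \<exists>a\<in>A. cmod (\<psi> n (inv\<^bsub>L\<^esub> l \<otimes>\<^bsub>L\<^esub> a)) > \<delta>}"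
        using good AE_space
      proof eventually_elim
        case (elim x)
        obtain i where i: "(\<Sum>m. sq (m + i) x) < \<epsilon> / 2"
          using order_tendstoD(2)[OF summable_tail_tendsto_0[OF elim(1)], of "\<epsilon> / 2"] \<epsilon>
          by (auto simp: eventually_sequentially)
        define N where "N = (\<Sum>g\<in>supp (c' i). cmod (c' i g)) + 1"
        have N: "N > 0" unfolding N_def by (intro add_nonneg_pos sum_nonneg) auto
        \<comment> \<open>If all the relevant values of \<open>\<Psi>\<close> were at most
          \<open>\<delta>\<close>, the approximating section would be at most
          \<open>\<epsilon> / 2\<close>; with an error below \<open>\<epsilon> / 2\<close> this
          would exclude \<open>l\<close> from \<open>B x\<close>. The summand one in
          \<open>N\<close> keeps the denominator positive.\<close>
        define \<delta> where "\<delta> = \<epsilon> / (2 * N)"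
        have \<delta>0: "\<delta> > 0" using N \<epsilon> by (simp add: \<delta>_def)
        have "\<exists>a\<in>(\<lambda>g. pt g x) ` supp (c' i). cmod (\<Psi> (inv\<^bsub>L\<^esub> l \<otimes>\<^bsub>L\<^esub> a)) > \<delta>" if l: "l \<in> B x" for l
        proof (rule ccontr)
          assume "\<not> ?thesis"
          then have le: "cmod (\<Psi> (inv\<^bsub>L\<^esub> l \<otimes>\<^bsub>L\<^esub> pt g x)) \<le> \<delta>" if "g \<in> supp (c' i)" for g
            using that by (auto simp: not_less)
          have lL: "l \<in> carrier L" "cmod (f x l) > \<epsilon>" using l by (auto simp: B_def)
          have "cmod (sect \<Psi> (c' i) x l) \<le> (\<Sum>g\<in>supp (c' i). cmod (c' i g) * \<delta>)"
            unfolding sect_def by (rule sum_norm_le) (use le in \<open>auto simp: norm_mult intro: mult_left_mono\<close>)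
          also have "\<dots> = (N - 1) * \<delta>" by (simp add: N_def sum_distrib_right)
          also have "\<dots> \<le> N * \<delta>" using \<delta>0 by (intro mult_right_mono) auto
          also have "\<dots> = \<epsilon> / 2" using N by (simp add: \<delta>_def)
          finally have "cmod (sect \<Psi> (c' i) x l) \<le> \<epsilon> / 2" .
          moreover have "cmod (f x l - sect \<Psi> (c' i) x l) < \<epsilon> / 2"
            using fl(2)[OF elim(2) lL(1) elim(1), of i] i by linarith
          moreover have "cmod (f x l) \<le> cmod (f x l - sect \<Psi> (c' i) x l) + cmod (sect \<Psi> (c' i) x l)"
            using norm_triangle_ineq[of "f x l - sect \<Psi> (c' i) x l" "sect \<Psi> (c' i) x l"] by simp
          ultimately show False using lL(2) by linarith
        qed
        moreover note \<delta>0
        moreover have "finite ((\<lambda>g. pt g x) ` supp (c' i))" "(\<lambda>g. pt g x) ` supp (c' i) \<subseteq> carrier L"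
          using c'[of i] elim by (auto intro!: pt_closed)
        ultimately show ?case unfolding \<Psi>_def by blast
      qed
    qed
  qed
qed

end

section \<open>The Bass--Serre tree of a free product\<close>

abbreviation lcp :: "'a list \<Rightarrow> 'a list \<Rightarrow> nat" where
  "lcp u v \<equiv> length (longest_common_prefix u v)"

text \<open>Lists are vertices of the tree of prefixes rooted at \<open>[]\<close>; the path between
  two of them turns at the longest common prefix.\<close>

definition tree_dist :: "'a list \<Rightarrow> 'a list \<Rightarrow> nat" where
  "tree_dist u v = (length u - lcp u v) + (length v - lcp u v)"

lemma lcp_le: "lcp u v \<le> length u" "lcp u v \<le> length v"
  by (simp_all add: longest_common_prefix_prefix1 longest_common_prefix_prefix2 prefix_length_le)

lemma lcp_commute: "lcp u v = lcp v u"
  by (induction u v rule: longest_common_prefix.induct) auto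

lemma lcp_ultrametric: "min (lcp u v) (lcp v w) \<le> lcp u w"
proof (induction u v arbitrary: w rule: longest_common_prefix.induct)
  case (1 x xs y ys) then show ?case by (cases w) auto
qed auto

lemma int_tree_dist: "int (tree_dist u v) = int (length u) + int (length v) - 2 * int (lcp u v)"
  using lcp_le[of u v] by (simp add: tree_dist_def)

lemma tree_dist_commute: "tree_dist u v = tree_dist v u"
  using lcp_commute[of u v] by (simp add: tree_dist_def)

lemma tree_dist_self [simp]: "tree_dist u u = 0"
proof -
  have "lcp u u = length u" by (induction u) auto
  then show ?thesis by (simp add: tree_dist_def)
qed

lemma tree_dist_eq_0: "tree_dist u v = 0 \<Longrightarrow> u = v"
proof -
  assume "tree_dist u v = 0"
  then have "length u \<le> lcp u v" "length v \<le> lcp u v" by (auto simp: tree_dist_def)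
  then show "u = v"
    by (metis lcp_le longest_common_prefix_prefix1 longest_common_prefix_prefix2 order_antisym prefix_order.antisym
        prefix_order.order_refl not_equal_is_parallel prefix_length_prefix)
qed

lemma tree_dist_triangle: "tree_dist u w \<le> tree_dist u v + tree_dist v w"
proof -
  have "int (tree_dist u w) \<le> int (tree_dist u v) + int (tree_dist v w)"
    unfolding int_tree_dist using lcp_ultrametric[of u v w] lcp_le[of u v] lcp_le[of v w] by linarith
  then show ?thesis by linarith
qed

text \<open>The length of the common prefix is the Gromov product with base point \<open>[]\<close>,
  and it satisfies the ultrametric inequality; this is the form of hyperbolicity that characterises
  trees. Uniqueness of geodesic points and of centres comes from it.\<close>

lemma tree_dist_four_point:
  "tree_dist u v + tree_dist w x \<le> max (tree_dist u w + tree_dist v x) (tree_dist u x + tree_dist v w)"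
proof -
  have "int (tree_dist u v) + int (tree_dist w x)
     \<le> max (int (tree_dist u w) + int (tree_dist v x)) (int (tree_dist u x) + int (tree_dist v w))"
    unfolding int_tree_dist
    using lcp_ultrametric[of u w v] lcp_ultrametric[of u x v] lcp_ultrametric[of w u x] lcp_ultrametric[of w v x]
      lcp_commute[of u v] lcp_commute[of u w] lcp_commute[of u x] lcp_commute[of v w] lcp_commute[of v x] lcp_commute[of w x]
    by linarith
  then show ?thesis by linarith
qed

lemma lcp_append: "lcp (p @ u) (p @ v) = length p + lcp u v"
  by (induction p) auto

lemma tree_dist_append: "tree_dist (p @ u) (p @ v) = tree_dist u v"
  by (simp add: tree_dist_def lcp_append)

lemma lcp_prefix: "prefix u v \<Longrightarrow> lcp u v = length u"
  by (metis append_Nil2 lcp_append list.size(3) longest_common_prefix.simps(2) prefixE Nat.add_0_right)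

lemma geodesic_point_aux:
  assumes "k \<le> length u - lcp u v"
  shows "tree_dist u (take (length u - k) u) = k"
    and "tree_dist (take (length u - k) u) v = tree_dist u v - k"
proof -
  let ?p = "take (length u - k) u"
  have pu: "prefix ?p u" by (simp add: take_is_prefix)
  have l: "length ?p = length u - k" by simp
  have k: "k \<le> length u" using assms by simp
  have lp: "lcp ?p u = length u - k" using lcp_prefix[OF pu] by simp
  show "tree_dist u ?p = k" unfolding tree_dist_commute[of u] using lp k by (simp add: tree_dist_def)
  have "lcp u v \<le> length u - k" using assms lcp_le[of u v] k by linarith
  moreover have "lcp ?p v \<ge> min (lcp ?p u) (lcp u v)" by (rule lcp_ultrametric)
  moreover have "lcp u v \<ge> min (lcp u ?p) (lcp ?p v)" by (rule lcp_ultrametric)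
  moreover have "lcp ?p v \<le> length ?p" by (rule lcp_le)
  ultimately have "lcp ?p v = lcp u v" using lp lcp_commute[of u ?p] by simp
  then show "tree_dist ?p v = tree_dist u v - k"
    using assms lcp_le[of u v] k l by (simp add: tree_dist_def)
qed

text \<open>On the near side of the branch point letters are dropped from \<open>u\<close>; beyond
  it the point is found by walking back from \<open>v\<close>.\<close>

lemma geodesic_point:
  assumes V: "\<And>w n. w \<in> V \<Longrightarrow> take n w \<in> V" and uv: "u \<in> V" "v \<in> V" and k: "k \<le> tree_dist u v"
  shows "\<exists>w\<in>V. tree_dist u w = k \<and> tree_dist w v = tree_dist u v - k"
proof (cases "k \<le> length u - lcp u v")
  case True
  then show ?thesis using geodesic_point_aux[OF True] V[OF uv(1)] by blast
next
  case False
  let ?k = "tree_dist u v - k"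
  have le: "?k \<le> length v - lcp v u" using False k lcp_commute[of u v] by (auto simp: tree_dist_def)
  have "tree_dist (take (length v - ?k) v) u = tree_dist v u - ?k" by (rule geodesic_point_aux(2)[OF le])
  also have "\<dots> = k" using k tree_dist_commute[of u v] by simp
  finally have "tree_dist u (take (length v - ?k) v) = k" by (simp add: tree_dist_commute)
  moreover have "tree_dist (take (length v - ?k) v) v = ?k"
    using geodesic_point_aux(1)[OF le] by (simp add: tree_dist_commute)
  ultimately show ?thesis using V[OF uv(2)] by blast
qed

lemma geodesic_point_unique:
  assumes "tree_dist u w = k" "tree_dist w v = tree_dist u v - k" "k \<le> tree_dist u v"
    and "tree_dist u w' = k" "tree_dist w' v = tree_dist u v - k"
  shows "w = w'"
proof -
  have "tree_dist w w' + tree_dist u v \<le> max (tree_dist w u + tree_dist w' v) (tree_dist w v + tree_dist w' u)"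
    by (rule tree_dist_four_point)
  then have "tree_dist w w' = 0"
    using assms by (simp add: tree_dist_commute[of w u] tree_dist_commute[of w' u])
  then show ?thesis by (rule tree_dist_eq_0)
qed

text \<open>The midpoint of a diameter: the two conditions force the diameter of \<open>B\<close> to
  be \<open>2 * R\<close>, so only sets of even diameter can have such a vertex.\<close>

definition is_center :: "'a list set \<Rightarrow> 'a list \<Rightarrow> bool" where
  "is_center B m \<longleftrightarrow> (\<exists>R. (\<forall>b\<in>B. tree_dist m b \<le> R) \<and> (\<exists>p\<in>B. \<exists>q\<in>B. tree_dist p q = 2 * R))"

text \<open>Both radii are half the diameter, hence equal, and the four-point inequality for the two
  centres and the ends of one diameter leaves no distance between the centres.\<close>

lemma center_unique:
  assumes "is_center B m" "is_center B m'"
  shows "m = m'"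
proof -
  obtain R p q where R: "\<forall>b\<in>B. tree_dist m b \<le> R" "p \<in> B" "q \<in> B" "tree_dist p q = 2 * R"
    using assms(1) by (auto simp: is_center_def)
  obtain R' p' q' where R': "\<forall>b\<in>B. tree_dist m' b \<le> R'" "p' \<in> B" "q' \<in> B" "tree_dist p' q' = 2 * R'"
    using assms(2) by (auto simp: is_center_def)
  have mp: "tree_dist p' m \<le> R" "tree_dist m q' \<le> R" "tree_dist m p \<le> R" "tree_dist m q \<le> R"
    using R(1) R(2-3) R'(2,3) by (auto simp: tree_dist_commute)
  have mp': "tree_dist p m' \<le> R'" "tree_dist m' q \<le> R'" "tree_dist m' p \<le> R'" "tree_dist m' q \<le> R'"
    using R'(1) R(2-3) R'(2,3) by (auto simp: tree_dist_commute)
  have "R = R'"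
    using tree_dist_triangle[of p' q' m] tree_dist_triangle[of p q m'] mp mp' R(4) R'(4) by linarith
  moreover have "tree_dist m m' + tree_dist p q \<le> max (tree_dist m p + tree_dist m' q) (tree_dist m q + tree_dist m' p)"
    by (rule tree_dist_four_point)
  ultimately have "tree_dist m m' = 0" using mp mp' R(4) by linarith
  then show ?thesis by (rule tree_dist_eq_0)
qed

lemma center_exists:
  assumes V: "\<And>w n. w \<in> V \<Longrightarrow> take n w \<in> V" and B: "B \<subseteq> V" "B \<noteq> {}"
    and bdd: "\<And>p q. p \<in> B \<Longrightarrow> q \<in> B \<Longrightarrow> tree_dist p q \<le> N"
    and ev: "\<And>p. p \<in> B \<Longrightarrow> even (length p)"
  shows "\<exists>m\<in>V. is_center B m"
proof -
  define Ds where "Ds = (\<lambda>(p, q). tree_dist p q) ` (B \<times> B)"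
  have fin: "finite Ds" by (rule finite_subset[of _ "{..N}"]) (use bdd in \<open>auto simp: Ds_def\<close>)
  have ne: "Ds \<noteq> {}" using B by (auto simp: Ds_def)
  obtain p q where pq: "p \<in> B" "q \<in> B" "tree_dist p q = Max Ds"
    using Max_in[OF fin ne] by (auto simp: Ds_def)
  have mx: "tree_dist b b' \<le> tree_dist p q" if "b \<in> B" "b' \<in> B" for b b'
    unfolding pq(3) using that by (intro Max_ge[OF fin]) (auto simp: Ds_def)
  \<comment> \<open>Here parity enters: points of even depth have even mutual distances, so the
    midpoint of a diameter is a vertex and not the middle of an edge.\<close>
  have "even (int (tree_dist p q))" unfolding int_tree_dist using ev[OF pq(1)] ev[OF pq(2)] by simp
  then obtain R where R: "tree_dist p q = 2 * R" by (auto elim: evenE)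
  obtain m where m: "m \<in> V" "tree_dist p m = R" "tree_dist m q = R"
  proof -
    have "p \<in> V" "q \<in> V" "R \<le> tree_dist p q" "tree_dist p q - R = R" using pq B R by auto
    then show ?thesis using geodesic_point[OF V, of p q R] that by auto
  qed
  have "tree_dist m b \<le> R" if b: "b \<in> B" for b
  proof -
    have "tree_dist m b + tree_dist p q \<le> max (tree_dist m p + tree_dist b q) (tree_dist m q + tree_dist b p)"
      by (rule tree_dist_four_point)
    then show ?thesis using mx[OF b pq(1)] mx[OF b pq(2)] m R by (simp add: tree_dist_commute[of m p])
  qed
  then have "is_center B m" unfolding is_center_def using pq(1,2) R by blast
  then show ?thesis using m by blast
qed

text \<open>The Bass--Serre tree of a free product, rooted at the identity. A vertex is coded by the path
  from the root: \<open>Inl j\<close> leads from the group element reached so far to its coset of the \<open>j\<close>-th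
  factor, and \<open>Inr a\<close> with \<open>a \<noteq> \<one>\<close> leads from that coset to another of its elements.\<close>

fun bs_vertex :: "'i set \<Rightarrow> ('i \<Rightarrow> 'g monoid) \<Rightarrow> ('i + 'g) list \<Rightarrow> bool" where
  "bs_vertex I G [] = True"
| "bs_vertex I G [Inl j] = (j \<in> I)"
| "bs_vertex I G (Inl j # Inr a # v) =
     (j \<in> I \<and> a \<in> carrier (G j) \<and> a \<noteq> \<one>\<^bsub>G j\<^esub> \<and> bs_vertex I G v \<and> (v = [] \<or> hd v \<noteq> Inl j))"
| "bs_vertex I G _ = False"

text \<open>A trivial coefficient contributes no step. In this way each vertex other than
  \<open>[Inl j]\<close> is \<open>bs_cons\<close> of its \<open>bs_coef\<close> and
  \<open>bs_rest\<close>, where the rest does not begin with \<open>Inl j\<close>.\<close>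

definition bs_cons :: "('i \<Rightarrow> 'g monoid) \<Rightarrow> 'i \<Rightarrow> 'g \<Rightarrow> ('i + 'g) list \<Rightarrow> ('i + 'g) list" where
  "bs_cons G j a v = (if a = \<one>\<^bsub>G j\<^esub> then v else Inl j # Inr a # v)"

fun bs_coef :: "('i \<Rightarrow> 'g monoid) \<Rightarrow> 'i \<Rightarrow> ('i + 'g) list \<Rightarrow> 'g" where
  "bs_coef G j (Inl i # Inr a # v) = (if i = j then a else \<one>\<^bsub>G j\<^esub>)"
| "bs_coef G j _ = \<one>\<^bsub>G j\<^esub>"

fun bs_rest :: "'i \<Rightarrow> ('i + 'g) list \<Rightarrow> ('i + 'g) list" where
  "bs_rest j (Inl i # Inr a # v) = (if i = j then v else Inl i # Inr a # v)"
| "bs_rest j v = v"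

text \<open>Van der Waerden's trick: left multiplication in the factor \<open>j\<close> alters only
  the leading coefficient for \<open>j\<close>, and it fixes \<open>[Inl j]\<close>, the factor
  itself viewed as a coset.\<close>

definition bs_mul :: "('i \<Rightarrow> 'g monoid) \<Rightarrow> 'i \<Rightarrow> 'g \<Rightarrow> ('i + 'g) list \<Rightarrow> ('i + 'g) list" where
  "bs_mul G j a v = (if v = [Inl j] then v else bs_cons G j (a \<otimes>\<^bsub>G j\<^esub> bs_coef G j v) (bs_rest j v))"

text \<open>Reads off the group element at a vertex; at a coset vertex the last letter is dropped,
  which leaves a representative of the coset.\<close>

fun bs_word :: "('i + 'g) list \<Rightarrow> ('i \<times> 'g) list" where
  "bs_word (Inl j # Inr a # v) = (j, a) # bs_word v"
| "bs_word _ = []"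

definition bs_act :: "('i \<Rightarrow> 'g monoid) \<Rightarrow> ('i \<times> 'g) list \<Rightarrow> ('i + 'g) list \<Rightarrow> ('i + 'g) list" where
  "bs_act G w v = foldr (\<lambda>(j, a). bs_mul G j a) w v"

lemma bs_act_simps [simp]:
  "bs_act G [] v = v" "bs_act G ((j, a) # w) v = bs_mul G j a (bs_act G w v)"
  "bs_act G (u @ w) v = bs_act G u (bs_act G w v)"
  by (simp_all add: bs_act_def)

locale group_family =
  fixes I :: "'i set" and G :: "'i \<Rightarrow> 'g monoid"
  assumes grp: "\<And>i. i \<in> I \<Longrightarrow> group (G i)"
begin

abbreviation "V \<equiv> {v. bs_vertex I G v}"
abbreviation "P \<equiv> free_product I G"

lemma bs_cases:
  assumes "bs_vertex I G v" "j \<in> I"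
  obtains "v = [Inl j]"
  | "v \<noteq> [Inl j]" "v = bs_cons G j (bs_coef G j v) (bs_rest j v)" "bs_coef G j v \<in> carrier (G j)"
    "bs_vertex I G (bs_rest j v)" "bs_rest j v = [] \<or> hd (bs_rest j v) \<noteq> Inl j"
proof -
  interpret group "G j" using grp assms by simp
  have "v = [Inl j] \<or> v \<noteq> [Inl j] \<and> bs_cons G j (bs_coef G j v) (bs_rest j v) = v \<and>
    bs_coef G j v \<in> carrier (G j) \<and> bs_vertex I G (bs_rest j v) \<and> (bs_rest j v = [] \<or> hd (bs_rest j v) \<noteq> Inl j)"
    using assms by (cases "(I, G, v)" rule: bs_vertex.cases) (auto simp: bs_cons_def)
  then show thesis using that by metis
qed

lemma bs_cons:
  assumes "bs_vertex I G r" "r = [] \<or> hd r \<noteq> Inl j" "j \<in> I" "a \<in> carrier (G j)"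
  shows "bs_vertex I G (bs_cons G j a r)" "bs_cons G j a r \<noteq> [Inl j]"
    "bs_coef G j (bs_cons G j a r) = a" "bs_rest j (bs_cons G j a r) = r"
  using assms
  by (cases "(I, G, r)" rule: bs_vertex.cases; auto simp: bs_cons_def)+

lemma bs_mul_cons:
  assumes "bs_vertex I G r" "r = [] \<or> hd r \<noteq> Inl j" "j \<in> I" "b \<in> carrier (G j)"
  shows "bs_mul G j a (bs_cons G j b r) = bs_cons G j (a \<otimes>\<^bsub>G j\<^esub> b) r"
  using bs_cons[OF assms] by (simp add: bs_mul_def)

lemma bs_mul_root [simp]: "bs_mul G j a [Inl j] = [Inl j]"
  by (simp add: bs_mul_def)

lemma bs_mul_vertex:
  assumes "bs_vertex I G v" "j \<in> I" "a \<in> carrier (G j)"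
  shows "bs_vertex I G (bs_mul G j a v)"
proof -
  interpret group "G j" using grp assms by simp
  show ?thesis using assms(1,2)
  proof (cases rule: bs_cases)
    case 2
    show ?thesis unfolding bs_mul_def using 2(1,3,4,5) assms bs_cons(1)[of "bs_rest j v" j] by simp
  qed (use assms in simp)
qed

lemma bs_mul_one:
  assumes "bs_vertex I G v" "j \<in> I"
  shows "bs_mul G j \<one>\<^bsub>G j\<^esub> v = v"
proof -
  interpret group "G j" using grp assms by simp
  show ?thesis using assms
  proof (cases rule: bs_cases)
    case 2
    show ?thesis unfolding bs_mul_def using 2(1,3) 2(2)[symmetric] by simp
  qed simp
qed

lemma bs_mul_mult:
  assumes "bs_vertex I G v" "j \<in> I" "a \<in> carrier (G j)" "b \<in> carrier (G j)"
  shows "bs_mul G j a (bs_mul G j b v) = bs_mul G j (a \<otimes>\<^bsub>G j\<^esub> b) v"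
proof -
  interpret group "G j" using grp assms by simp
  show ?thesis using assms(1,2)
  proof (cases rule: bs_cases)
    case 2
    have "bs_mul G j b v = bs_cons G j (b \<otimes>\<^bsub>G j\<^esub> bs_coef G j v) (bs_rest j v)"
      using 2(1) by (simp add: bs_mul_def)
    then show ?thesis using 2(1,3,4,5) assms by (simp add: bs_mul_cons m_assoc) (simp add: bs_mul_def m_assoc)
  qed simp
qed

text \<open>If the coefficients differ, the path runs through \<open>[Inl j]\<close>, also when one
  of them is trivial. So only equality of the coefficients matters, and this is what left
  multiplication preserves.\<close>

lemma tree_dist_bs_cons:
  assumes "r = [] \<or> hd r \<noteq> Inl j" "r' = [] \<or> hd r' \<noteq> Inl j"
  shows "tree_dist (bs_cons G j b r) (bs_cons G j b' r') =
    (if b = b' then tree_dist r r' else length r + length r' + 2)"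
proof (cases "b = b'")
  case True
  then show ?thesis using tree_dist_append[of "[Inl j, Inr b]" r r'] by (auto simp: bs_cons_def)
next
  case False
  have l: "lcp r (Inl j # v) = 0" "lcp (Inl j # v) r' = 0" for v :: "('i + 'g) list"
    using assms by (cases r; cases r'; auto)+
  show ?thesis using False l by (auto simp: bs_cons_def tree_dist_def)
qed

lemma tree_dist_bs_cons_root:
  assumes "r = [] \<or> hd r \<noteq> Inl j"
  shows "tree_dist [Inl j] (bs_cons G j b r) = length r + 1"
  using assms by (cases r) (auto simp: bs_cons_def tree_dist_def)

lemma bs_mul_isometry:
  assumes v: "bs_vertex I G v" and w: "bs_vertex I G w" and j: "j \<in> I" "a \<in> carrier (G j)"
  shows "tree_dist (bs_mul G j a v) (bs_mul G j a w) = tree_dist v w"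
proof -
  interpret group "G j" using grp j by simp
  have one: "tree_dist (bs_mul G j a [Inl j]) (bs_mul G j a w) = tree_dist [Inl j] w"
    if "bs_vertex I G w" for w using that j(1)
  proof (cases rule: bs_cases)
    case 2
    have "tree_dist [Inl j] (bs_mul G j a w) = tree_dist [Inl j] (bs_cons G j (bs_coef G j w) (bs_rest j w))"
      unfolding tree_dist_bs_cons_root[OF 2(5)] using 2(1,5) by (simp add: bs_mul_def tree_dist_bs_cons_root)
    then show ?thesis unfolding 2(2)[symmetric] bs_mul_root .
  qed simp
  from v j(1) show ?thesis
  proof (cases rule: bs_cases)
    case 1 then show ?thesis using one w by simp
  next
    case v2: 2
    from w j(1) show ?thesis
    proof (cases rule: bs_cases)
      case 1 then show ?thesis using one[OF v] by (simp add: tree_dist_commute[of _ "[Inl j]"])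
    next
      case w2: 2
      have "tree_dist (bs_mul G j a v) (bs_mul G j a w)
        = tree_dist (bs_cons G j (bs_coef G j v) (bs_rest j v)) (bs_cons G j (bs_coef G j w) (bs_rest j w))"
        using v2(1,3,5) w2(1,3,5) j by (simp add: bs_mul_def tree_dist_bs_cons)
      then show ?thesis unfolding v2(2)[symmetric] w2(2)[symmetric] .
    qed
  qed
qed

lemma bs_act_vertex:
  assumes "bs_vertex I G v" "w \<in> free_product_words I G"
  shows "bs_vertex I G (bs_act G w v)"
  using assms(2)
proof (induction w)
  case (Cons x w) then show ?case by (cases x) (auto intro: bs_mul_vertex)
qed (use assms in simp)

lemma bs_act_isometry:
  assumes "bs_vertex I G v" "bs_vertex I G v'" "w \<in> free_product_words I G"
  shows "tree_dist (bs_act G w v) (bs_act G w v') = tree_dist v v'"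
  using assms(3)
proof (induction w)
  case (Cons x w)
  then show ?case using assms by (cases x) (auto simp: bs_mul_isometry bs_act_vertex)
qed simp

lemma bs_act_rel:
  assumes "(w, w') \<in> free_product_rel I G" "bs_vertex I G v"
  shows "bs_act G w v = bs_act G w' v"
  using assms
proof (induction arbitrary: v)
  case (one u w i) then show ?case by (simp add: bs_mul_one bs_act_vertex)
next
  case (mult u w i a b) then show ?case by (simp add: bs_mul_mult bs_act_vertex)
qed auto

lemma bs_word_words: "bs_vertex I G v \<Longrightarrow> bs_word v \<in> free_product_words I G"
  by (induction v rule: bs_word.induct) auto

lemma bs_act_word:
  assumes "bs_vertex I G v" "even (length v)"
  shows "bs_act G (bs_word v) [] = v"
  using assms
proof (induction v rule: bs_word.induct)
  case (1 j a v)
  interpret group "G j" using grp 1 by simp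
  have "bs_mul G j a v = Inl j # Inr a # v"
  proof -
    have "bs_mul G j a (bs_cons G j \<one>\<^bsub>G j\<^esub> v) = bs_cons G j (a \<otimes>\<^bsub>G j\<^esub> \<one>\<^bsub>G j\<^esub>) v"
      by (rule bs_mul_cons) (use 1 in auto)
    then show ?thesis using 1 by (simp add: bs_cons_def)
  qed
  then show ?case using 1 by simp
next
  case ("2_1") then show ?case by simp
next
  case ("2_2" v va) then show ?case by simp
next
  case ("2_3" v) then show ?case by simp
next
  case ("2_4" v vb va) then show ?case by simp
qed

lemma bs_act_word_coset:
  assumes "bs_vertex I G (v @ [Inl j])" "even (length v)"
  shows "bs_act G (bs_word v) [Inl j] = v @ [Inl j]"
  using assms
proof (induction v rule: bs_word.induct)
  case (1 i a v)
  interpret group "G i" using grp 1 by simp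
  have "bs_mul G i a (v @ [Inl j]) = Inl i # Inr a # v @ [Inl j]"
  proof -
    have "bs_mul G i a (bs_cons G i \<one>\<^bsub>G i\<^esub> (v @ [Inl j])) = bs_cons G i (a \<otimes>\<^bsub>G i\<^esub> \<one>\<^bsub>G i\<^esub>) (v @ [Inl j])"
      by (rule bs_mul_cons) (use 1 in auto)
    then show ?thesis using 1 by (simp add: bs_cons_def)
  qed
  then show ?case using 1 by simp
next
  case ("2_1") then show ?case by simp
next
  case ("2_2" v va) then show ?case by simp
next
  case ("2_3" v) then show ?case by simp
next
  case ("2_4" v vb va) then show ?case by simp
qed

lemma bs_even_length:
  assumes "bs_vertex I G v" "w \<in> free_product_words I G"
  shows "even (length (bs_act G w v)) \<longleftrightarrow> even (length v)"
proof -
  have one: "even (length (bs_mul G j a v)) \<longleftrightarrow> even (length v)" if "bs_vertex I G v" "j \<in> I" for j a v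
    using that
  proof (cases rule: bs_cases)
    case 2
    have "length v = length (bs_cons G j (bs_coef G j v) (bs_rest j v))" by (rule arg_cong[OF 2(2)])
    then show ?thesis using 2(1) by (simp add: bs_mul_def bs_cons_def)
  qed simp
  show ?thesis using assms(2)
  proof (induction w)
    case (Cons x w)
    then show ?case by (cases x) (auto simp: one bs_act_vertex assms)
  qed simp
qed

text \<open>A trivial coefficient, which leaves no letter in the vertex, agrees with the letter it
  stands for by the relation \<open>one\<close>; the remaining step is the relation
  \<open>mult\<close> on the leading coefficient.\<close>

lemma bs_word_mul:
  assumes "bs_vertex I G v" "even (length v)" "j \<in> I" "a \<in> carrier (G j)"
  shows "(bs_word (bs_mul G j a v), (j, a) # bs_word v) \<in> free_product_rel I G"
proof -
  interpret group "G j" using grp assms by simp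
  from assms(1,3) show ?thesis
  proof (cases rule: bs_cases)
    case 2
    let ?b = "bs_coef G j v" and ?r = "bs_rest j v"
    have r: "bs_word ?r \<in> free_product_words I G" using bs_word_words[OF 2(4)] .
    have c: "(bs_word (bs_cons G j x ?r), (j, x) # bs_word ?r) \<in> free_product_rel I G" if "x \<in> carrier (G j)" for x
    proof (cases "x = \<one>\<^bsub>G j\<^esub>")
      case True
      then show ?thesis
        using free_product_rel.sym[OF free_product_rel.one[of "[]" I G "bs_word ?r" j]] r assms by (simp add: bs_cons_def)
    next
      case False
      then show ?thesis using free_product_rel.refl[of "(j, x) # bs_word ?r" I G] r assms that by (simp add: bs_cons_def)
    qed
    have "(bs_word (bs_mul G j a v), (j, a \<otimes>\<^bsub>G j\<^esub> ?b) # bs_word ?r) \<in> free_product_rel I G"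
      using c[of "a \<otimes>\<^bsub>G j\<^esub> ?b"] 2(1,3) assms by (simp add: bs_mul_def)
    also have "((j, a \<otimes>\<^bsub>G j\<^esub> ?b) # bs_word ?r, (j, a) # (j, ?b) # bs_word ?r) \<in> free_product_rel I G"
      using free_product_rel.sym[OF free_product_rel.mult[of "[]" I G "bs_word ?r" j a ?b]] r assms 2(3) by simp
    also (free_product_rel.trans) have "((j, a) # (j, ?b) # bs_word ?r, (j, a) # bs_word v) \<in> free_product_rel I G"
      using free_product_rel_context[OF grp free_product_rel.sym[OF c[OF 2(3)]], of "[(j, a)]" "[]"] assms 2(2)[symmetric] by simp
    finally (free_product_rel.trans) show ?thesis .
  qed (use assms in simp)
qed

text \<open>The normal form theorem for free products in another guise: since the word can be read
  off from the image of the root, the root has trivial stabiliser, as \<open>act_root_inj\<close>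
  records.\<close>

lemma bs_word_act:
  assumes "w \<in> free_product_words I G"
  shows "(bs_word (bs_act G w []), w) \<in> free_product_rel I G"
  using assms
proof (induction w)
  case Nil then show ?case using free_product_rel.refl[of "[]" I G] by simp
next
  case (Cons x w)
  obtain j a where x: "x = (j, a)" by force
  have w: "w \<in> free_product_words I G" "j \<in> I" "a \<in> carrier (G j)" using Cons x by auto
  have "(bs_word (bs_act G (x # w) []), (j, a) # bs_word (bs_act G w [])) \<in> free_product_rel I G"
    using bs_word_mul[of "bs_act G w []" j a] bs_even_length[of "[]" w] bs_act_vertex[of "[]" w] w x by simp
  moreover have "((j, a) # bs_word (bs_act G w []), x # w) \<in> free_product_rel I G"
    using free_product_rel_context[OF grp Cons.IH, of "[(j, a)]" "[]"] w x by simp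
  ultimately show ?case by (rule free_product_rel.trans)
qed

text \<open>The choice of a word is harmless on vertices by \<open>bs_act_rel\<close>.\<close>

definition act :: "('i \<times> 'g) list set \<Rightarrow> ('i + 'g) list \<Rightarrow> ('i + 'g) list" where
  "act x v = bs_act G (SOME w. w \<in> x) v"

lemma group_P: "group P" by (rule group_free_product[OF grp])

lemma carrier_P:
  assumes "x \<in> carrier P"
  obtains w where "w \<in> free_product_words I G" "x = free_product_rel I G `` {w}"
  using assms by (auto simp: free_product_def elim: quotientE)

lemma class_P: "w \<in> free_product_words I G \<Longrightarrow> free_product_rel I G `` {w} \<in> carrier P"
  by (auto simp: free_product_def intro: quotientI)

lemma act_class:
  assumes "w \<in> free_product_words I G" "bs_vertex I G v"
  shows "act (free_product_rel I G `` {w}) v = bs_act G w v"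
proof -
  have "w \<in> free_product_rel I G `` {w}" using free_product_rel.refl[OF assms(1)] by simp
  then have "(SOME w'. w' \<in> free_product_rel I G `` {w}) \<in> free_product_rel I G `` {w}" by (rule someI)
  then show ?thesis unfolding act_def using bs_act_rel[OF _ assms(2)] by auto
qed

lemma act_vertex: "x \<in> carrier P \<Longrightarrow> bs_vertex I G v \<Longrightarrow> bs_vertex I G (act x v)"
  by (elim carrier_P) (simp add: act_class bs_act_vertex)

lemma act_mult:
  assumes "x \<in> carrier P" "y \<in> carrier P" "bs_vertex I G v"
  shows "act (x \<otimes>\<^bsub>P\<^esub> y) v = act x (act y v)"
  using assms by (elim carrier_P) (simp add: free_product_mult[OF grp] act_class bs_act_vertex)

lemma act_one: "bs_vertex I G v \<Longrightarrow> act \<one>\<^bsub>P\<^esub> v = v"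
  using act_class[of "[]" v] by (simp add: free_product_def)

lemma act_isometry:
  assumes "x \<in> carrier P" "bs_vertex I G v" "bs_vertex I G w"
  shows "tree_dist (act x v) (act x w) = tree_dist v w"
  using assms by (elim carrier_P) (simp add: act_class bs_act_isometry)

lemma act_even: "x \<in> carrier P \<Longrightarrow> bs_vertex I G v \<Longrightarrow> even (length (act x v)) \<longleftrightarrow> even (length v)"
  by (elim carrier_P) (simp add: act_class bs_even_length)

lemma act_root_inj:
  assumes "x \<in> carrier P" "y \<in> carrier P" "act x [] = act y []"
  shows "x = y"
proof -
  obtain u w where uw: "u \<in> free_product_words I G" "x = free_product_rel I G `` {u}"
     "w \<in> free_product_words I G" "y = free_product_rel I G `` {w}"
    using assms by (elim carrier_P)
  have "bs_act G u [] = bs_act G w []" using assms(3) uw by (simp add: act_class)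
  then have "(u, w) \<in> free_product_rel I G"
    using bs_word_act[OF uw(1)] bs_word_act[OF uw(3)] free_product_rel.sym free_product_rel.trans by metis
  then show ?thesis using equiv_class_eq[OF equiv_free_product_rel[OF grp]] uw by simp
qed

definition elt :: "('i + 'g) list \<Rightarrow> ('i \<times> 'g) list set" where
  "elt v = free_product_rel I G `` {bs_word v}"

lemma elt_closed: "bs_vertex I G v \<Longrightarrow> elt v \<in> carrier P"
  unfolding elt_def by (intro class_P bs_word_words)

lemma act_elt: "bs_vertex I G v \<Longrightarrow> even (length v) \<Longrightarrow> act (elt v) [] = v"
  unfolding elt_def by (simp add: act_class bs_word_words bs_act_word)

lemma bs_vertex_coset:
  assumes "bs_vertex I G v" "odd (length v)"
  shows "\<exists>u j. v = u @ [Inl j] \<and> bs_vertex I G u \<and> even (length u) \<and> j \<in> I"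
  using assms
proof (induction v rule: bs_word.induct)
  case (1 j a v)
  then obtain u i where u: "v = u @ [Inl i]" "bs_vertex I G u" "even (length u)" "i \<in> I" by auto
  then show ?case using 1(2)
    by (intro exI[of _ "Inl j # Inr a # u"] exI[of _ i]) (cases u, auto)
next
  case ("2_1") then show ?case by simp
next
  case ("2_2" v va) then show ?case by simp
next
  case ("2_3" v) then show ?case by (cases v) auto
next
  case ("2_4" v vb va) then show ?case by simp
qed

lemma act_elt_coset:
  assumes "bs_vertex I G (u @ [Inl j])" "bs_vertex I G u" "even (length u)"
  shows "act (elt u) [Inl j] = u @ [Inl j]"
proof -
  have "j \<in> I" using bs_vertex_coset[OF assms(1)] assms(3) by auto
  then show ?thesis
    unfolding elt_def using assms by (simp add: act_class bs_word_words bs_act_word_coset)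
qed

text \<open>Multiplication never touches the last letter of a path of odd length. The factor to
  which a coset belongs is therefore an invariant, which later tells the indices apart.\<close>

lemma act_last:
  assumes "bs_vertex I G v" "odd (length v)" "x \<in> carrier P"
  shows "last (act x v) = last v"
proof -
  have one: "last (bs_mul G j a v) = last v" if "bs_vertex I G v" "odd (length v)" "j \<in> I" for j a v
    using that(1,3)
  proof (cases rule: bs_cases)
    case 2
    have r: "bs_rest j v \<noteq> []"
    proof
      assume "bs_rest j v = []"
      then have "length v = 0 \<or> length v = 2" using arg_cong[OF 2(2), of length] by (simp add: bs_cons_def split: if_splits)
      then show False using that(2) by auto
    qed
    have "last v = last (bs_cons G j (bs_coef G j v) (bs_rest j v))" by (rule arg_cong[OF 2(2)])
    then show ?thesis using 2(1) r by (simp add: bs_mul_def bs_cons_def)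
  qed simp
  obtain w where w: "w \<in> free_product_words I G" "x = free_product_rel I G `` {w}" using assms(3) by (rule carrier_P)
  have "last (bs_act G w v) = last v" using w(1)
  proof (induction w)
    case (Cons y w)
    then show ?case using bs_even_length[OF assms(1), of w] assms
      by (cases y) (auto simp: one bs_act_vertex)
  qed simp
  then show ?thesis using w assms by (simp add: act_class)
qed

lemma incl_closed: "j \<in> I \<Longrightarrow> a \<in> carrier (G j) \<Longrightarrow> free_product_incl I G j a \<in> carrier P"
  using free_product_incl_hom[where I = I and G = G, OF grp] by (auto simp: hom_def)

lemma act_incl:
  assumes "j \<in> I" "a \<in> carrier (G j)" "bs_vertex I G v"
  shows "act (free_product_incl I G j a) v = bs_mul G j a v"
  using act_class[of "[(j, a)]" v] assms by (simp add: free_product_incl_def)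

lemma incl_inj:
  assumes "j \<in> I" "a \<in> carrier (G j)" "b \<in> carrier (G j)" "free_product_incl I G j a = free_product_incl I G j b"
  shows "a = b"
proof -
  interpret group "G j" using grp assms by simp
  have "bs_mul G j a [] = bs_mul G j b []" using act_incl[of j _ "[]"] assms by (metis bs_vertex.simps(1))
  then show ?thesis using assms by (auto simp: bs_mul_def bs_cons_def split: if_splits)
qed

text \<open>An element fixing \<open>[Inl j]\<close> moves the root to a neighbour of that vertex;
  these neighbours are the elements of the factor \<open>j\<close>, and the root has trivial
  stabiliser.\<close>

lemma act_coset_stab:
  assumes x: "x \<in> carrier P" and j: "j \<in> I" and fixd: "act x [Inl j] = [Inl j]"
  shows "\<exists>a\<in>carrier (G j). x = free_product_incl I G j a"
proof -
  interpret group "G j" using grp j by simp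
  let ?v = "act x []"
  have v: "bs_vertex I G ?v" "even (length ?v)" using act_vertex[OF x, of "[]"] act_even[OF x, of "[]"] by auto
  have "tree_dist ?v [Inl j] = tree_dist ([] :: ('i + 'g) list) [Inl j]"
    using act_isometry[OF x, of "[]" "[Inl j]"] fixd j by simp
  also have "\<dots> = 1" by (simp add: tree_dist_def)
  finally have d: "tree_dist [Inl j] ?v = 1" by (simp add: tree_dist_commute)
  from v(1) j have "\<exists>a\<in>carrier (G j). ?v = bs_mul G j a []"
  proof (cases rule: bs_cases)
    case 2
    have "tree_dist [Inl j] (bs_cons G j (bs_coef G j ?v) (bs_rest j ?v)) = 1" unfolding 2(2)[symmetric] by (rule d)
    then have "bs_rest j ?v = []" unfolding tree_dist_bs_cons_root[OF 2(5)] by simp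
    then have "?v = bs_cons G j (bs_coef G j ?v) []" using 2(2) by metis
    then show ?thesis using 2(3) by (intro bexI[of _ "bs_coef G j ?v"]) (simp_all add: bs_mul_def)
  qed (use v in simp)
  then obtain a where a: "a \<in> carrier (G j)" "?v = act (free_product_incl I G j a) []"
    using act_incl[OF j] by (metis bs_vertex.simps(1))
  then show ?thesis using act_root_inj[OF x incl_closed[OF j a(1)]] by blast
qed

lemma bs_vertex_take: "bs_vertex I G v \<Longrightarrow> bs_vertex I G (take n v)"
proof (induction v arbitrary: n rule: bs_word.induct)
  case (1 j a v)
  show ?case
  proof (cases "n < 2")
    case True
    then consider "n = 0" | "n = 1" by linarith
    then show ?thesis using 1(2) by cases auto
  next
    case False
    then obtain m where m: "n = Suc (Suc m)" by (metis Suc_1 less_2_cases_iff not_less old.nat.exhaust not0_implies_Suc One_nat_def)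
    show ?thesis using 1(2) 1(1)[of m] by (cases m; cases v) (auto simp: m)
  qed
next
  case ("2_3" j) then show ?case by (cases n) auto
qed auto

end

section \<open>Invariant sections of the tree\<close>

text \<open>Essential injectivity: a return to the same piece with trivial cocycle value comes from
  the identity. It is stated piecewise because the orbit map of an amplification is injective only
  on pieces.\<close>

locale inj_cocycle = pmp_cocycle M K L \<alpha> \<omega>
  for M :: "'x measure" and K :: "('k, 'a) monoid_scheme" and L :: "('l, 'b) monoid_scheme"
    and \<alpha> :: "'k \<Rightarrow> 'x \<Rightarrow> 'x" and \<omega> :: "'k \<Rightarrow> 'x \<Rightarrow> 'l" +
  fixes \<P> :: "'x set set"
  assumes countable_\<P>: "countable \<P>" and sets_\<P>: "\<P> \<subseteq> sets M" and cover: "AE x in M. x \<in> \<Union>\<P>"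
    and \<omega>_inj: "Z \<in> \<P> \<Longrightarrow> h \<in> carrier K \<Longrightarrow> x \<in> Z \<Longrightarrow> \<alpha> h x \<in> Z \<Longrightarrow> \<omega> h x = \<one>\<^bsub>L\<^esub> \<Longrightarrow> h = \<one>\<^bsub>K\<^esub>"
begin

text \<open>An equivariant section of finite sets would bound the number of returns of an orbit to a set
  of positive measure, which contradicts the invariance of the measure.\<close>

lemma finite_section_empty:
  assumes H: "subgroup H K" "infinite H"
    and F: "\<And>x. F x \<subseteq> carrier L" and fin: "AE x in M. finite (F x)"
    and meas: "\<And>l. l \<in> carrier L \<Longrightarrow> {x \<in> space M. l \<in> F x} \<in> sets M"
    and equi: "\<And>h. h \<in> H \<Longrightarrow> AE x in M. \<forall>l\<in>carrier L. \<omega> h x \<otimes>\<^bsub>L\<^esub> l \<in> F (\<alpha> h x) \<longleftrightarrow> l \<in> F x"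
  shows "AE x in M. F x = {}"
proof (rule ccontr)
  assume ne: "\<not> (AE x in M. F x = {})"
  have HK: "H \<subseteq> carrier K" using H(1) by (rule subgroup.subset)
  define \<A> where "\<A> = {A. finite A \<and> A \<subseteq> carrier L}"
  have cA: "countable \<A>" unfolding \<A>_def by (rule countable_Collect_finite_subset[OF countable_L])
  define W where "W A Z = Z \<inter> {x \<in> space M. F x = A}" for A Z
  have Wm: "W A Z \<in> sets M" if "A \<in> \<A>" "Z \<in> \<P>" for A Z
  proof -
    have "{x \<in> space M. F x = A} = {x \<in> space M. \<forall>l\<in>carrier L. l \<in> F x \<longleftrightarrow> l \<in> A}"
      using F that by (auto simp: \<A>_def)
    also have "\<dots> \<in> sets M"
    proof (rule sets.sets_Collect_countable_All'[OF _ countable_L])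
      fix l assume "l \<in> carrier L"
      then show "{x \<in> space M. (l \<in> F x) = (l \<in> A)} \<in> sets M"
        using meas[of l] sets.sets_Collect_neg[OF meas[of l]] by (cases "l \<in> A") auto
    qed
    finally show ?thesis using that sets_\<P> by (auto simp: W_def)
  qed
  \<comment> \<open>There are only countably many finite subsets and pieces, so some combination
    with nonempty \<open>A\<close> has positive measure.\<close>
  have "\<exists>A\<in>\<A>. \<exists>Z\<in>\<P>. A \<noteq> {} \<and> emeasure M (W A Z) \<noteq> 0"
  proof (rule ccontr)
    assume n: "\<not> ?thesis"
    have z: "W A Z \<in> null_sets M" if "A \<in> \<A>" "A \<noteq> {}" "Z \<in> \<P>" for A Z
    proof (rule null_setsI)
      show "emeasure M (W A Z) = 0" using n that by blast
    qed (use that Wm in blast)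
    have "AE x in M. \<forall>A\<in>\<A>. \<forall>Z\<in>\<P>. A \<noteq> {} \<longrightarrow> x \<notin> W A Z"
      unfolding AE_ball_countable[OF cA] AE_ball_countable[OF countable_\<P>]
      using z by (auto intro: AE_not_in)
    then have "AE x in M. F x = {}"
      using cover fin AE_space
    proof eventually_elim
      case (elim x)
      then obtain Z where "Z \<in> \<P>" "x \<in> Z" by auto
      moreover have "F x \<in> \<A>" using elim F by (simp add: \<A>_def)
      ultimately show ?case using elim(1,4) by (auto simp: W_def)
    qed
    then show False using ne by simp
  qed
  then obtain A Z where AZ: "A \<in> \<A>" "A \<noteq> {}" "Z \<in> \<P>" "emeasure M (W A Z) \<noteq> 0" by blast
  define p where "p = measure M (W A Z)"
  have p: "p > 0" using AZ(4) by (auto simp: p_def emeasure_eq_measure measure_nonneg less_le)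
  obtain hh :: "nat \<Rightarrow> 'k" where hh: "inj hh" "range hh \<subseteq> H"
    using infinite_countable_subset[OF H(2)] by blast
  then have hK: "hh i \<in> carrier K" "hh i \<in> H" for i using HK by auto
  have bound: "AE x in M. (\<Sum>i<m. indicator (W A Z) (\<alpha> (hh i) x)) \<le> real (card A)" for m :: nat
  proof -
    have "AE x in M. \<forall>i. \<forall>l\<in>carrier L. \<omega> (hh i) x \<otimes>\<^bsub>L\<^esub> l \<in> F (\<alpha> (hh i) x) \<longleftrightarrow> l \<in> F x"
      unfolding AE_all_countable using equi hK by blast
    then show ?thesis using AE_space
    proof eventually_elim
      case (elim x)
      define S where "S = {i. i < m \<and> \<alpha> (hh i) x \<in> W A Z}"
      have "(\<Sum>i<m. indicator (W A Z) (\<alpha> (hh i) x)) = (\<Sum>i\<in>S. 1::real)"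
        by (intro sum.mono_neutral_cong_right) (auto simp: S_def indicator_def)
      then have eq: "(\<Sum>i<m. indicator (W A Z) (\<alpha> (hh i) x)) = real (card S)" by simp
      have "card S \<le> card A"
      proof (cases "S = {}")
        case False
        then obtain i0 where i0: "i0 \<in> S" by auto
        obtain a where a: "a \<in> A" using AZ by auto
        have w: "\<omega> (hh i) x \<in> carrier L" for i using hK elim \<omega>_closed by auto
        have aL: "a \<in> carrier L" using a AZ by (auto simp: \<A>_def)
        \<comment> \<open>The fibre point that the return number \<open>i0\<close> carries to
          \<open>a\<close>. Every other return carries it into \<open>A\<close> as well, and
          injectivity of the cocycle on \<open>Z\<close> keeps these values apart.\<close>
        define l where "l = inv\<^bsub>L\<^esub> (\<omega> (hh i0) x) \<otimes>\<^bsub>L\<^esub> a"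
        have l: "l \<in> carrier L" using w aL by (simp add: l_def)
        have "\<omega> (hh i0) x \<otimes>\<^bsub>L\<^esub> l = a" using w aL by (simp add: l_def L.m_assoc[symmetric])
        then have lF: "l \<in> F x" using elim(1) l i0 a by (auto simp: S_def W_def)
        have im: "\<omega> (hh i) x \<otimes>\<^bsub>L\<^esub> l \<in> A" if "i \<in> S" for i
          using elim(1) l lF that by (auto simp: S_def W_def)
        have "inj_on (\<lambda>i. \<omega> (hh i) x \<otimes>\<^bsub>L\<^esub> l) S"
        proof (rule inj_onI)
          fix i j assume ij: "i \<in> S" "j \<in> S" "\<omega> (hh i) x \<otimes>\<^bsub>L\<^esub> l = \<omega> (hh j) x \<otimes>\<^bsub>L\<^esub> l"
          then have weq: "\<omega> (hh i) x = \<omega> (hh j) x" using w l by simp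
          let ?h = "hh j \<otimes>\<^bsub>K\<^esub> inv\<^bsub>K\<^esub> (hh i)" and ?y = "\<alpha> (hh i) x"
          have y: "?y \<in> space M" using hK elim by (simp add: \<alpha>_space)
          have e: "?h \<otimes>\<^bsub>K\<^esub> hh i = hh j" using hK by (simp add: K.m_assoc)
          have hc: "?h \<in> carrier K" using hK by simp
          have ay: "\<alpha> ?h ?y = \<alpha> (hh j) x" using \<alpha>_mult[OF hc hK(1)[of i] elim(2)] e by simp
          have "\<omega> (hh j) x = \<omega> ?h ?y \<otimes>\<^bsub>L\<^esub> \<omega> (hh i) x"
            using \<omega>_mult[OF hc hK(1)[of i] elim(2)] e by simp
          then have "\<omega> ?h ?y \<otimes>\<^bsub>L\<^esub> \<omega> (hh j) x = \<omega> (hh j) x" using weq by simp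
          then have "\<omega> ?h ?y = \<one>\<^bsub>L\<^esub>" using w[of j] \<omega>_closed[OF hc y] by (simp add: L.r_cancel_one')
          then have "?h = \<one>\<^bsub>K\<^esub>"
            by (intro \<omega>_inj[OF AZ(3) hc, of ?y]) (use ij ay in \<open>auto simp: S_def W_def\<close>)
          then have "hh j = hh i" using e hK by simp
          then show "i = j" using hh(1) by (simp add: inj_eq)
        qed
        then show ?thesis
          by (rule card_inj_on_le) (use im AZ in \<open>auto simp: \<A>_def\<close>)
      qed simp
      then show ?case using eq by simp
    qed
  qed
  \<comment> \<open>Integrating the bound: by invariance of the measure each of the \<open>m\<close>
    visits has probability \<open>p\<close>.\<close>
  have "real m * p \<le> real (card A)" for m :: nat
  proof -
    have ind: "integrable M (\<lambda>x. indicator (W A Z) (\<alpha> (hh i) x) :: real)"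
        "(\<integral>x. indicator (W A Z) (\<alpha> (hh i) x) \<partial>M) = p" for i
    proof -
      note am = \<alpha>_measurable[OF hK(1)[of i]]
      have im: "(indicator (W A Z) :: 'x \<Rightarrow> real) \<in> borel_measurable M"
        using Wm[OF AZ(1,3)] by simp
      show "integrable M (\<lambda>x. indicator (W A Z) (\<alpha> (hh i) x) :: real)"
        by (rule integrable_const_bound[of _ 1]) (use measurable_compose[OF am im] in \<open>auto simp: indicator_def\<close>)
      have "(\<integral>x. (indicator (W A Z) (\<alpha> (hh i) x) :: real) \<partial>M) = (\<integral>x. indicator (W A Z) x \<partial>(distr M M (\<alpha> (hh i))))"
        by (rule integral_distr[OF am im, symmetric])
      also have "\<dots> = p" using Wm[OF AZ(1,3)] by (simp add: \<alpha>_distr[OF hK(1)] p_def)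
      finally show "(\<integral>x. indicator (W A Z) (\<alpha> (hh i) x) \<partial>M) = p" .
    qed
    have "(\<integral>x. (\<Sum>i<m. indicator (W A Z) (\<alpha> (hh i) x)) \<partial>M) \<le> (\<integral>x. real (card A) \<partial>M)"
      by (rule integral_mono_AE[OF _ _ bound]) (auto intro: ind)
    then show ?thesis by (simp add: ind prob_space)
  qed
  then show False using reals_Archimedean3[OF p] by (metis not_le)
qed

text \<open>Superlevel sets of Haagerup functions are finite, so property (T) would produce a finite
  equivariant section that is not almost everywhere empty.\<close>

lemma no_haagerup_target:
  assumes H: "subgroup H K" "infinite H" "relative_property_T K H"
    and haag: "haagerup_property L"
  shows False
proof -
  obtain \<phi> :: "nat \<Rightarrow> 'l \<Rightarrow> complex" where \<phi>: "\<And>k. positive_definite L (\<phi> k)" "\<And>k. \<phi> k \<one>\<^bsub>L\<^esub> = 1"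
      "\<And>k \<epsilon>. \<epsilon> > 0 \<Longrightarrow> finite {g \<in> carrier L. cmod (\<phi> k g) \<ge> \<epsilon>}"
      "\<And>g. g \<in> carrier L \<Longrightarrow> (\<lambda>k. \<phi> k g) \<longlonglongrightarrow> 1"
    using haag unfolding haagerup_property_def by auto
  have lim: "AE x in M. (\<lambda>n. \<phi> n (\<omega> g x)) \<longlonglongrightarrow> 1" if "g \<in> carrier K" for g
    using \<omega>_closed[OF that] by (intro AE_I2 \<phi>(4))
  show False
  proof (rule relative_T_invariant_sets[OF H(3,1) \<phi>(1,2) lim])
    fix n and B :: "'x \<Rightarrow> 'l set"
    assume B: "\<And>x. B x \<subseteq> carrier L"
      "\<And>l. l \<in> carrier L \<Longrightarrow> {x \<in> space M. l \<in> B x} \<in> sets M"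
      "\<And>h. h \<in> H \<Longrightarrow> AE x in M. \<forall>l\<in>carrier L. \<omega> h x \<otimes>\<^bsub>L\<^esub> l \<in> B (\<alpha> h x) \<longleftrightarrow> l \<in> B x"
      "AE x in M. \<exists>\<delta>>0. \<exists>A. finite A \<and> A \<subseteq> carrier L \<and>
        B x \<subseteq> {l. \<exists>a\<in>A. cmod (\<phi> n (inv\<^bsub>L\<^esub> l \<otimes>\<^bsub>L\<^esub> a)) > \<delta>}"
      "\<not> (AE x in M. B x = {})"
    have "AE x in M. finite (B x)" using B(4)
    proof eventually_elim
      case (elim x)
      then obtain \<delta> A where A: "\<delta> > 0" "finite A" "A \<subseteq> carrier L"
        "B x \<subseteq> {l. \<exists>a\<in>A. cmod (\<phi> n (inv\<^bsub>L\<^esub> l \<otimes>\<^bsub>L\<^esub> a)) > \<delta>}" by blast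
      define T where "T = {g \<in> carrier L. cmod (\<phi> n g) \<ge> \<delta>}"
      have "B x \<subseteq> (\<lambda>(a, g). a \<otimes>\<^bsub>L\<^esub> inv\<^bsub>L\<^esub> g) ` (A \<times> T)"
      proof
        fix l assume l: "l \<in> B x"
        then obtain a where a: "a \<in> A" "cmod (\<phi> n (inv\<^bsub>L\<^esub> l \<otimes>\<^bsub>L\<^esub> a)) > \<delta>" using A by auto
        have lL: "l \<in> carrier L" "a \<in> carrier L" using l B(1) a A by auto
        have "l = a \<otimes>\<^bsub>L\<^esub> inv\<^bsub>L\<^esub> (inv\<^bsub>L\<^esub> l \<otimes>\<^bsub>L\<^esub> a)"
          using lL by (simp add: L.inv_mult_group L.m_assoc[symmetric])
        moreover have "inv\<^bsub>L\<^esub> l \<otimes>\<^bsub>L\<^esub> a \<in> T" using a lL by (simp add: T_def)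
        ultimately show "l \<in> (\<lambda>(a, g). a \<otimes>\<^bsub>L\<^esub> inv\<^bsub>L\<^esub> g) ` (A \<times> T)" using a(1) by force
      qed
      moreover have "finite T" unfolding T_def by (rule \<phi>(3)[OF A(1)])
      ultimately show ?case using A(2) by (meson finite_SigmaI finite_imageI finite_subset)
    qed
    then have "AE x in M. B x = {}" by (rule finite_section_empty[OF H(1,2) B(1) _ B(2,3)])
    then show False using B(5) by simp
  qed
qed

end

text \<open>Each entry is a sum over the common prefixes of the two words, so the form becomes a sum
  of squared moduli of the \<open>z p\<close>, with nonnegative weights that depend on the length of
  the prefix.\<close>

lemma psd_tree_kernel:
  fixes r :: real
  assumes r: "0 < r" "r \<le> 1"
  shows "psd_on UNIV (\<lambda>u v. complex_of_real (r ^ tree_dist u v))"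
  unfolding psd_on_def
proof (intro allI impI, elim conjE)
  fix F :: "'a list set" and c :: "'a list \<Rightarrow> complex" assume F: "finite F"
  define q where "q = (1 / r)\<^sup>2"
  have q: "q \<ge> 1" unfolding q_def using r by (intro one_le_power) simp
  \<comment> \<open>The weights telescope: those of all prefixes of a word of length
    \<open>m\<close> add up to \<open>q ^ m\<close>, which compensates the factor
    \<open>r ^ (2 * m)\<close>. They are nonnegative since \<open>q \<ge> 1\<close>.\<close>
  define a where "a k = (case k of 0 \<Rightarrow> 1 | Suc m \<Rightarrow> q ^ Suc m - q ^ m)" for k :: nat
  have a0: "a k \<ge> 0" for k using q by (auto simp: a_def mult_le_cancel_right1 split: nat.split)
  have asum: "(\<Sum>k\<le>m. a k) = q ^ m" for m by (induction m) (auto simp: a_def)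
  define pre where "pre = (\<Union>u\<in>F. set (prefixes u))"
  have pre: "finite pre" using F by (simp add: pre_def)
  define z where "z p = (\<Sum>u\<in>F. if prefix p u then c u * of_real (r ^ length u) else 0)" for p
  have ker: "r ^ tree_dist u v = (\<Sum>p\<in>pre. a (length p) * (if prefix p u then r ^ length u else 0) * (if prefix p v then r ^ length v else 0))"
    if "u \<in> F" "v \<in> F" for u v
  proof -
    let ?w = "longest_common_prefix u v"
    have ww: "prefix p u \<and> prefix p v \<longleftrightarrow> prefix p ?w" for p
      by (meson longest_common_prefix_max_prefix longest_common_prefix_prefix1 longest_common_prefix_prefix2 prefix_order.trans)
    have tp: "take (length p) ?w = p" if "prefix p ?w" for p using that by (auto simp: prefix_def)
    have "(\<Sum>p\<in>pre. a (length p) * (if prefix p u then r ^ length u else 0) * (if prefix p v then r ^ length v else 0))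
       = (\<Sum>p\<in>{p. prefix p ?w}. a (length p) * (r ^ length u * r ^ length v))"
      using pre that by (intro sum.mono_neutral_cong_right) (auto simp: ww[symmetric] pre_def)
    also have "\<dots> = (\<Sum>k\<le>length ?w. a k * (r ^ length u * r ^ length v))"
      by (rule sum.reindex_bij_witness[of _ "\<lambda>k. take k ?w" length])
        (auto simp: take_is_prefix prefix_length_le tp)
    also have "\<dots> = q ^ length ?w * (r ^ length u * r ^ length v)"
      by (simp add: sum_distrib_right[symmetric] asum)
    also have "\<dots> = r ^ tree_dist u v"
    proof -
      have "length u + length v = tree_dist u v + 2 * length ?w"
        using lcp_le[of u v] by (simp add: tree_dist_def)
      then have "r ^ length u * r ^ length v = r ^ tree_dist u v * (r ^ 2) ^ length ?w"
        by (simp add: power_add[symmetric] power_mult[symmetric])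
      moreover have "q ^ length ?w * (r ^ 2) ^ length ?w = 1"
        unfolding power_mult_distrib[symmetric] q_def using r by (simp add: field_simps)
      ultimately show ?thesis by (simp add: mult_ac)
    qed
    finally show ?thesis by simp
  qed
  have "(\<Sum>u\<in>F. \<Sum>v\<in>F. cnj (c u) * c v * complex_of_real (r ^ tree_dist u v))
    = (\<Sum>u\<in>F. \<Sum>v\<in>F. \<Sum>p\<in>pre. of_real (a (length p)) *
        cnj (if prefix p u then c u * of_real (r ^ length u) else 0) * (if prefix p v then c v * of_real (r ^ length v) else 0))"
    by (intro sum.cong HOL.refl, subst ker, assumption+, unfold of_real_sum sum_distrib_left, intro sum.cong HOL.refl)
      (simp add: mult_ac)
  also have "\<dots> = (\<Sum>u\<in>F. \<Sum>p\<in>pre. \<Sum>v\<in>F. of_real (a (length p)) *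
        cnj (if prefix p u then c u * of_real (r ^ length u) else 0) * (if prefix p v then c v * of_real (r ^ length v) else 0))"
    by (intro sum.cong HOL.refl sum.swap)
  also have "\<dots> = (\<Sum>p\<in>pre. \<Sum>u\<in>F. \<Sum>v\<in>F. of_real (a (length p)) *
        cnj (if prefix p u then c u * of_real (r ^ length u) else 0) * (if prefix p v then c v * of_real (r ^ length v) else 0))"
    by (rule sum.swap)
  also have "\<dots> = (\<Sum>p\<in>pre. of_real (a (length p)) * (cnj (z p) * z p))"
    unfolding z_def cnj_sum sum_product by (intro sum.cong HOL.refl) (simp add: sum_distrib_left mult.assoc)
  also have "\<dots> = of_real (\<Sum>p\<in>pre. a (length p) * (cmod (z p))\<^sup>2)"
    unfolding of_real_sum of_real_mult complex_norm_square by (simp add: mult.commute)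
  also have "\<dots> \<in> \<real>\<^sub>\<ge>\<^sub>0" by (subst nonneg_Reals_of_real_iff, intro sum_nonneg mult_nonneg_nonneg a0 zero_le_power2)
  finally show "(\<Sum>u\<in>F. \<Sum>v\<in>F. cnj (c u) * c v * complex_of_real (r ^ tree_dist u v)) \<in> \<real>\<^sub>\<ge>\<^sub>0" .
qed

lemma finite_at_most_one: "(\<And>x y. x \<in> A \<Longrightarrow> y \<in> A \<Longrightarrow> y = x) \<Longrightarrow> finite A"
  by (cases "A = {}") (blast, metis finite.simps finite_subset insertCI subsetI ex_in_conv singleton_iff)

lemma bs_vertex_lists: "bs_vertex I G v \<Longrightarrow> v \<in> lists (Inl ` I \<union> Inr ` (\<Union>i\<in>I. carrier (G i)))"
  by (induction I G v rule: bs_vertex.induct) auto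

context group_family
begin

lemma carrier_P_one: "\<one>\<^bsub>P\<^esub> \<in> carrier P"
  using group.is_monoid[OF group_P] by (rule monoid.one_closed)

lemma act_inv:
  assumes "g \<in> carrier P" "bs_vertex I G v"
  shows "act (inv\<^bsub>P\<^esub> g) (act g v) = v" "act g (act (inv\<^bsub>P\<^esub> g) v) = v"
proof -
  interpret Pg: group P by (rule group_P)
  show "act (inv\<^bsub>P\<^esub> g) (act g v) = v" "act g (act (inv\<^bsub>P\<^esub> g) v) = v"
    using assms by (simp_all add: act_mult[symmetric] act_one)
qed

lemma act_inj:
  assumes "g \<in> carrier P" "bs_vertex I G v" "bs_vertex I G w"
  shows "act g v = act g w \<longleftrightarrow> v = w"
  using act_inv(1)[OF assms(1,2)] act_inv(1)[OF assms(1,3)] by metis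

lemma tree_dist_act_inv:
  assumes "g \<in> carrier P" "h \<in> carrier P"
  shows "tree_dist [] (act (inv\<^bsub>P\<^esub> g \<otimes>\<^bsub>P\<^esub> h) []) = tree_dist (act g []) (act h [])"
proof -
  interpret Pg: group P by (rule group_P)
  have "tree_dist [] (act (inv\<^bsub>P\<^esub> g \<otimes>\<^bsub>P\<^esub> h) []) = tree_dist (act g []) (act g (act (inv\<^bsub>P\<^esub> g \<otimes>\<^bsub>P\<^esub> h) []))"
    by (rule act_isometry[symmetric]) (use assms act_vertex in auto)
  also have "act g (act (inv\<^bsub>P\<^esub> g \<otimes>\<^bsub>P\<^esub> h) []) = act h []"
    using assms by (simp add: act_mult act_vertex act_inv)
  finally show ?thesis .
qed

lemma positive_definite_tree:
  assumes r: "0 < r" "r \<le> 1"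
  shows "positive_definite P (\<lambda>l. complex_of_real (r ^ tree_dist [] (act l [])))"
proof -
  have "psd_on (carrier P) (\<lambda>g h. complex_of_real (r ^ tree_dist (act g []) (act h [])))"
    by (rule psd_on_pullback[OF psd_tree_kernel[OF r], of "\<lambda>g. act g []"]) simp
  then have p: "(\<Sum>g\<in>F. \<Sum>h\<in>F. cnj (c g) * c h * complex_of_real (r ^ tree_dist (act g []) (act h []))) \<in> \<real>\<^sub>\<ge>\<^sub>0"
    if "finite F \<and> F \<subseteq> carrier P" for F c using that unfolding psd_on_def by blast
  show ?thesis
    unfolding positive_definite_def
  proof (intro allI impI)
    fix F c assume F: "finite F \<and> F \<subseteq> carrier P"
    have "(\<Sum>g\<in>F. \<Sum>h\<in>F. cnj (c g) * c h * complex_of_real (r ^ tree_dist [] (act (inv\<^bsub>P\<^esub> g \<otimes>\<^bsub>P\<^esub> h) [])))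
      = (\<Sum>g\<in>F. \<Sum>h\<in>F. cnj (c g) * c h * complex_of_real (r ^ tree_dist (act g []) (act h [])))"
      using F by (intro sum.cong HOL.refl) (simp add: tree_dist_act_inv subset_iff)
    then show "(\<Sum>g\<in>F. \<Sum>h\<in>F. cnj (c g) * c h * complex_of_real (r ^ tree_dist [] (act (inv\<^bsub>P\<^esub> g \<otimes>\<^bsub>P\<^esub> h) []))) \<in> \<real>\<^sub>\<ge>\<^sub>0"
      using p[OF F] by simp
  qed
qed

lemma is_center_image:
  assumes g: "g \<in> carrier P" and B: "B \<subseteq> V" and v: "v \<in> V"
  shows "is_center (act g ` B) (act g v) \<longleftrightarrow> is_center B v"
proof -
  have B': "bs_vertex I G b" if "b \<in> B" for b using B that by auto
  have "(\<forall>b\<in>act g ` B. tree_dist (act g v) b \<le> R) \<longleftrightarrow> (\<forall>b\<in>B. tree_dist v b \<le> R)" for R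
    using g v B' by (auto simp: act_isometry)
  moreover have "(\<exists>p\<in>act g ` B. \<exists>q\<in>act g ` B. tree_dist p q = 2 * R) \<longleftrightarrow> (\<exists>p\<in>B. \<exists>q\<in>B. tree_dist p q = 2 * R)" for R
    using g B' by (auto simp: act_isometry)
  ultimately show ?thesis unfolding is_center_def by simp
qed

lemma countable_V:
  assumes "countable I" "\<And>i. i \<in> I \<Longrightarrow> countable (carrier (G i))"
  shows "countable V"
proof -
  let ?S = "Inl ` I \<union> Inr ` (\<Union>i\<in>I. carrier (G i))"
  have "V \<subseteq> lists ?S" using bs_vertex_lists by blast
  moreover have "countable (lists ?S)" using assms by (intro countable_lists countable_Un countable_image countable_UN) auto
  ultimately show ?thesis by (rule countable_subset)
qed

end

section \<open>Equivariant sections of vertices\<close>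

locale tree_cocycle = group_family I G + inj_cocycle M K "free_product I G" \<alpha> \<omega> \<P>
  for I :: "'i set" and G :: "'i \<Rightarrow> 'g monoid" and M :: "'x measure" and K :: "('k, 'a) monoid_scheme"
    and \<alpha> :: "'k \<Rightarrow> 'x \<Rightarrow> 'x" and \<omega> :: "'k \<Rightarrow> 'x \<Rightarrow> ('i \<times> 'g) list set" and \<P> :: "'x set set" +
  assumes countable_I: "countable I" and countable_G: "\<And>i. i \<in> I \<Longrightarrow> countable (carrier (G i))"
begin

lemma cV: "countable V" by (rule countable_V[OF countable_I countable_G])

text \<open>\<open>None\<close> marks points where no vertex is selected. As there are countably
  many vertices, measurability is tested at one vertex at a time.\<close>

definition msec :: "('x \<Rightarrow> ('i + 'g) list option) \<Rightarrow> bool" where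
  "msec s \<longleftrightarrow> (\<forall>x v. s x = Some v \<longrightarrow> v \<in> V) \<and> (\<forall>v\<in>V. {x \<in> space M. s x = Some v} \<in> sets M)"

definition esec :: "'k set \<Rightarrow> ('x \<Rightarrow> ('i + 'g) list option) \<Rightarrow> bool" where
  "esec H s \<longleftrightarrow> (\<forall>h\<in>H. AE x in M. s (\<alpha> h x) = map_option (act (\<omega> h x)) (s x))"

lemma msec_vertex: "msec s \<Longrightarrow> s x = Some v \<Longrightarrow> bs_vertex I G v"
  by (auto simp: msec_def)

lemma esec_iff:
  assumes "msec s" "s (\<alpha> h x) = map_option (act (\<omega> h x)) (s x)" "h \<in> carrier K" "x \<in> space M" "bs_vertex I G v"
  shows "s (\<alpha> h x) = Some (act (\<omega> h x) v) \<longleftrightarrow> s x = Some v"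
  using assms msec_vertex[OF assms(1)] by (auto simp: act_inj \<omega>_closed)

text \<open>A vertex of even depth is a single group element, and an equivariant choice of such
  vertices would be a finite section.\<close>

lemma odd_section:
  assumes H: "subgroup H K" "infinite H" and s: "msec s" "esec H s"
  shows "AE x in M. \<forall>v. s x = Some v \<longrightarrow> odd (length v)"
proof -
  have HK: "H \<subseteq> carrier K" using H(1) by (rule subgroup.subset)
  define F where "F x = {l \<in> carrier P. s x = Some (act l [])}" for x
  have "AE x in M. F x = {}"
  proof (rule finite_section_empty[OF H])
    show "F x \<subseteq> carrier P" for x by (auto simp: F_def)
    have "l' = l" if "l \<in> F x" "l' \<in> F x" for x l l'
      by (rule act_root_inj) (use that in \<open>auto simp: F_def\<close>)
    then have "finite (F x)" for x by (rule finite_at_most_one)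
    then show "AE x in M. finite (F x)" by simp
    show "{x \<in> space M. l \<in> F x} \<in> sets M" if "l \<in> carrier P" for l
      using s(1) that act_vertex[OF that, of "[]"] by (simp add: F_def msec_def)
    show "AE x in M. \<forall>l\<in>carrier P. \<omega> h x \<otimes>\<^bsub>P\<^esub> l \<in> F (\<alpha> h x) \<longleftrightarrow> l \<in> F x" if h: "h \<in> H" for h
    proof -
      have "AE x in M. s (\<alpha> h x) = map_option (act (\<omega> h x)) (s x)" using s(2) h by (auto simp: esec_def)
      then show ?thesis using AE_space
      proof eventually_elim
        case (elim x)
        have hK: "h \<in> carrier K" using h HK by auto
        show ?case
        proof
          fix l assume l: "l \<in> carrier P"
          show "\<omega> h x \<otimes>\<^bsub>P\<^esub> l \<in> F (\<alpha> h x) \<longleftrightarrow> l \<in> F x"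
            using esec_iff[OF s(1) elim(1) hK elim(2), of "act l []"] l \<omega>_closed[OF hK elim(2)]
            by (simp add: F_def act_mult act_vertex)
        qed
      qed
    qed
  qed
  then show ?thesis
  proof eventually_elim
    case (elim x)
    show ?case
    proof (intro allI impI, rule ccontr)
      fix v assume v: "s x = Some v" "\<not> odd (length v)"
      then have "elt v \<in> F x" using msec_vertex[OF s(1) v(1)] by (simp add: F_def elt_closed act_elt)
      then show False using elim by simp
    qed
  qed
qed

text \<open>If two equivariant sections differed, the second vertex of the geodesic between them would
  be an equivariant section of vertices with trivial stabiliser.\<close>

lemma section_unique:
  assumes H: "subgroup H K" "infinite H" and s: "msec s" "esec H s" and t: "msec t" "esec H t"
  shows "AE x in M. \<forall>v w. s x = Some v \<longrightarrow> t x = Some w \<longrightarrow> v = w"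
proof -
  have HK: "H \<subseteq> carrier K" using H(1) by (rule subgroup.subset)
  \<comment> \<open>\<open>l\<close> is the neighbour of \<open>v\<close> on the geodesic to
    \<open>w\<close>; where \<open>v\<close> is a coset vertex that neighbour is a group
    element.\<close>
  define Q where "Q v w l \<longleftrightarrow> v \<noteq> w \<and> tree_dist v (act l []) = 1 \<and> tree_dist (act l []) w = tree_dist v w - 1" for v w l
  define F where "F x = {l \<in> carrier P. \<exists>v w. s x = Some v \<and> t x = Some w \<and> Q v w l}" for x
  have Q1: "1 \<le> tree_dist v w" if "Q v w l" for v w l
  proof (cases "tree_dist v w")
    case 0
    then show ?thesis using that tree_dist_eq_0[of v w] by (simp add: Q_def)
  qed simp
  have Qact: "Q (act g v) (act g w) (g \<otimes>\<^bsub>P\<^esub> l) \<longleftrightarrow> Q v w l"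
    if "g \<in> carrier P" "l \<in> carrier P" "bs_vertex I G v" "bs_vertex I G w" for g l v w
    using that by (simp add: Q_def act_mult act_inj act_isometry act_vertex)
  have "AE x in M. F x = {}"
  proof (rule finite_section_empty[OF H])
    show "F x \<subseteq> carrier P" for x by (auto simp: F_def)
    have one: "l' = l" if l: "l \<in> F x" "l' \<in> F x" for x l l'
    proof -
      obtain v w where vw: "s x = Some v" "t x = Some w" "Q v w l" "Q v w l'" using l by (auto simp: F_def)
      have "act l [] = act l' []"
        by (rule geodesic_point_unique[of v _ 1 w]) (use vw Q1 in \<open>auto simp: Q_def\<close>)
      then show ?thesis by (intro act_root_inj) (use l in \<open>auto simp: F_def\<close>)
    qed
    then have "finite (F x)" for x by (rule finite_at_most_one)
    then show "AE x in M. finite (F x)" by simp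
    show "{x \<in> space M. l \<in> F x} \<in> sets M" if "l \<in> carrier P" for l
    proof -
      have "{x \<in> space M. l \<in> F x} = (\<Union>v\<in>V. \<Union>w\<in>V.
          if Q v w l then {x \<in> space M. s x = Some v} \<inter> {x \<in> space M. t x = Some w} else {})"
        using that msec_vertex[OF s(1)] msec_vertex[OF t(1)] by (auto simp: F_def split: if_splits)
      also have "\<dots> \<in> sets M"
      proof (intro sets.countable_UN' cV image_subsetI)
        fix v w assume "v \<in> V" "w \<in> V"
        then have "{x \<in> space M. s x = Some v} \<in> sets M" "{x \<in> space M. t x = Some w} \<in> sets M"
          using s(1) t(1) by (auto simp: msec_def)
        then show "(if Q v w l then {x \<in> space M. s x = Some v} \<inter> {x \<in> space M. t x = Some w} else {}) \<in> sets M"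
          by auto
      qed
      finally show ?thesis .
    qed
    show "AE x in M. \<forall>l\<in>carrier P. \<omega> h x \<otimes>\<^bsub>P\<^esub> l \<in> F (\<alpha> h x) \<longleftrightarrow> l \<in> F x" if h: "h \<in> H" for h
    proof -
      have "AE x in M. s (\<alpha> h x) = map_option (act (\<omega> h x)) (s x)" "AE x in M. t (\<alpha> h x) = map_option (act (\<omega> h x)) (t x)"
        using s(2) t(2) h by (auto simp: esec_def)
      then show ?thesis using AE_space
      proof eventually_elim
        case (elim x)
        have hK: "h \<in> carrier K" using h HK by auto
        note w = \<omega>_closed[OF hK elim(3)]
        show ?case
        proof
          fix l assume l: "l \<in> carrier P"
          have "\<omega> h x \<otimes>\<^bsub>P\<^esub> l \<in> carrier P"
            using w l group.is_monoid[OF group_P] by (rule monoid.m_closed[rotated])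
          then show "\<omega> h x \<otimes>\<^bsub>P\<^esub> l \<in> F (\<alpha> h x) \<longleftrightarrow> l \<in> F x"
            using elim(1,2) l Qact[OF w l] msec_vertex[OF s(1)] msec_vertex[OF t(1)]
            by (auto simp: F_def)
        qed
      qed
    qed
  qed
  then show ?thesis using odd_section[OF H s] odd_section[OF H t]
  proof eventually_elim
    case (elim x)
    show ?case
    proof (intro allI impI, rule ccontr)
      fix v w assume vw: "s x = Some v" "t x = Some w" "v \<noteq> w"
      have V: "v \<in> V" "w \<in> V" using msec_vertex[OF s(1) vw(1)] msec_vertex[OF t(1) vw(2)] by auto
      have od: "odd (length v)" using elim(2) vw by auto
      have "1 \<le> tree_dist v w" using vw(3) tree_dist_eq_0[of v w] by (cases "tree_dist v w") auto
      then obtain e where e: "e \<in> V" "tree_dist v e = 1" "tree_dist e w = tree_dist v w - 1"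
        using geodesic_point[of V v w 1] V bs_vertex_take by blast
      have "even (length e)"
      proof (rule ccontr)
        assume "odd (length e)"
        then have "even (int (tree_dist v e))" unfolding int_tree_dist using od by simp
        then show False using e by simp
      qed
      then have "elt e \<in> F x" using e vw by (auto simp: F_def Q_def elt_closed act_elt)
      then show False using elim(1) by simp
    qed
  qed
qed

end

context tree_cocycle
begin

lemma act_mult_incl_root:
  assumes "j \<in> I" "l \<in> carrier P" "b \<in> carrier (G j)"
  shows "act (l \<otimes>\<^bsub>P\<^esub> free_product_incl I G j b) [Inl j] = act l [Inl j]"
  using assms by (simp add: act_mult incl_closed act_incl)

lemma msec_measurable:
  assumes "msec s"
  shows "s \<in> measurable M (count_space (insert None (Some ` V)))"
proof -
  have c: "countable (insert None (Some ` V))" using cV by auto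
  have sv: "s -` {Some v} \<inter> space M \<in> sets M" if "v \<in> V" for v
  proof -
    have "s -` {Some v} \<inter> space M = {x \<in> space M. s x = Some v}" by auto
    then show ?thesis using assms that by (simp add: msec_def)
  qed
  have "s -` {None} \<inter> space M = space M - (\<Union>v\<in>V. s -` {Some v} \<inter> space M)"
    using msec_vertex[OF assms] by (auto, metis option.exhaust)
  also have "\<dots> \<in> sets M" using sv cV by (intro sets.compl_sets sets.countable_UN') auto
  finally have "s -` {None} \<inter> space M \<in> sets M" .
  then show ?thesis unfolding measurable_count_space_eq_countable[OF c]
    using sv msec_vertex[OF assms] by (auto, metis image_eqI mem_Collect_eq option.exhaust)
qed

text \<open>Group elements sit at the vertices of even depth, and a superlevel set of
  \<open>r\<close> to the power of the distance is bounded. The centre of a set is determined by the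
  set, so equivariance passes from the sets to their centres.\<close>

lemma bounded_section_exists:
  assumes H: "subgroup H K" "relative_property_T K H"
  obtains s where "msec s" "esec H s" "\<not> (AE x in M. s x = None)"
proof -
  have HK: "H \<subseteq> carrier K" using H(1) by (rule subgroup.subset)
  \<comment> \<open>Strictly between zero and one already at \<open>k = 0\<close>, and tending to
    one.\<close>
  define r where "r k = 1 - inverse (real (Suc (Suc k)))" for k
  have r: "0 < r k" "r k < 1" for k by (auto simp: r_def field_simps)
  have "(\<lambda>k. inverse (real (Suc (Suc k)))) \<longlonglongrightarrow> 0"
    using LIMSEQ_Suc[OF LIMSEQ_inverse_real_of_nat] by simp
  then have "r \<longlonglongrightarrow> 1 - 0" unfolding r_def by (intro tendsto_intros)
  then have rl: "r \<longlonglongrightarrow> 1" by simp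
  define \<psi> where "\<psi> k l = complex_of_real (r k ^ tree_dist [] (act l []))" for k l
  have pd: "positive_definite P (\<psi> k)" for k unfolding \<psi>_def by (rule positive_definite_tree) (use r[of k] in auto)
  have one: "\<psi> k \<one>\<^bsub>P\<^esub> = 1" for k by (simp add: \<psi>_def act_one)
  have "(\<lambda>k. \<psi> k l) \<longlonglongrightarrow> of_real (1 ^ tree_dist [] (act l []))" for l
    unfolding \<psi>_def by (intro tendsto_intros rl)
  then have lim: "AE x in M. (\<lambda>n. \<psi> n (\<omega> g x)) \<longlonglongrightarrow> 1" for g by simp
  show thesis
  proof (rule relative_T_invariant_sets[OF H(2,1) pd one lim])
    fix n and B :: "'x \<Rightarrow> ('i \<times> 'g) list set set"
    assume B: "\<And>x. B x \<subseteq> carrier P"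
      "\<And>l. l \<in> carrier P \<Longrightarrow> {x \<in> space M. l \<in> B x} \<in> sets M"
      "\<And>h. h \<in> H \<Longrightarrow> AE x in M. \<forall>l\<in>carrier P. \<omega> h x \<otimes>\<^bsub>P\<^esub> l \<in> B (\<alpha> h x) \<longleftrightarrow> l \<in> B x"
      "AE x in M. \<exists>\<delta>>0. \<exists>A. finite A \<and> A \<subseteq> carrier P \<and>
        B x \<subseteq> {l. \<exists>a\<in>A. cmod (\<psi> n (inv\<^bsub>P\<^esub> l \<otimes>\<^bsub>P\<^esub> a)) > \<delta>}"
      "\<not> (AE x in M. B x = {})"
    define Bv where "Bv x = (\<lambda>l. act l []) ` B x" for x
    have BvV: "Bv x \<subseteq> V" for x unfolding Bv_def
    proof (intro image_subsetI)
      fix l assume "l \<in> B x"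
      then have "l \<in> carrier P" using B(1) by blast
      then show "act l [] \<in> V" using act_vertex[of l "[]"] by simp
    qed
    define s where "s x = (if \<exists>m\<in>V. is_center (Bv x) m then Some (SOME m. m \<in> V \<and> is_center (Bv x) m) else None)" for x
    have s_iff: "s x = Some v \<longleftrightarrow> v \<in> V \<and> is_center (Bv x) v" for x v
    proof
      assume "s x = Some v"
      then have ex: "\<exists>m. m \<in> V \<and> is_center (Bv x) m" and v: "v = (SOME m. m \<in> V \<and> is_center (Bv x) m)"
        by (auto simp: s_def split: if_splits)
      show "v \<in> V \<and> is_center (Bv x) v" unfolding v by (rule someI_ex[OF ex])
    next
      assume v: "v \<in> V \<and> is_center (Bv x) v"
      then have "(SOME m. m \<in> V \<and> is_center (Bv x) m) = v"
        by (intro some_equality) (auto intro: center_unique)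
      then show "s x = Some v" using v by (auto simp: s_def)
    qed
    have ms: "msec s" unfolding msec_def
    proof (intro conjI allI impI ballI)
      show "v \<in> V" if "s x = Some v" for x v using that s_iff by auto
      fix v assume v: "v \<in> V"
      have "{x \<in> space M. s x = Some v} = {x \<in> space M. \<exists>R. (\<forall>l\<in>carrier P. l \<in> B x \<longrightarrow> tree_dist v (act l []) \<le> R) \<and>
          (\<exists>l\<in>carrier P. \<exists>l'\<in>carrier P. (l \<in> B x \<and> l' \<in> B x) \<and> tree_dist (act l []) (act l' []) = 2 * R)}"
        using v B(1) unfolding s_iff is_center_def Bv_def by (auto 4 4 simp: subset_iff)
      also have "\<dots> \<in> sets M"
        by (intro sets.sets_Collect_countable_Ex sets.sets_Collect_conj sets.sets_Collect_countable_All'[OF _ countable_L]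
           sets.sets_Collect_countable_Ex'[OF _ countable_L] sets.sets_Collect_imp sets.sets_Collect_const B(2))
      finally show "{x \<in> space M. s x = Some v} \<in> sets M" .
    qed
    have es: "esec H s" unfolding esec_def
    proof
      fix h assume h: "h \<in> H"
      then have hK: "h \<in> carrier K" using HK by auto
      show "AE x in M. s (\<alpha> h x) = map_option (act (\<omega> h x)) (s x)"
        using B(3)[OF h] AE_space
      proof eventually_elim
        case (elim x)
        note w = \<omega>_closed[OF hK elim(2)]
        have BB: "B (\<alpha> h x) = (\<lambda>l. \<omega> h x \<otimes>\<^bsub>P\<^esub> l) ` B x"
        proof (intro equalityI subsetI)
          fix l assume l: "l \<in> B (\<alpha> h x)"
          then have lP: "l \<in> carrier P" using B(1) by blast
          let ?l = "inv\<^bsub>P\<^esub> (\<omega> h x) \<otimes>\<^bsub>P\<^esub> l"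
          have "?l \<in> carrier P" "\<omega> h x \<otimes>\<^bsub>P\<^esub> ?l = l" using w lP by (simp_all add: L.m_assoc[symmetric])
          then show "l \<in> (\<lambda>l. \<omega> h x \<otimes>\<^bsub>P\<^esub> l) ` B x" using elim(1) l by (metis image_eqI)
        next
          fix l assume "l \<in> (\<lambda>l. \<omega> h x \<otimes>\<^bsub>P\<^esub> l) ` B x"
          then show "l \<in> B (\<alpha> h x)" using elim(1) B(1) by blast
        qed
        have "act (\<omega> h x \<otimes>\<^bsub>P\<^esub> l) [] = act (\<omega> h x) (act l [])" if "l \<in> B x" for l
          using that B(1) w by (intro act_mult) auto
        then have Bh: "Bv (\<alpha> h x) = act (\<omega> h x) ` Bv x" unfolding Bv_def BB image_image by simp
        have fwd: "s (\<alpha> h x) = Some (act (\<omega> h x) v)" if "s x = Some v" for v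
          using that w is_center_image[OF w BvV, of v x] act_vertex[OF w, of v] unfolding s_iff Bh by auto
        show ?case
        proof (cases "s x")
          case (Some v) then show ?thesis using fwd by simp
        next
          case None
          have "s (\<alpha> h x) \<noteq> Some u" for u
          proof
            assume u: "s (\<alpha> h x) = Some u"
            let ?v = "act (inv\<^bsub>P\<^esub> (\<omega> h x)) u"
            have uV: "bs_vertex I G u" using u s_iff by auto
            have v: "?v \<in> V" using act_vertex[OF L.inv_closed[OF w] uV] by simp
            have "is_center (act (\<omega> h x) ` Bv x) (act (\<omega> h x) ?v)"
              using u unfolding s_iff Bh act_inv(2)[OF w uV] by simp
            then have "s x = Some ?v" unfolding s_iff using v is_center_image[OF w BvV v] by simp
            then show False using None by simp
          qed
          then show ?thesis using None by (cases "s (\<alpha> h x)") auto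
        qed
      qed
    qed
    have "\<not> (AE x in M. s x = None)"
    proof
      assume n: "AE x in M. s x = None"
      \<comment> \<open>A nonempty bounded set of even vertices has a centre, so where no vertex is
        selected the set itself is empty.\<close>
      have "AE x in M. B x = {}" using n B(4)
      proof eventually_elim
        case (elim x)
        then obtain \<delta> A where A: "\<delta> > 0" "finite A" "A \<subseteq> carrier P"
          "B x \<subseteq> {l. \<exists>a\<in>A. cmod (\<psi> n (inv\<^bsub>P\<^esub> l \<otimes>\<^bsub>P\<^esub> a)) > \<delta>}" by blast
        obtain N where N: "r n ^ N < \<delta>" using real_arch_pow_inv[OF A(1) r(2)] by blast
        define E where "E = (\<Sum>a\<in>A. tree_dist (act a []) [])"
        have bd: "tree_dist p [] \<le> N + E" if p: "p \<in> Bv x" for p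
        proof -
          obtain l where l: "l \<in> B x" "p = act l []" using p by (auto simp: Bv_def)
          have lP: "l \<in> carrier P" using l B(1) by blast
          obtain a where a: "a \<in> A" "cmod (\<psi> n (inv\<^bsub>P\<^esub> l \<otimes>\<^bsub>P\<^esub> a)) > \<delta>" using A(4) l by blast
          have aP: "a \<in> carrier P" using a A by blast
          have "tree_dist [] (act (inv\<^bsub>P\<^esub> l \<otimes>\<^bsub>P\<^esub> a) []) = tree_dist (act l []) (act a [])"
            by (rule tree_dist_act_inv[OF lP aP])
          then have "r n ^ tree_dist p (act a []) > \<delta>" using a(2) r(1)[of n] by (simp add: \<psi>_def l norm_power)
          then have "tree_dist p (act a []) < N"
            using N power_decreasing[of N "tree_dist p (act a [])" "r n"] r[of n] by (meson less_imp_le not_less order_less_trans order_less_le_trans)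
          moreover have "tree_dist (act a []) [] \<le> E" unfolding E_def by (rule member_le_sum) (use a A in auto)
          ultimately show ?thesis using tree_dist_triangle[of p "[]" "act a []"] by linarith
        qed
        show "B x = {}"
        proof (rule ccontr)
          assume "B x \<noteq> {}"
          then have "Bv x \<noteq> {}" by (simp add: Bv_def)
          moreover have "tree_dist p q \<le> 2 * (N + E)" if "p \<in> Bv x" "q \<in> Bv x" for p q
          proof -
            have "tree_dist p q \<le> tree_dist p [] + tree_dist q []"
              using tree_dist_triangle[of p q "[]"] by (simp add: tree_dist_commute[of "[]" q])
            also have "\<dots> \<le> (N + E) + (N + E)" by (rule add_mono[OF bd[OF that(1)] bd[OF that(2)]])
            finally show ?thesis by simp
          qed
          moreover have "even (length p)" if p: "p \<in> Bv x" for p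
          proof -
            obtain l where l: "l \<in> B x" "p = act l []" using p by (auto simp: Bv_def)
            then show ?thesis using B(1) act_even[of l "[]"] by auto
          qed
          ultimately have "\<exists>m\<in>V. is_center (Bv x) m"
            by (intro center_exists[OF _ BvV]) (auto intro: bs_vertex_take)
          then show False using elim(1) by (auto simp: s_def)
        qed
      qed
      then show False using B(5) by simp
    qed
    then show thesis using that ms es by blast
  qed
qed

text \<open>Since the invariant vertex is unique and \<open>H\<close> is normal, its translates agree almost
  everywhere and hence form a section that is equivariant under the whole group.\<close>

lemma normal_section_extends:
  assumes H: "H \<lhd> K" "infinite H" and s: "msec s" "esec H s"
  obtains S where "msec S" "\<forall>k\<in>carrier K. \<forall>x\<in>space M. S (\<alpha> k x) = map_option (act (\<omega> k x)) (S x)"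
    "AE x in M. s x \<noteq> None \<longrightarrow> S x \<noteq> None"
proof -
  have sub: "subgroup H K" using H(1) by (rule normal_imp_subgroup)
  have HK: "H \<subseteq> carrier K" using sub by (rule subgroup.subset)
  \<comment> \<open>The section \<open>s\<close> transported by \<open>g\<close>: the vertex over
    the preimage of \<open>x\<close> is carried along the cocycle.\<close>
  define sg where "sg g x = (if x \<in> space M then map_option (act (\<omega> g (\<alpha> (inv\<^bsub>K\<^esub> g) x))) (s (\<alpha> (inv\<^bsub>K\<^esub> g) x)) else None)" for g x
  have mm: "map_option (act (a \<otimes>\<^bsub>P\<^esub> b)) (s y) = map_option (act a) (map_option (act b) (s y))"
    if "a \<in> carrier P" "b \<in> carrier P" for a b y
    using that msec_vertex[OF s(1), of y] by (cases "s y") (auto simp: act_mult)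
  have tr: "sg g (\<alpha> k x) = map_option (act (\<omega> k x)) (sg (inv\<^bsub>K\<^esub> k \<otimes>\<^bsub>K\<^esub> g) x)"
    if g: "g \<in> carrier K" "k \<in> carrier K" "x \<in> space M" for g k x
  proof -
    let ?m = "inv\<^bsub>K\<^esub> k \<otimes>\<^bsub>K\<^esub> g"
    define y where "y = \<alpha> (inv\<^bsub>K\<^esub> ?m) x"
    have m: "?m \<in> carrier K" using g by simp
    have y: "y \<in> space M" using g by (simp add: y_def \<alpha>_space)
    have "\<alpha> (inv\<^bsub>K\<^esub> g) (\<alpha> k x) = y" using g by (simp add: y_def \<alpha>_mult[symmetric] K.inv_mult_group)
    moreover have "\<omega> g y = \<omega> k x \<otimes>\<^bsub>P\<^esub> \<omega> ?m y"
    proof -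
      have "\<omega> (k \<otimes>\<^bsub>K\<^esub> ?m) y = \<omega> k (\<alpha> ?m y) \<otimes>\<^bsub>P\<^esub> \<omega> ?m y" by (rule \<omega>_mult[OF g(2) m y])
      moreover have "k \<otimes>\<^bsub>K\<^esub> ?m = g" using g by (simp add: K.m_assoc[symmetric])
      moreover have "\<alpha> ?m y = x" unfolding y_def by (rule \<alpha>_inv(2)[OF m g(3)])
      ultimately show ?thesis by simp
    qed
    moreover have "sg ?m x = map_option (act (\<omega> ?m y)) (s y)" using g by (simp add: sg_def y_def)
    moreover have "\<alpha> k x \<in> space M" using g by (simp add: \<alpha>_space)
    ultimately show ?thesis using mm[OF \<omega>_closed[OF g(2,3)] \<omega>_closed[OF m y], of y] by (simp add: sg_def)
  qed
  have msg: "msec (sg g)" if g: "g \<in> carrier K" for g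
    unfolding msec_def
  proof (intro conjI allI impI ballI)
    have gi: "inv\<^bsub>K\<^esub> g \<in> carrier K" using g by simp
    fix x v assume v: "sg g x = Some v"
    then have x: "x \<in> space M" by (auto simp: sg_def split: if_splits)
    then obtain w where w: "s (\<alpha> (inv\<^bsub>K\<^esub> g) x) = Some w" "v = act (\<omega> g (\<alpha> (inv\<^bsub>K\<^esub> g) x)) w"
      using v by (auto simp: sg_def)
    then show "v \<in> V" using act_vertex[OF \<omega>_closed[OF g \<alpha>_space[OF gi x]] msec_vertex[OF s(1) w(1)]] by simp
  next
    have gi: "inv\<^bsub>K\<^esub> g \<in> carrier K" using g by simp
    fix v assume v: "v \<in> V"
    have m: "\<omega> g -` {l. act l w = v} \<inter> space M \<in> sets M" for w
    proof -
      have "\<omega> g -` {l. act l w = v} \<inter> space M = \<omega> g -` {l \<in> carrier P. act l w = v} \<inter> space M"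
        using \<omega>_closed[OF g] by auto
      also have "\<dots> \<in> sets M" by (rule measurable_sets[OF \<omega>_measurable[OF g]]) auto
      finally show ?thesis .
    qed
    define Y where "Y = (\<Union>w\<in>V. {y \<in> space M. s y = Some w} \<inter> (\<omega> g -` {l. act l w = v} \<inter> space M))"
    have "Y \<in> sets M" unfolding Y_def using s(1) m
      by (intro sets.countable_UN'[OF cV] sets.Int) (auto simp: msec_def)
    moreover have "{x \<in> space M. sg g x = Some v} = \<alpha> (inv\<^bsub>K\<^esub> g) -` Y \<inter> space M"
      using \<alpha>_space[OF gi] msec_vertex[OF s(1)] by (auto simp: sg_def Y_def)
    ultimately show "{x \<in> space M. sg g x = Some v} \<in> sets M"
      using measurable_sets[OF \<alpha>_measurable[OF gi]] by simp
  qed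
  have esg: "esec H (sg g)" if g: "g \<in> carrier K" for g
    unfolding esec_def
  proof
    fix h assume h: "h \<in> H"
    have hK: "h \<in> carrier K" using h HK by auto
    \<comment> \<open>Normality enters here: \<open>inv h\<close> times \<open>g\<close> equals
      \<open>g\<close> times an element of \<open>H\<close>, so transport by \<open>g\<close> keeps
      equivariance under \<open>H\<close>.\<close>
    define h' where "h' = inv\<^bsub>K\<^esub> g \<otimes>\<^bsub>K\<^esub> inv\<^bsub>K\<^esub> h \<otimes>\<^bsub>K\<^esub> g"
    have "inv\<^bsub>K\<^esub> h \<in> H" using h sub by (simp add: subgroup.m_inv_closed)
    then have h': "h' \<in> H" unfolding h'_def using normal.inv_op_closed1[OF H(1) g] by simp
    have h'K: "h' \<in> carrier K" using h' HK by auto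
    have e: "inv\<^bsub>K\<^esub> h \<otimes>\<^bsub>K\<^esub> g = g \<otimes>\<^bsub>K\<^esub> h'" using g hK by (simp add: h'_def K.m_assoc[symmetric])
    let ?m = "g \<otimes>\<^bsub>K\<^esub> h'"
    have m: "?m \<in> carrier K" "inv\<^bsub>K\<^esub> ?m \<in> carrier K" using g h'K by auto
    have "AE y in M. s (\<alpha> h' y) = map_option (act (\<omega> h' y)) (s y)" using s(2) h' by (auto simp: esec_def)
    from AE_\<alpha>[OF m(2) this] show "AE x in M. sg g (\<alpha> h x) = map_option (act (\<omega> h x)) (sg g x)"
      using AE_space
    proof eventually_elim
      case (elim x)
      define y where "y = \<alpha> (inv\<^bsub>K\<^esub> ?m) x"
      have y: "y \<in> space M" using m elim by (simp add: y_def \<alpha>_space)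
      have z: "\<alpha> h' y = \<alpha> (inv\<^bsub>K\<^esub> g) x"
        using g h'K elim by (simp add: y_def \<alpha>_mult[symmetric] K.inv_mult_group K.m_assoc[symmetric])
      have "sg ?m x = map_option (act (\<omega> ?m y)) (s y)" using elim by (simp add: sg_def y_def)
      also have "\<omega> ?m y = \<omega> g (\<alpha> h' y) \<otimes>\<^bsub>P\<^esub> \<omega> h' y" by (rule \<omega>_mult[OF g h'K y])
      also have "map_option (act \<dots>) (s y) = map_option (act (\<omega> g (\<alpha> h' y))) (map_option (act (\<omega> h' y)) (s y))"
        by (rule mm[OF \<omega>_closed[OF g \<alpha>_space[OF h'K y]] \<omega>_closed[OF h'K y]])
      also have "map_option (act (\<omega> h' y)) (s y) = s (\<alpha> h' y)" using elim(1) by (simp add: y_def)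
      also have "map_option (act (\<omega> g (\<alpha> h' y))) (s (\<alpha> h' y)) = sg g x" using elim by (simp add: sg_def z)
      finally show ?case using tr[OF g hK elim(2)] e by simp
    qed
  qed
  \<comment> \<open>The set of values of all transports is equivariant at every point. Selecting a
    vertex only where this set is a singleton makes \<open>S\<close> equivariant without exceptional
    null sets.\<close>
  define R where "R x = {v. \<exists>g\<in>carrier K. sg g x = Some v}" for x
  have RV: "R x \<subseteq> V" for x using msec_vertex[OF msg] by (auto simp: R_def)
  have R_sub: "R (\<alpha> k x) \<subseteq> act (\<omega> k x) ` R x" if k: "k \<in> carrier K" "x \<in> space M" for k x
  proof
    fix v assume "v \<in> R (\<alpha> k x)"
    then obtain g where g: "g \<in> carrier K" "sg g (\<alpha> k x) = Some v" by (auto simp: R_def)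
    then obtain w where "sg (inv\<^bsub>K\<^esub> k \<otimes>\<^bsub>K\<^esub> g) x = Some w" "v = act (\<omega> k x) w" using tr[OF g(1) k] by auto
    then show "v \<in> act (\<omega> k x) ` R x" unfolding R_def using g k by blast
  qed
  have R_act: "R (\<alpha> k x) = act (\<omega> k x) ` R x" if k: "k \<in> carrier K" "x \<in> space M" for k x
  proof (rule equalityI[OF R_sub[OF k]], rule image_subsetI)
    fix v assume "v \<in> R x"
    then obtain g where g: "g \<in> carrier K" "sg g x = Some v" by (auto simp: R_def)
    have "sg (k \<otimes>\<^bsub>K\<^esub> g) (\<alpha> k x) = map_option (act (\<omega> k x)) (sg (inv\<^bsub>K\<^esub> k \<otimes>\<^bsub>K\<^esub> (k \<otimes>\<^bsub>K\<^esub> g)) x)"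
      by (rule tr) (use k g in auto)
    also have "inv\<^bsub>K\<^esub> k \<otimes>\<^bsub>K\<^esub> (k \<otimes>\<^bsub>K\<^esub> g) = g" using k g by (simp add: K.m_assoc[symmetric])
    finally show "act (\<omega> k x) v \<in> R (\<alpha> k x)" using g k unfolding R_def by auto
  qed
  define S where "S x = (if x \<in> space M \<and> (\<exists>v. R x = {v}) then Some (THE v. R x = {v}) else None)" for x
  have S_iff: "S x = Some v \<longleftrightarrow> x \<in> space M \<and> R x = {v}" for x v
  proof (cases "x \<in> space M \<and> (\<exists>v. R x = {v})")
    case True
    then obtain w where w: "R x = {w}" by blast
    have "(THE v. R x = {v}) = w" by (rule the_equality) (simp_all add: w)
    then have "S x = Some w" using True by (simp only: S_def if_True simp_thms)
    then show ?thesis using True w by auto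
  next
    case False
    then have "S x = None" unfolding S_def by (rule if_not_P)
    then show ?thesis using False by auto
  qed
  show thesis
  proof (rule that)
    show "msec S" unfolding msec_def
    proof (intro conjI allI impI ballI)
      show "v \<in> V" if "S x = Some v" for x v using that RV[of x] by (auto simp: S_iff)
      fix v assume v: "v \<in> V"
      have "{x \<in> space M. S x = Some v} = {x \<in> space M. (\<exists>g\<in>carrier K. sg g x = Some v) \<and>
          (\<forall>w\<in>V. \<forall>g\<in>carrier K. sg g x = Some w \<longrightarrow> w = v)}"
        using RV by (auto simp: S_iff R_def)
      also have "\<dots> \<in> sets M"
        by (intro sets.sets_Collect_conj sets.sets_Collect_countable_Ex'[OF _ countable_K]
          sets.sets_Collect_countable_All'[OF _ cV] sets.sets_Collect_countable_All'[OF _ countable_K]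
          sets.sets_Collect_imp sets.sets_Collect_const)
          (use msg v in \<open>auto simp: msec_def\<close>)
      finally show "{x \<in> space M. S x = Some v} \<in> sets M" .
    qed
    have "S (\<alpha> k x) = map_option (act (\<omega> k x)) (S x)" if k: "k \<in> carrier K" "x \<in> space M" for k x
    proof -
      have ax: "\<alpha> k x \<in> space M" using k by (simp add: \<alpha>_space)
      show ?thesis
      proof (cases "S x")
        case (Some v)
        then have "R x = {v}" by (simp add: S_iff)
        then have "R (\<alpha> k x) = {act (\<omega> k x) v}" using R_act[OF k] by simp
        then have "S (\<alpha> k x) = Some (act (\<omega> k x) v)" unfolding S_iff using ax by simp
        then show ?thesis using Some by simp
      next
        case None
        have "S (\<alpha> k x) \<noteq> Some w" for w
        proof
          assume "S (\<alpha> k x) = Some w"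
          then have "R (\<alpha> k x) = {w}" by (simp add: S_iff)
          then have "R (\<alpha> (inv\<^bsub>K\<^esub> k) (\<alpha> k x)) = {act (\<omega> (inv\<^bsub>K\<^esub> k) (\<alpha> k x)) w}"
            using R_act[OF _ ax, of "inv\<^bsub>K\<^esub> k"] k by simp
          then have "R x = {act (\<omega> (inv\<^bsub>K\<^esub> k) (\<alpha> k x)) w}" using \<alpha>_inv(1)[OF k] by simp
          then have "S x = Some (act (\<omega> (inv\<^bsub>K\<^esub> k) (\<alpha> k x)) w)" unfolding S_iff using k by simp
          then show False using None by simp
        qed
        then show ?thesis using None by (cases "S (\<alpha> k x)") auto
      qed
    qed
    then show "\<forall>k\<in>carrier K. \<forall>x\<in>space M. S (\<alpha> k x) = map_option (act (\<omega> k x)) (S x)" by blast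
    have "AE x in M. \<forall>g\<in>carrier K. \<forall>v w. s x = Some v \<longrightarrow> sg g x = Some w \<longrightarrow> v = w"
      unfolding AE_ball_countable[OF countable_K]
      by (intro ballI section_unique[OF sub H(2) s msg esg])
    then show "AE x in M. s x \<noteq> None \<longrightarrow> S x \<noteq> None" using AE_space
    proof eventually_elim
      case (elim x)
      show ?case
      proof
        assume "s x \<noteq> None"
        then obtain v where v: "s x = Some v" by auto
        have "sg \<one>\<^bsub>K\<^esub> x = Some v"
          using v elim(2) msec_vertex[OF s(1) v] by (simp add: sg_def \<alpha>_one \<omega>_one act_one)
        then have "R x = {v}" using elim(1) v unfolding R_def by (auto intro: bexI[of _ "\<one>\<^bsub>K\<^esub>"])
        then show "S x \<noteq> None" using S_iff[of x v] elim(2) by simp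
      qed
    qed
  qed
qed

text \<open>\<open>u x\<close> represents the coset of the \<open>j\<close>-th factor that is
  selected over \<open>x\<close>. The last clause says that the cocycle twisted by \<open>u\<close>
  takes values in that factor, at all points of an invariant conull set.\<close>

definition coset_section :: "'i \<Rightarrow> 'x set \<Rightarrow> ('x \<Rightarrow> ('i \<times> 'g) list set) \<Rightarrow> bool" where
  "coset_section j D u \<longleftrightarrow> j \<in> I \<and> D \<in> sets M \<and> (AE x in M. x \<in> D) \<and> u \<in> measurable M (count_space (carrier P)) \<and>
    (\<forall>g\<in>carrier K. \<forall>x\<in>D. \<alpha> g x \<in> D \<and>
      (\<exists>b\<in>carrier (G j). \<omega> g x \<otimes>\<^bsub>P\<^esub> u x = u (\<alpha> g x) \<otimes>\<^bsub>P\<^esub> free_product_incl I G j b))"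

lemma coset_section_exists:
  assumes H: "H \<lhd> K" "infinite H" "relative_property_T K H"
    and erg: "\<And>A. A \<in> sets M \<Longrightarrow> (\<And>g. g \<in> carrier K \<Longrightarrow> \<alpha> g -` A \<inter> space M = A) \<Longrightarrow> measure M A = 0 \<or> measure M A = 1"
  shows "\<exists>j D u. coset_section j D u"
proof -
  have sub: "subgroup H K" using H(1) by (rule normal_imp_subgroup)
  obtain s where s: "msec s" "esec H s" "\<not> (AE x in M. s x = None)"
    by (rule bounded_section_exists[OF sub H(3)])
  obtain S where S: "msec S" and eq0: "\<forall>k\<in>carrier K. \<forall>x\<in>space M. S (\<alpha> k x) = map_option (act (\<omega> k x)) (S x)"
    and Ss: "AE x in M. s x \<noteq> None \<longrightarrow> S x \<noteq> None"
    by (rule normal_section_extends[OF H(1,2) s(1,2)])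
  note eq = eq0[rule_format]
  \<comment> \<open>The set where the selected coset belongs to the factor \<open>j\<close>. It is
    invariant by \<open>act_last\<close>, so ergodicity makes a non-null one conull.\<close>
  define D where "D j = {x \<in> space M. \<exists>v\<in>{v\<in>V. odd (length v) \<and> last v = Inl j}. S x = Some v}" for j
  have D: "D j \<in> sets M" for j
    unfolding D_def by (rule sets.sets_Collect_countable_Ex')
      (use S in \<open>auto simp: msec_def intro: countable_subset[OF _ cV]\<close>)
  have Dk: "\<alpha> k x \<in> D j" if k: "k \<in> carrier K" and x: "x \<in> D j" for k x j
  proof -
    from x obtain v where v: "x \<in> space M" "bs_vertex I G v" "odd (length v)" "last v = Inl j" "S x = Some v"
      by (auto simp: D_def)
    note w = \<omega>_closed[OF k v(1)]
    have "S (\<alpha> k x) = Some (act (\<omega> k x) v)" using eq[OF k v(1)] v by simp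
    then show ?thesis unfolding D_def
      using \<alpha>_space[OF k v(1)] act_vertex[OF w v(2)] act_even[OF w v(2)] act_last[OF v(2,3) w] v by auto
  qed
  have Dinv: "\<alpha> k -` D j \<inter> space M = D j" if k: "k \<in> carrier K" for k j
  proof (intro equalityI subsetI)
    fix x assume x: "x \<in> \<alpha> k -` D j \<inter> space M"
    then have xs: "x \<in> space M" and "\<alpha> (inv\<^bsub>K\<^esub> k) (\<alpha> k x) \<in> D j" using k by (auto intro: Dk)
    then show "x \<in> D j" unfolding \<alpha>_inv(1)[OF k xs] by blast
  qed (use Dk[OF k] in \<open>auto simp: D_def\<close>)
  have "\<exists>j\<in>I. measure M (D j) \<noteq> 0"
  proof (rule ccontr)
    assume n: "\<not> (\<exists>j\<in>I. measure M (D j) \<noteq> 0)"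
    have "AE x in M. \<forall>j\<in>I. x \<notin> D j"
      unfolding AE_ball_countable[OF countable_I]
    proof
      fix j assume "j \<in> I"
      then have "D j \<in> null_sets M" using n D by (auto simp: null_sets_def emeasure_eq_measure)
      then show "AE x in M. x \<notin> D j" by (rule AE_not_in)
    qed
    moreover have "esec H S" unfolding esec_def using eq subgroup.subset[OF sub] by (auto intro!: AE_I2)
    note odd_section[OF sub H(2) S this]
    ultimately have "AE x in M. s x = None" using Ss AE_space
    proof eventually_elim
      case (elim x)
      show ?case
      proof (rule ccontr)
        assume "s x \<noteq> None"
        then obtain v where v: "S x = Some v" using elim(3) by auto
        have o: "odd (length v)" using elim(2) v by simp
        have vV: "bs_vertex I G v" by (rule msec_vertex[OF S v])
        obtain u j where "v = u @ [Inl j]" "j \<in> I" using bs_vertex_coset[OF vV o] by auto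
        then show False using elim(1,4) v o vV by (auto simp: D_def)
      qed
    qed
    then show False using s(3) by simp
  qed
  then obtain j where j: "j \<in> I" "measure M (D j) \<noteq> 0" by blast
  then have "measure M (D j) = 1" using erg[OF D Dinv] by blast
  then have AED: "AE x in M. x \<in> D j" using D by (simp add: prob_eq_1)
  \<comment> \<open>Dropping the last letter of a coset vertex leaves an element of the coset. The
    default value keeps the function inside the carrier.\<close>
  define U where "U o' = (case o' of Some v \<Rightarrow> if odd (length v) then elt (butlast v) else \<one>\<^bsub>P\<^esub> | None \<Rightarrow> \<one>\<^bsub>P\<^esub>)" for o' :: "('i + 'g) list option"
  have U: "U o' \<in> carrier P" if "o' \<in> insert None (Some ` V)" for o'
    using that bs_vertex_take[of _ "length _ - 1"] elt_closed carrier_P_one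
    by (auto simp: U_def butlast_conv_take split: option.split)
  have um: "(\<lambda>x. U (S x)) \<in> measurable M (count_space (carrier P))"
    by (rule measurable_compose[OF msec_measurable[OF S]]) (use U in auto)
  have uD: "act (U (S x)) [Inl j] = v" if "x \<in> D j" "S x = Some v" for x v
  proof -
    have v: "bs_vertex I G v" "odd (length v)" "last v = Inl j" using that by (auto simp: D_def)
    obtain u i where u: "v = u @ [Inl i]" "bs_vertex I G u" "even (length u)" using bs_vertex_coset[OF v(1,2)] by auto
    have "v = u @ [Inl j]" using u v by simp
    then show ?thesis using act_elt_coset[of u j] v u that by (simp add: U_def)
  qed
  have "coset_section j (D j) (\<lambda>x. U (S x))"
    unfolding coset_section_def
  proof (intro conjI ballI j D AED um)
    fix g x assume g: "g \<in> carrier K" and x: "x \<in> D j"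
    show gx: "\<alpha> g x \<in> D j" by (rule Dk[OF g x])
    obtain v where v: "S x = Some v" "x \<in> space M" "bs_vertex I G v" using x by (auto simp: D_def)
    note w = \<omega>_closed[OF g v(2)]
    have S2: "S (\<alpha> g x) = Some (act (\<omega> g x) v)" using eq[OF g v(2)] v by simp
    let ?u = "U (S x)" and ?u' = "U (S (\<alpha> g x))"
    have uc: "?u \<in> carrier P" "?u' \<in> carrier P"
      using measurable_space[OF um v(2)] measurable_space[OF um \<alpha>_space[OF g v(2)]] by auto
    let ?l = "inv\<^bsub>P\<^esub> ?u' \<otimes>\<^bsub>P\<^esub> (\<omega> g x \<otimes>\<^bsub>P\<^esub> ?u)"
    have l: "?l \<in> carrier P" using uc w by simp
    have r: "bs_vertex I G [Inl j]" using j by simp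
    have "act (\<omega> g x \<otimes>\<^bsub>P\<^esub> ?u) [Inl j] = act (\<omega> g x) v" using uD[OF x v(1)] act_mult[OF w uc(1) r] by simp
    also have "\<dots> = act ?u' [Inl j]" using uD[OF gx S2] by simp
    finally have "act ?l [Inl j] = [Inl j]"
      using uc w r act_mult[of "inv\<^bsub>P\<^esub> ?u'" "\<omega> g x \<otimes>\<^bsub>P\<^esub> ?u" "[Inl j]"] act_inv(1)[OF uc(2) r] by simp
    then obtain b where b: "b \<in> carrier (G j)" "?l = free_product_incl I G j b"
      using act_coset_stab[OF l j(1)] by blast
    have "\<omega> g x \<otimes>\<^bsub>P\<^esub> ?u = ?u' \<otimes>\<^bsub>P\<^esub> ?l" using uc w by (simp add: L.m_assoc[symmetric])
    then show "\<exists>b\<in>carrier (G j). \<omega> g x \<otimes>\<^bsub>P\<^esub> ?u = ?u' \<otimes>\<^bsub>P\<^esub> free_product_incl I G j b" using b by auto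
  qed
  then show ?thesis by blast
qed

text \<open>Both give equivariant vertex sections for the same infinite group, hence equal ones
  almost everywhere. Equal cosets have the same factor index, and their representatives differ by an
  element of the factor.\<close>

lemma coset_section_unique:
  assumes K: "infinite (carrier K)" and 1: "coset_section j D u" and 2: "coset_section j' D' u'"
  shows "j = j'" "AE x in M. \<exists>b\<in>carrier (G j). u' x = u x \<otimes>\<^bsub>P\<^esub> free_product_incl I G j b"
proof -
  define sec where "sec j D u x = (if x \<in> D then Some (act (u x) [Inl j]) else None)" for j :: 'i and D :: "'x set" and u x
  have sec: "msec (sec j D u) \<and> esec (carrier K) (sec j D u)" if c: "coset_section j D u" for j D u
  proof
    have j: "j \<in> I" "D \<in> sets M" and um: "u \<in> measurable M (count_space (carrier P))" and AED: "AE x in M. x \<in> D"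
      using c by (auto simp: coset_section_def)
    have DM: "D \<subseteq> space M" using j(2) by (rule sets.sets_into_space)
    have uc: "u x \<in> carrier P" if "x \<in> D" for x using measurable_space[OF um] that DM by auto
    have r: "bs_vertex I G [Inl j]" using j by simp
    show "msec (sec j D u)" unfolding msec_def
    proof (intro conjI allI impI ballI)
      show "v \<in> V" if "sec j D u x = Some v" for x v
        using that act_vertex[OF uc r] by (auto simp: sec_def split: if_splits)
      fix v
      have "{x \<in> space M. sec j D u x = Some v} = D \<inter> (u -` {l \<in> carrier P. act l [Inl j] = v} \<inter> space M)"
        using uc DM by (auto simp: sec_def)
      also have "\<dots> \<in> sets M" by (intro sets.Int j measurable_sets[OF um]) auto
      finally show "{x \<in> space M. sec j D u x = Some v} \<in> sets M" .
    qed
    show "esec (carrier K) (sec j D u)" unfolding esec_def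
    proof
      fix g assume g: "g \<in> carrier K"
      show "AE x in M. sec j D u (\<alpha> g x) = map_option (act (\<omega> g x)) (sec j D u x)"
        using AED
      proof eventually_elim
        case (elim x)
        have "\<alpha> g x \<in> D \<and> (\<exists>b\<in>carrier (G j). \<omega> g x \<otimes>\<^bsub>P\<^esub> u x = u (\<alpha> g x) \<otimes>\<^bsub>P\<^esub> free_product_incl I G j b)"
          using c g elim unfolding coset_section_def by blast
        then obtain b where b: "\<alpha> g x \<in> D" "b \<in> carrier (G j)" "\<omega> g x \<otimes>\<^bsub>P\<^esub> u x = u (\<alpha> g x) \<otimes>\<^bsub>P\<^esub> free_product_incl I G j b"
          by blast
        have "act (\<omega> g x) (act (u x) [Inl j]) = act (\<omega> g x \<otimes>\<^bsub>P\<^esub> u x) [Inl j]"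
          by (rule act_mult[symmetric]) (use uc elim r DM \<omega>_closed[OF g] in auto)
        also have "\<dots> = act (u (\<alpha> g x)) [Inl j]"
          unfolding b(3) by (rule act_mult_incl_root[OF j(1) uc[OF b(1)] b(2)])
        finally show ?case using elim b(1) by (simp add: sec_def)
      qed
    qed
  qed
  have c: "D \<in> sets M" "D' \<in> sets M" "AE x in M. x \<in> D" "AE x in M. x \<in> D'" "j \<in> I" "j' \<in> I"
    "u \<in> measurable M (count_space (carrier P))" "u' \<in> measurable M (count_space (carrier P))"
    using 1 2 by (auto simp: coset_section_def)
  have AEq: "AE x in M. x \<in> space M \<and> act (u x) [Inl j] = act (u' x) [Inl j']"
    using section_unique[OF K.subgroup_self K conjunct1[OF sec[OF 1]] conjunct2[OF sec[OF 1]] conjunct1[OF sec[OF 2]] conjunct2[OF sec[OF 2]]]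
      c(3,4) AE_space by eventually_elim (simp add: sec_def)
  have jj: "j = j'" if x: "x \<in> space M" "act (u x) [Inl j] = act (u' x) [Inl j']" for x
  proof -
    have "u x \<in> carrier P" "u' x \<in> carrier P" using measurable_space[OF c(7)] measurable_space[OF c(8)] x by auto
    then show ?thesis using act_last[of "[Inl j]" "u x"] act_last[of "[Inl j']" "u' x"] c x(2) by simp
  qed
  show j: "j = j'"
  proof (rule ccontr)
    assume "j \<noteq> j'"
    note nj = this
    have "AE x in M. False" by (rule AE_mp[OF AEq], rule AE_I2) (use jj \<open>j \<noteq> j'\<close> in blast)
    then show False by (simp add: AE_False)
  qed
  show "AE x in M. \<exists>b\<in>carrier (G j). u' x = u x \<otimes>\<^bsub>P\<^esub> free_product_incl I G j b"
    using AEq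
  proof eventually_elim
    case (elim x)
    have uc: "u x \<in> carrier P" "u' x \<in> carrier P" using measurable_space[OF c(7)] measurable_space[OF c(8)] elim by auto
    have r: "bs_vertex I G [Inl j]" using c by simp
    let ?l = "inv\<^bsub>P\<^esub> (u x) \<otimes>\<^bsub>P\<^esub> u' x"
    have l: "?l \<in> carrier P" using uc by simp
    have "act ?l [Inl j] = [Inl j]"
      using elim j act_mult[of "inv\<^bsub>P\<^esub> (u x)" "u' x" "[Inl j]"] uc r act_inv(1)[OF uc(1) r] by simp
    then obtain b where b: "b \<in> carrier (G j)" "?l = free_product_incl I G j b"
      using act_coset_stab[OF l c(5)] by blast
    have "u' x = u x \<otimes>\<^bsub>P\<^esub> ?l" using uc by (simp add: L.m_assoc[symmetric])
    then show ?case using b by auto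
  qed
qed

end

section \<open>Orbit maps between free actions\<close>

text \<open>Twisting the cocycle by \<open>u\<close> turns it into one with values in the factor
  \<open>j\<close>, and this one falls under \<open>no_haagerup_target\<close>.\<close>

lemma (in tree_cocycle) coset_section_not_haagerup:
  assumes H: "subgroup H K" "infinite H" "relative_property_T K H"
    and c: "coset_section j D u" and haag: "haagerup_property (G j)"
  shows False
proof -
  have j: "j \<in> I" and D: "D \<in> sets M" "AE x in M. x \<in> D" and um: "u \<in> measurable M (count_space (carrier P))"
    using c unfolding coset_section_def by auto
  have st: "\<And>g x. g \<in> carrier K \<Longrightarrow> x \<in> D \<Longrightarrow> \<alpha> g x \<in> D \<and>
      (\<exists>b. b \<in> carrier (G j) \<and> \<omega> g x \<otimes>\<^bsub>P\<^esub> u x = u (\<alpha> g x) \<otimes>\<^bsub>P\<^esub> free_product_incl I G j b)"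
    using c unfolding coset_section_def by blast
  interpret Gj: group "G j" by (rule grp[OF j])
  let ?i = "free_product_incl I G j"
  have DM: "D \<subseteq> space M" using D(1) by (rule sets.sets_into_space)
  have uc: "u x \<in> carrier P" if "x \<in> space M" for x using measurable_space[OF um that] by simp
  \<comment> \<open>As \<open>D\<close> is invariant, the value \<open>\<one>\<close> outside
    \<open>D\<close> preserves the cocycle identity.\<close>
  define \<omega>' where "\<omega>' g x = (if x \<in> D then SOME b. b \<in> carrier (G j) \<and> \<omega> g x \<otimes>\<^bsub>P\<^esub> u x = u (\<alpha> g x) \<otimes>\<^bsub>P\<^esub> ?i b else \<one>\<^bsub>G j\<^esub>)" for g x
  have \<omega>': "\<omega>' g x \<in> carrier (G j)" "\<omega> g x \<otimes>\<^bsub>P\<^esub> u x = u (\<alpha> g x) \<otimes>\<^bsub>P\<^esub> ?i (\<omega>' g x)" if "g \<in> carrier K" "x \<in> D" for g x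
    using someI_ex[OF conjunct2[OF st[OF that]]] that by (simp_all add: \<omega>'_def)
  have \<omega>'c: "\<omega>' g x \<in> carrier (G j)" if "g \<in> carrier K" for g x
    using \<omega>'(1)[OF that, of x] by (cases "x \<in> D") (auto simp: \<omega>'_def)
  have ic: "?i b \<in> carrier P" if "b \<in> carrier (G j)" for b using incl_closed[OF j that] .
  have \<omega>'eq: "inv\<^bsub>P\<^esub> (u (\<alpha> g x)) \<otimes>\<^bsub>P\<^esub> (\<omega> g x \<otimes>\<^bsub>P\<^esub> u x) = ?i (\<omega>' g x)" if "g \<in> carrier K" "x \<in> D" for g x
  proof -
    have "u (\<alpha> g x) \<in> carrier P" using uc \<alpha>_space that DM by auto
    then show ?thesis unfolding \<omega>'(2)[OF that] using ic[OF \<omega>'(1)[OF that]] by (simp add: L.m_assoc[symmetric])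
  qed
  \<comment> \<open>Pieces on which \<open>u\<close> is constant as well, with value
    \<open>l\<close>: there a trivial twisted value means that \<open>\<omega> h x\<close> times
    \<open>l\<close> is \<open>l\<close>, so the original value is trivial.\<close>
  define \<P>' where "\<P>' = (\<lambda>(Z, l). Z \<inter> D \<inter> (u -` {l} \<inter> space M)) ` (\<P> \<times> carrier P)"
  interpret sub: inj_cocycle M K "G j" \<alpha> \<omega>' \<P>'
  proof unfold_locales
    show "countable (carrier K)" by (rule countable_K)
    show "countable (carrier (G j))" by (rule countable_G[OF j])
    fix g assume g: "g \<in> carrier K"
    show "\<alpha> g \<in> measurable M M" "distr M M (\<alpha> g) = M" using g by (rule \<alpha>_measurable \<alpha>_distr)+
    show "\<omega>' g \<in> measurable M (count_space (carrier (G j)))"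
      unfolding measurable_count_space_eq_countable[OF countable_G[OF j]]
    proof (intro conjI ballI)
      show "\<omega>' g \<in> space M \<rightarrow> carrier (G j)" using \<omega>'c[OF g] by auto
      fix b assume b: "b \<in> carrier (G j)"
      define h where "h x = inv\<^bsub>P\<^esub> (u (\<alpha> g x)) \<otimes>\<^bsub>P\<^esub> (\<omega> g x \<otimes>\<^bsub>P\<^esub> u x)" for x
      have ua: "(\<lambda>x. u (\<alpha> g x)) \<in> measurable M (count_space (carrier P))"
        by (rule measurable_compose[OF \<alpha>_measurable[OF g] um])
      have hm: "h \<in> measurable M (count_space (carrier P))"
      proof -
        have 1: "(\<lambda>x. inv\<^bsub>P\<^esub> l \<otimes>\<^bsub>P\<^esub> (m \<otimes>\<^bsub>P\<^esub> u x)) \<in> measurable M (count_space (carrier P))"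
          if "l \<in> carrier P" "m \<in> carrier P" for l m
          by (rule measurable_from_L[OF um]) (use that in simp)
        have "(\<lambda>x. inv\<^bsub>P\<^esub> l \<otimes>\<^bsub>P\<^esub> (\<omega> g x \<otimes>\<^bsub>P\<^esub> u x)) \<in> measurable M (count_space (carrier P))"
          if l: "l \<in> carrier P" for l
          by (rule measurable_compose_countable'[OF 1[OF l] \<omega>_measurable[OF g] countable_L])
        then show ?thesis unfolding h_def
          by (rule measurable_compose_countable'[OF _ ua countable_L])
      qed
      have "\<omega>' g -` {b} \<inter> space M = (D \<inter> (h -` {?i b} \<inter> space M)) \<union> (if b = \<one>\<^bsub>G j\<^esub> then space M - D else {})"
      proof -
        have "\<omega>' g x = b \<longleftrightarrow> h x = ?i b" if "x \<in> D" for x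
          unfolding h_def \<omega>'eq[OF g that] using incl_inj[OF j \<omega>'(1)[OF g that] b] by auto
        moreover have "\<omega>' g x = \<one>\<^bsub>G j\<^esub>" if "x \<notin> D" for x using that by (simp add: \<omega>'_def)
        ultimately show ?thesis using DM by auto
      qed
      also have "\<dots> \<in> sets M" using D measurable_sets[OF hm, of "{?i b}"] ic[OF b] by auto
      finally show "\<omega>' g -` {b} \<inter> space M \<in> sets M" .
    qed
    fix h x assume h: "h \<in> carrier K" and x: "x \<in> space M"
    show "\<alpha> (g \<otimes>\<^bsub>K\<^esub> h) x = \<alpha> g (\<alpha> h x)" by (rule \<alpha>_mult[OF g h x])
    have Di: "\<alpha> h x \<in> D \<longleftrightarrow> x \<in> D"
      using st[OF h, of x] st[of "inv\<^bsub>K\<^esub> h" "\<alpha> h x"] \<alpha>_inv(1)[OF h x] h by auto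
    show "\<omega>' (g \<otimes>\<^bsub>K\<^esub> h) x = \<omega>' g (\<alpha> h x) \<otimes>\<^bsub>G j\<^esub> \<omega>' h x"
    proof (cases "x \<in> D")
      case True
      have hx: "\<alpha> h x \<in> D" using Di True by simp
      have gh: "g \<otimes>\<^bsub>K\<^esub> h \<in> carrier K" using g h by simp
      have cl: "u x \<in> carrier P" "u (\<alpha> h x) \<in> carrier P" "u (\<alpha> g (\<alpha> h x)) \<in> carrier P" "\<omega> h x \<in> carrier P" "\<omega> g (\<alpha> h x) \<in> carrier P"
        using uc \<omega>_closed \<alpha>_space g h x by auto
      note ib = ic[OF \<omega>'(1)[OF h True]] ic[OF \<omega>'(1)[OF g hx]]
      have "u (\<alpha> g (\<alpha> h x)) \<otimes>\<^bsub>P\<^esub> ?i (\<omega>' (g \<otimes>\<^bsub>K\<^esub> h) x) = \<omega> (g \<otimes>\<^bsub>K\<^esub> h) x \<otimes>\<^bsub>P\<^esub> u x"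
        using \<omega>'(2)[OF gh True] \<alpha>_mult[OF g h x] by simp
      also have "\<dots> = \<omega> g (\<alpha> h x) \<otimes>\<^bsub>P\<^esub> (\<omega> h x \<otimes>\<^bsub>P\<^esub> u x)" using cl by (simp add: \<omega>_mult[OF g h x] L.m_assoc)
      also have "\<dots> = (\<omega> g (\<alpha> h x) \<otimes>\<^bsub>P\<^esub> u (\<alpha> h x)) \<otimes>\<^bsub>P\<^esub> ?i (\<omega>' h x)"
        unfolding \<omega>'(2)[OF h True] using cl ib by (simp add: L.m_assoc)
      also have "\<dots> = u (\<alpha> g (\<alpha> h x)) \<otimes>\<^bsub>P\<^esub> (?i (\<omega>' g (\<alpha> h x)) \<otimes>\<^bsub>P\<^esub> ?i (\<omega>' h x))"
        unfolding \<omega>'(2)[OF g hx] using cl ib by (simp add: L.m_assoc)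
      also have "?i (\<omega>' g (\<alpha> h x)) \<otimes>\<^bsub>P\<^esub> ?i (\<omega>' h x) = ?i (\<omega>' g (\<alpha> h x) \<otimes>\<^bsub>G j\<^esub> \<omega>' h x)"
        using hom_mult[OF free_product_incl_hom[where I = I and G = G, OF grp j] \<omega>'(1)[OF g hx] \<omega>'(1)[OF h True]] by simp
      finally have "?i (\<omega>' (g \<otimes>\<^bsub>K\<^esub> h) x) = ?i (\<omega>' g (\<alpha> h x) \<otimes>\<^bsub>G j\<^esub> \<omega>' h x)"
        using cl(3) ic \<omega>'c gh g h by simp
      then show ?thesis by (intro incl_inj[OF j]) (use \<omega>'c gh g h in auto)
    qed (use Di in \<open>simp add: \<omega>'_def\<close>)
  next
    show "\<alpha> \<one>\<^bsub>K\<^esub> x = x" if "x \<in> space M" for x by (rule \<alpha>_one[OF that])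
    show "countable \<P>'" unfolding \<P>'_def using countable_\<P> countable_L by auto
    show "\<P>' \<subseteq> sets M" unfolding \<P>'_def using sets_\<P> D measurable_sets[OF um] by auto
    show "AE x in M. x \<in> \<Union>\<P>'" using cover D(2) AE_space
      by eventually_elim (use uc in \<open>auto simp: \<P>'_def\<close>)
    fix Z h x assume *: "Z \<in> \<P>'" "h \<in> carrier K" "x \<in> Z" "\<alpha> h x \<in> Z" "\<omega>' h x = \<one>\<^bsub>G j\<^esub>"
    then obtain Z0 l where Z: "Z0 \<in> \<P>" "l \<in> carrier P" "Z = Z0 \<inter> D \<inter> (u -` {l} \<inter> space M)" by (auto simp: \<P>'_def)
    then have x: "x \<in> D" "x \<in> space M" "u x = l" "u (\<alpha> h x) = l" "x \<in> Z0" "\<alpha> h x \<in> Z0" using * by auto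
    have "?i \<one>\<^bsub>G j\<^esub> = \<one>\<^bsub>P\<^esub>"
      by (rule hom_one[OF free_product_incl_hom[where I = I and G = G, OF grp j] grp[OF j] group_P])
    then have "\<omega> h x \<otimes>\<^bsub>P\<^esub> l = l" using \<omega>'(2)[OF *(2) x(1)] x *(5) Z by simp
    then have "\<omega> h x = \<one>\<^bsub>P\<^esub>" using Z \<omega>_closed[OF *(2) x(2)] by (simp add: L.r_cancel_one')
    then show "h = \<one>\<^bsub>K\<^esub>" using \<omega>_inj[OF Z(1) *(2)] x by simp
  qed
  show False by (rule sub.no_haagerup_target[OF H haag])
qed

locale strict_action = prob_space M + group G for M :: "'x measure" and G :: "('g, 'b) monoid_scheme" +
  fixes \<sigma> :: "'g \<Rightarrow> 'x \<Rightarrow> 'x"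
  assumes countable_G: "countable (carrier G)"
    and \<sigma>_measurable: "g \<in> carrier G \<Longrightarrow> \<sigma> g \<in> measurable M M"
    and \<sigma>_distr: "g \<in> carrier G \<Longrightarrow> distr M M (\<sigma> g) = M"
    and \<sigma>_one: "x \<in> space M \<Longrightarrow> \<sigma> \<one>\<^bsub>G\<^esub> x = x"
    and \<sigma>_mult: "g \<in> carrier G \<Longrightarrow> h \<in> carrier G \<Longrightarrow> x \<in> space M \<Longrightarrow> \<sigma> (g \<otimes>\<^bsub>G\<^esub> h) x = \<sigma> g (\<sigma> h x)"
    and \<sigma>_free: "g \<in> carrier G \<Longrightarrow> x \<in> space M \<Longrightarrow> \<sigma> g x = x \<Longrightarrow> g = \<one>\<^bsub>G\<^esub>"
begin

lemma \<sigma>_space: "g \<in> carrier G \<Longrightarrow> x \<in> space M \<Longrightarrow> \<sigma> g x \<in> space M"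
  using \<sigma>_measurable by (auto simp: measurable_def)

lemma \<sigma>_inv:
  assumes "g \<in> carrier G" "x \<in> space M"
  shows "\<sigma> (inv\<^bsub>G\<^esub> g) (\<sigma> g x) = x" "\<sigma> g (\<sigma> (inv\<^bsub>G\<^esub> g) x) = x"
  using assms by (simp_all add: \<sigma>_mult[symmetric] \<sigma>_one)

lemma \<sigma>_eq_iff:
  assumes "g \<in> carrier G" "h \<in> carrier G" "x \<in> space M" "\<sigma> g x = \<sigma> h x"
  shows "g = h"
proof -
  have "\<sigma> (inv\<^bsub>G\<^esub> h \<otimes>\<^bsub>G\<^esub> g) x = x" using assms \<sigma>_inv(1)[of h x] by (simp add: \<sigma>_mult)
  then have "inv\<^bsub>G\<^esub> h \<otimes>\<^bsub>G\<^esub> g = \<one>\<^bsub>G\<^esub>" using \<sigma>_free[of "inv\<^bsub>G\<^esub> h \<otimes>\<^bsub>G\<^esub> g" x] assms by simp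
  then show ?thesis using assms by (metis inv_closed inv_equality inv_inv)
qed

end

text \<open>The model is an isomorphism onto an amplification followed by projection to the first
  coordinate: it matches orbits in both directions but is injective only where the second coordinate
  is constant. A map back that selects a point in each orbit has the same shape.\<close>

locale orbit_map = A: strict_action M G \<sigma> + B: strict_action N L \<theta>
  for M :: "'x measure" and G :: "('g, 'b) monoid_scheme" and \<sigma> :: "'g \<Rightarrow> 'x \<Rightarrow> 'x"
    and N :: "'y measure" and L :: "('l, 'c) monoid_scheme" and \<theta> :: "'l \<Rightarrow> 'y \<Rightarrow> 'y" +
  fixes q :: "'x \<Rightarrow> 'y" and \<P> :: "'x set set"
  assumes q_measurable: "q \<in> measurable M N"
    and orbits: "x \<in> space M \<Longrightarrow> x' \<in> space M \<Longrightarrow>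
      (\<exists>g\<in>carrier G. \<sigma> g x = x') \<longleftrightarrow> (\<exists>l\<in>carrier L. \<theta> l (q x) = q x')"
    and countable_pieces: "countable \<P>" and sets_pieces: "\<P> \<subseteq> sets M" and pieces_cover: "space M \<subseteq> \<Union>\<P>"
    and q_inj: "Z \<in> \<P> \<Longrightarrow> inj_on q Z"
    and diagonal: "f \<in> measurable M N \<Longrightarrow> f' \<in> measurable M N \<Longrightarrow> {x \<in> space M. f x = f' x} \<in> sets M"
    and q_null: "A \<in> null_sets N \<Longrightarrow> q -` A \<inter> space M \<in> null_sets M"
begin

lemma q_space: "x \<in> space M \<Longrightarrow> q x \<in> space N"
  using q_measurable by (auto simp: measurable_def)

definition cocycle :: "'g \<Rightarrow> 'x \<Rightarrow> 'l" where
  "cocycle g x = (SOME l. l \<in> carrier L \<and> \<theta> l (q x) = q (\<sigma> g x))"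

lemma cocycle:
  assumes "g \<in> carrier G" "x \<in> space M"
  shows "cocycle g x \<in> carrier L" "\<theta> (cocycle g x) (q x) = q (\<sigma> g x)"
proof -
  have "\<exists>l. l \<in> carrier L \<and> \<theta> l (q x) = q (\<sigma> g x)"
    using orbits[OF assms(2) A.\<sigma>_space[OF assms]] assms by blast
  from someI_ex[OF this] show "cocycle g x \<in> carrier L" "\<theta> (cocycle g x) (q x) = q (\<sigma> g x)"
    by (auto simp: cocycle_def)
qed

lemma cocycle_unique:
  assumes "g \<in> carrier G" "x \<in> space M" "l \<in> carrier L" "\<theta> l (q x) = q (\<sigma> g x)"
  shows "cocycle g x = l"
  by (rule B.\<sigma>_eq_iff[of _ _ "q x"]) (use assms cocycle q_space in auto)

text \<open>A trivial cocycle value means that \<open>q\<close> does not change; inside a piece this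
  fixes the point, and freeness makes the group element trivial.\<close>

lemma inj_cocycle_subgroup:
  assumes K: "group K" "countable (carrier K)" and \<iota>: "\<iota> \<in> hom K G" "inj_on \<iota> (carrier K)"
  shows "inj_cocycle M K L (\<lambda>k. \<sigma> (\<iota> k)) (\<lambda>k. cocycle (\<iota> k)) \<P>"
proof -
  interpret K: group K by fact
  have ic: "\<iota> k \<in> carrier G" if "k \<in> carrier K" for k using \<iota>(1) that by (auto simp: hom_def)
  have i1: "\<iota> \<one>\<^bsub>K\<^esub> = \<one>\<^bsub>G\<^esub>" by (rule hom_one[OF \<iota>(1) K(1) A.is_group])
  show ?thesis
  proof unfold_locales
    show "countable (carrier K)" "countable (carrier L)" "countable \<P>" "\<P> \<subseteq> sets M"
      by (rule K B.countable_G countable_pieces sets_pieces)+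
    show "AE x in M. x \<in> \<Union>\<P>" using pieces_cover by (intro AE_I2) auto
    show "\<sigma> (\<iota> \<one>\<^bsub>K\<^esub>) x = x" if "x \<in> space M" for x using that by (simp add: i1 A.\<sigma>_one)
    fix g assume g: "g \<in> carrier K"
    show "\<sigma> (\<iota> g) \<in> measurable M M" "distr M M (\<sigma> (\<iota> g)) = M" using ic[OF g] by (rule A.\<sigma>_measurable A.\<sigma>_distr)+
    show "cocycle (\<iota> g) \<in> measurable M (count_space (carrier L))"
      unfolding measurable_count_space_eq_countable[OF B.countable_G]
    proof (intro conjI ballI)
      show "cocycle (\<iota> g) \<in> space M \<rightarrow> carrier L" using cocycle(1)[OF ic[OF g]] by auto
      fix l assume l: "l \<in> carrier L"
      have "cocycle (\<iota> g) -` {l} \<inter> space M = {x \<in> space M. \<theta> l (q x) = q (\<sigma> (\<iota> g) x)}"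
        using cocycle[OF ic[OF g]] cocycle_unique[OF ic[OF g] _ l] by auto
      also have "\<dots> \<in> sets M"
        by (rule diagonal[OF measurable_compose[OF q_measurable B.\<sigma>_measurable[OF l]]
          measurable_compose[OF A.\<sigma>_measurable[OF ic[OF g]] q_measurable]])
      finally show "cocycle (\<iota> g) -` {l} \<inter> space M \<in> sets M" .
    qed
    fix h x assume h: "h \<in> carrier K" and x: "x \<in> space M"
    have m: "\<iota> (g \<otimes>\<^bsub>K\<^esub> h) = \<iota> g \<otimes>\<^bsub>G\<^esub> \<iota> h" using \<iota>(1) g h by (auto simp: hom_def)
    show mm: "\<sigma> (\<iota> (g \<otimes>\<^bsub>K\<^esub> h)) x = \<sigma> (\<iota> g) (\<sigma> (\<iota> h) x)"
      unfolding m by (rule A.\<sigma>_mult[OF ic[OF g] ic[OF h] x])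
    have hx: "\<sigma> (\<iota> h) x \<in> space M" by (rule A.\<sigma>_space[OF ic[OF h] x])
    show "cocycle (\<iota> (g \<otimes>\<^bsub>K\<^esub> h)) x = cocycle (\<iota> g) (\<sigma> (\<iota> h) x) \<otimes>\<^bsub>L\<^esub> cocycle (\<iota> h) x"
    proof (rule cocycle_unique)
      show "\<theta> (cocycle (\<iota> g) (\<sigma> (\<iota> h) x) \<otimes>\<^bsub>L\<^esub> cocycle (\<iota> h) x) (q x) = q (\<sigma> (\<iota> (g \<otimes>\<^bsub>K\<^esub> h)) x)"
        using B.\<sigma>_mult[OF cocycle(1)[OF ic[OF g] hx] cocycle(1)[OF ic[OF h] x] q_space[OF x]]
        by (simp add: cocycle(2)[OF ic[OF h] x] cocycle(2)[OF ic[OF g] hx] mm)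
    qed (use ic g h x hx cocycle(1) in auto)
  next
    fix Z h x assume *: "Z \<in> \<P>" "h \<in> carrier K" "x \<in> Z" "\<sigma> (\<iota> h) x \<in> Z" "cocycle (\<iota> h) x = \<one>\<^bsub>L\<^esub>"
    have x: "x \<in> space M" using * sets_pieces sets.sets_into_space by blast
    have "q (\<sigma> (\<iota> h) x) = q x" using cocycle(2)[OF ic[OF *(2)] x] *(5) B.\<sigma>_one[OF q_space[OF x]] by simp
    then have "\<sigma> (\<iota> h) x = x" using q_inj[OF *(1)] * by (auto simp: inj_on_def)
    then have "\<iota> h = \<iota> \<one>\<^bsub>K\<^esub>" using A.\<sigma>_free[OF ic[OF *(2)] x] i1 by simp
    then show "h = \<one>\<^bsub>K\<^esub>" using \<iota>(2) *(2) by (auto simp: inj_on_def)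
  qed
qed

end

definition ergodic_on :: "('k, 'b) monoid_scheme \<Rightarrow> 'x measure \<Rightarrow> ('k \<Rightarrow> 'x \<Rightarrow> 'x) \<Rightarrow> bool" where
  "ergodic_on K M \<alpha> \<longleftrightarrow> (\<forall>A\<in>sets M. (\<forall>g\<in>carrier K. \<alpha> g -` A \<inter> space M = A) \<longrightarrow> measure M A = 0 \<or> measure M A = 1)"

text \<open>The point \<open>shift \<theta> u q x\<close> lies in the same orbit as \<open>q x\<close>; a section of cosets of the
  \<open>j\<close>-th factor makes it depend, up to the action of that factor, only on the \<open>K\<close>-orbit of \<open>x\<close>.\<close>

definition shift :: "('l, 'c) monoid_scheme \<Rightarrow> ('l \<Rightarrow> 'y \<Rightarrow> 'y) \<Rightarrow> ('x \<Rightarrow> 'l) \<Rightarrow> ('x \<Rightarrow> 'y) \<Rightarrow> 'x \<Rightarrow> 'y" where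
  "shift L \<theta> u q x = \<theta> (inv\<^bsub>L\<^esub> (u x)) (q x)"

text \<open>The coset relation for the cocycle, solved for the element of the factor and applied to
  \<open>q x\<close>, becomes a relation between shifted points. The Haagerup index
  \<open>j0\<close> is excluded by \<open>coset_section_not_haagerup\<close>.\<close>

lemma orbit_map_section:
  fixes \<Lambda> :: "'i \<Rightarrow> 'g monoid"
  assumes om: "orbit_map M Gr \<sigma> N (free_product J \<Lambda>) \<theta> q \<P>"
    and J: "countable J" "\<And>j. j \<in> J \<Longrightarrow> group (\<Lambda> j) \<and> countable (carrier (\<Lambda> j))"
    and K: "group K" "countable (carrier K)" and \<iota>: "\<iota> \<in> hom K Gr" "inj_on \<iota> (carrier K)"
    and H: "H \<lhd> K" "infinite H" "relative_property_T K H" and erg: "ergodic_on K M (\<lambda>k. \<sigma> (\<iota> k))"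
    and haag: "haagerup_property (\<Lambda> j0)"
  shows "\<exists>j D u. j \<in> J \<and> j \<noteq> j0 \<and> D \<in> sets M \<and> (AE x in M. x \<in> D) \<and>
    u \<in> measurable M (count_space (carrier (free_product J \<Lambda>))) \<and>
    (\<forall>k\<in>carrier K. \<forall>x\<in>D. \<sigma> (\<iota> k) x \<in> D \<and> (\<exists>b\<in>carrier (\<Lambda> j).
      shift (free_product J \<Lambda>) \<theta> u q (\<sigma> (\<iota> k) x)
        = \<theta> (free_product_incl J \<Lambda> j b) (shift (free_product J \<Lambda>) \<theta> u q x)))"
proof -
  interpret orbit_map M Gr \<sigma> N "free_product J \<Lambda>" \<theta> q \<P> by fact
  interpret K: group K by fact
  interpret ic: inj_cocycle M K "free_product J \<Lambda>" "\<lambda>k. \<sigma> (\<iota> k)" "\<lambda>k. cocycle (\<iota> k)" \<P>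
    by (rule inj_cocycle_subgroup[OF K \<iota>])
  have grpJ: "group (\<Lambda> j)" if "j \<in> J" for j using J(2)[OF that] by (rule conjunct1)
  have cntJ: "countable (carrier (\<Lambda> j))" if "j \<in> J" for j using J(2)[OF that] by (rule conjunct2)
  have gf: "group_family J \<Lambda>" by (rule group_family.intro[OF grpJ])
  have "tree_cocycle J \<Lambda> M K (\<lambda>k. \<sigma> (\<iota> k)) (\<lambda>k. cocycle (\<iota> k)) \<P>"
    by (rule tree_cocycle.intro[OF gf ic.inj_cocycle_axioms tree_cocycle_axioms.intro[OF J(1) cntJ]])
  then interpret tc: tree_cocycle J \<Lambda> M K "\<lambda>k. \<sigma> (\<iota> k)" "\<lambda>k. cocycle (\<iota> k)" \<P> .
  have "\<exists>j D u. tc.coset_section j D u"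
    by (rule tc.coset_section_exists[OF H erg[unfolded ergodic_on_def, rule_format]])
  then obtain j D u where c: "tc.coset_section j D u" by blast
  have "j \<noteq> j0"
    using tc.coset_section_not_haagerup[OF normal_imp_subgroup[OF H(1)] H(2,3) c] haag by auto
  have c': "j \<in> J" "D \<in> sets M" "AE x in M. x \<in> D" "u \<in> measurable M (count_space (carrier (free_product J \<Lambda>)))"
    using c unfolding tc.coset_section_def by auto
  have st: "\<And>k x. k \<in> carrier K \<Longrightarrow> x \<in> D \<Longrightarrow> \<sigma> (\<iota> k) x \<in> D \<and>
      (\<exists>b\<in>carrier (\<Lambda> j). cocycle (\<iota> k) x \<otimes>\<^bsub>free_product J \<Lambda>\<^esub> u x = u (\<sigma> (\<iota> k) x) \<otimes>\<^bsub>free_product J \<Lambda>\<^esub> free_product_incl J \<Lambda> j b)"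
    using c unfolding tc.coset_section_def by blast
  have "\<exists>b\<in>carrier (\<Lambda> j). shift (free_product J \<Lambda>) \<theta> u q (\<sigma> (\<iota> k) x) = \<theta> (free_product_incl J \<Lambda> j b) (shift (free_product J \<Lambda>) \<theta> u q x)"
    if k: "k \<in> carrier K" and x: "x \<in> D" for k x
  proof -
    let ?P = "free_product J \<Lambda>" and ?y = "\<sigma> (\<iota> k) x" and ?w = "cocycle (\<iota> k) x"
    obtain b where b: "b \<in> carrier (\<Lambda> j)" "?w \<otimes>\<^bsub>?P\<^esub> u x = u ?y \<otimes>\<^bsub>?P\<^esub> free_product_incl J \<Lambda> j b"
      using st[OF k x] by blast
    have xs: "x \<in> space M" using x c'(2) sets.sets_into_space by blast
    have kG: "\<iota> k \<in> carrier Gr" using \<iota>(1) k by (auto simp: hom_def)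
    have ys: "?y \<in> space M" by (rule A.\<sigma>_space[OF kG xs])
    have cl: "u x \<in> carrier ?P" "u ?y \<in> carrier ?P" "?w \<in> carrier ?P" "free_product_incl J \<Lambda> j b \<in> carrier ?P"
      using measurable_space[OF c'(4) xs] measurable_space[OF c'(4) ys] cocycle(1)[OF kG xs] tc.incl_closed[OF c'(1) b(1)] by auto
    have "inv\<^bsub>?P\<^esub> (u ?y) \<otimes>\<^bsub>?P\<^esub> ?w = free_product_incl J \<Lambda> j b \<otimes>\<^bsub>?P\<^esub> inv\<^bsub>?P\<^esub> (u x)"
    proof -
      have "inv\<^bsub>?P\<^esub> (u ?y) \<otimes>\<^bsub>?P\<^esub> ?w = inv\<^bsub>?P\<^esub> (u ?y) \<otimes>\<^bsub>?P\<^esub> (?w \<otimes>\<^bsub>?P\<^esub> u x) \<otimes>\<^bsub>?P\<^esub> inv\<^bsub>?P\<^esub> (u x)"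
        using cl by (simp add: B.m_assoc)
      also have "\<dots> = free_product_incl J \<Lambda> j b \<otimes>\<^bsub>?P\<^esub> inv\<^bsub>?P\<^esub> (u x)"
        unfolding b(2) using cl by (simp add: B.m_assoc[symmetric])
      finally show ?thesis .
    qed
    then have "\<theta> (inv\<^bsub>?P\<^esub> (u ?y)) (\<theta> ?w (q x)) = \<theta> (free_product_incl J \<Lambda> j b) (\<theta> (inv\<^bsub>?P\<^esub> (u x)) (q x))"
      using cl q_space[OF xs] by (simp add: B.\<sigma>_mult[symmetric])
    then show ?thesis using b(1) unfolding shift_def cocycle(2)[OF kG xs] by blast
  qed
  then show ?thesis using c' st \<open>j \<noteq> j0\<close> by blast
qed

lemma AE_null_superset: "AE x in M. P x \<Longrightarrow> \<exists>A\<in>null_sets M. {x \<in> space M. \<not> P x} \<subseteq> A"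
  by (simp add: eventually_ae_filter)

lemma (in strict_action) null_vimage:
  assumes "g \<in> carrier G" "A \<in> null_sets M"
  shows "\<sigma> g -` A \<inter> space M \<in> null_sets M"
proof -
  have m: "A \<in> sets M" "emeasure M A = 0" using assms by auto
  have "emeasure M (\<sigma> g -` A \<inter> space M) = emeasure (distr M M (\<sigma> g)) A"
    by (rule emeasure_distr[OF \<sigma>_measurable[OF assms(1)] m(1), symmetric])
  then show ?thesis using m measurable_sets[OF \<sigma>_measurable[OF assms(1)] m(1)] by (simp add: \<sigma>_distr[OF assms(1)] null_setsI)
qed

context orbit_map
begin

lemma shift_measurable:
  assumes u: "u \<in> measurable M (count_space (carrier L))"
  shows "shift L \<theta> u q \<in> measurable M N"
proof -
  have 1: "(\<lambda>x. \<theta> (inv\<^bsub>L\<^esub> l) (q x)) \<in> measurable M N" if "l \<in> carrier L" for l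
    by (rule measurable_compose[OF q_measurable B.\<sigma>_measurable]) (use that in simp)
  have "(\<lambda>x. \<theta> (inv\<^bsub>L\<^esub> (u x)) (q x)) \<in> measurable M N"
    by (rule measurable_compose_countable'[OF 1 u B.countable_G])
  then show ?thesis by (simp add: shift_def[abs_def])
qed

lemma shift_null:
  assumes u: "u \<in> measurable M (count_space (carrier L))" and A: "A \<in> null_sets N"
  shows "shift L \<theta> u q -` A \<inter> space M \<in> null_sets M"
proof (rule null_sets_subset)
  show "(\<Union>l\<in>carrier L. q -` (\<theta> (inv\<^bsub>L\<^esub> l) -` A \<inter> space N) \<inter> space M) \<in> null_sets M"
    by (intro null_sets_UN' B.countable_G q_null B.null_vimage A) simp
  show "shift L \<theta> u q -` A \<inter> space M \<in> sets M"
    using measurable_sets[OF shift_measurable[OF u]] A by auto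
  show "shift L \<theta> u q -` A \<inter> space M \<subseteq> (\<Union>l\<in>carrier L. q -` (\<theta> (inv\<^bsub>L\<^esub> l) -` A \<inter> space N) \<inter> space M)"
  proof
    fix x assume x: "x \<in> shift L \<theta> u q -` A \<inter> space M"
    then have "u x \<in> carrier L" using measurable_space[OF u] by auto
    then show "x \<in> (\<Union>l\<in>carrier L. q -` (\<theta> (inv\<^bsub>L\<^esub> l) -` A \<inter> space N) \<inter> space M)"
      by (rule UN_I) (use x q_space in \<open>auto simp: shift_def\<close>)
  qed
qed

end

text \<open>Following a section from the \<open>i\<close>-th factor to the \<open>j\<close>-th one by a section back gives a
  coset section of the tautological cocycle of the \<open>i\<close>-th factor, which is unique.\<close>

lemma section_composition:
  fixes \<Gamma> :: "'i \<Rightarrow> 'g monoid" and \<Lambda> :: "'j \<Rightarrow> 'h monoid"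
    and I :: "'i set" and J :: "'j set"
  defines "GI \<equiv> free_product I \<Gamma>" and "LJ \<equiv> free_product J \<Lambda>"
  assumes om1: "orbit_map M GI \<sigma> N LJ \<theta> q \<P>" and om2: "orbit_map N LJ \<theta> M GI \<sigma> v \<Q>"
    and qv: "\<And>y. y \<in> space N \<Longrightarrow> \<exists>l\<in>carrier LJ. \<theta> l y = q (v y)"
    and diagM: "\<And>g. g \<in> measurable M M \<Longrightarrow> {x \<in> space M. g x = x} \<in> sets M"
    and I: "countable I" "\<And>i. i \<in> I \<Longrightarrow> group (\<Gamma> i) \<and> countable (carrier (\<Gamma> i))"
    and J: "\<And>j. j \<in> J \<Longrightarrow> group (\<Lambda> j)"
    and i: "i \<in> I" "infinite (carrier (\<Gamma> i))" and j: "j \<in> J" and i': "i' \<in> I"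
    and D: "D \<in> sets M" "AE x in M. x \<in> D" and u: "u \<in> measurable M (count_space (carrier LJ))"
    and st: "\<And>k x. k \<in> carrier (\<Gamma> i) \<Longrightarrow> x \<in> D \<Longrightarrow> \<sigma> (free_product_incl I \<Gamma> i k) x \<in> D \<and>
      (\<exists>b\<in>carrier (\<Lambda> j). shift LJ \<theta> u q (\<sigma> (free_product_incl I \<Gamma> i k) x)
        = \<theta> (free_product_incl J \<Lambda> j b) (shift LJ \<theta> u q x))"
    and D': "D' \<in> sets N" "AE y in N. y \<in> D'" and u': "u' \<in> measurable N (count_space (carrier GI))"
    and st': "\<And>k y. k \<in> carrier (\<Lambda> j) \<Longrightarrow> y \<in> D' \<Longrightarrow> \<theta> (free_product_incl J \<Lambda> j k) y \<in> D' \<and>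
      (\<exists>b\<in>carrier (\<Gamma> i'). shift GI \<sigma> u' v (\<theta> (free_product_incl J \<Lambda> j k) y)
        = \<sigma> (free_product_incl I \<Gamma> i' b) (shift GI \<sigma> u' v y))"
  shows "i' = i \<and> (\<exists>X2. X2 \<in> sets M \<and> (AE x in M. x \<in> X2) \<and> (\<forall>x\<in>X2. \<forall>x'\<in>X2.
      (\<exists>a\<in>carrier (\<Gamma> i). \<sigma> (free_product_incl I \<Gamma> i a) x = x') \<longleftrightarrow>
      (\<exists>c\<in>carrier (\<Lambda> j). \<theta> (free_product_incl J \<Lambda> j c) (shift LJ \<theta> u q x) = shift LJ \<theta> u q x')))"
proof -
  interpret o1: orbit_map M GI \<sigma> N LJ \<theta> q \<P> by fact
  interpret o2: orbit_map N LJ \<theta> M GI \<sigma> v \<Q> by fact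
  have grpI: "group (\<Gamma> i)" if "i \<in> I" for i using I(2)[OF that] by (rule conjunct1)
  have cntI: "countable (carrier (\<Gamma> i))" if "i \<in> I" for i using I(2)[OF that] by (rule conjunct2)
  interpret gI: group_family I \<Gamma> by (rule group_family.intro[OF grpI])
  interpret gJ: group_family J \<Lambda> by (rule group_family.intro[OF J])
  interpret Gi: group "\<Gamma> i" by (rule grpI[OF i(1)])
  let ?ii = "free_product_incl I \<Gamma>" and ?ij = "free_product_incl J \<Lambda>"
  define z where "z = shift LJ \<theta> u q"
  define w where "w = shift GI \<sigma> u' v"
  have hom: "?ii i \<in> hom (\<Gamma> i) GI" unfolding GI_def by (rule free_product_incl_hom[OF grpI i(1)])
  have ic: "?ii i a \<in> carrier GI" if "a \<in> carrier (\<Gamma> i)" for a using hom that by (auto simp: hom_def)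
  have ic': "?ii i' a \<in> carrier GI" if "a \<in> carrier (\<Gamma> i')" for a unfolding GI_def by (rule gI.incl_closed[OF i' that])
  have zm: "z \<in> measurable M N" unfolding z_def by (rule o1.shift_measurable[OF u])
  have wm: "w \<in> measurable N M" unfolding w_def by (rule o2.shift_measurable[OF u'])
  have zs: "z x \<in> space N" and wzs: "w (z x) \<in> space M" if "x \<in> space M" for x
    using measurable_space[OF zm that] measurable_space[OF wm] by auto
  have ex: "\<exists>g. g \<in> carrier GI \<and> \<sigma> g (w (z x)) = x" if x: "x \<in> space M" for x
  proof -
    have y: "z x \<in> space N" using zs x by simp
    have vs: "v (z x) \<in> space M" by (rule o2.q_space[OF y])
    have uc: "u x \<in> carrier LJ" "u' (z x) \<in> carrier GI" using measurable_space[OF u x] measurable_space[OF u' y] by auto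
    obtain l where l: "l \<in> carrier LJ" "\<theta> l (z x) = q (v (z x))" using qv[OF y] by blast
    have "\<theta> (l \<otimes>\<^bsub>LJ\<^esub> inv\<^bsub>LJ\<^esub> (u x)) (q x) = q (v (z x))"
      using l uc o1.q_space[OF x] by (simp add: o1.B.\<sigma>_mult z_def shift_def)
    then have "\<exists>l\<in>carrier LJ. \<theta> l (q x) = q (v (z x))" using l uc by (intro bexI[of _ "l \<otimes>\<^bsub>LJ\<^esub> inv\<^bsub>LJ\<^esub> (u x)"]) auto
    then obtain g where g: "g \<in> carrier GI" "\<sigma> g x = v (z x)" using o1.orbits[OF x vs] by blast
    let ?h = "inv\<^bsub>GI\<^esub> (u' (z x)) \<otimes>\<^bsub>GI\<^esub> g"
    have h: "?h \<in> carrier GI" "\<sigma> ?h x = w (z x)" using g uc x by (simp_all add: o1.A.\<sigma>_mult w_def shift_def)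
    then have "\<sigma> (inv\<^bsub>GI\<^esub> ?h) (w (z x)) = x" using o1.A.\<sigma>_inv(1)[OF h(1) x] by simp
    then show ?thesis using h(1) by (intro exI[of _ "inv\<^bsub>GI\<^esub> ?h"]) simp
  qed
  \<comment> \<open>The group element that undoes the round trip from \<open>x\<close> through
    \<open>z\<close> and \<open>w\<close>.\<close>
  define p where "p x = (SOME g. g \<in> carrier GI \<and> \<sigma> g (w (z x)) = x)" for x
  have p: "p x \<in> carrier GI" "\<sigma> (p x) (w (z x)) = x" if "x \<in> space M" for x
    using someI_ex[OF ex[OF that]] by (simp_all add: p_def)
  have pm: "p \<in> measurable M (count_space (carrier GI))"
    unfolding measurable_count_space_eq_countable[OF o1.A.countable_G]
  proof (intro conjI ballI)
    show "p \<in> space M \<rightarrow> carrier GI" using p(1) by auto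
    fix g assume g: "g \<in> carrier GI"
    have "p x = g \<longleftrightarrow> \<sigma> g (w (z x)) = x" if "x \<in> space M" for x
      using p[OF that] o1.A.\<sigma>_eq_iff[OF p(1)[OF that] g wzs[OF that]] by auto
    then have "p -` {g} \<inter> space M = {x \<in> space M. \<sigma> g (w (z x)) = x}" by auto
    also have "\<dots> \<in> sets M"
      by (rule diagM[OF measurable_compose[OF measurable_compose[OF zm wm] o1.A.\<sigma>_measurable[OF g]]])
    finally show "p -` {g} \<inter> space M \<in> sets M" .
  qed
  have ic1: "?ii i \<one>\<^bsub>\<Gamma> i\<^esub> = \<one>\<^bsub>GI\<^esub>" by (rule hom_one[OF hom grpI[OF i(1)] o1.A.is_group])
  have im: "?ii i (a \<otimes>\<^bsub>\<Gamma> i\<^esub> b) = ?ii i a \<otimes>\<^bsub>GI\<^esub> ?ii i b" if "a \<in> carrier (\<Gamma> i)" "b \<in> carrier (\<Gamma> i)" for a b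
    using hom_mult[OF hom that] .
  \<comment> \<open>The tautological cocycle of the inclusion does not depend on the point; it is
    injective everywhere, so a single piece suffices.\<close>
  have "inj_cocycle M (\<Gamma> i) GI (\<lambda>k. \<sigma> (?ii i k)) (\<lambda>k x. ?ii i k) {space M}"
  proof unfold_locales
    show "countable (carrier (\<Gamma> i))" "countable (carrier GI)" by (rule cntI[OF i(1)] o1.A.countable_G)+
    show "countable {space M}" "{space M} \<subseteq> sets M" by auto
    show "AE x in M. x \<in> \<Union>{space M}" by (rule AE_I2) simp
    fix g assume g: "g \<in> carrier (\<Gamma> i)"
    show "\<sigma> (?ii i g) \<in> measurable M M" "distr M M (\<sigma> (?ii i g)) = M"
      by (rule o1.A.\<sigma>_measurable[OF ic[OF g]] o1.A.\<sigma>_distr[OF ic[OF g]])+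
    show "(\<lambda>x. ?ii i g) \<in> measurable M (count_space (carrier GI))" using ic[OF g] by simp
    fix h x assume h: "h \<in> carrier (\<Gamma> i)" and x: "x \<in> space M"
    show "\<sigma> (?ii i (g \<otimes>\<^bsub>\<Gamma> i\<^esub> h)) x = \<sigma> (?ii i g) (\<sigma> (?ii i h) x)"
      unfolding im[OF g h] by (rule o1.A.\<sigma>_mult[OF ic[OF g] ic[OF h] x])
    show "?ii i (g \<otimes>\<^bsub>\<Gamma> i\<^esub> h) = ?ii i g \<otimes>\<^bsub>GI\<^esub> ?ii i h" by (rule im[OF g h])
  next
    show "\<sigma> (?ii i \<one>\<^bsub>\<Gamma> i\<^esub>) x = x" if "x \<in> space M" for x unfolding ic1 by (rule o1.A.\<sigma>_one[OF that])
    show "h = \<one>\<^bsub>\<Gamma> i\<^esub>" if "h \<in> carrier (\<Gamma> i)" "?ii i h = \<one>\<^bsub>GI\<^esub>" for h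
      by (rule gI.incl_inj[OF i(1) that(1)]) (use ic1 that in simp_all)
  qed
  then interpret ij: inj_cocycle M "\<Gamma> i" "free_product I \<Gamma>" "\<lambda>k. \<sigma> (?ii i k)" "\<lambda>k x. ?ii i k" "{space M}"
    unfolding GI_def .
  have "tree_cocycle I \<Gamma> M (\<Gamma> i) (\<lambda>k. \<sigma> (?ii i k)) (\<lambda>k x. ?ii i k) {space M}"
    by (rule tree_cocycle.intro[OF gI.group_family_axioms ij.inj_cocycle_axioms tree_cocycle_axioms.intro[OF I(1) cntI]])
  then interpret tc: tree_cocycle I \<Gamma> M "\<Gamma> i" "\<lambda>k. \<sigma> (?ii i k)" "\<lambda>k x. ?ii i k" "{space M}" .
  have c1: "tc.coset_section i (space M) (\<lambda>_. \<one>\<^bsub>GI\<^esub>)"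
    unfolding tc.coset_section_def GI_def[symmetric]
  proof (intro conjI ballI i(1) sets.top)
    show "AE x in M. x \<in> space M" by (rule AE_space)
    show "(\<lambda>_. \<one>\<^bsub>GI\<^esub>) \<in> measurable M (count_space (carrier GI))" by simp
    fix g x assume g: "g \<in> carrier (\<Gamma> i)" and x: "x \<in> space M"
    show "\<sigma> (?ii i g) x \<in> space M" by (rule o1.A.\<sigma>_space[OF ic[OF g] x])
    show "\<exists>b\<in>carrier (\<Gamma> i). ?ii i g \<otimes>\<^bsub>GI\<^esub> \<one>\<^bsub>GI\<^esub> = \<one>\<^bsub>GI\<^esub> \<otimes>\<^bsub>GI\<^esub> ?ii i b"
      by (rule bexI[OF _ g]) (simp add: ic[OF g])
  qed
  define D2 where "D2 = D \<inter> (z -` D' \<inter> space M)"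
  have D2: "D2 \<in> sets M" "AE x in M. x \<in> D2"
  proof -
    show "D2 \<in> sets M" unfolding D2_def using D(1) measurable_sets[OF zm D'(1)] by auto
    obtain A where A: "{y \<in> space N. y \<notin> D'} \<subseteq> A" "A \<in> null_sets N"
      using AE_null_superset[OF D'(2)] by blast
    have "AE x in M. x \<notin> z -` A \<inter> space M"
      by (rule AE_not_in) (use o1.shift_null[OF u A(2)] in \<open>simp add: z_def\<close>)
    then show "AE x in M. x \<in> D2" using D(2) AE_space
      by eventually_elim (use A(1) zs in \<open>auto simp: D2_def\<close>)
  qed
  have D2s: "x \<in> space M" "x \<in> D" "z x \<in> D'" if "x \<in> D2" for x using that by (auto simp: D2_def)
  have wst: "\<exists>b\<in>carrier (\<Gamma> i'). w (\<theta> (?ij j c) (z x)) = \<sigma> (?ii i' b) (w (z x))" if "x \<in> D2" "c \<in> carrier (\<Lambda> j)" for x c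
    using st'[OF that(2) D2s(3)[OF that(1)]] by (simp add: w_def)
  have c2: "tc.coset_section i' D2 p"
    unfolding tc.coset_section_def GI_def[symmetric]
  proof (intro conjI ballI i' D2 pm)
    fix g x assume g: "g \<in> carrier (\<Gamma> i)" and x: "x \<in> D2"
    note xs = D2s(1)[OF x]
    let ?y = "\<sigma> (?ii i g) x"
    have ys: "?y \<in> space M" by (rule o1.A.\<sigma>_space[OF ic[OF g] xs])
    obtain c where c: "c \<in> carrier (\<Lambda> j)" "z ?y = \<theta> (?ij j c) (z x)" and yD: "?y \<in> D"
      using st[OF g D2s(2)[OF x]] unfolding z_def by blast
    show "?y \<in> D2" using yD ys st'[OF c(1) D2s(3)[OF x]] by (simp add: D2_def c(2))
    obtain b where b: "b \<in> carrier (\<Gamma> i')" "w (z ?y) = \<sigma> (?ii i' b) (w (z x))"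
      using wst[OF x c(1)] c(2) by auto
    have "?ii i g \<otimes>\<^bsub>GI\<^esub> p x = p ?y \<otimes>\<^bsub>GI\<^esub> ?ii i' b"
    proof (rule o1.A.\<sigma>_eq_iff[OF _ _ wzs[OF xs]])
      have "\<sigma> (?ii i g \<otimes>\<^bsub>GI\<^esub> p x) (w (z x)) = ?y"
        using o1.A.\<sigma>_mult[OF ic[OF g] p(1)[OF xs] wzs[OF xs]] p(2)[OF xs] by simp
      also have "\<dots> = \<sigma> (p ?y) (w (z ?y))" using p(2)[OF ys] by simp
      also have "\<dots> = \<sigma> (p ?y \<otimes>\<^bsub>GI\<^esub> ?ii i' b) (w (z x))"
        unfolding b(2) by (rule o1.A.\<sigma>_mult[OF p(1)[OF ys] ic'[OF b(1)] wzs[OF xs], symmetric])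
      finally show "\<sigma> (?ii i g \<otimes>\<^bsub>GI\<^esub> p x) (w (z x)) = \<sigma> (p ?y \<otimes>\<^bsub>GI\<^esub> ?ii i' b) (w (z x))" .
    qed (use ic[OF g] p(1) xs ys ic'[OF b(1)] in auto)
    then show "\<exists>b\<in>carrier (\<Gamma> i'). ?ii i g \<otimes>\<^bsub>GI\<^esub> p x = p ?y \<otimes>\<^bsub>GI\<^esub> ?ii i' b" using b(1) by blast
  qed
  \<comment> \<open>Comparing \<open>p\<close> with the constant section: the indices agree, and
    \<open>p x\<close> lies almost everywhere in the factor \<open>i\<close>, so the round trip
    stays within one orbit of that factor.\<close>
  note un = tc.coset_section_unique[OF i(2) c1 c2, folded GI_def]
  have ii: "i' = i" using un(1) by simp
  have ae: "AE x in M. x \<in> D2 \<and> (\<exists>b\<in>carrier (\<Gamma> i). \<sigma> (?ii i b) (w (z x)) = x)"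
    using un(2) D2(2)
  proof eventually_elim
    case (elim x)
    then obtain b where b: "b \<in> carrier (\<Gamma> i)" "p x = \<one>\<^bsub>GI\<^esub> \<otimes>\<^bsub>GI\<^esub> ?ii i b" by blast
    then have pb: "p x = ?ii i b" using ic by simp
    then show ?case using elim(2) b(1) p(2)[OF D2s(1)[OF elim(2)]] unfolding pb by blast
  qed
  obtain A where A: "{x \<in> space M. \<not> (x \<in> D2 \<and> (\<exists>b\<in>carrier (\<Gamma> i). \<sigma> (?ii i b) (w (z x)) = x))} \<subseteq> A" "A \<in> null_sets M"
    using AE_null_superset[OF ae] by (elim bexE)
  define X2 where "X2 = space M - A"
  have X2: "X2 \<in> sets M" "AE x in M. x \<in> X2"
    unfolding X2_def using A(2) AE_not_in[OF A(2)] by (auto elim!: AE_mp intro!: AE_I2)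
  have X2s: "x \<in> D2" "\<exists>b\<in>carrier (\<Gamma> i). \<sigma> (?ii i b) (w (z x)) = x" if "x \<in> X2" for x
    using that A(1) by (auto simp: X2_def)
  have iff: "(\<exists>a\<in>carrier (\<Gamma> i). \<sigma> (?ii i a) x = x') \<longleftrightarrow> (\<exists>c\<in>carrier (\<Lambda> j). \<theta> (?ij j c) (z x) = z x')"
    if x: "x \<in> X2" "x' \<in> X2" for x x'
  proof
    assume "\<exists>a\<in>carrier (\<Gamma> i). \<sigma> (?ii i a) x = x'"
    then obtain a where a: "a \<in> carrier (\<Gamma> i)" "\<sigma> (?ii i a) x = x'" by blast
    have "\<exists>b\<in>carrier (\<Lambda> j). z x' = \<theta> (?ij j b) (z x)"
      using st[OF a(1) D2s(2)[OF X2s(1)[OF x(1)]]] by (simp add: z_def a(2))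
    then show "\<exists>c\<in>carrier (\<Lambda> j). \<theta> (?ij j c) (z x) = z x'" by metis
  next
    assume "\<exists>c\<in>carrier (\<Lambda> j). \<theta> (?ij j c) (z x) = z x'"
    then obtain c where c: "c \<in> carrier (\<Lambda> j)" "z x' = \<theta> (?ij j c) (z x)" by metis
    obtain b where b: "b \<in> carrier (\<Gamma> i)" "w (z x') = \<sigma> (?ii i b) (w (z x))"
      using wst[OF X2s(1)[OF x(1)] c(1)] c(2) ii by auto
    obtain d where d: "d \<in> carrier (\<Gamma> i)" "\<sigma> (?ii i d) (w (z x)) = x" using X2s(2)[OF x(1)] by blast
    obtain e where e: "e \<in> carrier (\<Gamma> i)" "\<sigma> (?ii i e) (w (z x')) = x'" using X2s(2)[OF x(2)] by blast
    have xs: "x \<in> space M" using D2s(1) X2s(1) x by blast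
    \<comment> \<open>From \<open>x\<close> to its round trip by \<open>inv d\<close>, across by
      \<open>b\<close>, and then to \<open>x'\<close> by \<open>e\<close>.\<close>
    let ?a = "e \<otimes>\<^bsub>\<Gamma> i\<^esub> b \<otimes>\<^bsub>\<Gamma> i\<^esub> inv\<^bsub>\<Gamma> i\<^esub> d"
    note wx = wzs[OF xs]
    have "\<sigma> (?ii i ?a) x = \<sigma> (?ii i ?a) (\<sigma> (?ii i d) (w (z x)))" using d(2) by simp
    also have "\<dots> = \<sigma> (?ii i ?a \<otimes>\<^bsub>GI\<^esub> ?ii i d) (w (z x))"
      by (rule o1.A.\<sigma>_mult[symmetric]) (use ic b d e wx in auto)
    also have "?ii i ?a \<otimes>\<^bsub>GI\<^esub> ?ii i d = ?ii i (?a \<otimes>\<^bsub>\<Gamma> i\<^esub> d)" by (rule im[symmetric]) (use b d e in auto)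
    also have "?a \<otimes>\<^bsub>\<Gamma> i\<^esub> d = e \<otimes>\<^bsub>\<Gamma> i\<^esub> b" using b d e by (simp add: Gi.m_assoc)
    also have "\<sigma> (?ii i (e \<otimes>\<^bsub>\<Gamma> i\<^esub> b)) (w (z x)) = \<sigma> (?ii i e) (\<sigma> (?ii i b) (w (z x)))"
      unfolding im[OF e(1) b(1)] by (rule o1.A.\<sigma>_mult[OF ic[OF e(1)] ic[OF b(1)] wx])
    also have "\<dots> = x'" using b(2) e(2) by simp
    finally show "\<exists>a\<in>carrier (\<Gamma> i). \<sigma> (?ii i a) x = x'" using b d e by (intro bexI[of _ ?a]) auto
  qed
  show ?thesis
  proof (intro conjI exI[of _ X2] ballI ii X2)
    fix x x' assume "x \<in> X2" "x' \<in> X2"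
    then show "(\<exists>a\<in>carrier (\<Gamma> i). \<sigma> (?ii i a) x = x') \<longleftrightarrow>
      (\<exists>c\<in>carrier (\<Lambda> j). \<theta> (?ij j c) (shift LJ \<theta> u q x) = shift LJ \<theta> u q x')"
      unfolding z_def[symmetric] by (rule iff)
  qed
qed

section \<open>Building an isomorphism from partial ones\<close>

primrec greedy :: "(nat \<Rightarrow> 'x set) \<Rightarrow> (nat \<Rightarrow> 'x \<Rightarrow> 'z) \<Rightarrow> nat \<Rightarrow> 'x set \<times> 'z set" where
  "greedy E \<tau> 0 = ({}, {})"
| "greedy E \<tau> (Suc n) =
    (fst (greedy E \<tau> n) \<union> {x \<in> E n. x \<notin> fst (greedy E \<tau> n) \<and> \<tau> n x \<notin> snd (greedy E \<tau> n)},
     snd (greedy E \<tau> n) \<union> \<tau> n ` {x \<in> E n. x \<notin> fst (greedy E \<tau> n) \<and> \<tau> n x \<notin> snd (greedy E \<tau> n)})"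

text \<open>Use the partial isomorphisms \<open>\<tau> n\<close> one after another, each as far as its values are still free.
  What is left over on the two sides has the same measure and is not connected by any \<open>\<tau> n\<close>.\<close>

lemma greedy_isomorphism:
  fixes M :: "'x measure" and T :: "'z measure" and \<tau> :: "nat \<Rightarrow> 'x \<Rightarrow> 'z" and E :: "nat \<Rightarrow> 'x set"
  assumes M: "prob_space M" and T: "prob_space T"
    and E: "\<And>n. E n \<in> sets M" and \<tau>E: "\<And>n x. x \<in> E n \<Longrightarrow> \<tau> n x \<in> space T"
    and meas: "\<And>n B. B \<in> sets T \<Longrightarrow> {x \<in> E n. \<tau> n x \<in> B} \<in> sets M"
    and inj: "\<And>n. inj_on (\<tau> n) (E n)"
    and img: "\<And>n A. A \<in> sets M \<Longrightarrow> A \<subseteq> E n \<Longrightarrow> \<tau> n ` A \<in> sets T \<and> emeasure T (\<tau> n ` A) = emeasure M A"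
    and trans: "\<And>A B. A \<in> sets M \<Longrightarrow> B \<in> sets T \<Longrightarrow> emeasure M A \<noteq> 0 \<Longrightarrow> emeasure T B \<noteq> 0 \<Longrightarrow>
      \<exists>n. \<exists>x\<in>A \<inter> E n. \<tau> n x \<in> B"
    and rel: "\<And>n m x x'. x \<in> E n \<Longrightarrow> x' \<in> E m \<Longrightarrow> (x, x') \<in> R \<longleftrightarrow> (\<tau> n x, \<tau> m x') \<in> S"
  shows "rel_isomorphic M R T S"
proof -
  interpret M: prob_space M by fact
  interpret T: prob_space T by fact
  define U where "U n = fst (greedy E \<tau> n)" for n
  define W where "W n = snd (greedy E \<tau> n)" for n
  define A where "A n = {x \<in> E n. x \<notin> U n \<and> \<tau> n x \<notin> W n}" for n
  have rec: "U 0 = {}" "W 0 = {}" "U (Suc n) = U n \<union> A n" "W (Suc n) = W n \<union> \<tau> n ` A n" for n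
    by (simp_all add: U_def W_def A_def)
  have AE: "A n \<subseteq> E n" for n by (auto simp: A_def)
  have Am': "A n \<in> sets M" if "U n \<in> sets M" "W n \<in> sets T" for n
  proof -
    have "A n = {x \<in> E n. \<tau> n x \<in> space T - W n} - U n" using \<tau>E by (auto simp: A_def)
    then show ?thesis using meas[of "space T - W n" n] that by auto
  qed
  have UW: "U n \<in> sets M \<and> W n \<in> sets T" for n
  proof (induction n)
    case (Suc n)
    then show ?case using Am'[of n] img[OF Am' AE, of n] by (simp add: rec sets.Un)
  qed (simp add: rec)
  have Am: "A n \<in> sets M" for n using Am' UW by simp
  have U: "U n = (\<Union>m<n. A m)" "W n = (\<Union>m<n. \<tau> m ` A m)" for n
    by (induction n) (auto simp: rec lessThan_Suc)
  have dA: "disjoint_family A"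
  proof -
    have "A m \<inter> A n = {}" if "m < n" for m n using that U(1)[of n] by (auto simp: A_def)
    then show ?thesis unfolding disjoint_family_on_def by (metis Int_commute linorder_neqE_nat)
  qed
  have dB: "disjoint_family (\<lambda>n. \<tau> n ` A n)"
  proof -
    have "\<tau> m ` A m \<inter> \<tau> n ` A n = {}" if "m < n" for m n
    proof -
      have "\<tau> m ` A m \<subseteq> W n" unfolding U(2)[of n] using that by blast
      moreover have "\<tau> n ` A n \<inter> W n = {}" by (auto simp: A_def)
      ultimately show ?thesis by blast
    qed
    then show ?thesis unfolding disjoint_family_on_def by (metis Int_commute linorder_neqE_nat)
  qed
  define X0 where "X0 = (\<Union>n. A n)"
  define Y0 where "Y0 = (\<Union>n. \<tau> n ` A n)"
  have im: "\<tau> n ` (A n \<inter> C) \<in> sets T" "emeasure T (\<tau> n ` (A n \<inter> C)) = emeasure M (A n \<inter> C)" if "C \<in> sets M" for n C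
    using img[of "A n \<inter> C" n] AE Am that by auto
  have X0: "X0 \<in> sets M" unfolding X0_def using Am by auto
  have Y0: "Y0 \<in> sets T" unfolding Y0_def using img[OF Am AE] by auto
  have X0s: "X0 \<subseteq> space M" and Y0s: "Y0 \<subseteq> space T" using X0 Y0 sets.sets_into_space by auto
  define F where "F x = \<tau> (THE n. x \<in> A n) x" for x
  have F: "F x = \<tau> n x" if "x \<in> A n" for n x
  proof -
    have "(THE n. x \<in> A n) = n"
      using that dA by (intro the_equality) (auto simp: disjoint_family_on_def)
    then show ?thesis by (simp add: F_def)
  qed
  have FC: "F ` (X0 \<inter> C) = (\<Union>n. \<tau> n ` (A n \<inter> C))" for C
    using F by (force simp: X0_def)
  have FX: "F ` X0 = Y0" using FC[of UNIV] by (simp add: Y0_def)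
  have Finj: "inj_on F X0"
  proof (rule inj_onI)
    fix x y assume xy: "x \<in> X0" "y \<in> X0" "F x = F y"
    then obtain n m where nm: "x \<in> A n" "y \<in> A m" by (auto simp: X0_def)
    then have eq: "\<tau> n x = \<tau> m y" using F xy by metis
    then have "n = m" using dB nm unfolding disjoint_family_on_def by blast
    then show "x = y" using inj[of n] nm AE eq by (auto simp: inj_on_def)
  qed
  have emF: "F ` (X0 \<inter> C) \<in> sets T \<and> emeasure T (F ` (X0 \<inter> C)) = emeasure M (X0 \<inter> C)" if C: "C \<in> sets M" for C
  proof
    show "F ` (X0 \<inter> C) \<in> sets T" unfolding FC using im(1)[OF C] by auto
    have "disjoint_family (\<lambda>n. \<tau> n ` (A n \<inter> C))" using dB by (auto simp: disjoint_family_on_def)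
    then have "emeasure T (F ` (X0 \<inter> C)) = (\<Sum>n. emeasure T (\<tau> n ` (A n \<inter> C)))"
      unfolding FC using im(1)[OF C] by (intro suminf_emeasure[symmetric]) auto
    also have "\<dots> = (\<Sum>n. emeasure M (A n \<inter> C))" using im(2)[OF C] by simp
    also have "\<dots> = emeasure M (\<Union>n. A n \<inter> C)"
      using dA Am C by (intro suminf_emeasure) (auto simp: disjoint_family_on_def)
    also have "(\<Union>n. A n \<inter> C) = X0 \<inter> C" by (auto simp: X0_def)
    finally show "emeasure T (F ` (X0 \<inter> C)) = emeasure M (X0 \<inter> C)" .
  qed
  have pre: "{x \<in> X0. F x \<in> B} \<in> sets M" if B: "B \<in> sets T" for B
  proof -
    have "{x \<in> X0. F x \<in> B} = (\<Union>n. A n \<inter> {x \<in> E n. \<tau> n x \<in> B})"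
      using F AE by (force simp: X0_def)
    then show ?thesis using Am meas[OF B] by auto
  qed
  have mXY: "emeasure M X0 = emeasure T Y0"
    using emF[of "space M"] X0s FX by (simp add: Int_absorb2)
  \<comment> \<open>If both leftovers had positive measure, some \<open>\<tau> n\<close> would
    connect them at a point that step \<open>n\<close> would have used. As the leftovers have equal
    measure, both are then null.\<close>
  have "emeasure M (space M - X0) = 0 \<or> emeasure T (space T - Y0) = 0"
  proof (rule ccontr)
    assume "\<not> ?thesis"
    then have "\<exists>n. \<exists>x\<in>(space M - X0) \<inter> E n. \<tau> n x \<in> space T - Y0"
      by (intro trans sets.compl_sets X0 Y0) simp_all
    then obtain n x where nx: "x \<in> (space M - X0) \<inter> E n" "\<tau> n x \<in> space T - Y0" by blast
    moreover have "U n \<subseteq> X0" "W n \<subseteq> Y0" unfolding U X0_def Y0_def by blast+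
    ultimately have "x \<in> A n" unfolding A_def by blast
    moreover have "A n \<subseteq> X0" unfolding X0_def by blast
    ultimately show False using nx by blast
  qed
  moreover have "emeasure M (space M - X0) = 1 - emeasure M X0" "emeasure T (space T - Y0) = 1 - emeasure T Y0"
    using X0 Y0 by (simp_all add: emeasure_compl M.emeasure_space_1 T.emeasure_space_1)
  ultimately have z: "emeasure M (space M - X0) = 0" "emeasure T (space T - Y0) = 0" using mXY by auto
  have ae: "AE x in M. x \<in> X0" "AE y in T. y \<in> Y0"
    using z X0 Y0 by (auto intro!: AE_I[of _ _ "space M - X0"] AE_I[of _ _ "space T - Y0"])
  have spM: "space (restrict_space M X0) = X0" "space (restrict_space T Y0) = Y0"
    using X0s Y0s by (auto simp: space_restrict_space)
  have fm: "F \<in> measurable (restrict_space M X0) (restrict_space T Y0)"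
  proof (rule measurableI)
    show "F x \<in> space (restrict_space T Y0)" if "x \<in> space (restrict_space M X0)" for x
      using that FX spM by auto
    fix B assume "B \<in> sets (restrict_space T Y0)"
    then have B: "B \<in> sets T" "B \<subseteq> Y0" using Y0 by (auto simp: sets_restrict_space_iff)
    have "F -` B \<inter> space (restrict_space M X0) = {x \<in> X0. F x \<in> B}" using spM by auto
    then show "F -` B \<inter> space (restrict_space M X0) \<in> sets (restrict_space M X0)"
      using pre[OF B(1)] X0 by (auto simp: sets_restrict_space_iff)
  qed
  have bij: "bij_betw F X0 Y0" using Finj FX by (simp add: bij_betw_def)
  have im2: "the_inv_into X0 F \<in> measurable (restrict_space T Y0) (restrict_space M X0)"
  proof (rule measurableI)
    show "the_inv_into X0 F y \<in> space (restrict_space M X0)" if "y \<in> space (restrict_space T Y0)" for y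
      using that spM the_inv_into_into[OF Finj, of y X0] FX by auto
    fix C assume "C \<in> sets (restrict_space M X0)"
    then have C: "C \<in> sets M" "C \<subseteq> X0" using X0 by (auto simp: sets_restrict_space_iff)
    have "the_inv_into X0 F -` C \<inter> Y0 = F ` (X0 \<inter> C)"
    proof (intro equalityI subsetI)
      fix y assume "y \<in> the_inv_into X0 F -` C \<inter> Y0"
      then have "the_inv_into X0 F y \<in> C" "y \<in> F ` X0" using FX by auto
      then show "y \<in> F ` (X0 \<inter> C)" using f_the_inv_into_f[OF Finj, of y] C by (metis IntI image_eqI subsetD)
    next
      fix y assume "y \<in> F ` (X0 \<inter> C)"
      then show "y \<in> the_inv_into X0 F -` C \<inter> Y0" using the_inv_into_f_f[OF Finj] FX by auto
    qed
    then show "the_inv_into X0 F -` C \<inter> space (restrict_space T Y0) \<in> sets (restrict_space T Y0)"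
      using emF[OF C(1)] Y0 FX spM by (auto simp: sets_restrict_space_iff)
  qed
  have dist: "distr (restrict_space M X0) (restrict_space T Y0) F = restrict_space T Y0"
  proof (rule measure_eqI)
    fix B assume "B \<in> sets (distr (restrict_space M X0) (restrict_space T Y0) F)"
    then have B': "B \<in> sets (restrict_space T Y0)" by simp
    then have B: "B \<in> sets T" "B \<subseteq> Y0" using Y0 by (auto simp: sets_restrict_space_iff)
    have C: "{x \<in> X0. F x \<in> B} \<in> sets M" by (rule pre[OF B(1)])
    have FB: "F ` (X0 \<inter> {x \<in> X0. F x \<in> B}) = B" using B FX by auto
    have "emeasure (distr (restrict_space M X0) (restrict_space T Y0) F) B = emeasure (restrict_space M X0) {x \<in> X0. F x \<in> B}"
      using emeasure_distr[OF fm B'] spM by (simp add: vimage_def Int_def conj_commute)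
    also have "\<dots> = emeasure M {x \<in> X0. F x \<in> B}" using X0 X0s by (intro emeasure_restrict_space) auto
    also have "\<dots> = emeasure T B"
    proof -
      have "X0 \<inter> {x \<in> X0. F x \<in> B} = {x \<in> X0. F x \<in> B}" by blast
      then show ?thesis using conjunct2[OF emF[OF C]] unfolding FB by (simp only:)
    qed
    also have "\<dots> = emeasure (restrict_space T Y0) B" using Y0 Y0s B by (intro emeasure_restrict_space[symmetric]) auto
    finally show "emeasure (distr (restrict_space M X0) (restrict_space T Y0) F) B = emeasure (restrict_space T Y0) B" .
  qed simp
  have "(x, x') \<in> R \<longleftrightarrow> (F x, F x') \<in> S" if x: "x \<in> X0" "x' \<in> X0" for x x'
  proof -
    obtain n m where nm: "x \<in> A n" "x' \<in> A m" using x by (auto simp: X0_def)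
    then show ?thesis using rel[of x n x' m] AE F by auto
  qed
  then show ?thesis unfolding rel_isomorphic_def using X0 Y0 ae bij fm im2 dist by blast
qed

section \<open>Amplifications and the isomorphism of the two orbit relations\<close>

text \<open>Extracted from the standard structure: countably many measurable sets that separate
  points make equality of two measurable maps a measurable condition.\<close>

definition separating :: "'x measure \<Rightarrow> bool" where
  "separating M \<longleftrightarrow> (\<exists>\<U>. countable \<U> \<and> \<U> \<subseteq> sets M \<and>
     (\<forall>x\<in>space M. \<forall>y\<in>space M. x \<noteq> y \<longrightarrow> (\<exists>U\<in>\<U>. x \<in> U \<and> y \<notin> U)))"

lemma separating_standard:
  assumes "standard_prob_space M"
  shows "separating M"
proof -
  obtain T where T: "completely_metrizable_space T" "second_countable T" "topspace T = space M"
      "sets M = sigma_sets (topspace T) {U. openin T U}"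
    using assms by (auto simp: standard_prob_space_def)
  have hd: "Hausdorff_space T"
    using T(1) by (simp add: completely_metrizable_imp_metrizable_space metrizable_imp_Hausdorff_space)
  obtain \<B> where B0: "countable \<B> \<and> (\<forall>V\<in>\<B>. openin T V) \<and>
      (\<forall>U x. openin T U \<and> x \<in> U \<longrightarrow> (\<exists>V\<in>\<B>. x \<in> V \<and> V \<subseteq> U))"
    using T(2) unfolding second_countable_def by (elim exE)
  then have B: "countable \<B>" "\<And>V. V \<in> \<B> \<Longrightarrow> openin T V"
      "\<And>U x. openin T U \<Longrightarrow> x \<in> U \<Longrightarrow> \<exists>V\<in>\<B>. x \<in> V \<and> V \<subseteq> U" by blast+
  have "\<exists>U\<in>\<B>. x \<in> U \<and> y \<notin> U" if xy: "x \<in> space M" "y \<in> space M" "x \<noteq> y" for x y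
  proof -
    have "\<exists>U V. openin T U \<and> openin T V \<and> x \<in> U \<and> y \<in> V \<and> disjnt U V"
      using hd[unfolded Hausdorff_space_def, rule_format, of x y] xy T(3) by simp
    then obtain U V where UV: "openin T U" "x \<in> U" "y \<in> V" "U \<inter> V = {}"
      unfolding disjnt_def by (elim exE conjE)
    obtain W where "W \<in> \<B>" "x \<in> W" "W \<subseteq> U" using B(3)[OF UV(1,2)] by (elim bexE conjE)
    then show ?thesis using UV(3,4) by blast
  qed
  moreover have "\<B> \<subseteq> sets M" unfolding T(4) using B(2) by (auto intro: sigma_sets.Basic)
  ultimately show ?thesis unfolding separating_def using B(1) by blast
qed

lemma sets_Collect_eq:
  assumes sep: "separating N" and f: "f \<in> measurable M N" and g: "g \<in> measurable M N"
  shows "{x \<in> space M. f x = g x} \<in> sets M"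
proof -
  obtain \<U> where U0: "countable \<U> \<and> \<U> \<subseteq> sets N \<and>
      (\<forall>x\<in>space N. \<forall>y\<in>space N. x \<noteq> y \<longrightarrow> (\<exists>U\<in>\<U>. x \<in> U \<and> y \<notin> U))"
    using sep unfolding separating_def by (elim exE)
  then have U: "countable \<U>" "\<U> \<subseteq> sets N"
      "\<And>x y. x \<in> space N \<Longrightarrow> y \<in> space N \<Longrightarrow> x \<noteq> y \<Longrightarrow> \<exists>U\<in>\<U>. x \<in> U \<and> y \<notin> U" by blast+
  have "f x = g x" if "x \<in> space M" "\<forall>U\<in>\<U>. f x \<in> U \<longrightarrow> g x \<in> U" for x
    using U(3)[OF measurable_space[OF f that(1)] measurable_space[OF g that(1)]] that(2) by blast
  then have "{x \<in> space M. f x = g x} = {x \<in> space M. \<forall>U\<in>\<U>. f x \<in> U \<longrightarrow> g x \<in> U}" by auto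
  also have "\<dots> \<in> sets M"
  proof (rule sets.sets_Collect_countable_All'[OF _ U(1)], rule sets.sets_Collect_imp)
    fix U assume "U \<in> \<U>"
    then have "U \<in> sets N" using U(2) by auto
    then show "{x \<in> space M. f x \<in> U} \<in> sets M" "{x \<in> space M. g x \<in> U} \<in> sets M"
      using measurable_sets[OF f, of U] measurable_sets[OF g, of U] by (simp_all add: vimage_def Int_def conj_commute)
  qed
  finally show ?thesis .
qed

lemma separating_restrict:
  assumes sep: "separating M" and X: "X \<in> sets M"
  shows "separating (restrict_space M X)"
proof -
  obtain \<U> where U0: "countable \<U> \<and> \<U> \<subseteq> sets M \<and>
      (\<forall>x\<in>space M. \<forall>y\<in>space M. x \<noteq> y \<longrightarrow> (\<exists>U\<in>\<U>. x \<in> U \<and> y \<notin> U))"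
    using sep unfolding separating_def by (elim exE)
  then have U: "countable \<U>" "\<U> \<subseteq> sets M"
      "\<And>x y. x \<in> space M \<Longrightarrow> y \<in> space M \<Longrightarrow> x \<noteq> y \<Longrightarrow> \<exists>U\<in>\<U>. x \<in> U \<and> y \<notin> U" by blast+
  have Xs: "X \<subseteq> space M" using X by (rule sets.sets_into_space)
  have "\<exists>U\<in>(\<lambda>U. U \<inter> X) ` \<U>. x \<in> U \<and> y \<notin> U" if "x \<in> X" "y \<in> X" "x \<noteq> y" for x y
    using U(3)[of x y] that Xs by auto
  moreover have "(\<lambda>U. U \<inter> X) ` \<U> \<subseteq> sets (restrict_space M X)"
    using U(2) X by (auto simp: sets_restrict_space_iff)
  moreover have "countable ((\<lambda>U. U \<inter> X) ` \<U>)" using U(1) by simp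
  ultimately show ?thesis unfolding separating_def using Xs by (metis (no_types, lifting) Int_absorb2 space_restrict_space)
qed

lemma pmp_actionD:
  assumes "pmp_action G M \<sigma>"
  shows "g \<in> carrier G \<Longrightarrow> \<sigma> g \<in> measurable M M" "g \<in> carrier G \<Longrightarrow> distr M M (\<sigma> g) = M"
    "x \<in> space M \<Longrightarrow> \<sigma> \<one>\<^bsub>G\<^esub> x = x"
    "g \<in> carrier G \<Longrightarrow> h \<in> carrier G \<Longrightarrow> x \<in> space M \<Longrightarrow> \<sigma> (g \<otimes>\<^bsub>G\<^esub> h) x = \<sigma> g (\<sigma> h x)"
    "g \<in> carrier G \<Longrightarrow> x \<in> space M \<Longrightarrow> \<sigma> g x \<in> space M"
    "g \<in> carrier G \<Longrightarrow> x \<in> space M \<Longrightarrow> \<sigma> (inv\<^bsub>G\<^esub> g) (\<sigma> g x) = x"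
    "g \<in> carrier G \<Longrightarrow> x \<in> space M \<Longrightarrow> \<sigma> g (\<sigma> (inv\<^bsub>G\<^esub> g) x) = x"
proof -
  have ga: "group_action G (space M) \<sigma>" using assms by (simp add: pmp_action_def)
  interpret group_action G "space M" \<sigma> by (rule ga)
  interpret G: group G using group_hom unfolding group_hom_def by simp
  show m: "\<sigma> g \<in> measurable M M" "distr M M (\<sigma> g) = M" if "g \<in> carrier G" for g
    using assms that by (auto simp: pmp_action_def)
  show sp: "\<sigma> g x \<in> space M" if "g \<in> carrier G" "x \<in> space M" for g x
    using measurable_space[OF m(1)[OF that(1)] that(2)] .
  show one: "\<sigma> \<one>\<^bsub>G\<^esub> x = x" if "x \<in> space M" for x
    using id_eq_one that by (metis restrict_apply')
  show mult: "\<sigma> (g \<otimes>\<^bsub>G\<^esub> h) x = \<sigma> g (\<sigma> h x)" if "g \<in> carrier G" "h \<in> carrier G" "x \<in> space M" for g h x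
    using composition_rule[OF that(3,1,2)] .
  show "\<sigma> (inv\<^bsub>G\<^esub> g) (\<sigma> g x) = x" "\<sigma> g (\<sigma> (inv\<^bsub>G\<^esub> g) x) = x" if "g \<in> carrier G" "x \<in> space M" for g x
    using that by (simp_all add: mult[symmetric] one)
qed

lemma strict_action_restrict:
  assumes M: "prob_space M" and G: "group G" "countable (carrier G)" and act: "pmp_action G M \<sigma>"
    and X: "X \<in> sets M" "AE x in M. x \<in> X" and inv: "\<And>g x. g \<in> carrier G \<Longrightarrow> x \<in> X \<Longrightarrow> \<sigma> g x \<in> X"
    and free: "\<And>g x. g \<in> carrier G \<Longrightarrow> x \<in> X \<Longrightarrow> \<sigma> g x = x \<Longrightarrow> g = \<one>\<^bsub>G\<^esub>"
  shows "strict_action (restrict_space M X) G \<sigma>"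
proof -
  interpret prob_space M by fact
  interpret G: group G by fact
  note a = pmp_actionD[OF act]
  have Xs: "X \<subseteq> space M" using X(1) by (rule sets.sets_into_space)
  then have sp: "space (restrict_space M X) = X" by (auto simp: space_restrict_space)
  have "emeasure M X = 1" using X by (simp add: emeasure_eq_measure prob_eq_1)
  then have pr: "prob_space (restrict_space M X)" by (rule prob_space_restrict_space[OF X(1)])
  then interpret R: prob_space "restrict_space M X" .
  have m: "\<sigma> g \<in> measurable (restrict_space M X) (restrict_space M X)" if "g \<in> carrier G" for g
    by (rule measurable_restrict_space3[OF a(1)[OF that]]) (use inv that in auto)
  show ?thesis
  proof unfold_locales
    show "countable (carrier G)" by fact
    fix g assume g: "g \<in> carrier G"
    show "\<sigma> g \<in> measurable (restrict_space M X) (restrict_space M X)" by (rule m[OF g])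
    show "distr (restrict_space M X) (restrict_space M X) (\<sigma> g) = restrict_space M X"
    proof (rule measure_eqI)
      fix B assume "B \<in> sets (distr (restrict_space M X) (restrict_space M X) (\<sigma> g))"
      then have B': "B \<in> sets (restrict_space M X)" by simp
      then have B: "B \<in> sets M" "B \<subseteq> X" using X by (auto simp: sets_restrict_space_iff)
      have eq: "\<sigma> g -` B \<inter> X = \<sigma> g -` B \<inter> space M"
        using B(2) Xs inv[of "inv\<^bsub>G\<^esub> g"] a(6)[OF g] g by (force dest: subsetD)
      have "emeasure (distr (restrict_space M X) (restrict_space M X) (\<sigma> g)) B = emeasure (restrict_space M X) (\<sigma> g -` B \<inter> X)"
        using emeasure_distr[OF m[OF g] B'] sp by simp
      also have "\<dots> = emeasure M (\<sigma> g -` B \<inter> X)" using X Xs by (intro emeasure_restrict_space) auto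
      also have "\<dots> = emeasure (distr M M (\<sigma> g)) B" unfolding eq by (rule emeasure_distr[OF a(1)[OF g] B(1), symmetric])
      also have "\<dots> = emeasure (restrict_space M X) B"
        using X Xs B by (simp add: a(2)[OF g] emeasure_restrict_space)
      finally show "emeasure (distr (restrict_space M X) (restrict_space M X) (\<sigma> g)) B = emeasure (restrict_space M X) B" .
    qed simp
    fix h x assume "h \<in> carrier G" "x \<in> space (restrict_space M X)"
    then show "\<sigma> (g \<otimes>\<^bsub>G\<^esub> h) x = \<sigma> g (\<sigma> h x)" using a(4)[OF g] Xs sp by auto
  next
    show "\<sigma> \<one>\<^bsub>G\<^esub> x = x" if "x \<in> space (restrict_space M X)" for x using a(3) that Xs sp by auto
    show "g = \<one>\<^bsub>G\<^esub>" if "g \<in> carrier G" "x \<in> space (restrict_space M X)" "\<sigma> g x = x" for g x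
      using free that sp by auto
  qed
qed

lemma amplified_space:
  assumes E: "E \<in> sets (N \<Otimes>\<^sub>M count_space {1..k})"
  shows "space (amplified_space N k E t) = E"
    and "B \<in> sets (amplified_space N k E t) \<longleftrightarrow> B \<in> sets (N \<Otimes>\<^sub>M count_space {1..k}) \<and> B \<subseteq> E"
    and "B \<in> sets (N \<Otimes>\<^sub>M count_space {1..k}) \<Longrightarrow> B \<subseteq> E \<Longrightarrow>
      emeasure (amplified_space N k E t) B = ennreal (1 / t) * emeasure (N \<Otimes>\<^sub>M count_space {1..k}) B"
proof -
  have Es: "E \<subseteq> space (N \<Otimes>\<^sub>M count_space {1..k})" using E by (rule sets.sets_into_space)
  have Ei: "E \<inter> space (N \<Otimes>\<^sub>M count_space {1..k}) \<in> sets (N \<Otimes>\<^sub>M count_space {1..k})"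
    unfolding Int_absorb2[OF Es] by (rule E)
  show "space (amplified_space N k E t) = E"
    using Es unfolding amplified_space_def space_scale_measure space_restrict_space by auto
  show "B \<in> sets (amplified_space N k E t) \<longleftrightarrow> B \<in> sets (N \<Otimes>\<^sub>M count_space {1..k}) \<and> B \<subseteq> E"
    unfolding amplified_space_def sets_scale_measure sets_restrict_space_iff[OF Ei] by blast
  show "emeasure (amplified_space N k E t) B = ennreal (1 / t) * emeasure (N \<Otimes>\<^sub>M count_space {1..k}) B"
    if "B \<in> sets (N \<Otimes>\<^sub>M count_space {1..k})" "B \<subseteq> E"
    unfolding amplified_space_def emeasure_scale_measure emeasure_restrict_space[OF Ei that(2)] by (rule HOL.refl)
qed

lemma slice_measurable: "B \<in> sets (N \<Otimes>\<^sub>M count_space {1..k}) \<Longrightarrow> {y \<in> space N. (y, a) \<in> B} \<in> sets N"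
  using sets_Pair2[of B N "count_space {1..k}" a] sets.sets_into_space[of "(\<lambda>y. (y, a)) -` B" N]
  by (simp add: vimage_def Int_absorb1 Collect_mono_iff subset_eq) (metis (no_types, lifting) Collect_cong)

lemma slice_null_iff:
  fixes k :: nat
  assumes "prob_space N" and B: "B \<in> sets (N \<Otimes>\<^sub>M count_space {1..k})"
  shows "emeasure (N \<Otimes>\<^sub>M count_space {1..k}) B = 0 \<longleftrightarrow> (\<forall>a\<in>{1..k}. emeasure N {y \<in> space N. (y, a) \<in> B} = 0)"
proof -
  let ?C = "count_space {1..k}" and ?S = "\<lambda>a. {y \<in> space N. (y, a) \<in> B}"
  have sf: "sigma_finite_measure ?C" by (rule sigma_finite_measure_count_space_finite) simp
  have S: "?S a \<in> sets N" for a by (rule slice_measurable[OF B])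
  have tm: "emeasure (N \<Otimes>\<^sub>M ?C) (?S a \<times> {a}) = emeasure N (?S a)" if "a \<in> {1..k}" for a
    using sigma_finite_measure.emeasure_pair_measure_Times[OF sf S, of "{a}" a] that by simp
  have Bs: "B \<subseteq> space N \<times> {1..k}" using sets.sets_into_space[OF B] by (simp add: space_pair_measure)
  then have Be: "B = (\<Union>a\<in>{1..k}. ?S a \<times> {a})" by auto
  have sm: "?S a \<times> {a} \<in> sets (N \<Otimes>\<^sub>M ?C)" if "a \<in> {1..k}" for a using S that by auto
  show ?thesis
  proof
    assume z: "emeasure (N \<Otimes>\<^sub>M ?C) B = 0"
    show "\<forall>a\<in>{1..k}. emeasure N (?S a) = 0"
    proof
      fix a assume a: "a \<in> {1..k}"
      have "emeasure (N \<Otimes>\<^sub>M ?C) (?S a \<times> {a}) \<le> emeasure (N \<Otimes>\<^sub>M ?C) B" using B by (intro emeasure_mono) auto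
      then show "emeasure N (?S a) = 0" using tm[OF a] z by simp
    qed
  next
    assume z: "\<forall>a\<in>{1..k}. emeasure N (?S a) = 0"
    have "(\<Union>a\<in>{1..k}. ?S a \<times> {a}) \<in> null_sets (N \<Otimes>\<^sub>M ?C)"
      by (intro null_sets_UN' null_setsI) (use sm tm z in auto)
    then show "emeasure (N \<Otimes>\<^sub>M ?C) B = 0" using Be by auto
  qed
qed

text \<open>Each slice carries a copy of the same invariant measure, so a group element followed by
  a change of slice preserves measure. The final isomorphism is built from such moves.\<close>

lemma amplified_move:
  fixes k :: nat
  assumes N: "prob_space N" and act: "pmp_action L N \<theta>" and L: "group L" and l: "l \<in> carrier L" and ab: "a \<in> {1..k}" "b \<in> {1..k}"
    and C: "C \<in> sets (N \<Otimes>\<^sub>M count_space {1..k})" "\<And>y c. (y, c) \<in> C \<Longrightarrow> c = a"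
  shows "(\<lambda>(y, c). (\<theta> l y, b)) ` C \<in> sets (N \<Otimes>\<^sub>M count_space {1..k})"
    and "emeasure (N \<Otimes>\<^sub>M count_space {1..k}) ((\<lambda>(y, c). (\<theta> l y, b)) ` C) = emeasure (N \<Otimes>\<^sub>M count_space {1..k}) C"
proof -
  let ?C = "count_space {1..k}" and ?S = "{y \<in> space N. (y, a) \<in> C}"
  note t = pmp_actionD[OF act]
  have li: "inv\<^bsub>L\<^esub> l \<in> carrier L" using L l by (rule group.inv_closed)
  have sf: "sigma_finite_measure ?C" by (rule sigma_finite_measure_count_space_finite) simp
  have S: "?S \<in> sets N" by (rule slice_measurable[OF C(1)])
  have Cs: "C \<subseteq> space N \<times> {1..k}" using sets.sets_into_space[OF C(1)] by (simp add: space_pair_measure)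
  then have Ce: "C = ?S \<times> {a}" using C(2) by auto
  have im: "\<theta> l ` ?S = \<theta> (inv\<^bsub>L\<^esub> l) -` ?S \<inter> space N"
  proof (intro equalityI subsetI)
    fix y assume "y \<in> \<theta> (inv\<^bsub>L\<^esub> l) -` ?S \<inter> space N"
    then have "\<theta> l (\<theta> (inv\<^bsub>L\<^esub> l) y) = y" "\<theta> (inv\<^bsub>L\<^esub> l) y \<in> ?S" using t(7)[OF l] by auto
    then show "y \<in> \<theta> l ` ?S" by (metis image_eqI)
  next
    fix y assume "y \<in> \<theta> l ` ?S"
    then show "y \<in> \<theta> (inv\<^bsub>L\<^esub> l) -` ?S \<inter> space N" using t(5,6) l by auto
  qed
  have ims: "\<theta> l ` ?S \<in> sets N" unfolding im by (rule measurable_sets[OF t(1)[OF li] S])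
  have img: "(\<lambda>(y, c). (\<theta> l y, b)) ` C = \<theta> l ` ?S \<times> {b}" using Ce by force
  show "(\<lambda>(y, c). (\<theta> l y, b)) ` C \<in> sets (N \<Otimes>\<^sub>M ?C)" unfolding img using ims ab by auto
  have "emeasure N (\<theta> l ` ?S) = emeasure (distr N N (\<theta> (inv\<^bsub>L\<^esub> l))) ?S"
    unfolding im by (rule emeasure_distr[OF t(1)[OF li] S, symmetric])
  then have "emeasure N (\<theta> l ` ?S) = emeasure N ?S" by (simp only: t(2)[OF li])
  then show "emeasure (N \<Otimes>\<^sub>M ?C) ((\<lambda>(y, c). (\<theta> l y, b)) ` C) = emeasure (N \<Otimes>\<^sub>M ?C) C"
    unfolding img using sigma_finite_measure.emeasure_pair_measure_Times[OF sf ims, of "{b}"]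
      sigma_finite_measure.emeasure_pair_measure_Times[OF sf S, of "{a}"] ab Ce by simp
qed

text \<open>Stabilisers along an orbit are conjugate, which gives invariance; countability of the
  group gives full measure.\<close>

lemma free_part:
  assumes M: "prob_space M" and G: "group G" "countable (carrier G)" and act: "pmp_action G M \<sigma>"
    and fr: "free_action G M \<sigma>" and sep: "separating M"
  defines "F \<equiv> {x \<in> space M. \<forall>g\<in>carrier G. \<sigma> g x = x \<longrightarrow> g = \<one>\<^bsub>G\<^esub>}"
  shows "F \<in> sets M" "AE x in M. x \<in> F" "\<And>g x. g \<in> carrier G \<Longrightarrow> x \<in> F \<Longrightarrow> \<sigma> g x \<in> F"
proof -
  interpret group G by fact
  note a = pmp_actionD[OF act]
  have m: "{x \<in> space M. \<sigma> g x = x} \<in> sets M" if "g \<in> carrier G" for g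
    by (rule sets_Collect_eq[OF sep a(1)[OF that]]) simp
  show "F \<in> sets M" unfolding F_def
    by (intro sets.sets_Collect_countable_All'[OF _ G(2)] sets.sets_Collect_imp sets.sets_Collect_const m)
  have "AE x in M. \<forall>g\<in>carrier G. g \<noteq> \<one>\<^bsub>G\<^esub> \<longrightarrow> \<sigma> g x \<noteq> x"
    unfolding AE_ball_countable[OF G(2)]
  proof
    fix g assume "g \<in> carrier G"
    then show "AE x in M. g \<noteq> \<one>\<^bsub>G\<^esub> \<longrightarrow> \<sigma> g x \<noteq> x" using fr by (cases "g = \<one>\<^bsub>G\<^esub>") (auto simp: free_action_def)
  qed
  then show "AE x in M. x \<in> F" using AE_space by eventually_elim (auto simp: F_def)
  fix g x assume g: "g \<in> carrier G" and x: "x \<in> F"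
  have xs: "x \<in> space M" using x by (simp add: F_def)
  have "h = \<one>\<^bsub>G\<^esub>" if h: "h \<in> carrier G" "\<sigma> h (\<sigma> g x) = \<sigma> g x" for h
  proof -
    let ?k = "inv\<^bsub>G\<^esub> g \<otimes>\<^bsub>G\<^esub> (h \<otimes>\<^bsub>G\<^esub> g)"
    have "\<sigma> ?k x = x" using a(4) a(6) h g xs by simp
    then have "?k = \<one>\<^bsub>G\<^esub>" using x g h by (simp add: F_def)
    then have "h \<otimes>\<^bsub>G\<^esub> g = g" using g h by (simp add: inv_solve_left')
    then show ?thesis using g h by (simp add: r_cancel_one')
  qed
  then show "\<sigma> g x \<in> F" using a(5)[OF g xs] by (simp add: F_def)
qed

section \<open>Conull invariant sets and the orbit maps in both directions\<close>

locale iso_setup =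
  fixes M :: "'x measure" and G :: "('g, 'b) monoid_scheme" and \<sigma> :: "'g \<Rightarrow> 'x \<Rightarrow> 'x"
    and N :: "'y measure" and L :: "('l, 'c) monoid_scheme" and \<theta> :: "'l \<Rightarrow> 'y \<Rightarrow> 'y"
    and t :: real and k :: nat and E :: "('y \<times> nat) set" and X0 :: "'x set" and Y0 :: "('y \<times> nat) set"
    and f :: "'x \<Rightarrow> 'y \<times> nat"
  assumes pM: "prob_space M" and pN: "prob_space N"
    and grpG: "group G" and cG: "countable (carrier G)" and grpL: "group L" and cL: "countable (carrier L)"
    and actG: "pmp_action G M \<sigma>" and actL: "pmp_action L N \<theta>"
    and freeG: "free_action G M \<sigma>" and freeL: "free_action L N \<theta>"
    and sepM: "separating M" and sepN: "separating N" and t: "t > 0"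
    and E: "E \<in> sets (N \<Otimes>\<^sub>M count_space {1..k})" and emE: "emeasure (N \<Otimes>\<^sub>M count_space {1..k}) E = ennreal t"
    and X0: "X0 \<in> sets M" and Y0: "Y0 \<in> sets (amplified_space N k E t)"
    and aeX: "AE x in M. x \<in> X0" and bij: "bij_betw f X0 Y0"
    and fm: "f \<in> measurable (restrict_space M X0) (restrict_space (amplified_space N k E t) Y0)"
    and fim: "the_inv_into X0 f \<in> measurable (restrict_space (amplified_space N k E t) Y0) (restrict_space M X0)"
    and fd: "distr (restrict_space M X0) (restrict_space (amplified_space N k E t) Y0) f
        = restrict_space (amplified_space N k E t) Y0"
    and rel: "\<And>x x'. x \<in> X0 \<Longrightarrow> x' \<in> X0 \<Longrightarrow>
        (x, x') \<in> orbit_relation G M \<sigma> \<longleftrightarrow> (f x, f x') \<in> amplified_rel (orbit_relation L N \<theta>) E"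
    and ergL: "ergodic_action L N \<theta>"
begin

abbreviation "T \<equiv> amplified_space N k E t"
abbreviation "NC \<equiv> N \<Otimes>\<^sub>M count_space {1..k}"

sublocale M: prob_space M by (rule pM)
sublocale N: prob_space N by (rule pN)
sublocale G: group G by (rule grpG)
sublocale L: group L by (rule grpL)

lemmas aG = pmp_actionD[OF actG]
lemmas aL = pmp_actionD[OF actL]
lemmas T_space = amplified_space(1)[OF E]
lemmas T_sets = amplified_space(2)[OF E]
lemmas T_emeasure = amplified_space(3)[OF E]

lemma E_space: "E \<subseteq> space N \<times> {1..k}"
  using sets.sets_into_space[OF E] by (simp add: space_pair_measure)

lemma X0_space: "X0 \<subseteq> space M" using X0 by (rule sets.sets_into_space)

lemma Y0_E: "Y0 \<subseteq> E" using Y0 T_sets by auto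

lemma f_E: "x \<in> X0 \<Longrightarrow> f x \<in> E" using bij Y0_E by (auto simp: bij_betw_def)

lemma f_space: "x \<in> X0 \<Longrightarrow> fst (f x) \<in> space N" "x \<in> X0 \<Longrightarrow> snd (f x) \<in> {1..k}"
  using f_E[of x] E_space by (cases "f x"; force)+

lemma f_inj: "inj_on f X0" using bij by (simp add: bij_betw_def)

lemma X0_Int: "X0 \<inter> space M \<in> sets M" using X0 by auto

lemma Y0_Int: "Y0 \<inter> space T \<in> sets T" using Y0 by auto

lemma f_pre:
  assumes "B \<in> sets T"
  shows "{x \<in> X0. f x \<in> B} \<in> sets M"
proof -
  have "B \<inter> Y0 \<in> sets (restrict_space T Y0)"
    unfolding sets_restrict_space_iff[OF Y0_Int] using assms Y0 by auto
  from measurable_sets[OF fm this] have "f -` (B \<inter> Y0) \<inter> X0 \<in> sets M"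
    using X0_space by (simp add: sets_restrict_space_iff[OF X0_Int] space_restrict_space Int_absorb2)
  moreover have "f -` (B \<inter> Y0) \<inter> X0 = {x \<in> X0. f x \<in> B}" using bij by (auto simp: bij_betw_def)
  ultimately show ?thesis by simp
qed

lemma f_img:
  assumes A: "A \<in> sets M" "A \<subseteq> X0"
  shows "f ` A \<in> sets T" "emeasure T (f ` A) = emeasure M A"
proof -
  have AR: "A \<in> sets (restrict_space M X0)" unfolding sets_restrict_space_iff[OF X0_Int] using A by auto
  have spY: "space (restrict_space T Y0) = Y0" using Y0_E by (auto simp: space_restrict_space T_space)
  have "the_inv_into X0 f -` A \<inter> Y0 = f ` A"
  proof (intro equalityI subsetI)
    fix y assume y: "y \<in> the_inv_into X0 f -` A \<inter> Y0"
    then have "y \<in> f ` X0" using bij by (simp add: bij_betw_def)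
    then have "f (the_inv_into X0 f y) = y" by (rule f_the_inv_into_f[OF f_inj])
    then show "y \<in> f ` A" using y by (metis IntD1 image_eqI vimageE)
  next
    fix y assume "y \<in> f ` A"
    then obtain x where x: "x \<in> A" "y = f x" by blast
    then have "x \<in> X0" using A by auto
    then show "y \<in> the_inv_into X0 f -` A \<inter> Y0"
      using x the_inv_into_f_f[OF f_inj, of x] bij by (auto simp: bij_betw_def)
  qed
  then have R: "f ` A \<in> sets (restrict_space T Y0)" using measurable_sets[OF fim AR] spY by simp
  then show "f ` A \<in> sets T" unfolding sets_restrict_space_iff[OF Y0_Int] by blast
  have sub: "f ` A \<subseteq> Y0" using R unfolding sets_restrict_space_iff[OF Y0_Int] by blast
  have "emeasure T (f ` A) = emeasure (restrict_space T Y0) (f ` A)"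
    by (rule emeasure_restrict_space[OF Y0_Int sub, symmetric])
  also have "\<dots> = emeasure (distr (restrict_space M X0) (restrict_space T Y0) f) (f ` A)" by (simp only: fd)
  also have "\<dots> = emeasure (restrict_space M X0) (f -` (f ` A) \<inter> space (restrict_space M X0))"
    by (rule emeasure_distr[OF fm R])
  also have "f -` (f ` A) \<inter> space (restrict_space M X0) = A"
  proof -
    have "space (restrict_space M X0) = X0" using X0_space by (auto simp: space_restrict_space)
    then show ?thesis using inj_on_image_mem_iff[OF f_inj _ A(2)] A(2) by blast
  qed
  also have "emeasure (restrict_space M X0) A = emeasure M A" by (rule emeasure_restrict_space[OF X0_Int A(2)])
  finally show "emeasure T (f ` A) = emeasure M A" .
qed

lemma T_zero: "B \<in> sets NC \<Longrightarrow> B \<subseteq> E \<Longrightarrow> emeasure T B = 0 \<longleftrightarrow> emeasure NC B = 0"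
  using t by (simp add: T_emeasure)

lemma box_sets: "A \<in> sets N \<Longrightarrow> E \<inter> (A \<times> {1..k}) \<in> sets T"
  unfolding T_sets using E by auto

lemma fst_pre:
  assumes "A \<in> sets N"
  shows "{x \<in> X0. fst (f x) \<in> A} \<in> sets M"
proof -
  have "{x \<in> X0. fst (f x) \<in> A} = {x \<in> X0. f x \<in> E \<inter> (A \<times> {1..k})}"
    using f_E f_space(2) by (auto simp: mem_Times_iff)
  then show ?thesis using f_pre[OF box_sets[OF assms]] by simp
qed

lemma f_null_T:
  assumes "B \<in> sets NC" "B \<subseteq> E" "emeasure NC B = 0"
  shows "{x \<in> X0. f x \<in> B} \<in> null_sets M"
proof (rule null_setsI)
  have B: "B \<in> sets T" "emeasure T B = 0" using assms T_sets T_zero by auto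
  show C: "{x \<in> X0. f x \<in> B} \<in> sets M" by (rule f_pre[OF B(1)])
  have "emeasure M {x \<in> X0. f x \<in> B} = emeasure T (f ` {x \<in> X0. f x \<in> B})" by (rule f_img(2)[OF C, symmetric]) auto
  also have "\<dots> \<le> emeasure T B" by (rule emeasure_mono) (use B in auto)
  finally show "emeasure M {x \<in> X0. f x \<in> B} = 0" using B by simp
qed

lemma f_null:
  assumes A: "A \<in> null_sets N"
  shows "{x \<in> X0. fst (f x) \<in> A} \<in> null_sets M"
proof -
  have Am: "A \<in> sets N" "emeasure N A = 0" using A by auto
  let ?B = "E \<inter> (A \<times> {1..k})"
  have B: "?B \<in> sets NC" using box_sets[OF Am(1)] T_sets by auto
  have "emeasure N {y \<in> space N. (y, a) \<in> ?B} = 0" for a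
  proof -
    have "emeasure N {y \<in> space N. (y, a) \<in> ?B} \<le> emeasure N A" by (rule emeasure_mono) (use Am in auto)
    then show ?thesis using Am by simp
  qed
  then have "emeasure NC ?B = 0" unfolding slice_null_iff[OF pN B] by blast
  from f_null_T[OF B _ this] have "{x \<in> X0. f x \<in> ?B} \<in> null_sets M" by blast
  moreover have "{x \<in> X0. f x \<in> ?B} = {x \<in> X0. fst (f x) \<in> A}"
    using f_E f_space(2) by (auto simp: mem_Times_iff)
  ultimately show ?thesis by simp
qed

lemma orb:
  assumes "x \<in> X0" "x' \<in> X0"
  shows "(\<exists>g\<in>carrier G. \<sigma> g x = x') \<longleftrightarrow> (\<exists>l\<in>carrier L. \<theta> l (fst (f x)) = fst (f x'))"
proof -
  have "(\<exists>g\<in>carrier G. \<sigma> g x = x') \<longleftrightarrow> (x, x') \<in> orbit_relation G M \<sigma>"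
    using assms X0_space by (auto simp: orbit_relation_def orbit_def)
  also have "\<dots> \<longleftrightarrow> (fst (f x), fst (f x')) \<in> orbit_relation L N \<theta>"
    unfolding rel[OF assms] using f_E[OF assms(1)] f_E[OF assms(2)] by (cases "f x"; cases "f x'") (simp add: amplified_rel_def)
  also have "\<dots> \<longleftrightarrow> (\<exists>l\<in>carrier L. \<theta> l (fst (f x)) = fst (f x'))"
    using f_space(1)[OF assms(1)] by (simp add: orbit_relation_def orbit_def) metis
  finally show ?thesis .
qed

definition "Xf = {x \<in> space M. \<forall>g\<in>carrier G. \<sigma> g x = x \<longrightarrow> g = \<one>\<^bsub>G\<^esub>}"
definition "Yf = {y \<in> space N. \<forall>l\<in>carrier L. \<theta> l y = y \<longrightarrow> l = \<one>\<^bsub>L\<^esub>}"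

lemmas Xf = free_part[OF pM grpG cG actG freeG sepM, folded Xf_def]
lemmas Yf = free_part[OF pN grpL cL actL freeL sepN, folded Yf_def]

definition "Xa = {x \<in> X0. fst (f x) \<in> Yf} \<inter> Xf"
text \<open>The invariant core of \<open>Xa\<close>, conull because the group is countable.
  \<open>Y1\<close> is its counterpart on the other side, cut out by saturation of the
  image.\<close>

definition "X1 = {x \<in> space M. \<forall>g\<in>carrier G. \<sigma> g x \<in> Xa}"
definition "Y1 = {y \<in> Yf. \<exists>l\<in>carrier L. \<exists>a\<in>{1..k}. (\<theta> l y, a) \<in> f ` X1}"

lemma Xa: "Xa \<in> sets M" "AE x in M. x \<in> Xa"
proof -
  show "Xa \<in> sets M" unfolding Xa_def using fst_pre[OF Yf(1)] Xf(1) by auto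
  obtain A where A: "A \<in> null_sets N" "{y \<in> space N. \<not> y \<in> Yf} \<subseteq> A" using AE_null_superset[OF Yf(2)] by blast
  show "AE x in M. x \<in> Xa" using AE_not_in[OF f_null[OF A(1)]] Xf(2) aeX
    by eventually_elim (use A(2) f_space(1) in \<open>auto simp: Xa_def\<close>)
qed

lemma X1: "X1 \<in> sets M" "AE x in M. x \<in> X1" "X1 \<subseteq> Xa" "\<And>g x. g \<in> carrier G \<Longrightarrow> x \<in> X1 \<Longrightarrow> \<sigma> g x \<in> X1"
proof -
  show "X1 \<in> sets M" unfolding X1_def
  proof (rule sets.sets_Collect_countable_All'[OF _ cG])
    fix g assume "g \<in> carrier G"
    then have "\<sigma> g -` Xa \<inter> space M \<in> sets M" by (intro measurable_sets[OF aG(1)] Xa)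
    then show "{x \<in> space M. \<sigma> g x \<in> Xa} \<in> sets M" by (simp add: vimage_def Int_def conj_commute)
  qed
  have "AE x in M. \<forall>g\<in>carrier G. \<sigma> g x \<in> Xa"
    unfolding AE_ball_countable[OF cG]
  proof
    fix g assume g: "g \<in> carrier G"
    have "AE x in distr M M (\<sigma> g). x \<in> Xa" unfolding aG(2)[OF g] by (rule Xa(2))
    then show "AE x in M. \<sigma> g x \<in> Xa" by (rule AE_distrD[OF aG(1)[OF g]])
  qed
  then show "AE x in M. x \<in> X1" using AE_space by eventually_elim (simp add: X1_def)
  show "X1 \<subseteq> Xa"
  proof
    fix x assume "x \<in> X1"
    then have "x \<in> space M" "\<sigma> \<one>\<^bsub>G\<^esub> x \<in> Xa" by (auto simp: X1_def)
    then show "x \<in> Xa" using aG(3) by simp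
  qed
  fix g x assume g: "g \<in> carrier G" and x: "x \<in> X1"
  have "\<sigma> h (\<sigma> g x) \<in> Xa" if h: "h \<in> carrier G" for h
  proof -
    have "\<sigma> (h \<otimes>\<^bsub>G\<^esub> g) x \<in> Xa" using x g h by (simp add: X1_def)
    then show ?thesis using aG(4)[OF h g, of x] x by (simp add: X1_def)
  qed
  then show "\<sigma> g x \<in> X1" using aG(5)[OF g] x by (simp add: X1_def)
qed

lemma X1_X0: "X1 \<subseteq> X0" and X1_space: "X1 \<subseteq> space M" and X1_Yf: "x \<in> X1 \<Longrightarrow> fst (f x) \<in> Yf" and X1_Xf: "X1 \<subseteq> Xf"
  using X1(3) by (auto simp: Xa_def X1_def)

lemma fX1: "f ` X1 \<in> sets NC" "f ` X1 \<subseteq> E" "emeasure NC (f ` X1) \<noteq> 0"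
proof -
  have m: "f ` X1 \<in> sets T" "emeasure T (f ` X1) = emeasure M X1" using f_img[OF X1(1) X1_X0] .
  then show s: "f ` X1 \<in> sets NC" "f ` X1 \<subseteq> E" using T_sets by auto
  have "emeasure M X1 = 1" using X1 by (simp add: M.emeasure_eq_measure M.prob_eq_1)
  then show "emeasure NC (f ` X1) \<noteq> 0" using T_zero[OF s] m by auto
qed

lemma pre_slice:
  assumes "B \<in> sets NC" "l \<in> carrier L"
  shows "{y \<in> space N. (\<theta> l y, a) \<in> B} \<in> sets N"
proof -
  have "\<theta> l -` {y \<in> space N. (y, a) \<in> B} \<inter> space N \<in> sets N"
    by (rule measurable_sets[OF aL(1)[OF assms(2)] slice_measurable[OF assms(1)]])
  also have "\<theta> l -` {y \<in> space N. (y, a) \<in> B} \<inter> space N = {y \<in> space N. (\<theta> l y, a) \<in> B}"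
    using aL(5)[OF assms(2)] by auto
  finally show ?thesis .
qed

text \<open>The image of \<open>X1\<close> is non-null in some slice, so its saturation is non-null,
  and ergodicity of the whole action makes it conull.\<close>

lemma Y1: "Y1 \<in> sets N" "AE y in N. y \<in> Y1" "\<And>l y. l \<in> carrier L \<Longrightarrow> y \<in> Y1 \<Longrightarrow> \<theta> l y \<in> Y1" "Y1 \<subseteq> Yf" "Y1 \<subseteq> space N"
proof -
  show YY: "Y1 \<subseteq> Yf" "Y1 \<subseteq> space N" by (auto simp: Y1_def Yf_def)
  have "Y1 = Yf \<inter> {y \<in> space N. \<exists>l\<in>carrier L. \<exists>a\<in>{1..k}. (\<theta> l y, a) \<in> f ` X1}" by (auto simp: Y1_def Yf_def)
  also have "\<dots> \<in> sets N"
    by (intro sets.Int Yf(1) sets.sets_Collect_countable_Ex'[OF _ cL] sets.sets_Collect_countable_Ex' pre_slice fX1) auto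
  finally show Ym: "Y1 \<in> sets N" .
  show inv: "\<theta> m y \<in> Y1" if m: "m \<in> carrier L" and y: "y \<in> Y1" for m y
  proof -
    obtain l a where la: "l \<in> carrier L" "a \<in> {1..k}" "(\<theta> l y, a) \<in> f ` X1" using y by (auto simp: Y1_def)
    have ys: "y \<in> space N" using y YY by auto
    have "\<theta> (l \<otimes>\<^bsub>L\<^esub> inv\<^bsub>L\<^esub> m) (\<theta> m y) = \<theta> l y" using la m ys by (simp add: aL(4,5,6))
    then show ?thesis using Yf(3)[OF m, of y] y la m unfolding Y1_def
      by (auto intro!: bexI[of _ "l \<otimes>\<^bsub>L\<^esub> inv\<^bsub>L\<^esub> m"] bexI[of _ a])
  qed
  have inv': "\<theta> m -` Y1 \<inter> space N = Y1" if m: "m \<in> carrier L" for m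
  proof (intro equalityI subsetI)
    fix y assume y: "y \<in> \<theta> m -` Y1 \<inter> space N"
    then have "\<theta> (inv\<^bsub>L\<^esub> m) (\<theta> m y) \<in> Y1" using inv m by auto
    then show "y \<in> Y1" using aL(6)[OF m, of y] y by simp
  qed (use inv[OF m] YY in auto)
  have "measure N Y1 = 0 \<or> measure N Y1 = 1"
    by (rule ergL[unfolded ergodic_action_def, rule_format, OF Ym inv'])
  moreover have "measure N Y1 \<noteq> 0"
  proof
    assume z: "measure N Y1 = 0"
    have "emeasure N {y \<in> space N. (y, a) \<in> f ` X1} = 0" if a: "a \<in> {1..k}" for a
    proof -
      have "{y \<in> space N. (y, a) \<in> f ` X1} \<subseteq> Y1"
      proof
        fix y assume y: "y \<in> {y \<in> space N. (y, a) \<in> f ` X1}"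
        then obtain x where x: "x \<in> X1" "f x = (y, a)" by auto
        have "y \<in> Yf" using X1_Yf[OF x(1)] x(2) by simp
        moreover have "(\<theta> \<one>\<^bsub>L\<^esub> y, a) \<in> f ` X1" using y aL(3)[of y] by simp
        ultimately show "y \<in> Y1" using a unfolding Y1_def by blast
      qed
      then have "emeasure N {y \<in> space N. (y, a) \<in> f ` X1} \<le> emeasure N Y1" by (rule emeasure_mono[OF _ Ym])
      then show ?thesis using z by (simp add: N.emeasure_eq_measure)
    qed
    then have "emeasure NC (f ` X1) = 0" unfolding slice_null_iff[OF pN fX1(1)] by blast
    then show False using fX1(3) by simp
  qed
  ultimately show "AE y in N. y \<in> Y1" using Ym by (simp add: N.prob_eq_1)
qed

abbreviation "M1 \<equiv> restrict_space M X1"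
abbreviation "N1 \<equiv> restrict_space N Y1"
abbreviation "q \<equiv> \<lambda>x. fst (f x)"

lemma space1: "space M1 = X1" "space N1 = Y1"
  using X1_space Y1(5) by (auto simp: space_restrict_space)

lemma sets1: "A \<in> sets M1 \<longleftrightarrow> A \<in> sets M \<and> A \<subseteq> X1" "B \<in> sets N1 \<longleftrightarrow> B \<in> sets N \<and> B \<subseteq> Y1"
  using X1(1) Y1(1) by (subst sets_restrict_space_iff; auto)+

lemma null1: "A \<in> null_sets M1 \<longleftrightarrow> A \<subseteq> X1 \<and> A \<in> null_sets M" "B \<in> null_sets N1 \<longleftrightarrow> B \<subseteq> Y1 \<and> B \<in> null_sets N"
  using null_sets_restrict_space[OF X1(1)] null_sets_restrict_space[OF Y1(1)] by auto

lemma strictM: "strict_action M1 G \<sigma>"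
  by (rule strict_action_restrict[OF pM grpG cG actG X1(1,2,4)]) (use X1_Xf in \<open>auto simp: Xf_def\<close>)

lemma strictN: "strict_action N1 L \<theta>"
  by (rule strict_action_restrict[OF pN grpL cL actL Y1(1,2,3)]) (use Y1(4) in \<open>auto simp: Yf_def\<close>)

lemma q_Y1: "x \<in> X1 \<Longrightarrow> q x \<in> Y1"
proof -
  assume x: "x \<in> X1"
  then have "(\<theta> \<one>\<^bsub>L\<^esub> (q x), snd (f x)) \<in> f ` X1" using aL(3)[of "q x"] f_space(1)[of x] X1_X0 by auto
  then show ?thesis using X1_Yf[OF x] f_space(2)[of x] x X1_X0 L.one_closed unfolding Y1_def by blast
qed

definition "pieces = (\<lambda>a. {x \<in> X1. snd (f x) = a}) ` {1..k}"

lemma om1: "orbit_map M1 G \<sigma> N1 L \<theta> q pieces"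
proof (rule orbit_map.intro[OF strictM strictN], rule orbit_map_axioms.intro)
  show "q \<in> measurable M1 N1"
  proof (rule measurableI)
    show "q x \<in> space N1" if "x \<in> space M1" for x using that q_Y1 by (simp add: space1)
    fix B assume "B \<in> sets N1"
    then have "{x \<in> X0. q x \<in> B} \<in> sets M" using sets1(2) fst_pre by auto
    then have "X1 \<inter> {x \<in> X0. q x \<in> B} \<in> sets M" using X1(1) by auto
    moreover have "q -` B \<inter> space M1 = X1 \<inter> {x \<in> X0. q x \<in> B}" using X1_X0 by (auto simp: space1)
    ultimately show "q -` B \<inter> space M1 \<in> sets M1" by (simp add: sets1)
  qed
  show "(\<exists>g\<in>carrier G. \<sigma> g x = x') \<longleftrightarrow> (\<exists>l\<in>carrier L. \<theta> l (q x) = q x')" if "x \<in> space M1" "x' \<in> space M1" for x x'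
    using orb[of x x'] that X1_X0 by (auto simp: space1)
  show "countable pieces" by (simp add: pieces_def)
  show "pieces \<subseteq> sets M1"
  proof
    fix Z assume "Z \<in> pieces"
    then obtain a where Z: "Z = {x \<in> X1. snd (f x) = a}" "a \<in> {1..k}" by (auto simp: pieces_def)
    have "E \<inter> (space N \<times> {a}) \<in> sets T" unfolding T_sets using E Z(2) by auto
    from f_pre[OF this] have "X1 \<inter> {x \<in> X0. f x \<in> E \<inter> (space N \<times> {a})} \<in> sets M" using X1(1) by auto
    moreover have "X1 \<inter> {x \<in> X0. f x \<in> E \<inter> (space N \<times> {a})} = Z"
      using X1_X0 f_E f_space(1) by (auto simp: Z mem_Times_iff)
    ultimately show "Z \<in> sets M1" by (auto simp: sets1 Z)
  qed
  show "space M1 \<subseteq> \<Union>pieces" using f_space(2) X1_X0 by (auto simp: space1 pieces_def)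
  show "inj_on q Z" if "Z \<in> pieces" for Z
  proof (rule inj_onI)
    fix x x' assume x: "x \<in> Z" "x' \<in> Z" "q x = q x'"
    then have "f x = f x'" "x \<in> X0" "x' \<in> X0" using that X1_X0 by (auto simp: pieces_def prod_eq_iff)
    then show "x = x'" using f_inj by (auto simp: inj_on_def)
  qed
  show "{x \<in> space M1. g x = g' x} \<in> sets M1" if "g \<in> measurable M1 N1" "g' \<in> measurable M1 N1" for g g'
    by (rule sets_Collect_eq[OF separating_restrict[OF sepN Y1(1)] that])
  show "q -` A \<inter> space M1 \<in> null_sets M1" if "A \<in> null_sets N1" for A
  proof -
    have "{x \<in> X0. q x \<in> A} \<in> null_sets M" using f_null that null1 by auto
    then have "X1 \<inter> {x \<in> X0. q x \<in> A} \<in> null_sets M" using null_set_Int1[OF _ X1(1)] by blast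
    moreover have "X1 \<inter> {x \<in> X0. q x \<in> A} = q -` A \<inter> space M1" using X1_X0 by (auto simp: space1)
    ultimately show ?thesis by (auto simp: null1 space1)
  qed
qed

definition "cs n = from_nat_into (carrier L \<times> {1..k}) n"
definition "ok n y \<longleftrightarrow> (\<theta> (fst (cs n)) y, snd (cs n)) \<in> f ` X1"
definition "idx y = (LEAST n. ok n y)"
text \<open>A measurable choice in the orbit: the first pair in an enumeration of group elements and
  slices that brings \<open>y\<close> into the image of \<open>X1\<close> decides where
  \<open>f\<close> is inverted.\<close>

definition "v y = the_inv_into X0 f (\<theta> (fst (cs (idx y))) y, snd (cs (idx y)))"

lemma cs: "y \<in> Y1 \<Longrightarrow> cs n \<in> carrier L \<times> {1..k}"
  unfolding cs_def by (rule from_nat_into) (auto simp: Y1_def)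

lemma ok_idx:
  assumes y: "y \<in> Y1"
  shows "ok (idx y) y"
proof -
  obtain l a where la: "(l, a) \<in> carrier L \<times> {1..k}" "(\<theta> l y, a) \<in> f ` X1" using y by (auto simp: Y1_def)
  have "countable (carrier L \<times> {1..k})" using cL by auto
  from from_nat_into_surj[OF this la(1)] obtain n where "cs n = (l, a)" by (auto simp: cs_def)
  then have "ok n y" using la by (simp add: ok_def)
  then show ?thesis unfolding idx_def by (rule LeastI)
qed

lemma v:
  assumes y: "y \<in> Y1"
  shows "v y \<in> X1" "f (v y) = (\<theta> (fst (cs (idx y))) y, snd (cs (idx y)))"
proof -
  obtain x where x: "x \<in> X1" "f x = (\<theta> (fst (cs (idx y))) y, snd (cs (idx y)))"
    using ok_idx[OF y] unfolding ok_def by (metis imageE)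
  have "v y = x" unfolding v_def x(2)[symmetric] using the_inv_into_f_f[OF f_inj] x(1) X1_X0 by auto
  then show "v y \<in> X1" "f (v y) = (\<theta> (fst (cs (idx y))) y, snd (cs (idx y)))" using x by auto
qed

lemma v_iff:
  assumes y: "y \<in> Y1" and B: "B \<subseteq> X1"
  shows "v y \<in> B \<longleftrightarrow> (\<theta> (fst (cs (idx y))) y, snd (cs (idx y))) \<in> f ` B"
  unfolding v(2)[OF y, symmetric]
  using inj_on_image_mem_iff[OF f_inj, of "v y" B] v(1)[OF y] X1_X0 B by blast

lemma idx_sets: "{y \<in> Y1. idx y = n} \<in> sets N"
proof (cases "Y1 = {}")
  case False
  then obtain y0 where y0: "y0 \<in> Y1" by blast
  have ok: "{y \<in> space N. ok m y} \<in> sets N" for m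
    unfolding ok_def by (rule pre_slice[OF fX1(1)]) (use cs[OF y0, of m] in auto)
  have iff: "idx y = n \<longleftrightarrow> ok n y \<and> (\<forall>m\<in>{..<n}. \<not> ok m y)" if y: "y \<in> Y1" for y
  proof
    assume n: "idx y = n"
    have "\<not> ok m y" if "m < idx y" for m using that unfolding idx_def by (rule not_less_Least)
    then show "ok n y \<and> (\<forall>m\<in>{..<n}. \<not> ok m y)" using ok_idx[OF y] n by simp
  next
    assume a: "ok n y \<and> (\<forall>m\<in>{..<n}. \<not> ok m y)"
    show "idx y = n" unfolding idx_def
    proof (rule Least_equality)
      show "ok n y" using a by blast
      show "n \<le> m" if "ok m y" for m using a that by (meson lessThan_iff not_le)
    qed
  qed
  have "{y \<in> Y1. idx y = n} = Y1 \<inter> {y \<in> space N. ok n y \<and> (\<forall>m\<in>{..<n}. \<not> ok m y)}"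
    using Y1(5) iff by blast
  also have "\<dots> \<in> sets N"
    by (intro sets.Int Y1(1) sets.sets_Collect_conj sets.sets_Collect_countable_All' sets.sets_Collect_neg ok) auto
  finally show ?thesis .
qed simp

lemma v_pre:
  assumes "B \<subseteq> X1"
  shows "v -` B \<inter> Y1 = (\<Union>n. {y \<in> Y1. idx y = n} \<inter> {y \<in> space N. (\<theta> (fst (cs n)) y, snd (cs n)) \<in> f ` B})"
  using v_iff[OF _ assms] Y1(5) by auto

lemma qv:
  assumes "y \<in> Y1"
  shows "\<exists>l\<in>carrier L. \<theta> l y = q (v y)"
  using v(2)[OF assms] cs[OF assms, of "idx y"] by (intro bexI[of _ "fst (cs (idx y))"]) auto

lemma same_orbit:
  assumes "y \<in> space N" "y' \<in> space N" "a \<in> carrier L" "b \<in> carrier L"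
  shows "(\<exists>l\<in>carrier L. \<theta> l (\<theta> a y) = \<theta> b y') \<longleftrightarrow> (\<exists>l\<in>carrier L. \<theta> l y = y')"
proof
  assume "\<exists>l\<in>carrier L. \<theta> l (\<theta> a y) = \<theta> b y'"
  then obtain l where l: "l \<in> carrier L" "\<theta> l (\<theta> a y) = \<theta> b y'" by blast
  have "\<theta> (inv\<^bsub>L\<^esub> b \<otimes>\<^bsub>L\<^esub> (l \<otimes>\<^bsub>L\<^esub> a)) y = y'" using l assms by (simp add: aL(4,6))
  then show "\<exists>l\<in>carrier L. \<theta> l y = y'" by (rule bexI) (use l assms in auto)
next
  assume "\<exists>l\<in>carrier L. \<theta> l y = y'"
  then obtain l where l: "l \<in> carrier L" "\<theta> l y = y'" by blast
  have "\<theta> (b \<otimes>\<^bsub>L\<^esub> (l \<otimes>\<^bsub>L\<^esub> inv\<^bsub>L\<^esub> a)) (\<theta> a y) = \<theta> b y'" using l assms by (simp add: aL(4,5,6))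
  then show "\<exists>l\<in>carrier L. \<theta> l (\<theta> a y) = \<theta> b y'" by (rule bexI) (use l assms in auto)
qed

definition "pieces' = range (\<lambda>n. {y \<in> Y1. idx y = n})"

text \<open>On a piece with constant index, \<open>v\<close> is a fixed group element followed by
  the inverse of \<open>f\<close>, hence injective and nonsingular.\<close>

lemma om2: "orbit_map N1 L \<theta> M1 G \<sigma> v pieces'"
proof (rule orbit_map.intro[OF strictN strictM], rule orbit_map_axioms.intro)
  have csL: "fst (cs n) \<in> carrier L" if "y \<in> Y1" for n y using cs[OF that, of n] by auto
  show "v \<in> measurable N1 M1"
  proof (rule measurableI)
    show "v y \<in> space M1" if "y \<in> space N1" for y using that v(1) by (simp add: space1)
    fix B assume "B \<in> sets M1"
    then have B: "B \<in> sets M" "B \<subseteq> X1" by (auto simp: sets1)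
    have fB: "f ` B \<in> sets NC" using f_img(1)[OF B(1)] B(2) X1_X0 T_sets by auto
    have "v -` B \<inter> Y1 \<in> sets N"
    proof (cases "Y1 = {}")
      case False
      then obtain y0 where "y0 \<in> Y1" by blast
      then show ?thesis unfolding v_pre[OF B(2)]
        by (intro sets.countable_nat_UN image_subsetI sets.Int idx_sets pre_slice[OF fB] csL)
    qed simp
    then show "v -` B \<inter> space N1 \<in> sets N1" by (auto simp: sets1 space1)
  qed
  show "(\<exists>l\<in>carrier L. \<theta> l y = y') \<longleftrightarrow> (\<exists>g\<in>carrier G. \<sigma> g (v y) = v y')" if y: "y \<in> space N1" "y' \<in> space N1" for y y'
  proof -
    have yY: "y \<in> Y1" "y' \<in> Y1" using y by (auto simp: space1)
    have "(\<exists>g\<in>carrier G. \<sigma> g (v y) = v y') \<longleftrightarrow> (\<exists>l\<in>carrier L. \<theta> l (q (v y)) = q (v y'))"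
      by (rule orb) (use v(1)[OF yY(1)] v(1)[OF yY(2)] X1_X0 in auto)
    also have "\<dots> \<longleftrightarrow> (\<exists>l\<in>carrier L. \<theta> l y = y')"
      unfolding v(2)[OF yY(1)] v(2)[OF yY(2)] fst_conv
      by (rule same_orbit) (use yY Y1(5) csL in auto)
    finally show ?thesis by blast
  qed
  show "countable pieces'" by (simp add: pieces'_def)
  show "pieces' \<subseteq> sets N1" using idx_sets by (auto simp: pieces'_def sets1)
  show "space N1 \<subseteq> \<Union>pieces'" by (auto simp: space1 pieces'_def)
  show "inj_on v Z" if "Z \<in> pieces'" for Z
  proof (rule inj_onI)
    fix y y' assume y: "y \<in> Z" "y' \<in> Z" "v y = v y'"
    then have yY: "y \<in> Y1" "y' \<in> Y1" "idx y = idx y'" using that by (auto simp: pieces'_def)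
    then have "\<theta> (fst (cs (idx y))) y = \<theta> (fst (cs (idx y))) y'" using v(2)[OF yY(1)] v(2)[OF yY(2)] y(3) by simp
    then show "y = y'" using aL(6)[OF csL[OF yY(1)], of y "idx y"] aL(6)[OF csL[OF yY(1)], of y' "idx y"] yY Y1(5) by (metis subsetD)
  qed
  show "{x \<in> space N1. g x = g' x} \<in> sets N1" if "g \<in> measurable N1 M1" "g' \<in> measurable N1 M1" for g g'
    by (rule sets_Collect_eq[OF separating_restrict[OF sepM X1(1)] that])
  show "v -` B \<inter> space N1 \<in> null_sets N1" if "B \<in> null_sets M1" for B
  proof -
    have B: "B \<in> sets M" "B \<subseteq> X1" "emeasure M B = 0" using that by (auto simp: null1)
    have fT: "f ` B \<in> sets T" "emeasure T (f ` B) = 0" using f_img[OF B(1)] B X1_X0 by auto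
    then have fB: "f ` B \<in> sets NC" "f ` B \<subseteq> E" using T_sets by auto
    have z: "emeasure NC (f ` B) = 0" using T_zero[OF fB] fT by simp
    have nl: "{y \<in> space N. (\<theta> l y, a) \<in> f ` B} \<in> null_sets N" if l: "l \<in> carrier L" and a: "a \<in> {1..k}" for l a
    proof (rule null_setsI)
      show m: "{y \<in> space N. (\<theta> l y, a) \<in> f ` B} \<in> sets N" by (rule pre_slice[OF fB(1) l])
      have sl: "{y \<in> space N. (y, a) \<in> f ` B} \<in> sets N" by (rule slice_measurable[OF fB(1)])
      have "{y \<in> space N. (\<theta> l y, a) \<in> f ` B} = \<theta> l -` {y \<in> space N. (y, a) \<in> f ` B} \<inter> space N"
        using aL(5)[OF l] by auto
      then have "emeasure N {y \<in> space N. (\<theta> l y, a) \<in> f ` B} = emeasure (distr N N (\<theta> l)) {y \<in> space N. (y, a) \<in> f ` B}"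
        using emeasure_distr[OF aL(1)[OF l] sl] by simp
      also have "\<dots> = 0" using z a unfolding aL(2)[OF l] slice_null_iff[OF pN fB(1)] by blast
      finally show "emeasure N {y \<in> space N. (\<theta> l y, a) \<in> f ` B} = 0" .
    qed
    have "v -` B \<inter> Y1 \<in> null_sets N"
    proof (cases "Y1 = {}")
      case False
      then obtain y0 where y0: "y0 \<in> Y1" by blast
      have "{y \<in> Y1. idx y = n} \<inter> {y \<in> space N. (\<theta> (fst (cs n)) y, snd (cs n)) \<in> f ` B} \<in> null_sets N" for n
        by (rule null_set_Int1[OF nl idx_sets]) (use cs[OF y0, of n] in auto)
      then show ?thesis unfolding v_pre[OF B(2)] by (intro null_sets_UN) auto
    qed simp
    then show ?thesis by (auto simp: null1 space1)
  qed
qed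

end

context iso_setup
begin

text \<open>The shifted map matches the two relations but need be neither injective nor measure
  preserving. Where \<open>u\<close> and the slice are constant it differs from \<open>f\<close> by
  a fixed group element; following it by elements of the factor and placing the result in any slice
  gives countably many partial isomorphisms, which \<open>greedy_isomorphism\<close>
  assembles.\<close>

lemma final_iso:
  fixes Kj :: "('k, 'd) monoid_scheme" and R :: "('x \<times> 'x) set"
  assumes X2: "X2 \<in> sets M" "X2 \<subseteq> X1" "AE x in M. x \<in> X2"
    and u: "u \<in> measurable M1 (count_space (carrier L))"
    and Kj: "group Kj" "countable (carrier Kj)" and \<iota>: "\<iota> \<in> hom Kj L"
    and erg: "ergodic_action Kj N (\<lambda>c. \<theta> (\<iota> c))"
    and iff: "\<And>x x'. x \<in> X2 \<Longrightarrow> x' \<in> X2 \<Longrightarrow>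
      (x, x') \<in> R \<longleftrightarrow> (\<exists>c\<in>carrier Kj. \<theta> (\<iota> c) (shift L \<theta> u q x) = shift L \<theta> u q x')"
  shows "rel_isomorphic M R T (amplified_rel (orbit_relation Kj N (\<lambda>c. \<theta> (\<iota> c))) E)"
proof -
  interpret Kj: group Kj by fact
  have ic: "\<iota> c \<in> carrier L" if "c \<in> carrier Kj" for c using \<iota> that by (auto simp: hom_def)
  have b1: "\<theta> (\<iota> \<one>\<^bsub>Kj\<^esub>) y = y" if "y \<in> space N" for y
    using aL(3)[OF that] hom_one[OF \<iota> Kj(1) grpL] by simp
  have bs: "\<theta> (\<iota> c) y \<in> space N" if "c \<in> carrier Kj" "y \<in> space N" for c y by (rule aL(5)[OF ic[OF that(1)] that(2)])
  have bm: "\<theta> (\<iota> (c \<otimes>\<^bsub>Kj\<^esub> d)) y = \<theta> (\<iota> c) (\<theta> (\<iota> d) y)" if "c \<in> carrier Kj" "d \<in> carrier Kj" "y \<in> space N" for c d y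
    using aL(4)[OF ic[OF that(1)] ic[OF that(2)] that(3)] hom_mult[OF \<iota> that(1,2)] by simp
  have bi: "\<theta> (\<iota> (inv\<^bsub>Kj\<^esub> c)) (\<theta> (\<iota> c) y) = y" if "c \<in> carrier Kj" "y \<in> space N" for c y
    using bm[of "inv\<^bsub>Kj\<^esub> c" c y] that b1 by simp
  \<comment> \<open>The data of one partial map: slice of origin, value of \<open>u\<close>,
    correcting element of the factor, slice of destination.\<close>
  define Idx where "Idx = {1..k} \<times> carrier L \<times> carrier Kj \<times> {1..k}"
  define ia where "ia n = fst (from_nat_into Idx n)" for n
  define il where "il n = fst (snd (from_nat_into Idx n))" for n
  define ik where "ik n = fst (snd (snd (from_nat_into Idx n)))" for n
  define ib where "ib n = snd (snd (snd (from_nat_into Idx n)))" for n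
  have "\<exists>x. x \<in> X1" using fX1(3) by (cases "X1 = {}") auto
  then have "{1..k} \<noteq> {}" using f_space(2) X1_X0 by blast
  moreover have "carrier L \<noteq> {}" "carrier Kj \<noteq> {}" using L.one_closed Kj.one_closed by blast+
  ultimately have "Idx \<noteq> {}" by (simp add: Idx_def)
  then have "from_nat_into Idx n \<in> Idx" for n by (rule from_nat_into)
  then have ix: "ia n \<in> {1..k}" "il n \<in> carrier L" "ik n \<in> carrier Kj" "ib n \<in> {1..k}" for n
    unfolding ia_def il_def ik_def ib_def by (simp_all only: Idx_def mem_Times_iff)
  have ix_surj: "\<exists>n. ia n = a \<and> il n = l \<and> ik n = c \<and> ib n = b"
    if "a \<in> {1..k}" "l \<in> carrier L" "c \<in> carrier Kj" "b \<in> {1..k}" for a l c b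
  proof -
    have cI: "countable Idx" unfolding Idx_def using cL Kj(2) by auto
    have mI: "(a, l, c, b) \<in> Idx" using that by (simp add: Idx_def)
    obtain n where "from_nat_into Idx n = (a, l, c, b)" using from_nat_into_surj[OF cI mI] by (elim exE)
    then show ?thesis unfolding ia_def il_def ik_def ib_def by (intro exI[of _ n]) simp
  qed
  define h where "h n = \<iota> (ik n) \<otimes>\<^bsub>L\<^esub> inv\<^bsub>L\<^esub> (il n)" for n
  have h: "h n \<in> carrier L" for n unfolding h_def by (intro L.m_closed L.inv_closed ic ix)
  define \<tau> where "\<tau> n x = (\<theta> (h n) (q x), ib n)" for n x
  define En where "En n B = {x \<in> X2. snd (f x) = ia n \<and> u x = il n \<and> \<tau> n x \<in> B}" for n B
  let ?z = "shift L \<theta> u q"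
  have X2_X0: "X2 \<subseteq> X0" using X2(2) X1_X0 by blast
  have qs: "q x \<in> space N" if "x \<in> X2" for x using f_space(1) that X2_X0 by blast
  have uc: "u x \<in> carrier L" if "x \<in> X2" for x
    using measurable_space[OF u, of x] that X2(2) by (auto simp: space1)
  have zs: "?z x \<in> space N" if "x \<in> X2" for x
    unfolding shift_def by (rule aL(5)[OF L.inv_closed[OF uc[OF that]] qs[OF that]])
  have \<tau>z: "\<tau> n x = (\<theta> (\<iota> (ik n)) (?z x), ib n)" if "x \<in> X2" "u x = il n" for n x
    using aL(4)[OF ic[OF ix(3)] L.inv_closed[OF ix(2)] qs[OF that(1)]] that(2) by (simp add: \<tau>_def shift_def h_def)
  have En_sets: "En n B \<in> sets M" if B: "B \<in> sets T" for n B
  proof -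
    have BN: "B \<in> sets NC" using B T_sets by auto
    have s: "{y \<in> space N. (\<theta> (h n) y, ib n) \<in> B} \<in> sets N" by (rule pre_slice[OF BN h])
    have "E \<inter> ({y \<in> space N. (\<theta> (h n) y, ib n) \<in> B} \<times> {ia n}) \<in> sets T"
      unfolding T_sets using E s ix(1) by (auto intro!: sets.Int pair_measureI)
    note f1 = f_pre[OF this]
    have "u -` {il n} \<inter> space M1 \<in> sets M1" using measurable_sets[OF u, of "{il n}"] ix(2) by auto
    then have f2: "u -` {il n} \<inter> X1 \<in> sets M" by (simp only: sets1(1) space1)
    have "En n B = X2 \<inter> (u -` {il n} \<inter> X1) \<inter> {x \<in> X0. f x \<in> E \<inter> ({y \<in> space N. (\<theta> (h n) y, ib n) \<in> B} \<times> {ia n})}"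
      using X2(2) X2_X0 qs f_E unfolding En_def \<tau>_def by (auto simp: mem_Times_iff)
    then show ?thesis using sets.Int[OF sets.Int[OF X2(1) f2] f1] by simp
  qed
  have orel: "(w, w') \<in> orbit_relation Kj N (\<lambda>c. \<theta> (\<iota> c)) \<longleftrightarrow> (\<exists>e\<in>carrier Kj. \<theta> (\<iota> e) w = w')"
    if "w \<in> space N" for w w' using that by (auto simp: orbit_relation_def orbit_def)
  have ET: "E \<in> sets T" unfolding T_sets using E by simp
  have eqE: "{x \<in> En n E. \<tau> n x \<in> B} = En n B" if "B \<in> sets T" for n B
    using that T_sets unfolding En_def by blast
  have pT: "prob_space T"
  proof
    have "emeasure T E = ennreal (1 / t) * ennreal t" using T_emeasure[OF E] emE by simp
    also have "\<dots> = ennreal ((1 / t) * t)" using t by (intro ennreal_mult[symmetric]) auto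
    finally show "emeasure T (space T) = 1" using t by (simp add: T_space)
  qed
  show ?thesis
  proof (rule greedy_isomorphism[where E = "\<lambda>n. En n E" and \<tau> = \<tau>])
    show "prob_space M" "prob_space T" by (rule pM pT)+
    show "En n E \<in> sets M" for n by (rule En_sets[OF ET])
    show "\<tau> n x \<in> space T" if "x \<in> En n E" for n x using that by (simp add: En_def T_space)
    show "{x \<in> En n E. \<tau> n x \<in> B} \<in> sets M" if "B \<in> sets T" for n B unfolding eqE[OF that] by (rule En_sets[OF that])
    show "inj_on (\<tau> n) (En n E)" for n
    proof (rule inj_onI)
      fix x x' assume x: "x \<in> En n E" "x' \<in> En n E" "\<tau> n x = \<tau> n x'"
      have xX: "x \<in> X2" "x' \<in> X2" using x by (auto simp: En_def)
      have "\<theta> (h n) (q x) = \<theta> (h n) (q x')" using x(3) by (simp add: \<tau>_def)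
      then have "q x = q x'" using aL(6)[OF h qs[OF xX(1)], of n] aL(6)[OF h qs[OF xX(2)], of n] by metis
      then have "f x = f x'" using x(1,2) by (simp add: En_def prod_eq_iff)
      then show "x = x'" using f_inj xX X2_X0 by (meson inj_onD subsetD)
    qed
    show "\<tau> n ` A \<in> sets T \<and> emeasure T (\<tau> n ` A) = emeasure M A" if A: "A \<in> sets M" "A \<subseteq> En n E" for n A
    proof -
      have AX: "A \<subseteq> X0" using A(2) X2_X0 by (auto simp: En_def)
      note fA = f_img[OF A(1) AX]
      have fN: "f ` A \<in> sets NC" "f ` A \<subseteq> E" using fA(1) T_sets by auto
      have fa: "c = ia n" if yc: "(y, c) \<in> f ` A" for y c
      proof -
        obtain x where x: "(y, c) = f x" "x \<in> A" using yc by (rule imageE)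
        have "snd (f x) = ia n" using A(2) x(2) unfolding En_def by blast
        then show ?thesis unfolding x(1)[symmetric] by simp
      qed
      have im: "(\<lambda>(y, c). (\<theta> (h n) y, ib n)) ` f ` A = \<tau> n ` A"
        unfolding image_image \<tau>_def by (simp add: case_prod_beta)
      have sub: "\<tau> n ` A \<subseteq> E" using A(2) by (auto simp: En_def)
      have s: "\<tau> n ` A \<in> sets NC"
        unfolding im[symmetric] by (rule amplified_move(1)[OF pN actL grpL h ix(1,4) fN(1) fa])
      have e: "emeasure NC (\<tau> n ` A) = emeasure NC (f ` A)"
        unfolding im[symmetric] by (rule amplified_move(2)[OF pN actL grpL h ix(1,4) fN(1) fa])
      have "\<tau> n ` A \<in> sets T" unfolding T_sets using s sub by simp
      moreover have "emeasure T (\<tau> n ` A) = emeasure T (f ` A)"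
        by (simp only: T_emeasure[OF s sub] T_emeasure[OF fN] e)
      ultimately show ?thesis using fA(2) by simp
    qed
    show "\<exists>n. \<exists>x\<in>A \<inter> En n E. \<tau> n x \<in> B"
      if A: "A \<in> sets M" and B: "B \<in> sets T" and nz: "emeasure M A \<noteq> 0" "emeasure T B \<noteq> 0" for A B
    proof -
      have BN: "B \<in> sets NC" "B \<subseteq> E" using B T_sets by auto
      have "emeasure NC B \<noteq> 0" using T_zero[OF BN] nz(2) by simp
      then obtain b where b: "b \<in> {1..k}" "emeasure N {y \<in> space N. (y, b) \<in> B} \<noteq> 0"
        unfolding slice_null_iff[OF pN BN(1)] by blast
      \<comment> \<open>The saturation under the factor of a non-null slice of \<open>B\<close>.
        Ergodicity of the factor makes it conull, so almost every point can be moved into that slice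
        by the factor.\<close>
      define Sat where "Sat = {y \<in> space N. \<exists>c\<in>carrier Kj. (\<theta> (\<iota> c) y, b) \<in> B}"
      have Sm: "Sat \<in> sets N" unfolding Sat_def
        by (rule sets.sets_Collect_countable_Ex'[OF _ Kj(2)]) (rule pre_slice[OF BN(1) ic])
      have inv: "\<theta> (\<iota> g) -` Sat \<inter> space N = Sat" if g: "g \<in> carrier Kj" for g
      proof (intro equalityI subsetI)
        fix y assume "y \<in> \<theta> (\<iota> g) -` Sat \<inter> space N"
        then obtain c where c: "y \<in> space N" "c \<in> carrier Kj" "(\<theta> (\<iota> c) (\<theta> (\<iota> g) y), b) \<in> B" by (auto simp: Sat_def)
        then have "(\<theta> (\<iota> (c \<otimes>\<^bsub>Kj\<^esub> g)) y, b) \<in> B" using bm[OF c(2) g c(1)] by simp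
        then show "y \<in> Sat" using c g unfolding Sat_def by blast
      next
        fix y assume "y \<in> Sat"
        then obtain c where c: "y \<in> space N" "c \<in> carrier Kj" "(\<theta> (\<iota> c) y, b) \<in> B" by (auto simp: Sat_def)
        have "\<theta> (\<iota> (c \<otimes>\<^bsub>Kj\<^esub> inv\<^bsub>Kj\<^esub> g)) (\<theta> (\<iota> g) y) = \<theta> (\<iota> c) y"
          using bm[OF c(2) Kj.inv_closed[OF g] bs[OF g c(1)]] bi[OF g c(1)] by simp
        then have "(\<theta> (\<iota> (c \<otimes>\<^bsub>Kj\<^esub> inv\<^bsub>Kj\<^esub> g)) (\<theta> (\<iota> g) y), b) \<in> B" using c(3) by simp
        moreover have "c \<otimes>\<^bsub>Kj\<^esub> inv\<^bsub>Kj\<^esub> g \<in> carrier Kj" using c(2) g by simp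
        ultimately have "\<theta> (\<iota> g) y \<in> Sat" using bs[OF g c(1)] unfolding Sat_def by blast
        then show "y \<in> \<theta> (\<iota> g) -` Sat \<inter> space N" using c(1) by simp
      qed
      have "measure N Sat = 0 \<or> measure N Sat = 1" by (rule erg[unfolded ergodic_action_def, rule_format, OF Sm inv])
      moreover have "measure N Sat \<noteq> 0"
      proof
        assume z: "measure N Sat = 0"
        have "{y \<in> space N. (y, b) \<in> B} \<subseteq> Sat"
        proof
          fix y assume "y \<in> {y \<in> space N. (y, b) \<in> B}"
          then have "y \<in> space N" "(\<theta> (\<iota> \<one>\<^bsub>Kj\<^esub>) y, b) \<in> B" using b1[of y] by auto
          then show "y \<in> Sat" unfolding Sat_def using Kj.one_closed by blast
        qed
        then have "emeasure N {y \<in> space N. (y, b) \<in> B} \<le> emeasure N Sat" by (rule emeasure_mono[OF _ Sm])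
        then show False using z b(2) by (simp add: N.emeasure_eq_measure)
      qed
      ultimately have AES: "AE y in N. y \<in> Sat" using Sm by (simp add: N.prob_eq_1)
      \<comment> \<open>Asked for all translates at once because the shift by \<open>u x\<close>
        varies with the point.\<close>
      have "AE y in N. \<forall>l\<in>carrier L. \<theta> l y \<in> Sat"
        unfolding AE_ball_countable[OF cL]
      proof
        fix l assume l: "l \<in> carrier L"
        have "AE y in distr N N (\<theta> l). y \<in> Sat" unfolding aL(2)[OF l] by (rule AES)
        then show "AE y in N. \<theta> l y \<in> Sat" by (rule AE_distrD[OF aL(1)[OF l]])
      qed
      from AE_null_superset[OF this] obtain Z where
        Z: "Z \<in> null_sets N" "{y \<in> space N. \<not> (\<forall>l\<in>carrier L. \<theta> l y \<in> Sat)} \<subseteq> Z" by (elim bexE)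
      have Z': "\<forall>l\<in>carrier L. \<theta> l y \<in> Sat" if "y \<in> space N" "y \<notin> Z" for y using Z(2) that by blast
      have AEx: "AE x in M. x \<in> X2 \<and> (\<forall>l\<in>carrier L. \<theta> l (q x) \<in> Sat)" using AE_not_in[OF f_null[OF Z(1)]] X2(3)
        by eventually_elim (use Z' qs X2_X0 in \<open>auto simp: subset_eq\<close>)
      have "\<exists>x\<in>A. x \<in> X2 \<and> (\<forall>l\<in>carrier L. \<theta> l (q x) \<in> Sat)"
      proof (rule ccontr)
        assume no: "\<not> ?thesis"
        have AA: "{x \<in> space M. \<not> x \<notin> A} = A" using sets.sets_into_space[OF A] by blast
        have "AE x in M. x \<notin> A" using AEx by eventually_elim (use no in blast)
        then have "emeasure M A = 0" using AE_iff_measurable[OF A AA] by simp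
        then show False using nz(1) by simp
      qed
      then obtain x where x: "x \<in> A" "x \<in> X2" "\<forall>l\<in>carrier L. \<theta> l (q x) \<in> Sat" by blast
      have "?z x \<in> Sat" unfolding shift_def using x(3) uc[OF x(2)] by simp
      then obtain c where c: "c \<in> carrier Kj" "(\<theta> (\<iota> c) (?z x), b) \<in> B" unfolding Sat_def by blast
      have "snd (f x) \<in> {1..k}" by (rule f_space(2)) (use x(2) X2_X0 in blast)
      from ix_surj[OF this uc[OF x(2)] c(1) b(1)] obtain n where
        n: "ia n = snd (f x)" "il n = u x" "ik n = c" "ib n = b" by blast
      have tB: "\<tau> n x \<in> B" unfolding \<tau>z[OF x(2) n(2)[symmetric]] using n c(2) by simp
      then have "x \<in> En n E" unfolding En_def using n x(2) BN(2) by auto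
      then show ?thesis using x(1) tB by blast
    qed
    show "(x, x') \<in> R \<longleftrightarrow> (\<tau> n x, \<tau> m x') \<in> amplified_rel (orbit_relation Kj N (\<lambda>c. \<theta> (\<iota> c))) E"
      if x: "x \<in> En n E" and x': "x' \<in> En m E" for n m x x'
    proof -
      have xX: "x \<in> X2" "x' \<in> X2" "u x = il n" "u x' = il m" "\<tau> n x \<in> E" "\<tau> m x' \<in> E" using x x' by (auto simp: En_def)
      note z = zs[OF xX(1)] zs[OF xX(2)]
      let ?c = "ik n" and ?d = "ik m"
      have "(\<tau> n x, \<tau> m x') \<in> amplified_rel (orbit_relation Kj N (\<lambda>c. \<theta> (\<iota> c))) E \<longleftrightarrow>
          (\<exists>e\<in>carrier Kj. \<theta> (\<iota> e) (\<theta> (\<iota> ?c) (?z x)) = \<theta> (\<iota> ?d) (?z x'))"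
        unfolding orel[OF bs[OF ix(3)[of n] z(1)], symmetric]
        using xX(5,6) unfolding \<tau>z[OF xX(1,3)] \<tau>z[OF xX(2,4)] by (simp add: amplified_rel_def)
      also have "\<dots> \<longleftrightarrow> (\<exists>e\<in>carrier Kj. \<theta> (\<iota> e) (?z x) = ?z x')"
      proof
        assume "\<exists>e\<in>carrier Kj. \<theta> (\<iota> e) (\<theta> (\<iota> ?c) (?z x)) = \<theta> (\<iota> ?d) (?z x')"
        then obtain e where e: "e \<in> carrier Kj" "\<theta> (\<iota> e) (\<theta> (\<iota> ?c) (?z x)) = \<theta> (\<iota> ?d) (?z x')" by blast
        have "\<theta> (\<iota> (inv\<^bsub>Kj\<^esub> ?d \<otimes>\<^bsub>Kj\<^esub> (e \<otimes>\<^bsub>Kj\<^esub> ?c))) (?z x) = ?z x'"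
          using e z ix(3) by (simp add: bm bi)
        then show "\<exists>e\<in>carrier Kj. \<theta> (\<iota> e) (?z x) = ?z x'" by (rule bexI) (use e ix(3) in simp)
      next
        assume "\<exists>e\<in>carrier Kj. \<theta> (\<iota> e) (?z x) = ?z x'"
        then obtain e where e: "e \<in> carrier Kj" "\<theta> (\<iota> e) (?z x) = ?z x'" by blast
        have "\<theta> (\<iota> (?d \<otimes>\<^bsub>Kj\<^esub> (e \<otimes>\<^bsub>Kj\<^esub> inv\<^bsub>Kj\<^esub> ?c))) (\<theta> (\<iota> ?c) (?z x)) = \<theta> (\<iota> ?d) (?z x')"
          using e z ix(3) bs by (simp add: bm bi)
        then show "\<exists>e\<in>carrier Kj. \<theta> (\<iota> e) (\<theta> (\<iota> ?c) (?z x)) = \<theta> (\<iota> ?d) (?z x')" by (rule bexI) (use e ix(3) in simp)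
      qed
      finally show ?thesis using iff[OF xX(1,2)] by blast
    qed
  qed
qed

lemma vq:
  assumes "x \<in> X1"
  shows "\<exists>g\<in>carrier G. \<sigma> g x = v (q x)"
proof -
  have y: "q x \<in> Y1" by (rule q_Y1[OF assms])
  show ?thesis using orb[of x "v (q x)"] qv[OF y] v(1)[OF y] assms X1_X0 by blast
qed

lemma ergodic_on_M1:
  assumes \<iota>: "\<iota> \<in> hom K G" and erg: "ergodic_action K M (\<lambda>g. \<sigma> (\<iota> g))"
  shows "ergodic_on K M1 (\<lambda>g. \<sigma> (\<iota> g))"
  unfolding ergodic_on_def
proof (intro ballI impI)
  fix A assume A: "A \<in> sets M1" and inv: "\<forall>g\<in>carrier K. \<sigma> (\<iota> g) -` A \<inter> space M1 = A"
  have Am: "A \<in> sets M" "A \<subseteq> X1" using A sets1 by auto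
  have eqA: "\<sigma> (\<iota> g) -` A \<inter> space M = A" if g: "g \<in> carrier K" for g
  proof -
    have ig: "\<iota> g \<in> carrier G" using \<iota> g by (auto simp: hom_def)
    have "x \<in> X1" if "x \<in> space M" "\<sigma> (\<iota> g) x \<in> A" for x
      using X1(4)[OF G.inv_closed[OF ig], of "\<sigma> (\<iota> g) x"] aG(6)[OF ig that(1)] that(2) Am(2) by auto
    then have "\<sigma> (\<iota> g) -` A \<inter> space M = \<sigma> (\<iota> g) -` A \<inter> X1" using X1_space by blast
    then show ?thesis using inv[rule_format, OF g] unfolding space1 by simp
  qed
  have "measure M A = 0 \<or> measure M A = 1" by (rule erg[unfolded ergodic_action_def, rule_format, OF Am(1) eqA])
  then show "measure M1 A = 0 \<or> measure M1 A = 1" using Am X1(1) by (simp add: measure_restrict_space)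
qed

lemma ergodic_on_N1:
  assumes \<iota>: "\<iota> \<in> hom K L" and erg: "ergodic_action K N (\<lambda>g. \<theta> (\<iota> g))"
  shows "ergodic_on K N1 (\<lambda>g. \<theta> (\<iota> g))"
  unfolding ergodic_on_def
proof (intro ballI impI)
  fix A assume A: "A \<in> sets N1" and inv: "\<forall>g\<in>carrier K. \<theta> (\<iota> g) -` A \<inter> space N1 = A"
  have Am: "A \<in> sets N" "A \<subseteq> Y1" using A sets1 by auto
  have eqA: "\<theta> (\<iota> g) -` A \<inter> space N = A" if g: "g \<in> carrier K" for g
  proof -
    have ig: "\<iota> g \<in> carrier L" using \<iota> g by (auto simp: hom_def)
    have "y \<in> Y1" if "y \<in> space N" "\<theta> (\<iota> g) y \<in> A" for y
      using Y1(3)[OF L.inv_closed[OF ig], of "\<theta> (\<iota> g) y"] aL(6)[OF ig that(1)] that(2) Am(2) by auto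
    then have "\<theta> (\<iota> g) -` A \<inter> space N = \<theta> (\<iota> g) -` A \<inter> Y1" using Y1(5) by blast
    then show ?thesis using inv[rule_format, OF g] unfolding space1 by simp
  qed
  have "measure N A = 0 \<or> measure N A = 1" by (rule erg[unfolded ergodic_action_def, rule_format, OF Am(1) eqA])
  then show "measure N1 A = 0 \<or> measure N1 A = 1" using Am Y1(1) by (simp add: measure_restrict_space)
qed

end

section \<open>The main theorem\<close>

lemma countable_free_product:
  assumes "countable I" "\<And>i. i \<in> I \<Longrightarrow> countable (carrier (G i))"
  shows "countable (carrier (free_product I G))"
proof -
  have "countable (SIGMA i:I. carrier (G i))" using assms by (intro countable_SIGMA)
  then have "countable (free_product_words I G)" unfolding free_product_words_def by (rule countable_lists)
  then show ?thesis unfolding free_product_def quotient_def by simp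
qed

text \<open>In a finite group the trivial subgroup is abelian of finite index.\<close>

lemma infinite_of_not_virtually_abelian:
  assumes "group K" "H \<lhd> K" "\<not> virtually_abelian (K\<lparr>carrier := H\<rparr>)"
  shows "infinite H"
proof
  assume fin: "finite H"
  interpret H: group "K\<lparr>carrier := H\<rparr>"
    using group.subgroup_imp_group[OF assms(1) normal_imp_subgroup[OF assms(2)]] .
  let ?H = "K\<lparr>carrier := H\<rparr>"
  have s: "subgroup {\<one>\<^bsub>?H\<^esub>} ?H" by (rule H.triv_subgroup)
  have "group (?H\<lparr>carrier := {\<one>\<^bsub>?H\<^esub>}\<rparr>)" by (rule H.subgroup_imp_group[OF s])
  then have "comm_group (?H\<lparr>carrier := {\<one>\<^bsub>?H\<^esub>}\<rparr>)" by (rule group.group_comm_groupI) simp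
  moreover have "finite (rcosets\<^bsub>?H\<^esub> {\<one>\<^bsub>?H\<^esub>})" unfolding RCOSETS_def using fin by simp
  ultimately have "virtually_abelian ?H" unfolding virtually_abelian_def using s by blast
  then show False using assms(3) by simp
qed

lemma enat_eq_of_bij:
  assumes "bij_betw F {i. enat i \<le> n \<and> 1 \<le> i} {j. enat j \<le> m \<and> 1 \<le> j}"
  shows "n = m"
proof -
  have fin: "{i. enat i \<le> enat a \<and> 1 \<le> i} = {1..a}" and inf: "{i. enat i \<le> \<infinity> \<and> 1 \<le> i} = {1..}" for a
    by auto
  have i: "infinite {1::nat..}" by (rule infinite_Ici)
  note fc = bij_betw_finite[OF assms] bij_betw_same_card[OF assms]
  show ?thesis
  proof (cases n)
    case hn: (enat a)
    show ?thesis
    proof (cases m)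
      case hm: (enat b)
      show ?thesis using fc(2) unfolding hn hm fin by simp
    next
      case hm: infinity
      show ?thesis using fc(1) i unfolding hn hm fin inf by simp
    qed
  next
    case hn: infinity
    show ?thesis
    proof (cases m)
      case hm: (enat b)
      show ?thesis using fc(1) i unfolding hn hm fin inf by simp
    next
      case hm: infinity
      show ?thesis unfolding hn hm by (rule HOL.refl)
    qed
  qed
qed

theorem corollary0p5:
  fixes \<Gamma> :: "nat \<Rightarrow> 'g monoid" and \<Lambda> :: "nat \<Rightarrow> 'h monoid"
    and n m :: enat
    and M :: "'x measure" and N :: "'y measure"
    and \<sigma> :: "(nat \<times> 'g) list set \<Rightarrow> 'x \<Rightarrow> 'x"
    and \<theta> :: "(nat \<times> 'h) list set \<Rightarrow> 'y \<Rightarrow> 'y"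
    and t :: real
  defines "I \<equiv> {i. enat i \<le> n}" and "J \<equiv> {j. enat j \<le> m}"
  assumes "1 \<le> n" and "1 \<le> m"
    and "\<And>i. i \<in> I \<Longrightarrow> group (\<Gamma> i) \<and> countable (carrier (\<Gamma> i))"
    and "\<And>j. j \<in> J \<Longrightarrow> group (\<Lambda> j) \<and> countable (carrier (\<Lambda> j))"
    and "haagerup_property (\<Gamma> 0)" and "haagerup_property (\<Lambda> 0)"
    and "\<And>i. i \<in> I \<Longrightarrow> i \<ge> 1 \<Longrightarrow> icc_group (\<Gamma> i) \<and>
           (\<exists>H. H \<lhd> \<Gamma> i \<and> \<not> virtually_abelian (\<Gamma> i\<lparr>carrier := H\<rparr>) \<and> relative_property_T (\<Gamma> i) H)"
    and "\<And>j. j \<in> J \<Longrightarrow> j \<ge> 1 \<Longrightarrow> icc_group (\<Lambda> j) \<and>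
           (\<exists>H. H \<lhd> \<Lambda> j \<and> \<not> virtually_abelian (\<Lambda> j\<lparr>carrier := H\<rparr>) \<and> relative_property_T (\<Lambda> j) H)"
    and "infinite (carrier (\<Gamma> 0)) \<or> n \<ge> 2"
    and "standard_prob_space M" and "standard_prob_space N"
    and "pmp_action (free_product I \<Gamma>) M \<sigma>" and "free_action (free_product I \<Gamma>) M \<sigma>"
    and "ergodic_action (free_product I \<Gamma>) M \<sigma>"
    and "pmp_action (free_product J \<Lambda>) N \<theta>" and "free_action (free_product J \<Lambda>) N \<theta>"
    and "ergodic_action (free_product J \<Lambda>) N \<theta>"
    and "\<And>i. i \<in> I \<Longrightarrow> i \<ge> 1 \<Longrightarrow> ergodic_action (\<Gamma> i) M (\<lambda>g. \<sigma> (free_product_incl I \<Gamma> i g))"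
    and "\<And>j. j \<in> J \<Longrightarrow> j \<ge> 1 \<Longrightarrow> ergodic_action (\<Lambda> j) N (\<lambda>h. \<theta> (free_product_incl J \<Lambda> j h))"
    and "t > 0"
    and "isomorphic_to_amplification M (orbit_relation (free_product I \<Gamma>) M \<sigma>)
           N (orbit_relation (free_product J \<Lambda>) N \<theta>) t"
  shows "n = m \<and>
    (\<exists>\<pi>. \<pi> permutes {i \<in> I. i \<ge> 1} \<and>
      (\<forall>i\<in>I. i \<ge> 1 \<longrightarrow>
        isomorphic_to_amplification
          M (orbit_relation (\<Gamma> i) M (\<lambda>g. \<sigma> (free_product_incl I \<Gamma> i g)))
          N (orbit_relation (\<Lambda> (\<pi> i)) N (\<lambda>h. \<theta> (free_product_incl J \<Lambda> (\<pi> i) h))) t))"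
proof -
  let ?G = "free_product I \<Gamma>" and ?L = "free_product J \<Lambda>"
  let ?ii = "free_product_incl I \<Gamma>" and ?ij = "free_product_incl J \<Lambda>"
  note gc1 = assms(5) and gc2 = assms(6) and haag1 = assms(7) and haag2 = assms(8)
    and rT1 = assms(9) and rT2 = assms(10) and stM = assms(12) and stN = assms(13)
    and erg1 = assms(20) and erg2 = assms(21)
  have gr1: "group (\<Gamma> i)" and cn1: "countable (carrier (\<Gamma> i))" if "i \<in> I" for i using gc1[OF that] by blast+
  have gr2: "group (\<Lambda> j)" and cn2: "countable (carrier (\<Lambda> j))" if "j \<in> J" for j using gc2[OF that] by blast+
  have cI: "countable I" and cJ: "countable J" by (rule countableI_type)+
  interpret gI: group_family I \<Gamma> by (rule group_family.intro[OF gr1])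
  interpret gJ: group_family J \<Lambda> by (rule group_family.intro[OF gr2])
  have hom1: "?ii i \<in> hom (\<Gamma> i) ?G" if "i \<in> I" for i by (rule free_product_incl_hom[OF gr1 that])
  have hom2: "?ij j \<in> hom (\<Lambda> j) ?L" if "j \<in> J" for j by (rule free_product_incl_hom[OF gr2 that])
  have inj1: "inj_on (?ii i) (carrier (\<Gamma> i))" if "i \<in> I" for i using gI.incl_inj[OF that] by (intro inj_onI)
  have inj2: "inj_on (?ij j) (carrier (\<Lambda> j))" if "j \<in> J" for j using gJ.incl_inj[OF that] by (intro inj_onI)
  obtain k E where kE: "real k \<ge> t" "E \<in> sets (N \<Otimes>\<^sub>M count_space {1..k})"
      "emeasure (N \<Otimes>\<^sub>M count_space {1..k}) E = ennreal t"
      "rel_isomorphic M (orbit_relation ?G M \<sigma>) (amplified_space N k E t) (amplified_rel (orbit_relation ?L N \<theta>) E)"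
    using assms(23) unfolding isomorphic_to_amplification_def by (elim exE conjE)
  obtain X0 Y0 f where F: "X0 \<in> sets M" "Y0 \<in> sets (amplified_space N k E t)" "AE x in M. x \<in> X0"
      "bij_betw f X0 Y0"
      "f \<in> measurable (restrict_space M X0) (restrict_space (amplified_space N k E t) Y0)"
      "the_inv_into X0 f \<in> measurable (restrict_space (amplified_space N k E t) Y0) (restrict_space M X0)"
      "distr (restrict_space M X0) (restrict_space (amplified_space N k E t) Y0) f = restrict_space (amplified_space N k E t) Y0"
      "\<forall>x\<in>X0. \<forall>x'\<in>X0. (x, x') \<in> orbit_relation ?G M \<sigma> \<longleftrightarrow> (f x, f x') \<in> amplified_rel (orbit_relation ?L N \<theta>) E"
    using kE(4) unfolding rel_isomorphic_def by (elim exE conjE)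
  interpret iso_setup M ?G \<sigma> N ?L \<theta> t k E X0 Y0 f
  proof (rule iso_setup.intro)
    show "prob_space M" "prob_space N" using stM stN by (auto simp: standard_prob_space_def)
    show "group ?G" by (rule group_free_product[OF gr1])
    show "group ?L" by (rule group_free_product[OF gr2])
    show "countable (carrier ?G)" by (rule countable_free_product[OF cI cn1])
    show "countable (carrier ?L)" by (rule countable_free_product[OF cJ cn2])
    show "separating M" "separating N" by (rule separating_standard[OF stM] separating_standard[OF stN])+
    show "(x, x') \<in> orbit_relation ?G M \<sigma> \<longleftrightarrow> (f x, f x') \<in> amplified_rel (orbit_relation ?L N \<theta>) E"
      if "x \<in> X0" "x' \<in> X0" for x x' using F(8) that by blast
  qed (fact assms kE F)+
  \<comment> \<open>Records that on the invariant set \<open>D\<close> the shift by \<open>u\<close>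
    carries orbits of the \<open>i\<close>-th factor into orbits of the \<open>j\<close>-th;
    \<open>SB\<close> is the same for the map back.\<close>
  define SA where "SA i j D u \<longleftrightarrow> D \<in> sets M1 \<and> (AE x in M1. x \<in> D) \<and> u \<in> measurable M1 (count_space (carrier ?L)) \<and>
    (\<forall>k\<in>carrier (\<Gamma> i). \<forall>x\<in>D. \<sigma> (?ii i k) x \<in> D \<and> (\<exists>b\<in>carrier (\<Lambda> j).
      shift ?L \<theta> u q (\<sigma> (?ii i k) x) = \<theta> (?ij j b) (shift ?L \<theta> u q x)))" for i j D u
  define SB where "SB j i D u \<longleftrightarrow> D \<in> sets N1 \<and> (AE y in N1. y \<in> D) \<and> u \<in> measurable N1 (count_space (carrier ?G)) \<and>
    (\<forall>k\<in>carrier (\<Lambda> j). \<forall>y\<in>D. \<theta> (?ij j k) y \<in> D \<and> (\<exists>b\<in>carrier (\<Gamma> i).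
      shift ?G \<sigma> u v (\<theta> (?ij j k) y) = \<sigma> (?ii i b) (shift ?G \<sigma> u v y)))" for j i D u
  have exA: "\<exists>j. j \<in> J \<and> 1 \<le> j \<and> (\<exists>D u. SA i j D u)" if i: "i \<in> I" "1 \<le> i" for i
  proof -
    obtain H where H: "H \<lhd> \<Gamma> i" "\<not> virtually_abelian (\<Gamma> i\<lparr>carrier := H\<rparr>)" "relative_property_T (\<Gamma> i) H"
      using rT1[OF i] by blast
    have "\<exists>j D u. j \<in> J \<and> j \<noteq> 0 \<and> SA i j D u" unfolding SA_def
      by (rule orbit_map_section[OF om1 cJ gc2 gr1[OF i(1)] cn1[OF i(1)] hom1[OF i(1)] inj1[OF i(1)] H(1)
        infinite_of_not_virtually_abelian[OF gr1[OF i(1)] H(1,2)] H(3) ergodic_on_M1[OF hom1[OF i(1)] erg1[OF i]] haag2])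
    then obtain j D u where "j \<in> J" "j \<noteq> 0" "SA i j D u" by (elim exE conjE)
    then show ?thesis by (metis less_one linorder_not_le)
  qed
  have exB: "\<exists>i. i \<in> I \<and> 1 \<le> i \<and> (\<exists>D u. SB j i D u)" if j: "j \<in> J" "1 \<le> j" for j
  proof -
    obtain H where H: "H \<lhd> \<Lambda> j" "\<not> virtually_abelian (\<Lambda> j\<lparr>carrier := H\<rparr>)" "relative_property_T (\<Lambda> j) H"
      using rT2[OF j] by blast
    have "\<exists>i D u. i \<in> I \<and> i \<noteq> 0 \<and> SB j i D u" unfolding SB_def
      by (rule orbit_map_section[OF om2 cI gc1 gr2[OF j(1)] cn2[OF j(1)] hom2[OF j(1)] inj2[OF j(1)] H(1)
        infinite_of_not_virtually_abelian[OF gr2[OF j(1)] H(1,2)] H(3) ergodic_on_N1[OF hom2[OF j(1)] erg2[OF j]] haag1])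
    then obtain i D u where "i \<in> I" "i \<noteq> 0" "SB j i D u" by (elim exE conjE)
    then show ?thesis by (metis less_one linorder_not_le)
  qed
  have infG: "infinite (carrier (\<Gamma> i))" if i: "i \<in> I" "1 \<le> i" for i
  proof -
    obtain H where H: "H \<lhd> \<Gamma> i" "\<not> virtually_abelian (\<Gamma> i\<lparr>carrier := H\<rparr>)" using rT1[OF i] by blast
    show ?thesis using infinite_of_not_virtually_abelian[OF gr1[OF i(1)] H] subgroup.subset[OF normal_imp_subgroup[OF H(1)]]
        finite_subset by blast
  qed
  have infL: "infinite (carrier (\<Lambda> j))" if j: "j \<in> J" "1 \<le> j" for j
  proof -
    obtain H where H: "H \<lhd> \<Lambda> j" "\<not> virtually_abelian (\<Lambda> j\<lparr>carrier := H\<rparr>)" using rT2[OF j] by blast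
    show ?thesis using infinite_of_not_virtually_abelian[OF gr2[OF j(1)] H] subgroup.subset[OF normal_imp_subgroup[OF H(1)]]
        finite_subset by blast
  qed
  have qv1: "\<exists>l\<in>carrier ?L. \<theta> l y = q (v y)" if "y \<in> space N1" for y using qv that by (simp add: space1)
  have vq1: "\<exists>g\<in>carrier ?G. \<sigma> g x = v (q x)" if "x \<in> space M1" for x using vq that by (simp add: space1)
  have dgM: "{x \<in> space M1. g x = x} \<in> sets M1" if "g \<in> measurable M1 M1" for g
    using sets_Collect_eq[OF separating_restrict[OF sepM X1(1)] that measurable_ident] by simp
  have dgN: "{y \<in> space N1. g y = y} \<in> sets N1" if "g \<in> measurable N1 N1" for g
    using sets_Collect_eq[OF separating_restrict[OF sepN Y1(1)] that measurable_ident] by simp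
  have compA: "i' = i \<and> (\<exists>X2. X2 \<in> sets M1 \<and> (AE x in M1. x \<in> X2) \<and> (\<forall>x\<in>X2. \<forall>x'\<in>X2.
      (\<exists>a\<in>carrier (\<Gamma> i). \<sigma> (?ii i a) x = x') \<longleftrightarrow>
      (\<exists>c\<in>carrier (\<Lambda> j). \<theta> (?ij j c) (shift ?L \<theta> u q x) = shift ?L \<theta> u q x')))"
    if i: "i \<in> I" "1 \<le> i" and j: "j \<in> J" and i': "i' \<in> I" and A: "SA i j D u" and B: "SB j i' D' u'" for i j i' D u D' u'
  proof (rule section_composition[OF om1 om2 qv1 dgM cI gc1 gr2 i(1) infG[OF i] j i'])
    show "D \<in> sets M1" "AE x in M1. x \<in> D" "u \<in> measurable M1 (count_space (carrier ?L))"
      using A unfolding SA_def by blast+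
    show "D' \<in> sets N1" "AE y in N1. y \<in> D'" "u' \<in> measurable N1 (count_space (carrier ?G))"
      using B unfolding SB_def by blast+
    show "\<sigma> (?ii i k) x \<in> D \<and> (\<exists>b\<in>carrier (\<Lambda> j). shift ?L \<theta> u q (\<sigma> (?ii i k) x) = \<theta> (?ij j b) (shift ?L \<theta> u q x))"
      if "k \<in> carrier (\<Gamma> i)" "x \<in> D" for k x using A that unfolding SA_def by blast
    show "\<theta> (?ij j k) y \<in> D' \<and> (\<exists>b\<in>carrier (\<Gamma> i'). shift ?G \<sigma> u' v (\<theta> (?ij j k) y) = \<sigma> (?ii i' b) (shift ?G \<sigma> u' v y))"
      if "k \<in> carrier (\<Lambda> j)" "y \<in> D'" for k y using B that unfolding SB_def by blast
  qed
  have compB: "j' = j"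
    if j: "j \<in> J" "1 \<le> j" and i: "i \<in> I" and j': "j' \<in> J" and B: "SB j i D u" and A: "SA i j' D' u'" for i j j' D u D' u'
  proof (rule section_composition[OF om2 om1 vq1 dgN cJ gc2 gr1 j(1) infL[OF j] i j', THEN conjunct1])
    show "D \<in> sets N1" "AE x in N1. x \<in> D" "u \<in> measurable N1 (count_space (carrier ?G))"
      using B unfolding SB_def by blast+
    show "D' \<in> sets M1" "AE y in M1. y \<in> D'" "u' \<in> measurable M1 (count_space (carrier ?L))"
      using A unfolding SA_def by blast+
    show "\<sigma> (?ii i k) x \<in> D' \<and> (\<exists>b\<in>carrier (\<Lambda> j'). shift ?L \<theta> u' q (\<sigma> (?ii i k) x) = \<theta> (?ij j' b) (shift ?L \<theta> u' q x))"
      if "k \<in> carrier (\<Gamma> i)" "x \<in> D'" for k x using A that unfolding SA_def by blast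
    show "\<theta> (?ij j k) y \<in> D \<and> (\<exists>b\<in>carrier (\<Gamma> i). shift ?G \<sigma> u v (\<theta> (?ij j k) y) = \<sigma> (?ii i b) (shift ?G \<sigma> u v y))"
      if "k \<in> carrier (\<Lambda> j)" "y \<in> D" for k y using B that unfolding SB_def by blast
  qed
  let ?I = "{i. enat i \<le> n \<and> 1 \<le> i}" and ?J = "{j. enat j \<le> m \<and> 1 \<le> j}"
  have "\<exists>F. \<forall>i. i \<in> I \<and> 1 \<le> i \<longrightarrow> F i \<in> J \<and> 1 \<le> F i \<and> (\<exists>D u. SA i (F i) D u)" using exA by metis
  then obtain F where F': "\<forall>i. i \<in> I \<and> 1 \<le> i \<longrightarrow> F i \<in> J \<and> 1 \<le> F i \<and> (\<exists>D u. SA i (F i) D u)" by (elim exE)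
  have FA: "F i \<in> J" "1 \<le> F i" "\<exists>D u. SA i (F i) D u" if "i \<in> I" "1 \<le> i" for i using F' that by blast+
  have "\<exists>g. \<forall>j. j \<in> J \<and> 1 \<le> j \<longrightarrow> g j \<in> I \<and> 1 \<le> g j \<and> (\<exists>D u. SB j (g j) D u)" using exB by metis
  then obtain g where g': "\<forall>j. j \<in> J \<and> 1 \<le> j \<longrightarrow> g j \<in> I \<and> 1 \<le> g j \<and> (\<exists>D u. SB j (g j) D u)" by (elim exE)
  have gB: "g j \<in> I" "1 \<le> g j" "\<exists>D u. SB j (g j) D u" if "j \<in> J" "1 \<le> j" for j using g' that by blast+
  \<comment> \<open>Whatever sections were chosen, composing them returns to the factor of
    departure, so \<open>F\<close> and \<open>g\<close> are inverse to each other.\<close>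
  have gF: "g (F i) = i" if i: "i \<in> I" "1 \<le> i" for i
  proof -
    obtain D u where A: "SA i (F i) D u" using FA(3)[OF i] by (elim exE)
    obtain D' u' where B: "SB (F i) (g (F i)) D' u'" using gB(3)[OF FA(1,2)[OF i]] by (elim exE)
    show ?thesis by (rule compA[OF i FA(1)[OF i] gB(1)[OF FA(1,2)[OF i]] A B, THEN conjunct1])
  qed
  have Fg: "F (g j) = j" if j: "j \<in> J" "1 \<le> j" for j
  proof -
    obtain D u where B: "SB j (g j) D u" using gB(3)[OF j] by (elim exE)
    obtain D' u' where A: "SA (g j) (F (g j)) D' u'" using FA(3)[OF gB(1,2)[OF j]] by (elim exE)
    show ?thesis by (rule compB[OF j gB(1)[OF j] FA(1)[OF gB(1,2)[OF j]] B A])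
  qed
  have bF: "bij_betw F ?I ?J"
    by (rule bij_betw_byWitness[where f' = g]) (use gF Fg FA gB in \<open>auto simp: I_def J_def\<close>)
  have nm: "n = m" by (rule enat_eq_of_bij[OF bF])
  \<comment> \<open>The identity off the index set, as \<open>permutes\<close> demands.\<close>
  define \<pi> where "\<pi> i = (if i \<in> ?I then F i else i)" for i
  have "bij_betw \<pi> ?I ?I"
    using bF unfolding nm by (rule bij_betw_cong[THEN iffD1, rotated]) (simp add: \<pi>_def nm)
  then have "\<pi> permutes ?I" by (rule bij_imp_permutes) (simp only: \<pi>_def if_False)
  then have perm: "\<pi> permutes {i \<in> I. i \<ge> 1}" by (simp add: I_def)
  have "isomorphic_to_amplification M (orbit_relation (\<Gamma> i) M (\<lambda>g. \<sigma> (?ii i g)))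
      N (orbit_relation (\<Lambda> (\<pi> i)) N (\<lambda>h. \<theta> (?ij (\<pi> i) h))) t" if i: "i \<in> I" "1 \<le> i" for i
  proof -
    have \<pi>: "\<pi> i = F i" using i by (simp add: \<pi>_def I_def)
    note j = FA(1,2)[OF i]
    obtain D u where A: "SA i (F i) D u" using FA(3)[OF i] by (elim exE)
    obtain D' u' where B: "SB (F i) (g (F i)) D' u'" using gB(3)[OF j] by (elim exE)
    obtain X2 where X2: "X2 \<in> sets M1" "AE x in M1. x \<in> X2" "\<forall>x\<in>X2. \<forall>x'\<in>X2.
        (\<exists>a\<in>carrier (\<Gamma> i). \<sigma> (?ii i a) x = x') \<longleftrightarrow>
        (\<exists>c\<in>carrier (\<Lambda> (F i)). \<theta> (?ij (F i) c) (shift ?L \<theta> u q x) = shift ?L \<theta> u q x')"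
      using compA[OF i j(1) gB(1)[OF j] A B, THEN conjunct2] by (elim exE conjE)
    have X2': "X2 \<in> sets M" "X2 \<subseteq> X1" using X2(1) by (simp_all add: sets1)
    have "AE x in M. x \<in> X1 \<longrightarrow> x \<in> X2" using X2(2) X1(1) by (subst (asm) AE_restrict_space_iff) auto
    then have AE2: "AE x in M. x \<in> X2" using X1(2) by eventually_elim blast
    have "rel_isomorphic M (orbit_relation (\<Gamma> i) M (\<lambda>g. \<sigma> (?ii i g))) T
        (amplified_rel (orbit_relation (\<Lambda> (F i)) N (\<lambda>h. \<theta> (?ij (F i) h))) E)"
    proof (rule final_iso[OF X2' AE2 _ gr2[OF j(1)] cn2[OF j(1)] hom2[OF j(1)] erg2[OF j]])
      show "u \<in> measurable M1 (count_space (carrier ?L))" using A unfolding SA_def by blast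
      fix x x' assume x: "x \<in> X2" "x' \<in> X2"
      have "x \<in> space M" using x(1) X2'(1) sets.sets_into_space by blast
      then have "(x, x') \<in> orbit_relation (\<Gamma> i) M (\<lambda>g. \<sigma> (?ii i g)) \<longleftrightarrow> (\<exists>a\<in>carrier (\<Gamma> i). \<sigma> (?ii i a) x = x')"
        by (auto simp: orbit_relation_def orbit_def)
      then show "(x, x') \<in> orbit_relation (\<Gamma> i) M (\<lambda>g. \<sigma> (?ii i g)) \<longleftrightarrow>
          (\<exists>c\<in>carrier (\<Lambda> (F i)). \<theta> (?ij (F i) c) (shift ?L \<theta> u q x) = shift ?L \<theta> u q x')"
        using X2(3) x by blast
    qed
    \<comment> \<open>All factors share the \<open>k\<close> and \<open>E\<close> of the given
      isomorphism.\<close>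
    then show ?thesis unfolding isomorphic_to_amplification_def \<pi> using kE(1,2,3) by blast
  qed
  then show ?thesis using nm perm by blast
qed

end
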